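(* Let $f:\mathbb{R}^2\to\mathbb{C}$, $f=f(x,y)\in C_0(\mathbb{R}^2)$, and let $f$ and its partial derivatives $\frac{\partial f}{\partial x}$ and $\frac{\partial f}{\partial y}$ be locally absolutely continuous on $(\mathbb{R}\setminus\{0\})^2$ in each variable. Let also the partial derivatives $\frac{\partial f}{\partial x}$, $\frac{\partial f}{\partial y}$ and $\frac{\partial^2 f}{\partial x\partial y}$ be almost everywhere bounded outside any neighborhood of the coordinate axes. If $$\int_{0}^1\int_{0}^1 f_{11}(x,y)\ln\frac2x\,\ln\frac2y\,dx\,dy<\infty,\qquad \int_{1}^\infty\int_1^\infty \frac{f_{00}(x,y)}{xy}\,dx\,dy<\infty,$$ $$\int_1^\infty\int_1^\infty\left(\int_x^\infty\int_y^\infty f_{00}(s,t)f_{11}(s,t)\,dt\,ds\right)^{1/2}\frac{dx}{x}\frac{dy}{y}<\infty,$$ $$\int_{x=0}^1\int_{y=1}^\infty f_{10}(x,y)\ln\frac2x\,\frac{dy}{y}\,dx<\infty,$$ $$\int_{x=0}^1\int_{y=1}^\infty\left(\int_y^\infty f_{10}(x,t)f_{11}(x,t)\,dt\right)^{1/2}\ln\frac2x\,\frac{dy}{y}\,dx<\infty,$$ $$\int_{x=1}^\infty\int_{y=0}^1 f_{01}(x,y)\ln\frac2y\,dy\,\frac{dx}{x}<\infty,$$ $$\int_{x=1}^\infty\int_{y=0}^1\left(\int_x^\infty f_{01}(s,y)f_{11}(s,y)\,ds\right)^{1/2}\ln\frac2y\,dy\,\frac{dx}{x}<\infty,$$ $$\int_1^\infty\int_1^\infty\left(\int_y^\infty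 f_{00}(x,t)f_{01}(x,t)\,dt\right)^{1/2}\frac{dx}{x}\frac{dy}{y}<\infty,$$ and $$\int_1^\infty\int_1^\infty\left(\int_x^\infty f_{00}(s,y)f_{10}(s,y)\,ds\right)^{1/2}\frac{dx}{x}\frac{dy}{y}<\infty,$$ then $f\in A(\mathbb{R}^2)$.
   Context: $C_0(\mathbb{R}^2)$ is the space of continuous functions on $\mathbb{R}^2$ tending to $0$ at infinity. One writes $f\in A(\mathbb{R}^2)$ if there is $g\in L_1(\mathbb{R}^2)$ with $f(y)=\int_{\mathbb{R}^2}g(x)e^{i(x,y)}\,dx$ for all $y\in\mathbb{R}^2$. The majorants are $$f_{00}(x,y)=\sup_{|u|\ge|x|,\,|v|\ge|y|}|f(u,v)|,\qquad f_{10}(x,y)=\sup_{|v|\ge|y|}\ \operatorname{ess\,sup}_{|u|\ge|x|>0}\left|\frac{\partial f}{\partial u}(u,v)\right|,$$ $$f_{01}(x,y)=\sup_{|u|\ge|x|}\ \operatorname{ess\,sup}_{|v|\ge|y|>0}\left|\frac{\partial f}{\partial v}(u,v)\right|,\qquad f_{11}(x,y)=\operatorname{ess\,sup}_{|u|\ge|x|>0,\,|v|\ge|y|>0}\left|\frac{\partial^2 f}{\partial u\,\partial v}(u,v)\right|.$$ "Almost everywhere bounded outside any neighborhood of the coordinate axes" means essentially bounded on $\{(x,y):|x|\ge\varepsilon,\ |y|\ge\varepsilon\}$ for every $\varepsilon>0$. *)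

theory Defs
  imports "HOL-Probability.Essential_Supremum"
begin

definition C0_functions :: "('a::real_normed_vector \<Rightarrow> complex) set" where
  "C0_functions = {f. continuous_on UNIV f \<and> (f \<longlongrightarrow> 0) at_infinity}"

definition fourier_L1_functions :: "('a::euclidean_space \<Rightarrow> complex) set" where
  "fourier_L1_functions =
     {f. \<exists>g. integrable lborel g \<and>
        (\<forall>y. f y = (LINT x|lborel. g x * exp (\<i> * complex_of_real (x \<bullet> y))))}"

definition abs_cont_on :: "real set \<Rightarrow> (real \<Rightarrow> 'a::real_normed_vector) \<Rightarrow> bool" where
  "abs_cont_on S g \<longleftrightarrow>
     (\<forall>\<epsilon>>0. \<exists>\<delta>>0. \<forall>I :: (real \<times> real) set.
        finite I \<and> (\<forall>(a, b)\<in>I. a \<le> b \<and> {a..b} \<subseteq> S) \<and>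
        pairwise (\<lambda>(a, b) (c, d). {a<..<b} \<inter> {c<..<d} = {}) I \<and>
        (\<Sum>(a, b)\<in>I. b - a) < \<delta> \<longrightarrow>
        (\<Sum>(a, b)\<in>I. norm (g b - g a)) < \<epsilon>)"

definition locally_abs_cont_on :: "real set \<Rightarrow> (real \<Rightarrow> 'a::real_normed_vector) \<Rightarrow> bool" where
  "locally_abs_cont_on U g \<longleftrightarrow> (\<forall>a b. {a..b} \<subseteq> U \<longrightarrow> abs_cont_on {a..b} g)"

text \<open>Local absolute continuity on the plane without the axes, in each variable separately:
  along every horizontal or vertical line other than a coordinate axis.\<close>

definition locally_abs_cont_off_axes :: "(real \<times> real \<Rightarrow> complex) \<Rightarrow> bool" where
  "locally_abs_cont_off_axes h \<longleftrightarrow>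
     (\<forall>y. y \<noteq> 0 \<longrightarrow> locally_abs_cont_on (- {0}) (\<lambda>x. h (x, y))) \<and>
     (\<forall>x. x \<noteq> 0 \<longrightarrow> locally_abs_cont_on (- {0}) (\<lambda>y. h (x, y)))"

text \<open>Where a partial derivative does not exist, these functions take an unspecified value.\<close>

definition pderiv1 :: "(real \<times> real \<Rightarrow> complex) \<Rightarrow> real \<times> real \<Rightarrow> complex" where
  "pderiv1 f = (\<lambda>(x, y). vector_derivative (\<lambda>u. f (u, y)) (at x))"

definition pderiv2 :: "(real \<times> real \<Rightarrow> complex) \<Rightarrow> real \<times> real \<Rightarrow> complex" where
  "pderiv2 f = (\<lambda>(x, y). vector_derivative (\<lambda>v. f (x, v)) (at y))"

text \<open>The mixed derivative differentiates in the second variable first.\<close>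

definition pderiv12 :: "(real \<times> real \<Rightarrow> complex) \<Rightarrow> real \<times> real \<Rightarrow> complex" where
  "pderiv12 f = pderiv1 (pderiv2 f)"

definition ae_bounded_off_axes :: "(real \<times> real \<Rightarrow> complex) \<Rightarrow> bool" where
  "ae_bounded_off_axes h \<longleftrightarrow>
     (\<forall>\<epsilon>>0. \<exists>M. AE (x, y) in lebesgue. \<bar>x\<bar> \<ge> \<epsilon> \<and> \<bar>y\<bar> \<ge> \<epsilon> \<longrightarrow> norm (h (x, y)) \<le> M)"

text \<open>The library's essential supremum is \<open>top\<close> on non-measurable functions. This never
  occurs for the functions considered here, whose sections and mixed derivative are measurable.\<close>

definition maj00 :: "(real \<times> real \<Rightarrow> complex) \<Rightarrow> real \<Rightarrow> real \<Rightarrow> ennreal" where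
  "maj00 f x y = (SUP (u, v)\<in>{u. \<bar>u\<bar> \<ge> \<bar>x\<bar>} \<times> {v. \<bar>v\<bar> \<ge> \<bar>y\<bar>}. ennreal (norm (f (u, v))))"

definition maj10 :: "(real \<times> real \<Rightarrow> complex) \<Rightarrow> real \<Rightarrow> real \<Rightarrow> ennreal" where
  "maj10 f x y = (SUP v\<in>{v. \<bar>v\<bar> \<ge> \<bar>y\<bar>}.
     esssup (lebesgue_on {u. \<bar>u\<bar> \<ge> \<bar>x\<bar> \<and> \<bar>x\<bar> > 0}) (\<lambda>u. ennreal (norm (pderiv1 f (u, v)))))"

definition maj01 :: "(real \<times> real \<Rightarrow> complex) \<Rightarrow> real \<Rightarrow> real \<Rightarrow> ennreal" where
  "maj01 f x y = (SUP u\<in>{u. \<bar>u\<bar> \<ge> \<bar>x\<bar>}.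
     esssup (lebesgue_on {v. \<bar>v\<bar> \<ge> \<bar>y\<bar> \<and> \<bar>y\<bar> > 0}) (\<lambda>v. ennreal (norm (pderiv2 f (u, v)))))"

definition maj11 :: "(real \<times> real \<Rightarrow> complex) \<Rightarrow> real \<Rightarrow> real \<Rightarrow> ennreal" where
  "maj11 f x y =
     esssup (lebesgue_on ({u. \<bar>u\<bar> \<ge> \<bar>x\<bar> \<and> \<bar>x\<bar> > 0} \<times> {v. \<bar>v\<bar> \<ge> \<bar>y\<bar> \<and> \<bar>y\<bar> > 0}))
       (\<lambda>z. ennreal (norm (pderiv12 f z)))"

definition ennreal_sqrt :: "ennreal \<Rightarrow> ennreal" where
  "ennreal_sqrt a = (if a = \<infinity> then \<infinity> else ennreal (sqrt (enn2real a)))"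

end

theory Submission imports Defs "HOL-Probability.Probability" begin

text \<open>On each half line, a function of one variable is split into dyadic pieces: its piecewise linear
  interpolant at the points \<open>2 ^ k\<close>, written in the hat function basis, and the interpolation errors on
  the blocks \<open>[2 ^ k, 2 ^ (k + 1)]\<close>. Near \<open>0\<close> the interpolant is expanded in the increments
  \<open>u (2 X) - u X\<close>, so that only differences enter there. The tensor product of two such splittings
  writes \<open>f\<close> as a sum over pairs of dyadic scales of functions with support in a rectangle, and the four
  majorants at the dyadic points bound the size of each piece and its first and mixed differences.

  A piece with these bounds has an integrable Fourier transform: by Cauchy--Schwarz against a weight and
  Bessel's inequality for difference quotients, its norm in \<open>A\<close> is a constant times the geometric
  mean of its size and its mixed difference, up to the square root of a logarithm when all differences
  are of the same order. The integral hypotheses dominate the resulting dyadic sums. The logarithm in the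
  region \<open>x, y \<ge> 1\<close> is compensated by the tail integral, since
  \<open>\<Sum> sqrt j * a j\<close> is at most twice the sum of the square roots of the tails of \<open>\<Sum> (a j)\<^sup>2\<close>.

  The difference bounds require that an absolutely continuous function with a derivative bounded almost
  everywhere where it exists is Lipschitz, which rests on Lebesgue's theorem on the
  differentiability of monotone functions.\<close>

section \<open>Lebesgue differentiation and absolute continuity\<close>

text \<open>Near an axis the size of \<open>f\<close> does not decay, so point values at
  \<open>2 ^ - i\<close> cannot be summed over the scales. Summation by parts replaces them by
  increments, each multiplied by the sum of the \<open>i\<close> hats at coarser nodes. These hats
  live on different scales and are estimated one at a time, so the norm grows like \<open>i\<close>;
  this is what the factors \<open>ln (2 / x)\<close> in the hypotheses pay for. Far from the axes
  point values are summable. The obstacle there is the interpolation error in both variables, with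
  size \<open>p\<close> and all differences of order \<open>s\<close>: a weight adapted to it has a
  reciprocal that spreads along a hyperbolic cross, and its integral contains
  \<open>ln (s / p)\<close>. The mixed majorant is bounded away from the axes, so this logarithm may
  be replaced by a multiple of \<open>i + k\<close>. Its square root is relaxed further to a
  multiple of \<open>sqrt (Suc i) * sqrt (Suc k)\<close>, which separates the variables and lets a
  one-variable tail inequality act twice.\<close>

lemma vitali_intervals:
  fixes S G :: "real set"
  assumes "open G" "S \<subseteq> G"
    and P: "\<And>x \<eta>. x \<in> S \<Longrightarrow> \<eta> > 0 \<Longrightarrow> \<exists>u v. u \<le> x \<and> x \<le> v \<and> u < v \<and> v - u < \<eta> \<and> P u v"
  obtains C where "countable C"
    "\<And>u v. (u, v) \<in> C \<Longrightarrow> u < v \<and> {u..v} \<subseteq> G \<and> P u v"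
    "pairwise (\<lambda>i j. disjnt {fst i..snd i} {fst j..snd j}) C"
    "negligible (S - (\<Union>(u, v)\<in>C. {u<..<v}))"
proof -
  let ?K = "{(u, v). u < v \<and> {u..v} \<subseteq> G \<and> P u v}"
  \<comment> \<open>The covering theorem speaks of closed balls, so an interval is coded by its
    midpoint and half its length.\<close>
  let ?a = "\<lambda>i::real\<times>real. (fst i + snd i) / 2" and ?r = "\<lambda>i::real\<times>real. (snd i - fst i) / 2"
  have cb: "cball (?a i) (?r i) = {fst i..snd i}" for i
    by (auto simp: cball_eq_atLeastAtMost field_simps)
  obtain C where C: "countable C" "C \<subseteq> ?K"
    "pairwise (\<lambda>i j. disjnt (cball (?a i) (?r i)) (cball (?a j) (?r j))) C"
    "negligible (S - (\<Union>i\<in>C. cball (?a i) (?r i)))"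
  proof (rule Vitali_covering_theorem_cballs[of ?K ?r S ?a])
    show "\<And>i. i \<in> ?K \<Longrightarrow> 0 < ?r i" by auto
    fix x d :: real assume x: "x \<in> S" "0 < d"
    then obtain e where e: "e > 0" "ball x e \<subseteq> G"
      using assms(1,2) by (meson openE subsetD)
    obtain u v where uv: "u \<le> x" "x \<le> v" "u < v" "v - u < min d e" "P u v"
      using P[OF x(1), of "min d e"] e x by auto
    have "{u..v} \<subseteq> ball x e"
      using uv by (auto simp: dist_real_def)
    with e uv have "(u, v) \<in> ?K" by auto
    moreover have "x \<in> cball (?a (u,v)) (?r (u,v))" unfolding cb using uv by auto
    moreover have "?r (u, v) < d" using uv by auto
    ultimately show "\<exists>i. i \<in> ?K \<and> x \<in> cball (?a i) (?r i) \<and> ?r i < d" by blast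
  qed
  show ?thesis
  proof (rule that)
    show "countable C" by fact
    show "\<And>u v. (u, v) \<in> C \<Longrightarrow> u < v \<and> {u..v} \<subseteq> G \<and> P u v" using C(2) by auto
    show "pairwise (\<lambda>i j. disjnt {fst i..snd i} {fst j..snd j}) C" using C(3) unfolding cb .
    \<comment> \<open>The countably many end points form a null set, so the interiors of the
      selected intervals still cover almost all of \<open>S\<close>.\<close>
    have "countable (fst ` C \<union> snd ` C)" using C(1) by simp
    then have "negligible (fst ` C \<union> snd ` C)" by (simp add: negligible_iff_null_sets countable_imp_null_set_lborel null_sets_completionI)
    with C(4)[unfolded cb]
    have "negligible ((S - (\<Union>i\<in>C. {fst i..snd i})) \<union> (fst ` C \<union> snd ` C))" by simp
    then show "negligible (S - (\<Union>(u, v)\<in>C. {u<..<v}))"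
      by (rule negligible_subset) (force simp: image_iff less_le)
  qed
qed

text \<open>Lebesgue outer measure; the sets of steep or flat points to which it is applied are not
  known to be measurable.\<close>

definition outer_length :: "real set \<Rightarrow> ennreal" where
  "outer_length S = (INF G\<in>{G. open G \<and> S \<subseteq> G}. emeasure lborel G)"

lemma negligible_open_cover:
  fixes N :: "real set"
  assumes "negligible N" "e > 0"
  obtains G where "open G" "N \<subseteq> G" "emeasure lborel G \<le> ennreal e"
proof -
  have N: "N \<in> null_sets lebesgue" using assms by (simp add: negligible_iff_null_sets)
  then have "N \<in> sets lebesgue" by auto
  then obtain T where T: "open T" "N \<subseteq> T" "T - N \<in> lmeasurable" "emeasure lebesgue (T - N) < ennreal e"
    using sets_lebesgue_outer_open assms(2) by blast
  have "emeasure lebesgue (T - N) = emeasure lebesgue T"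
    using T(1) N by (intro emeasure_Diff_null_set) auto
  moreover have "emeasure lebesgue T = emeasure lborel T"
    using T(1) by simp
  ultimately show ?thesis using that T by (metis less_imp_le)
qed

text \<open>The uncovered null set fits into an open set of measure \<open>e\<close>, so covering
  almost all of \<open>S\<close> is enough.\<close>

lemma outer_length_Un_negligible:
  assumes "open U" "negligible (S - U)"
  shows "outer_length S \<le> emeasure lborel U"
proof (rule ennreal_le_epsilon)
  fix e :: real assume "e > 0"
  obtain G where G: "open G" "S - U \<subseteq> G" "emeasure lborel G \<le> ennreal e"
    using negligible_open_cover[OF assms(2) \<open>e > 0\<close>] by blast
  have "outer_length S \<le> emeasure lborel (U \<union> G)"
    unfolding outer_length_def by (rule INF_lower) (use G assms in auto)
  also have "\<dots> \<le> emeasure lborel U + emeasure lborel G"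
    by (rule emeasure_subadditive) (use G assms in auto)
  also have "\<dots> \<le> emeasure lborel U + ennreal e" using G by (intro add_left_mono)
  finally show "outer_length S \<le> emeasure lborel U + ennreal e" .
qed

lemma outer_length_0_negligible:
  assumes "outer_length S = 0" shows "negligible S"
  unfolding negligible_outer
proof (intro allI impI)
  fix e :: real assume "e > 0"
  then have "outer_length S < ennreal e" using assms by simp
  then obtain G where G: "open G" "S \<subseteq> G" "emeasure lborel G < ennreal e"
    unfolding outer_length_def INF_less_iff by auto
  then have "G \<in> lmeasurable" 
    by (intro fmeasurableI) (auto intro: less_trans simp: ennreal_less_top)
  moreover have "measure lebesgue G < e"
  proof -
    have "emeasure lborel G = ennreal (measure lborel G)"
      using G(3) by (intro emeasure_eq_ennreal_measure) (auto simp: less_top[symmetric])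
    then have "measure lborel G < e" using G(3) \<open>e > 0\<close> by (simp add: ennreal_less_iff)
    then show ?thesis using G(1) by (simp add: measure_def)
  qed
  ultimately show "\<exists>T. S \<subseteq> T \<and> T \<in> lmeasurable \<and> measure lebesgue T < e" using G by blast
qed

lemma disjoint_family_on_subintervals:
  fixes C :: "(real \<times> real) set"
  assumes "pairwise (\<lambda>i j. disjnt {fst i..snd i} {fst j..snd j}) C"
    and "\<And>i. A i \<subseteq> {fst i..snd i}"
  shows "disjoint_family_on A C"
  unfolding disjoint_family_on_def
proof (intro ballI impI)
  fix i j assume "i \<in> C" "j \<in> C" "i \<noteq> j"
  then have "{fst i..snd i} \<inter> {fst j..snd j} = {}"
    using assms(1) by (auto simp: pairwise_def disjnt_def)
  then show "A i \<inter> A j = {}" using assms(2)[of i] assms(2)[of j] by blast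
qed

section \<open>Monotone functions are differentiable almost everywhere\<close>

definition upper_steep :: "(real \<Rightarrow> real) \<Rightarrow> real \<Rightarrow> real \<Rightarrow> bool" where
  "upper_steep F q x \<longleftrightarrow> (\<forall>\<eta>>0. \<exists>u v. u \<le> x \<and> x \<le> v \<and> u < v \<and> v - u < \<eta> \<and> F v - F u > q * (v - u))"

text \<open>With \<open>upper_steep\<close>, the comparison of derivates with \<open>p\<close> and
  \<open>q\<close>. The quotients run over all short intervals that contain \<open>x\<close>,
  because such intervals form a Vitali cover.\<close>

definition lower_flat :: "(real \<Rightarrow> real) \<Rightarrow> real \<Rightarrow> real \<Rightarrow> bool" where
  "lower_flat F p x \<longleftrightarrow> (\<forall>\<eta>>0. \<exists>u v. u \<le> x \<and> x \<le> v \<and> u < v \<and> v - u < \<eta> \<and> F v - F u < p * (v - u))"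

text \<open>Right continuity makes \<open>F v - F u\<close> the Stieltjes measure of
  \<open>{u<..v}\<close>, so that increments over countably many disjoint intervals add up.\<close>

locale right_continuous_mono =
  fixes F :: "real \<Rightarrow> real"
  assumes mono: "\<And>x y. x \<le> y \<Longrightarrow> F x \<le> F y" and rcont: "\<And>a. continuous (at_right a) F"
begin

lemma measure_Ioc: "u \<le> v \<Longrightarrow> emeasure (interval_measure F) {u<..v} = ennreal (F v - F u)"
  using emeasure_interval_measure_Ioc[OF _ mono rcont] .

text \<open>The disjoint steep intervals given by the Vitali cover exhaust \<open>S\<close> up to a
  null set, lie in \<open>G\<close>, and each has Stieltjes measure at least \<open>q\<close> times
  its length.\<close>

lemma upper_steep_outer_length:
  assumes "q \<ge> 0" "open G" "S \<subseteq> G" "\<And>x. x \<in> S \<Longrightarrow> upper_steep F q x"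
  shows "ennreal q * outer_length S \<le> emeasure (interval_measure F) G"
proof -
  obtain C where C: "countable C"
    "\<And>u v. (u, v) \<in> C \<Longrightarrow> u < v \<and> {u..v} \<subseteq> G \<and> F v - F u > q * (v - u)"
    "pairwise (\<lambda>i j. disjnt {fst i..snd i} {fst j..snd j}) C"
    "negligible (S - (\<Union>(u, v)\<in>C. {u<..<v}))"
  proof (rule vitali_intervals[OF assms(2,3), where P="\<lambda>u v. F v - F u > q * (v - u)"])
    show "\<exists>u v. u \<le> x \<and> x \<le> v \<and> u < v \<and> v - u < \<eta> \<and> F v - F u > q * (v - u)"
      if "x \<in> S" "\<eta> > 0" for x \<eta>
      using assms(4)[OF that(1)] that(2) unfolding upper_steep_def by blast
  qed (rule that; assumption)
  have disj: "disjoint_family_on (\<lambda>(u,v). {u<..v}) C" "disjoint_family_on (\<lambda>(u,v). {u<..<v}) C"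
    using C(3) by (rule disjoint_family_on_subintervals; force)+
  have "outer_length S \<le> emeasure lborel (\<Union>(u, v)\<in>C. {u<..<v})"
    by (rule outer_length_Un_negligible) (use C in auto)
  also have "\<dots> = (\<integral>\<^sup>+i. emeasure lborel (case i of (u, v) \<Rightarrow> {u<..<v}) \<partial>count_space C)"
    using C disj by (subst emeasure_UN_countable) auto
  finally have "ennreal q * outer_length S \<le> (\<integral>\<^sup>+i. ennreal q * emeasure lborel (case i of (u, v) \<Rightarrow> {u<..<v}) \<partial>count_space C)"
    by (subst nn_integral_cmult) (auto intro: mult_left_mono)
  also have "\<dots> \<le> (\<integral>\<^sup>+i. emeasure (interval_measure F) (case i of (u, v) \<Rightarrow> {u<..v}) \<partial>count_space C)"
  proof (rule nn_integral_mono, clarsimp)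
    fix u v assume "(u, v) \<in> C"
    then show "ennreal q * emeasure lborel {u<..<v} \<le> emeasure (interval_measure F) {u<..v}"
      using C(2)[of u v] assms(1) by (simp add: measure_Ioc ennreal_mult'[symmetric] ennreal_leI)
  qed
  also have "\<dots> = emeasure (interval_measure F) (\<Union>(u, v)\<in>C. {u<..v})"
    using C disj by (subst emeasure_UN_countable) auto
  also have "\<dots> \<le> emeasure (interval_measure F) G"
    by (rule emeasure_mono) (use C(2) assms(2) in \<open>fastforce\<close>)+
  finally show ?thesis .
qed

text \<open>The opposite comparison, on disjoint flat intervals inside \<open>G\<close>. Their union
  \<open>U\<close> is kept because the steep estimate is applied inside it afterwards.\<close>

lemma lower_flat_cover:
  assumes "p \<ge> 0" "open G" "S \<subseteq> G" "\<And>x. x \<in> S \<Longrightarrow> lower_flat F p x"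
  obtains U where "open U" "U \<subseteq> G" "negligible (S - U)"
    "emeasure (interval_measure F) U \<le> ennreal p * emeasure lborel G"
proof -
  obtain C where C: "countable C"
    "\<And>u v. (u, v) \<in> C \<Longrightarrow> u < v \<and> {u..v} \<subseteq> G \<and> F v - F u < p * (v - u)"
    "pairwise (\<lambda>i j. disjnt {fst i..snd i} {fst j..snd j}) C"
    "negligible (S - (\<Union>(u, v)\<in>C. {u<..<v}))"
  proof (rule vitali_intervals[OF assms(2,3), where P="\<lambda>u v. F v - F u < p * (v - u)"])
    show "\<exists>u v. u \<le> x \<and> x \<le> v \<and> u < v \<and> v - u < \<eta> \<and> F v - F u < p * (v - u)"
      if "x \<in> S" "\<eta> > 0" for x \<eta>
      using assms(4)[OF that(1)] that(2) unfolding lower_flat_def by blast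
  qed (rule that; assumption)
  have disj: "disjoint_family_on (\<lambda>(u,v). {u<..v}) C" "disjoint_family_on (\<lambda>(u,v). {u<..<v}) C"
    using C(3) by (rule disjoint_family_on_subintervals; force)+
  let ?U = "\<Union>(u, v)\<in>C. {u<..<v}"
  have "emeasure (interval_measure F) ?U \<le> emeasure (interval_measure F) (\<Union>(u, v)\<in>C. {u<..v})"
  proof (rule emeasure_mono)
    show "?U \<subseteq> (\<Union>(u, v)\<in>C. {u<..v})" by (rule UN_mono) auto
    show "(\<Union>(u, v)\<in>C. {u<..v}) \<in> sets (interval_measure F)"
      using C(1) by (intro sets.countable_UN') auto
  qed
  also have "\<dots> = (\<integral>\<^sup>+i. emeasure (interval_measure F) (case i of (u, v) \<Rightarrow> {u<..v}) \<partial>count_space C)"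
    using C disj by (subst emeasure_UN_countable) auto
  also have "\<dots> \<le> (\<integral>\<^sup>+i. ennreal p * emeasure lborel (case i of (u, v) \<Rightarrow> {u<..<v}) \<partial>count_space C)"
  proof (rule nn_integral_mono, clarsimp)
    fix u v assume "(u, v) \<in> C"
    then show "emeasure (interval_measure F) {u<..v} \<le> ennreal p * emeasure lborel {u<..<v}"
      using C(2)[of u v] assms(1) by (simp add: measure_Ioc ennreal_mult'[symmetric] ennreal_leI)
  qed
  also have "\<dots> = ennreal p * emeasure lborel ?U"
    using C disj by (subst emeasure_UN_countable) (auto simp: nn_integral_cmult)
  also have "\<dots> \<le> ennreal p * emeasure lborel G"
    by (intro mult_left_mono emeasure_mono) (use C(2) assms(2) in \<open>fastforce\<close>)+
  finally have "emeasure (interval_measure F) ?U \<le> ennreal p * emeasure lborel G" .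
  moreover have "?U \<subseteq> G" using C(2) by fastforce
  moreover have "open ?U" by auto
  ultimately show ?thesis using that C(4) by blast
qed

text \<open>Flat intervals first, then steep ones inside them: for every open \<open>G\<close>
  around \<open>S\<close>, \<open>q\<close> times the outer measure of \<open>S\<close> is at most
  the Stieltjes measure of \<open>U\<close>, hence at most \<open>p\<close> times the measure of
  \<open>G\<close>. The infimum over \<open>G\<close> contradicts \<open>p < q\<close> unless the
  finite outer measure is zero.\<close>

lemma negligible_gap:
  assumes "0 < p" "p < q" "S \<subseteq> {a<..<b}"
    and "\<And>x. x \<in> S \<Longrightarrow> lower_flat F p x" "\<And>x. x \<in> S \<Longrightarrow> upper_steep F q x"
  shows "negligible S"
proof -
  have *: "ennreal q * outer_length S \<le> ennreal p * emeasure lborel G" if G: "open G" "S \<subseteq> G" for G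
  proof -
    obtain U where U: "open U" "U \<subseteq> G" "negligible (S - U)"
      "emeasure (interval_measure F) U \<le> ennreal p * emeasure lborel G"
      using lower_flat_cover[of p G S] assms G by auto
    \<comment> \<open>The part of \<open>S\<close> outside \<open>U\<close> is null, and for the
      part inside, \<open>U\<close> itself may serve as the open set of the steep estimate.\<close>
    have "outer_length S \<le> outer_length (S \<inter> U)"
      unfolding outer_length_def[of "S \<inter> U"]
    proof (rule INF_greatest)
      fix H assume "H \<in> {G. open G \<and> S \<inter> U \<subseteq> G}"
      moreover from this have "S - H \<subseteq> S - U" by auto
      ultimately show "outer_length S \<le> emeasure lborel H"
        by (intro outer_length_Un_negligible) (auto intro: negligible_subset[OF U(3)])
    qed
    then have "ennreal q * outer_length S \<le> ennreal q * outer_length (S \<inter> U)"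
      by (rule mult_left_mono) simp
    also have "\<dots> \<le> emeasure (interval_measure F) U"
      by (rule upper_steep_outer_length) (use assms U in auto)
    also note U(4)
    finally show ?thesis .
  qed
  have fin: "outer_length S < top"
  proof -
    have "outer_length S \<le> emeasure lborel {a<..<b}"
      unfolding outer_length_def by (rule INF_lower) (use assms in auto)
    also have "\<dots> \<le> emeasure lborel {a..b}" by (rule emeasure_mono) auto
    also have "\<dots> < top" using emeasure_lborel_cbox_finite[of a b] by simp
    finally show ?thesis .
  qed
  have "ennreal q * outer_length S \<le> ennreal p * outer_length S"
  proof -
    \<comment> \<open>Dividing by \<open>p\<close> isolates the measure of \<open>G\<close>, so that
      the infimum that defines the outer measure can be taken.\<close>
    have "ennreal (q/p) * outer_length S \<le> emeasure lborel G" if "open G" "S \<subseteq> G" for G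
    proof -
      have "ennreal (1/p) * (ennreal q * outer_length S) \<le> ennreal (1/p) * (ennreal p * emeasure lborel G)"
        by (intro mult_left_mono * that) auto
      then show ?thesis using assms(1,2)
        by (simp add: mult.assoc[symmetric] ennreal_mult''[symmetric])
    qed
    then have "ennreal (q/p) * outer_length S \<le> outer_length S"
      unfolding outer_length_def[of S] by (intro INF_greatest) (auto simp: outer_length_def[symmetric])
    then have "ennreal p * (ennreal (q/p) * outer_length S) \<le> ennreal p * outer_length S"
      by (rule mult_left_mono) simp
    then show ?thesis using assms(1,2)
      by (simp add: mult.assoc[symmetric] ennreal_mult''[symmetric])
  qed
  moreover obtain m where m: "outer_length S = ennreal m" "m \<ge> 0"
    using fin by (cases "outer_length S") auto
  ultimately have "q * m \<le> p * m"
    using assms(1,2) by (simp add: ennreal_mult''[symmetric])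
  then have "m = 0" using assms(2) m(2) by (smt (verit) mult_right_less_imp_less mult_le_cancel_right)
  then show ?thesis using m by (intro outer_length_0_negligible) simp
qed

text \<open>The outer measure times any slope stays below the total increase
  \<open>F b - F a\<close>.\<close>

lemma negligible_infinitely_steep:
  "negligible {x\<in>{a<..<b}. \<forall>q. upper_steep F q x}" (is "negligible ?S")
proof (cases "a < b")
  case True
  have *: "ennreal q * outer_length ?S \<le> ennreal (F b - F a)" if "q \<ge> 0" for q
  proof -
    have "ennreal q * outer_length ?S \<le> emeasure (interval_measure F) {a<..<b}"
      by (rule upper_steep_outer_length) (use that in auto)
    also have "\<dots> \<le> emeasure (interval_measure F) {a<..b}" by (rule emeasure_mono) auto
    also have "\<dots> = ennreal (F b - F a)" using True by (simp add: measure_Ioc)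
    finally show ?thesis .
  qed
  have "outer_length ?S = 0"
  proof (rule ccontr)
    assume "outer_length ?S \<noteq> 0"
    moreover have "outer_length ?S \<noteq> top" using *[of 1] by (auto simp: top_unique)
    ultimately obtain m where m: "outer_length ?S = ennreal m" "m > 0"
      by (cases "outer_length ?S") (auto simp: less_le)
    \<comment> \<open>With this slope, \<open>?q * m\<close> exceeds the total increase by
      \<open>1\<close>.\<close>
    let ?q = "(F b - F a + 1) / m"
    have "F b - F a \<ge> 0" using mono[of a b] True by simp
    then have "?q * m \<le> F b - F a"
      using *[of ?q] m by (simp add: ennreal_mult''[symmetric])
    then show False using m by simp
  qed
  then show ?thesis by (rule outer_length_0_negligible)
qed auto

text \<open>Off countably many null sets the upper derivate is finite and no rational pair separates
  it from the lower one, so the two agree.\<close>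

lemma differentiable_ae: "negligible {x\<in>{a<..<b}. \<not> F differentiable (at x)}"
proof -
  let ?A = "\<lambda>p q. {x\<in>{a<..<b}. lower_flat F p x \<and> upper_steep F q x}"
  let ?I = "{(p, q). p \<in> \<rat> \<and> q \<in> \<rat> \<and> 0 < p \<and> p < q}"
  have "?I \<subseteq> \<rat> \<times> \<rat>" by auto
  then have "countable ?I" by (rule countable_subset) (simp add: countable_rat)
  then have "negligible (\<Union>((\<lambda>(p, q). ?A p q) ` ?I))"
    by (intro negligible_countable_Union) (auto intro!: negligible_gap)
  then have "negligible (\<Union>((\<lambda>(p, q). ?A p q) ` ?I) \<union> {x\<in>{a<..<b}. \<forall>q. upper_steep F q x})"
    using negligible_infinitely_steep by simp
  then show ?thesis
  proof (rule negligible_subset, intro subsetI)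
    fix x assume x: "x \<in> {x\<in>{a<..<b}. \<not> F differentiable (at x)}"
    show "x \<in> \<Union>((\<lambda>(p, q). ?A p q) ` ?I) \<union> {x\<in>{a<..<b}. \<forall>q. upper_steep F q x}"
    proof (rule ccontr)
      assume nx: "x \<notin> \<Union>((\<lambda>(p, q). ?A p q) ` ?I) \<union> {x\<in>{a<..<b}. \<forall>q. upper_steep F q x}"
      let ?Q = "{q. \<not> upper_steep F q x}"
      \<comment> \<open>\<open>L\<close> is the upper derivate at \<open>x\<close>: slopes below
        \<open>L\<close> are exceeded on arbitrarily short intervals around \<open>x\<close>, slopes
        above \<open>L\<close> on no sufficiently short one.\<close>
      define L where "L = Inf ?Q"
      have ne: "?Q \<noteq> {}" using nx x by auto
      have neg: "upper_steep F q x" if "q < 0" for q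
        unfolding upper_steep_def
      proof (intro allI impI)
        fix \<eta> :: real assume "\<eta> > 0"
        moreover have "q * (x + \<eta>/2 - x) < 0" using that \<open>\<eta> > 0\<close> by (simp add: mult_neg_pos)
        moreover have "F x \<le> F (x + \<eta>/2)" using \<open>\<eta> > 0\<close> by (intro mono) simp
        ultimately show "\<exists>u v. u \<le> x \<and> x \<le> v \<and> u < v \<and> v - u < \<eta> \<and> F v - F u > q * (v - u)"
          by (intro exI[of _ x] exI[of _ "x + \<eta>/2"]) auto
      qed
      have bd: "bdd_below ?Q" using neg by (intro bdd_belowI[of _ 0]) (auto simp: not_less[symmetric])
      have up: "\<exists>\<eta>>0. \<forall>u v. u \<le> x \<longrightarrow> x \<le> v \<longrightarrow> u < v \<longrightarrow> v - u < \<eta> \<longrightarrow> F v - F u \<le> q * (v - u)" if "q > L" for q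
      proof -
        obtain q' where q': "q' \<in> ?Q" "q' < q" using cInf_lessD[OF ne, of q] \<open>q > L\<close> unfolding L_def by blast
        then obtain \<eta> where \<eta>: "\<eta> > 0" "\<And>u v. u \<le> x \<Longrightarrow> x \<le> v \<Longrightarrow> u < v \<Longrightarrow> v - u < \<eta> \<Longrightarrow> F v - F u \<le> q' * (v - u)"
          unfolding upper_steep_def by (simp add: not_less) (metis not_less)
        have "F v - F u \<le> q * (v - u)" if "u \<le> x" "x \<le> v" "u < v" "v - u < \<eta>" for u v
        proof -
          have "q' * (v - u) \<le> q * (v - u)" using q' that by (intro mult_right_mono) auto
          then show ?thesis using \<eta>(2)[OF that] by linarith
        qed
        then show ?thesis using \<eta>(1) by blast
      qed
      have lo: "\<exists>\<eta>>0. \<forall>u v. u \<le> x \<longrightarrow> x \<le> v \<longrightarrow> u < v \<longrightarrow> v - u < \<eta> \<longrightarrow> F v - F u \<ge> p * (v - u)" if "p < L" for p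
      proof (cases "p < 0")
        \<comment> \<open>Negative slopes are settled by monotonicity, since the exceptional sets
          run over positive rationals only.\<close>
        case True
        have "F v - F u \<ge> p * (v - u)" if "u < v" for u v
        proof -
          have "p * (v - u) \<le> 0" using True that by (simp add: mult_nonpos_nonneg)
          then show ?thesis using mono[of u v] that by simp
        qed
        then show ?thesis by (intro exI[of _ 1]) auto
      next
        case False
        \<comment> \<open>Two rationals between \<open>p\<close> and \<open>L\<close>. As
          \<open>q' < L\<close>, the point is steep for \<open>q'\<close>; it avoids the exceptional
          set of the pair, so it is not flat for \<open>p'\<close>.\<close>
        obtain p' where p': "p' \<in> \<rat>" "p < p'" "p' < L" using Rats_dense_in_real[OF \<open>p < L\<close>] by auto
        obtain q' where q': "q' \<in> \<rat>" "p' < q'" "q' < L" using Rats_dense_in_real[OF p'(3)] by auto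
        have "upper_steep F q' x" using q'(3) bd unfolding L_def
          by (metis (no_types, lifting) cInf_lower mem_Collect_eq not_le)
        then have "\<not> lower_flat F p' x" using nx x p' q' False by fastforce
        then obtain \<eta> where \<eta>: "\<eta> > 0" "\<And>u v. u \<le> x \<Longrightarrow> x \<le> v \<Longrightarrow> u < v \<Longrightarrow> v - u < \<eta> \<Longrightarrow> F v - F u \<ge> p' * (v - u)"
          unfolding lower_flat_def by (simp add: not_less) (metis not_less)
        have "F v - F u \<ge> p * (v - u)" if "u \<le> x" "x \<le> v" "u < v" "v - u < \<eta>" for u v
        proof -
          have "p * (v - u) \<le> p' * (v - u)" using p' that by (intro mult_right_mono) auto
          then show ?thesis using \<eta>(2)[OF that] by linarith
        qed
        then show ?thesis using \<eta>(1) by blast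
      qed
      have "(F has_real_derivative L) (at x)"
        unfolding has_field_derivative_iff LIM_def
      proof (intro allI impI)
        fix e :: real assume "e > 0"
        obtain \<eta>1 where 1: "\<eta>1 > 0" "\<And>u v. u \<le> x \<Longrightarrow> x \<le> v \<Longrightarrow> u < v \<Longrightarrow> v - u < \<eta>1 \<Longrightarrow> F v - F u \<le> (L+e/2) * (v - u)"
          using up[of "L+e/2"] \<open>e > 0\<close> by auto
        obtain \<eta>2 where 2: "\<eta>2 > 0" "\<And>u v. u \<le> x \<Longrightarrow> x \<le> v \<Longrightarrow> u < v \<Longrightarrow> v - u < \<eta>2 \<Longrightarrow> F v - F u \<ge> (L-e/2) * (v - u)"
          using lo[of "L-e/2"] \<open>e > 0\<close> by auto
        have "dist ((F y - F x) / (y - x)) L < e" if "y \<noteq> x" "dist y x < min \<eta>1 \<eta>2" for y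
        proof -
          define u v where "u = min x y" and "v = max x y"
          have uv: "u \<le> x" "x \<le> v" "u < v" "v - u < \<eta>1" "v - u < \<eta>2"
            using that by (auto simp: u_def v_def dist_real_def)
          have eq: "(F y - F x) / (y - x) = (F v - F u) / (v - u)"
            using that by (auto simp: u_def v_def min_def max_def field_simps)
          have "(F v - F u) / (v - u) \<le> L + e/2" "(F v - F u) / (v - u) \<ge> L - e/2"
            using 1(2)[OF uv(1-4)] 2(2)[OF uv(1-3,5)] uv(3) by (auto simp: field_simps)
          then have "\<bar>(F v - F u) / (v - u) - L\<bar> \<le> e/2" unfolding abs_le_iff by linarith
          then show ?thesis unfolding eq dist_real_def using \<open>e > 0\<close> by linarith
        qed
        then show "\<exists>s>0. \<forall>y. y \<noteq> x \<and> dist y x < s \<longrightarrow> dist ((F y - F x) / (y - x)) L < e"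
          using 1(1) 2(1) by (intro exI[of _ "min \<eta>1 \<eta>2"]) auto
      qed
      then have "F differentiable (at x)" by (auto simp: real_differentiable_def)
      with x show False by simp
    qed
  qed
qed

end

text \<open>Replaces the variation function, whose right continuity is not established, by a right
  continuous function to which a Stieltjes measure belongs.\<close>

definition right_limit :: "(real \<Rightarrow> real) \<Rightarrow> real \<Rightarrow> real" where
  "right_limit V x = Inf (V ` {x<..})"

lemma
  assumes mono: "mono V"
  shows right_limit_le: "x < y \<Longrightarrow> right_limit V x \<le> V y"
    and right_limit_ge: "V x \<le> right_limit V x"
    and right_limit_less: "right_limit V x < e \<Longrightarrow> \<exists>y>x. V y < e"
proof -
  have bdd: "bdd_below (V ` {x<..})" for x
    using mono by (intro bdd_belowI[of _ "V x"]) (auto simp: mono_def)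
  show "x < y \<Longrightarrow> right_limit V x \<le> V y"
    unfolding right_limit_def by (rule cInf_lower) (use bdd in auto)
  show "V x \<le> right_limit V x"
    unfolding right_limit_def by (rule cInf_greatest) (use mono in \<open>auto simp: mono_def\<close>)
  show "\<exists>y>x. V y < e" if "right_limit V x < e"
  proof -
    have "V ` {x<..} \<noteq> {}" by simp
    from cInf_lessD[OF this that[unfolded right_limit_def]] show ?thesis by blast
  qed
qed

lemma right_limit_mono:
  assumes "mono V" "x \<le> y" shows "right_limit V x \<le> right_limit V y"
proof (cases "x = y")
  case False
  then have "right_limit V x \<le> V y" using assms by (intro right_limit_le) auto
  then show ?thesis using right_limit_ge[OF assms(1), of y] by linarith
qed simp

lemma right_limit_continuous:
  assumes "mono V" shows "continuous (at_right a) (right_limit V)"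
proof -
  have "(right_limit V \<longlongrightarrow> right_limit V a) (at_right a)"
  proof (rule order_tendstoI)
    fix e assume "e < right_limit V a"
    then show "\<forall>\<^sub>F x in at_right a. e < right_limit V x"
      unfolding eventually_at_right_field
    proof (intro exI[of _ "a + 1"] conjI allI impI)
      fix x assume "e < right_limit V a" "a < x"
      then show "e < right_limit V x" using right_limit_mono[OF assms, of a x] by simp
    qed simp
  next
    fix e assume "right_limit V a < e"
    then obtain y where "y > a" "V y < e" using right_limit_less[OF assms] by blast
    then show "\<forall>\<^sub>F x in at_right a. right_limit V x < e"
      unfolding eventually_at_right_field
    proof (intro exI[of _ y] conjI allI impI)
      fix x assume "V y < e" "x < y"
      then show "right_limit V x < e" using right_limit_le[OF assms, of x y] by simp
    qed simp
  qed
  then show ?thesis by (simp add: continuous_within)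
qed

text \<open>Continuity of \<open>h\<close> carries the domination over to right limits: compare on a
  slightly shifted interval, then let its left end and after that its right end return.\<close>

lemma right_limit_dominates:
  fixes h :: "real \<Rightarrow> real"
  assumes "mono V" "continuous_on UNIV h" "\<And>x y. x \<le> y \<Longrightarrow> h y - h x \<le> V y - V x" "x \<le> y"
  shows "h y - h x \<le> right_limit V y - right_limit V x"
proof (rule field_le_epsilon)
  fix e :: real assume "e > 0"
  have lim: "(h \<longlongrightarrow> h z) (at_right z)" for z
    using assms(2) by (metis UNIV_I continuous_on_def tendsto_within_subset subset_UNIV)
  obtain y0 where y0: "y0 > y" "V y0 < right_limit V y + e"
    using right_limit_less[OF assms(1), of y "right_limit V y + e"] \<open>e > 0\<close> by auto
  have *: "h y' - h x \<le> V y0 - right_limit V x" if "y < y'" "y' \<le> y0" for y'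
  proof -
    have "\<forall>\<^sub>F x' in at_right x. h y' - h x' \<le> V y0 - right_limit V x"
      unfolding eventually_at_right_field
    proof (intro exI[of _ y'] conjI allI impI)
      fix x' assume x': "x < x'" "x' < y'"
      have "h y' - h x' \<le> V y' - V x'" using x' by (intro assms) auto
      moreover have "V y' \<le> V y0" using assms(1) that by (auto simp: mono_def)
      moreover have "right_limit V x \<le> V x'" using x' by (intro right_limit_le assms)
      ultimately show "h y' - h x' \<le> V y0 - right_limit V x" by linarith
    qed (use that assms in auto)
    then show ?thesis
      by (intro tendsto_upperbound[OF tendsto_diff[OF tendsto_const lim]]) auto
  qed
  have "\<forall>\<^sub>F y' in at_right y. h y' - h x \<le> V y0 - right_limit V x"
    unfolding eventually_at_right_field using y0 by (intro exI[of _ y0]) (auto intro: *)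
  then have "h y - h x \<le> V y0 - right_limit V x"
    by (intro tendsto_upperbound[OF tendsto_diff[OF lim tendsto_const]]) auto
  with y0 show "h y - h x \<le> right_limit V y - right_limit V x + e" by linarith
qed

section \<open>Absolutely continuous functions: differentiability and the Lipschitz bound\<close>

definition interval_family :: "real set \<Rightarrow> (real \<times> real) set \<Rightarrow> bool" where
  "interval_family S I \<longleftrightarrow> finite I \<and> (\<forall>(a, b)\<in>I. a \<le> b \<and> {a..b} \<subseteq> S) \<and>
     pairwise (\<lambda>(a, b) (c, d). {a<..<b} \<inter> {c<..<d} = {}) I"

lemma interval_family_mono: "interval_family S I \<Longrightarrow> S \<subseteq> T \<Longrightarrow> interval_family T I"
  unfolding interval_family_def by blast

lemma abs_cont_on_iff:
  "abs_cont_on S g \<longleftrightarrow> (\<forall>\<epsilon>>0. \<exists>\<delta>>0. \<forall>I. interval_family S I \<longrightarrow>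
     (\<Sum>(a, b)\<in>I. b - a) < \<delta> \<longrightarrow> (\<Sum>(a, b)\<in>I. norm (g b - g a)) < \<epsilon>)"
  unfolding abs_cont_on_def interval_family_def by (simp add: conj_assoc) (simp add: imp_conjL)

lemma abs_cont_onE:
  assumes "abs_cont_on S g" "\<epsilon> > 0"
  obtains \<delta> where "\<delta> > 0" "\<And>I. interval_family S I \<Longrightarrow>
     (\<Sum>(a, b)\<in>I. b - a) < \<delta> \<Longrightarrow> (\<Sum>(a, b)\<in>I. norm (g b - g a)) < \<epsilon>"
  using assms unfolding abs_cont_on_iff by meson

lemma abs_cont_on_dominated:
  assumes "abs_cont_on S g" "\<And>x y. norm (h x - h y) \<le> norm (g x - g y)"
  shows "abs_cont_on S h"
proof -
  have "(\<Sum>(a, b)\<in>I. norm (h b - h a)) \<le> (\<Sum>(a, b)\<in>I. norm (g b - g a))" for I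
    by (intro sum_mono) (auto intro: assms(2))
  then show ?thesis using assms(1) unfolding abs_cont_on_iff by (meson le_less_trans)
qed

lemma abs_cont_on_imp_continuous:
  fixes g :: "real \<Rightarrow> 'a::real_normed_vector"
  assumes "abs_cont_on {a..b} g" shows "continuous_on {a..b} g"
  unfolding continuous_on_iff
proof (intro ballI allI impI)
  fix x e :: real assume x: "x \<in> {a..b}" "e > 0"
  obtain \<delta> where \<delta>: "\<delta> > 0" "\<And>I. interval_family {a..b} I \<Longrightarrow>
        (\<Sum>(a, b)\<in>I. b - a) < \<delta> \<Longrightarrow> (\<Sum>(a, b)\<in>I. norm (g b - g a)) < e"
    by (rule abs_cont_onE[OF assms x(2)]) (rule that; assumption)
  have "dist (g y) (g x) < e" if "y \<in> {a..b}" "dist y x < \<delta>" for y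
  proof -
    have "norm (g (max x y) - g (min x y)) < e"
      using \<delta>(2)[of "{(min x y, max x y)}"] x that
      by (auto simp: interval_family_def dist_real_def pairwise_def min_def max_def split: if_splits)
    then show ?thesis by (auto simp: dist_norm min_def max_def norm_minus_commute split: if_splits)
  qed
  with \<delta>(1) show "\<exists>d>0. \<forall>y\<in>{a..b}. dist y x < d \<longrightarrow> dist (g y) (g x) < e" by blast
qed

text \<open>Jordan decomposition. The variation is at most \<open>1\<close>, hence finite; with
  \<open>W\<close> the right limit of the variation function, \<open>W - h\<close> and
  \<open>W + h\<close> are increasing and right continuous, and \<open>h\<close> is half of their
  difference.\<close>

lemma abs_cont_short_differentiable_ae:
  fixes h :: "real \<Rightarrow> real"
  assumes cont: "continuous_on {a..b} h" and "a \<le> b"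
    and short: "\<And>I. interval_family {a..b} I \<Longrightarrow> (\<Sum>(a, b)\<in>I. \<bar>h b - h a\<bar>) \<le> 1"
  shows "negligible {x\<in>{a<..<b}. \<not> h differentiable (at x)}"
proof -
  \<comment> \<open>Clamping to \<open>[a, b]\<close> extends \<open>h\<close> continuously to the
    whole line, where the results on monotone functions live.\<close>
  define cl where "cl x = max a (min b x)" for x
  define k where "k x = h (cl x)" for x
  have cl: "cl x \<in> {a..b}" "x \<le> y \<Longrightarrow> cl x \<le> cl y" "x \<in> {a..b} \<Longrightarrow> cl x = x" for x y
    using \<open>a \<le> b\<close> by (auto simp: cl_def)
  have contk: "continuous_on UNIV k"
    unfolding k_def cl_def
    by (rule continuous_on_compose2[OF cont]) (use \<open>a \<le> b\<close> in \<open>auto intro!: continuous_intros\<close>)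
  define ok where "ok x = interval_family {a..cl x}" for x
  define s where "s I = (\<Sum>(c, d)\<in>I. \<bar>h d - h c\<bar>)" for I
  \<comment> \<open>The variation of \<open>h\<close> over \<open>[a, cl x]\<close>.\<close>
  define V where "V x = Sup (s ` {I. ok x I})" for x
  have okmono: "ok y I" if "ok x I" "x \<le> y" for x y I
    proof -
    have "{a..cl x} \<subseteq> {a..cl y}" using cl(2)[OF that(2)] by auto
    then show ?thesis using that(1) interval_family_mono unfolding ok_def by blast
  qed
  have s1: "s I \<le> 1" if "ok x I" for x I
  proof -
    have "{a..cl x} \<subseteq> {a..b}" using cl(1)[of x] by auto
    then show ?thesis using that interval_family_mono short unfolding ok_def s_def by blast
  qed
  have bdd: "bdd_above (s ` {I. ok x I})" for x using s1 by (intro bdd_aboveI[of _ 1]) auto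
  have ok0: "ok x {}" for x by (auto simp: ok_def interval_family_def)
  have Vge: "s I \<le> V x" if "ok x I" for x I
    unfolding V_def by (rule cSup_upper) (use that bdd in auto)
  have step: "\<bar>k y - k x\<bar> \<le> V y - V x" if "x \<le> y" for x y
  proof -
    \<comment> \<open>The interval from \<open>cl x\<close> to \<open>cl y\<close> may be appended
      to any family below \<open>cl x\<close>, so the variation grows at least by the increment of
      \<open>k\<close>.\<close>
    have "s I + \<bar>k y - k x\<bar> \<le> V y" if I: "ok x I" for I
    proof (cases "cl x = cl y")
      case True
      then show ?thesis using Vge[OF okmono[OF I \<open>x \<le> y\<close>]] by (simp add: k_def)
    next
      case False
      then have less: "cl x < cl y" using cl(2)[OF \<open>x \<le> y\<close>] by simp
      have sub: "d \<le> cl x \<and> a \<le> c \<and> c \<le> d" if "(c, d) \<in> I" for c d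
    proof -
      have "c \<le> d" "{c..d} \<subseteq> {a..cl x}" using I that unfolding ok_def interval_family_def by auto
      then show ?thesis by auto
    qed
      have nin: "(cl x, cl y) \<notin> I" using sub[of "cl x" "cl y"] less by auto
      have "ok y (insert (cl x, cl y) I)"
        proof -
        have "{c<..<d} \<inter> {cl x<..<cl y} = {}" if "(c, d) \<in> I" for c d
          using sub[OF that] by auto
        moreover have "{cl x..cl y} \<subseteq> {a..cl y}" "cl x \<le> cl y" using less cl(1)[of x] by auto
        ultimately show ?thesis using okmono[OF I \<open>x \<le> y\<close>]
          unfolding ok_def interval_family_def pairwise_insert finite_insert
          by (simp only: split_paired_all split_paired_All prod.case ball_simps Int_commute simp_thms) blast
      qed
      then have "s (insert (cl x, cl y) I) \<le> V y" by (rule Vge)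
      moreover have "s (insert (cl x, cl y) I) = s I + \<bar>k y - k x\<bar>"
        using I nin by (simp add: s_def ok_def k_def interval_family_def)
      ultimately show ?thesis by simp
    qed
    then have "V x \<le> V y - \<bar>k y - k x\<bar>"
      unfolding V_def[of x]
    proof (intro cSup_least)
      show "s ` {I. ok x I} \<noteq> {}" using ok0[of x] by auto
      fix r assume "r \<in> s ` {I. ok x I}"
      then obtain I where "r = s I" "ok x I" by auto
      with \<open>\<And>I. ok x I \<Longrightarrow> s I + \<bar>k y - k x\<bar> \<le> V y\<close>[of I] show "r \<le> V y - \<bar>k y - k x\<bar>" by simp
    qed
    then show ?thesis by simp
  qed
  have V: "mono V" using step by (intro monoI) (smt (verit))
  define W where "W = right_limit V"
  have step1: "k y - k x \<le> V y - V x" "- k y - - k x \<le> V y - V x" if "x \<le> y" for x y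
    using step[OF that] by linarith+
  have W1: "k y - k x \<le> W y - W x" if "x \<le> y" for x y
    unfolding W_def by (rule right_limit_dominates[OF V contk step1(1) that])
  have W2: "k x - k y \<le> W y - W x" if "x \<le> y" for x y
    using right_limit_dominates[OF V continuous_on_minus[OF contk] step1(2) that] unfolding W_def by simp
  have contr: "continuous (at_right x) k" for x
    using contk by (metis UNIV_I continuous_on_eq_continuous_within continuous_within_subset subset_UNIV)
  interpret A: right_continuous_mono "\<lambda>x. W x - k x"
    by unfold_locales (use W1 in \<open>smt (verit)\<close>, auto intro!: continuous_intros contr right_limit_continuous V simp: W_def)
  interpret B: right_continuous_mono "\<lambda>x. W x + k x"
    by unfold_locales (use W2 in \<open>smt (verit)\<close>, auto intro!: continuous_intros contr right_limit_continuous V simp: W_def)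
  have "negligible ({x\<in>{a<..<b}. \<not> (\<lambda>x. W x - k x) differentiable (at x)} \<union>
      {x\<in>{a<..<b}. \<not> (\<lambda>x. W x + k x) differentiable (at x)})"
    using A.differentiable_ae[of a b] B.differentiable_ae[of a b] by simp
  then show ?thesis
  proof (rule negligible_subset, safe)
    fix x assume x: "x \<in> {a<..<b}" and nh: "\<not> h differentiable (at x)"
      and dB: "(\<lambda>x. W x + k x) differentiable (at x)"
    show "(\<lambda>x. W x - k x) differentiable (at x) \<Longrightarrow> False"
    proof -
      assume dA: "(\<lambda>x. W x - k x) differentiable (at x)"
      have "(\<lambda>x. (1/2) *\<^sub>R ((W x + k x) - (W x - k x))) differentiable (at x)"
        by (intro differentiable_scaleR differentiable_diff dA dB differentiable_const)
      then have "k differentiable (at x)" by simp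
      then obtain D where "(k has_derivative D) (at x)" unfolding differentiable_def by blast
      then have "(h has_derivative D) (at x)"
        using x by (intro has_derivative_transform_within_open[of k D x UNIV "{a<..<b}" h]) (auto simp: k_def cl_def)
      with nh show False unfolding differentiable_def by blast
    qed
  qed
qed

text \<open>Absolute continuity with \<open>\<epsilon> = 1\<close> bounds the variation by
  \<open>1\<close> on every interval shorter than \<open>\<delta>\<close>, and countably many of
  these, with rational ends, cover the open interval.\<close>

lemma abs_cont_differentiable_ae:
  fixes h :: "real \<Rightarrow> real"
  assumes ac: "abs_cont_on {a..b} h"
  shows "negligible {x\<in>{a<..<b}. \<not> h differentiable (at x)}"
proof -
  obtain \<delta> where \<delta>: "\<delta> > 0" "\<And>I. interval_family {a..b} I \<Longrightarrow>
        (\<Sum>(a, b)\<in>I. b - a) < \<delta> \<Longrightarrow> (\<Sum>(a, b)\<in>I. norm (h b - h a)) < 1"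
    by (rule abs_cont_onE[OF ac zero_less_one]) (rule that; assumption)
  let ?I = "{(r, s). r \<in> \<rat> \<and> s \<in> \<rat> \<and> a < r \<and> r \<le> s \<and> s < b \<and> s - r < \<delta>}"
  have "?I \<subseteq> \<rat> \<times> \<rat>" by auto
  then have "countable ?I" by (rule countable_subset) (simp add: countable_rat)
  moreover have "negligible {x\<in>{r<..<s}. \<not> h differentiable (at x)}" if "(r, s) \<in> ?I" for r s
  proof (rule abs_cont_short_differentiable_ae)
    show "continuous_on {r..s} h"
      by (rule continuous_on_subset[OF abs_cont_on_imp_continuous[OF ac]]) (use that in auto)
    show "r \<le> s" using that by auto
    fix I :: "(real \<times> real) set"
    assume "interval_family {r..s} I"
    then have I: "finite I" "\<And>c d. (c, d) \<in> I \<Longrightarrow> c \<le> d \<and> {c..d} \<subseteq> {r..s}"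
      "pairwise (\<lambda>(a, b) (c, d). {a<..<b} \<inter> {c<..<d} = {}) I"
      by (auto simp: interval_family_def)
    have sub: "{r..s} \<subseteq> {a..b}" using that by auto
    \<comment> \<open>The sum of the lengths is the measure of a disjoint union inside
      \<open>[r, s]\<close>.\<close>
    have "ennreal (\<Sum>(c, d)\<in>I. d - c) = (\<Sum>(c, d)\<in>I. ennreal (d - c))"
      using I(2) by (subst sum_ennreal[symmetric]) (auto simp: case_prod_unfold)
    also have "\<dots> = (\<Sum>i\<in>I. emeasure lborel {fst i<..<snd i})"
      using I(2) by (intro sum.cong) auto
    also have "\<dots> = emeasure lborel (\<Union>i\<in>I. {fst i<..<snd i})"
      using I(1,3) by (intro sum_emeasure) (auto simp: disjoint_family_on_def pairwise_def case_prod_unfold)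
    also have "\<dots> \<le> emeasure lborel {r..s}"
      by (rule emeasure_mono) (use I(2) in \<open>fastforce\<close>)+
    also have "\<dots> = ennreal (s - r)" using that by simp
    finally have "(\<Sum>(c, d)\<in>I. d - c) \<le> s - r" using that by simp
    then have "(\<Sum>(c, d)\<in>I. d - c) < \<delta>" using that by simp
    then have "(\<Sum>(a, b)\<in>I. norm (h b - h a)) < 1" using I sub by (intro \<delta>(2)) (fastforce simp: interval_family_def)+
    then show "(\<Sum>(a, b)\<in>I. \<bar>h b - h a\<bar>) \<le> 1" by simp
  qed
  ultimately have "negligible (\<Union>((\<lambda>(r, s). {x\<in>{r<..<s}. \<not> h differentiable (at x)}) ` ?I))"
    by (intro negligible_countable_Union) auto
  then show ?thesis
  proof (rule negligible_subset, intro subsetI)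
    fix x assume x: "x \<in> {x\<in>{a<..<b}. \<not> h differentiable (at x)}"
    obtain r where r: "r \<in> \<rat>" "max a (x - \<delta>/2) < r" "r < x"
      using Rats_dense_in_real[of "max a (x - \<delta>/2)" x] x \<delta>(1) by auto
    obtain s where s: "s \<in> \<rat>" "x < s" "s < min b (x + \<delta>/2)"
      using Rats_dense_in_real[of x "min b (x + \<delta>/2)"] x \<delta>(1) by auto
    have "(r, s) \<in> ?I" using r s by auto
    then show "x \<in> \<Union>((\<lambda>(r, s). {x\<in>{r<..<s}. \<not> h differentiable (at x)}) ` ?I)"
      by (rule UN_I) (use r s x in auto)
  qed
qed

text \<open>A gauge-fine tagged division separates two kinds of intervals. Around a tag where the
  derivative is at most \<open>M\<close>, increments have slope at most
  \<open>M + \<epsilon>\<close>; intervals with exceptional tags lie in an open set of small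
  measure, where absolute continuity makes the sum of the increments small.\<close>

lemma abs_cont_increment_le:
  fixes h :: "real \<Rightarrow> real"
  assumes ac: "abs_cont_on {a..b} h" and "a \<le> b" and N: "negligible N"
    and deriv: "\<And>x. x \<in> {a<..<b} - N \<Longrightarrow> \<exists>D\<le>M. (h has_real_derivative D) (at x)"
  shows "h b - h a \<le> M * (b - a)"
proof (rule field_le_epsilon)
  fix e :: real assume "e > 0"
  \<comment> \<open>Three errors must fit into \<open>e\<close>: \<open>\<epsilon> * (b - a)\<close>
    from the slopes, \<open>\<epsilon>\<close> from the increments over exceptional intervals, and
    \<open>\<bar>M\<bar> * \<epsilon>\<close> from the length that these take away from the
    rest.\<close>
  define \<epsilon> where "\<epsilon> = e / (2 * (b - a + 1) + \<bar>M\<bar>)"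
  have "0 < 2 * (b - a + 1) + \<bar>M\<bar>" using \<open>a \<le> b\<close> by (intro add_pos_nonneg) auto
  then have \<epsilon>: "\<epsilon> > 0" using \<open>e > 0\<close> by (simp add: \<epsilon>_def)
  have \<epsilon>e: "\<epsilon> * (b - a) + \<epsilon> + \<bar>M\<bar> * \<epsilon> \<le> e"
  proof -
    have "\<epsilon> * (b - a) + \<epsilon> + \<bar>M\<bar> * \<epsilon> = \<epsilon> * (b - a + 1 + \<bar>M\<bar>)" by (simp add: algebra_simps)
    also have "\<dots> \<le> \<epsilon> * (2 * (b - a + 1) + \<bar>M\<bar>)"
      using \<epsilon> \<open>a \<le> b\<close> by (intro mult_left_mono) auto
    also have "\<dots> = e" using \<open>0 < 2 * (b - a + 1) + \<bar>M\<bar>\<close> by (simp add: \<epsilon>_def)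
    finally show ?thesis .
  qed
  obtain \<delta> where \<delta>: "\<delta> > 0" "\<And>I. interval_family {a..b} I \<Longrightarrow>
     (\<Sum>(a, b)\<in>I. b - a) < \<delta> \<Longrightarrow> (\<Sum>(a, b)\<in>I. norm (h b - h a)) < \<epsilon>"
    by (rule abs_cont_onE[OF ac \<epsilon>]) (rule that; assumption)
  \<comment> \<open>The end points join the exceptional set, since derivatives are supplied in the
    open interval only.\<close>
  define N' where "N' = N \<union> {a, b}"
  have "negligible N'" using N by (simp add: N'_def)
  define \<eta> where "\<eta> = min (\<delta>/2) \<epsilon>"
  have "\<eta> > 0" using \<delta>(1) \<epsilon> by (simp add: \<eta>_def)
  then obtain G where G: "open G" "N' \<subseteq> G" "emeasure lborel G \<le> ennreal \<eta>"
    using negligible_open_cover[OF \<open>negligible N'\<close>] by blast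
  have "\<exists>d>0. (x \<in> N' \<longrightarrow> ball x d \<subseteq> G) \<and> (x \<in> {a..b} - N' \<longrightarrow>
      (\<forall>u v. u \<le> x \<longrightarrow> x \<le> v \<longrightarrow> u \<in> ball x d \<longrightarrow> v \<in> ball x d \<longrightarrow> h v - h u \<le> (M + \<epsilon>) * (v - u)))" for x
  proof (cases "x \<in> N'")
    case True
    then show ?thesis using G(1,2) by (meson DiffE openE subsetD)
  next
    case False
    show ?thesis
    proof (cases "x \<in> {a..b}")
      case True
      then obtain D where D: "D \<le> M" "(h has_real_derivative D) (at x)"
        using deriv[of x] False unfolding N'_def by force
      then have "(\<lambda>y. (h y - h x) / (y - x)) \<midarrow>x\<rightarrow> D" by (simp add: has_field_derivative_iff)
      then obtain d where d: "d > 0" "\<And>y. y \<noteq> x \<Longrightarrow> dist y x < d \<Longrightarrow> dist ((h y - h x) / (y - x)) D < \<epsilon>"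
        unfolding LIM_def using \<epsilon> by blast
      have q: "(h y - h x) / (y - x) \<le> M + \<epsilon>" if "y \<noteq> x" "dist y x < d" for y
        using d(2)[OF that] D(1) unfolding dist_real_def by linarith
      have "h v - h u \<le> (M + \<epsilon>) * (v - u)" if "u \<le> x" "x \<le> v" "u \<in> ball x d" "v \<in> ball x d" for u v
      proof -
        have "h v - h x \<le> (M + \<epsilon>) * (v - x)"
          using q[of v] that by (cases "v = x") (auto simp: dist_commute divide_le_eq)
        moreover have "h x - h u \<le> (M + \<epsilon>) * (x - u)"
          using q[of u] that by (cases "u = x") (auto simp: dist_commute divide_le_eq algebra_simps)
        ultimately show ?thesis by (simp add: algebra_simps)
      qed
      then show ?thesis using d(1) False by blast
    next
      case False
      with \<open>x \<notin> N'\<close> show ?thesis by (intro exI[of _ 1]) auto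
    qed
  qed
  then obtain d where d: "\<And>x. d x > 0" "\<And>x. x \<in> N' \<Longrightarrow> ball x (d x) \<subseteq> G"
    "\<And>x u v. x \<in> {a..b} - N' \<Longrightarrow> u \<le> x \<Longrightarrow> x \<le> v \<Longrightarrow> u \<in> ball x (d x) \<Longrightarrow> v \<in> ball x (d x)
       \<Longrightarrow> h v - h u \<le> (M + \<epsilon>) * (v - u)"
    by metis
  have "gauge (\<lambda>x. ball x (d x))" using d(1) by (simp add: gauge_def)
  then obtain p where p: "p tagged_division_of {a..b}" "(\<lambda>x. ball x (d x)) fine p"
    by (rule fine_division_exists_real)
  have pK: "\<exists>u v. K = {u..v} \<and> u \<le> x \<and> x \<le> v \<and> {u..v} \<subseteq> {a..b} \<and> {u..v} \<subseteq> ball x (d x)"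
    if "(x, K) \<in> p" for x K
    using tagged_division_ofD(2-4)[OF p(1) that] fineD[OF p(2) that] by fastforce
  define pN where "pN = {(x, K)\<in>p. x \<in> N'}"
  have fin: "finite p" using p(1) by auto
  have pN: "pN \<subseteq> p" "finite pN" using fin by (auto simp: pN_def intro: finite_subset)
  \<comment> \<open>Degenerate intervals are dropped: only a nonempty interior forces two tagged
    pairs with the same interval to coincide, and this makes the passage to end points
    injective.\<close>
  define J where "J = (\<lambda>(x, K). (Inf K, Sup K)) ` {(x, K)\<in>pN. interior K \<noteq> {}}"
  have inj: "inj_on (\<lambda>(x, K). (Inf K, Sup K)) {(x, K)\<in>pN. interior K \<noteq> {}}"
  proof (rule inj_onI, clarify)
    fix x K y L assume *: "(x, K) \<in> pN" "(y, L) \<in> pN" "interior K \<noteq> {}" "interior L \<noteq> {}"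
      "Inf K = Inf L" "Sup K = Sup L"
    obtain u v u' v' where "K = {u..v}" "u \<le> v" "L = {u'..v'}" "u' \<le> v'"
      using pK *(1,2) pN(1) by (meson order_trans subsetD)
    then have "K = L" using *(5,6) by simp
    then have "x = y" using tagged_division_ofD(5)[OF p(1), of x K y L] * pN(1) by auto
    with \<open>K = L\<close> show "x = y \<and> K = L" by simp
  qed
  have JE: "\<exists>x. (x, {c..d'}) \<in> pN \<and> c < d' \<and> {c..d'} \<subseteq> {a..b} \<and> {c..d'} \<subseteq> G" if cd: "(c, d') \<in> J" for c d'
  proof -
    obtain x K where xK: "(x, K) \<in> pN" "interior K \<noteq> {}" "c = Inf K" "d' = Sup K"
      using cd unfolding J_def by auto
    obtain u v where uv: "K = {u..v}" "u \<le> x" "x \<le> v" "{u..v} \<subseteq> {a..b}" "{u..v} \<subseteq> ball x (d x)"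
      using pK[of x K] xK(1) pN(1) by blast
    have "u < v" using xK(2) uv by (simp add: interior_atLeastAtMost_real)
    moreover have "x \<in> N'" using xK(1) by (auto simp: pN_def)
    ultimately show ?thesis using uv xK(1,3,4) d(2)[of x] by (intro exI[of _ x]) auto
  qed
  have fam: "interval_family {a..b} J"
    unfolding interval_family_def
  proof (intro conjI)
    show "finite J" unfolding J_def by (rule finite_imageI, rule finite_subset[OF _ pN(2)]) auto
    show "\<forall>(c, d)\<in>J. c \<le> d \<and> {c..d} \<subseteq> {a..b}" using JE less_imp_le by blast
    show "pairwise (\<lambda>(a, b) (c, d). {a<..<b} \<inter> {c<..<d} = {}) J"
    proof (rule pairwiseI)
      fix i j assume ij: "i \<in> J" "j \<in> J" "i \<noteq> j"
      obtain c d' c' d'' where eq: "i = (c, d')" "j = (c', d'')" by (meson surj_pair)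
      note * = ij[unfolded eq]
      obtain x where x: "(x, {c..d'}) \<in> pN" "c < d'" using JE[OF *(1)] by auto
      obtain y where y: "(y, {c'..d''}) \<in> pN" "c' < d''" using JE[OF *(2)] by auto
      have "{c..d'} \<noteq> {c'..d''}" using *(3) x y by (auto simp: Icc_eq_Icc)
      then show "(case i of (a, b) \<Rightarrow> \<lambda>(c, d). {a<..<b} \<inter> {c<..<d} = {}) j" unfolding eq prod.case
        using tagged_division_ofD(5)[OF p(1), of x "{c..d'}" y "{c'..d''}"] x y pN(1)
        by (auto simp: interior_atLeastAtMost_real)
    qed
  qed
  have lenJ: "(\<Sum>(c, d)\<in>J. d - c) \<le> \<eta>"
  proof -
    have "ennreal (\<Sum>(c, d)\<in>J. d - c) = (\<Sum>(c, d)\<in>J. ennreal (d - c))"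
      using fam by (subst sum_ennreal[symmetric]) (auto simp: case_prod_unfold interval_family_def)
    also have "\<dots> = (\<Sum>i\<in>J. emeasure lborel {fst i<..<snd i})"
      using fam by (intro sum.cong) (auto simp: interval_family_def)
    also have "\<dots> = emeasure lborel (\<Union>i\<in>J. {fst i<..<snd i})"
      using fam by (intro sum_emeasure) (auto simp: interval_family_def disjoint_family_on_def pairwise_def case_prod_unfold)
    also have "\<dots> \<le> emeasure lborel G"
    proof (rule emeasure_mono)
      show "(\<Union>i\<in>J. {fst i<..<snd i}) \<subseteq> G"
      proof (rule UN_least, clarify)
        fix c d' x assume "(c, d') \<in> J" "x \<in> {fst (c, d')<..<snd (c, d')}"
        then show "x \<in> G" using JE[of c d'] by auto
      qed
    qed (use G in auto)
    also have "\<dots> \<le> ennreal \<eta>" by (rule G)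
    finally show ?thesis using \<open>\<eta> > 0\<close> by simp
  qed
  have sumN: "(\<Sum>(x, K)\<in>pN. g (Sup K) - g (Inf K)) = (\<Sum>(c, d)\<in>J. g d - g c)" for g :: "real \<Rightarrow> real"
  proof -
    have "(\<Sum>(x, K)\<in>pN. g (Sup K) - g (Inf K)) = (\<Sum>(x, K)\<in>{(x, K)\<in>pN. interior K \<noteq> {}}. g (Sup K) - g (Inf K))"
    proof (rule sum.mono_neutral_right[OF pN(2)], blast, rule ballI)
      fix i assume i: "i \<in> pN - {(x, K)\<in>pN. interior K \<noteq> {}}"
      obtain x K where ixK: "i = (x, K)" by (rule prod.exhaust)
      with i have xK: "(x, K) \<in> pN" "interior K = {}" by auto
      then obtain u v where uv: "K = {u..v}" "u \<le> x" "x \<le> v" using pK[of x K] pN(1) by auto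
      then have "u = v" using xK(2) by (simp add: interior_atLeastAtMost_real)
      then show "(case i of (x, K) \<Rightarrow> g (Sup K) - g (Inf K)) = 0" using uv ixK by simp
    qed
    also have "\<dots> = (\<Sum>(c, d)\<in>J. g d - g c)"
      unfolding J_def by (subst sum.reindex[OF inj]) (auto intro!: sum.cong)
    finally show ?thesis .
  qed
  have "(\<Sum>(c, d)\<in>J. h d - h c) \<le> (\<Sum>(c, d)\<in>J. norm (h d - h c))"
    by (intro sum_mono) auto
  also have "\<dots> \<le> \<epsilon>"
    using \<delta>(2)[OF fam] lenJ \<delta>(1) \<epsilon> by (simp add: \<eta>_def)
  finally have hN: "(\<Sum>(x, K)\<in>pN. h (Sup K) - h (Inf K)) \<le> \<epsilon>" unfolding sumN .
  have lN: "(\<Sum>(x, K)\<in>pN. Sup K - Inf K) \<le> \<epsilon>" "(\<Sum>(x, K)\<in>pN. Sup K - Inf K) \<ge> 0"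
  proof -
    show "(\<Sum>(x, K)\<in>pN. Sup K - Inf K) \<le> \<epsilon>"
      using lenJ sumN[of "\<lambda>x. x"] by (simp add: \<eta>_def)
    show "(\<Sum>(x, K)\<in>pN. Sup K - Inf K) \<ge> 0"
    proof (rule sum_nonneg, clarify)
      fix x K assume "(x, K) \<in> pN"
      then obtain u v where "K = {u..v}" "u \<le> x" "x \<le> v" using pK[of x K] pN(1) by auto
      then show "0 \<le> Sup K - Inf K" by simp
    qed
  qed
  have rest: "(\<Sum>(x, K)\<in>p - pN. h (Sup K) - h (Inf K)) \<le> (\<Sum>(x, K)\<in>p - pN. (M + \<epsilon>) * (Sup K - Inf K))"
  proof (rule sum_mono, clarify)
    fix x K assume xK: "(x, K) \<in> p" "(x, K) \<notin> pN"
    obtain u v where uv: "K = {u..v}" "u \<le> x" "x \<le> v" "{u..v} \<subseteq> {a..b}" "{u..v} \<subseteq> ball x (d x)"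
      using pK[OF xK(1)] by blast
    have "x \<in> {a..b} - N'" using xK uv by (auto simp: pN_def)
    moreover have "u \<in> {u..v}" "v \<in> {u..v}" using uv by auto
    then have "u \<in> ball x (d x)" "v \<in> ball x (d x)" using uv(5) by blast+
    ultimately have "h v - h u \<le> (M + \<epsilon>) * (v - u)" using d(3) uv(2,3) by blast
    then show "h (Sup K) - h (Inf K) \<le> (M + \<epsilon>) * (Sup K - Inf K)" using uv by simp
  qed
  have split: "(\<Sum>(x, K)\<in>p. g (Sup K) - g (Inf K)) =
      (\<Sum>(x, K)\<in>pN. g (Sup K) - g (Inf K)) + (\<Sum>(x, K)\<in>p - pN. g (Sup K) - g (Inf K))" for g :: "real \<Rightarrow> real"
    using sum.subset_diff[OF pN(1) fin] by (simp add: add.commute)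
  have "h b - h a = (\<Sum>(x, K)\<in>p. h (Sup K) - h (Inf K))"
    using additive_tagged_division_1[OF \<open>a \<le> b\<close> p(1), of h] by simp
  also have "\<dots> \<le> \<epsilon> + (M + \<epsilon>) * (\<Sum>(x, K)\<in>p - pN. Sup K - Inf K)"
    using hN rest unfolding split[of h] by (simp add: sum_distrib_left case_prod_unfold)
  also have "(\<Sum>(x, K)\<in>p - pN. Sup K - Inf K) = b - a - (\<Sum>(x, K)\<in>pN. Sup K - Inf K)"
    using additive_tagged_division_1[OF \<open>a \<le> b\<close> p(1), of "\<lambda>x. x"] split[of "\<lambda>x. x"] by simp
  finally have "h b - h a \<le> \<epsilon> + (M + \<epsilon>) * (b - a) - (M + \<epsilon>) * (\<Sum>(x, K)\<in>pN. Sup K - Inf K)"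
    (is "_ \<le> _ - _ * ?l") by (simp add: algebra_simps)
  moreover have "- ((M + \<epsilon>) * ?l) \<le> \<bar>M\<bar> * \<epsilon>"
  proof -
    have "- (M + \<epsilon>) * ?l \<le> \<bar>M\<bar> * ?l" using \<epsilon> lN(2) by (intro mult_right_mono) auto
    also have "\<dots> \<le> \<bar>M\<bar> * \<epsilon>" using lN(1) by (intro mult_left_mono) auto
    finally show ?thesis by (simp only: mult_minus_left)
  qed
  ultimately show "h b - h a \<le> M * (b - a) + e" using \<epsilon>e by (simp add: algebra_simps)
qed

text \<open>Rotating the increment of \<open>g\<close> onto the positive real axis reduces the claim
  to a real function. The bound on \<open>vector_derivative\<close> carries information only where
  \<open>g\<close> is differentiable, so the exceptional set must also contain the points where the
  real or the imaginary part is not.\<close>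

lemma abs_cont_on_lipschitz:
  fixes g :: "real \<Rightarrow> complex"
  assumes ac: "abs_cont_on {a..b} g" and "a \<le> b"
    and bound: "AE x in lborel. x \<in> {a<..<b} \<longrightarrow> norm (vector_derivative g (at x)) \<le> M"
  shows "norm (g b - g a) \<le> M * (b - a)"
proof -
  define z where "z = g b - g a"
  \<comment> \<open>If \<open>z = 0\<close> then \<open>c = 0\<close>; so
    \<open>norm c \<le> 1\<close> is what is recorded, not equality.\<close>
  define c where "c = cnj (sgn z)"
  define h where "h x = Re (c * g x)" for x
  have c: "norm c \<le> 1" by (simp add: c_def norm_sgn)
  have ach: "abs_cont_on {a..b} h"
  proof (rule abs_cont_on_dominated[OF ac])
    fix x y
    have "norm (h x - h y) \<le> norm (c * (g x - g y))"
      unfolding h_def by (metis abs_Re_le_cmod minus_complex.simps(1) real_norm_def right_diff_distrib)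
    also have "\<dots> \<le> 1 * norm (g x - g y)" unfolding norm_mult using c by (intro mult_right_mono) auto
    finally show "norm (h x - h y) \<le> norm (g x - g y)" by simp
  qed
  have acRe: "abs_cont_on {a..b} (\<lambda>x. Re (g x))" "abs_cont_on {a..b} (\<lambda>x. Im (g x))"
    by (rule abs_cont_on_dominated[OF ac], metis abs_Re_le_cmod abs_Im_le_cmod minus_complex.simps real_norm_def)+
  from AE_E[OF bound] obtain N0 where N0: "{x\<in>space lborel. \<not> (x \<in> {a<..<b} \<longrightarrow> norm (vector_derivative g (at x)) \<le> M)} \<subseteq> N0"
    "emeasure lborel N0 = 0" "N0 \<in> sets lborel" .
  then have "N0 \<in> null_sets lebesgue" by (intro null_sets_completionI null_setsI)
  then have "negligible N0" by (simp add: negligible_iff_null_sets)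
  then have N1: "negligible {x\<in>{a<..<b}. \<not> norm (vector_derivative g (at x)) \<le> M}"
    by (rule negligible_subset) (use N0(1) in auto)
  define N where "N = {x\<in>{a<..<b}. \<not> norm (vector_derivative g (at x)) \<le> M} \<union>
    ({x\<in>{a<..<b}. \<not> (\<lambda>x. Re (g x)) differentiable (at x)} \<union> {x\<in>{a<..<b}. \<not> (\<lambda>x. Im (g x)) differentiable (at x)})"
  have "negligible N" unfolding N_def
    by (intro negligible_Un N1 abs_cont_differentiable_ae acRe)
  have "h b - h a \<le> M * (b - a)"
  proof (rule abs_cont_increment_le[OF ach \<open>a \<le> b\<close> \<open>negligible N\<close>])
    fix x assume x: "x \<in> {a<..<b} - N"
    then obtain R I where RI: "((\<lambda>x. Re (g x)) has_real_derivative R) (at x)" "((\<lambda>x. Im (g x)) has_real_derivative I) (at x)"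
      unfolding N_def real_differentiable_def by auto
    have "((\<lambda>x. complex_of_real (Re (g x)) + \<i> * complex_of_real (Im (g x))) has_vector_derivative (complex_of_real R + \<i> * complex_of_real I)) (at x)"
      using RI by (intro has_vector_derivative_add has_vector_derivative_mult_right has_vector_derivative_of_real)
        (simp_all add: has_real_derivative_iff_has_vector_derivative)
    then have gd: "(g has_vector_derivative Complex R I) (at x)"
      by (simp flip: complex_eq add: Complex_eq)
    then have "norm (Complex R I) \<le> M"
      using x by (auto simp: N_def vector_derivative_at)
    moreover have "(h has_real_derivative Re (c * Complex R I)) (at x)"
      unfolding h_def has_real_derivative_iff_has_vector_derivative
      by (intro bounded_linear.has_vector_derivative[OF bounded_linear_Re] has_vector_derivative_mult_right gd)
    moreover have "Re (c * Complex R I) \<le> norm (Complex R I)"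
    proof -
      have "Re (c * Complex R I) \<le> norm c * norm (Complex R I)"
        by (metis complex_Re_le_cmod norm_mult)
      also have "\<dots> \<le> 1 * norm (Complex R I)" using c by (intro mult_right_mono) auto
      finally show ?thesis by simp
    qed
    ultimately show "\<exists>D\<le>M. (h has_real_derivative D) (at x)" by (intro exI[of _ "Re (c * Complex R I)"]) auto
  qed
  moreover have "h b - h a = norm z"
  proof -
    have "h b - h a = Re (c * z)" by (simp add: h_def z_def right_diff_distrib)
    also have "c * z = complex_of_real (norm z)"
    proof (cases "z = 0")
      case False
      have "c * z = cnj z * z / norm z" by (simp add: c_def sgn_eq)
      also have "cnj z * z = (complex_of_real (norm z))\<^sup>2" using complex_norm_square[of z] by (simp add: mult.commute)
      finally show ?thesis using False by (simp add: power2_eq_square)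
    qed (simp add: c_def)
    finally show ?thesis by simp
  qed
  ultimately show ?thesis by (simp add: z_def)
qed

section \<open>Fourier transforms on the plane\<close>

text \<open>An upper estimate of the norm in \<open>A\<close>, stated with a witness
  \<open>g\<close> so that uniqueness of the representing function never enters. Bounds in
  \<open>ennreal\<close> can be added and summed without side conditions.\<close>

definition fourier_bounded :: "('a::euclidean_space \<Rightarrow> complex) \<Rightarrow> ennreal \<Rightarrow> bool" where
  "fourier_bounded f B \<longleftrightarrow> (\<exists>g. integrable lborel g \<and>
     (\<forall>y. f y = (LINT x|lborel. g x * exp (\<i> * complex_of_real (x \<bullet> y)))) \<and>
     (\<integral>\<^sup>+x. ennreal (norm (g x)) \<partial>lborel) \<le> B)"

lemma fourier_boundedE:
  assumes "fourier_bounded f B"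
  obtains g where "integrable lborel g"
    "\<And>y. f y = (LINT x|lborel. g x * exp (\<i> * complex_of_real (x \<bullet> y)))"
    "(\<integral>\<^sup>+x. ennreal (norm (g x)) \<partial>lborel) \<le> B"
  using assms unfolding fourier_bounded_def by blast

lemma fourier_boundedI:
  assumes "integrable lborel g"
    "\<And>y. f y = (LINT x|lborel. g x * exp (\<i> * complex_of_real (x \<bullet> y)))"
    "(\<integral>\<^sup>+x. ennreal (norm (g x)) \<partial>lborel) \<le> B"
  shows "fourier_bounded f B"
  using assms unfolding fourier_bounded_def by blast

lemma fourier_bounded_imp_fourier_L1: "fourier_bounded f B \<Longrightarrow> f \<in> fourier_L1_functions"
  unfolding fourier_bounded_def fourier_L1_functions_def by blast

lemma norm_character [simp]: "norm (exp (\<i> * complex_of_real r)) = 1"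
  by (simp add: norm_exp_i_times)

lemma integrable_character:
  fixes g :: "'a::euclidean_space \<Rightarrow> complex"
  assumes "integrable lborel g"
  shows "integrable lborel (\<lambda>x. g x * exp (\<i> * complex_of_real (x \<bullet> y)))"
  by (rule Bochner_Integration.integrable_bound[OF assms]) (use assms in \<open>auto simp: norm_mult\<close>)

lemma fourier_bounded_mono: "fourier_bounded f B \<Longrightarrow> B \<le> B' \<Longrightarrow> fourier_bounded f B'"
  unfolding fourier_bounded_def using order_trans by blast

lemma fourier_bounded_0: "fourier_bounded (\<lambda>_. 0) B"
  by (rule fourier_boundedI[of "\<lambda>_. 0"]) auto

lemma fourier_bounded_cmult:
  assumes "fourier_bounded f B"
  shows "fourier_bounded (\<lambda>y. c * f y) (ennreal (norm c) * B)"
proof -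
  obtain g where g: "integrable lborel g"
    "\<And>y. f y = (LINT x|lborel. g x * exp (\<i> * complex_of_real (x \<bullet> y)))"
    "(\<integral>\<^sup>+x. ennreal (norm (g x)) \<partial>lborel) \<le> B"
    by (rule fourier_boundedE[OF assms]) (rule that; assumption)
  have [measurable]: "g \<in> borel_measurable lborel" using g by auto
  show ?thesis
  proof (rule fourier_boundedI[of "\<lambda>x. c * g x"])
    show "integrable lborel (\<lambda>x. c * g x)" using g by auto
    show "c * f y = (LINT x|lborel. c * g x * exp (\<i> * complex_of_real (x \<bullet> y)))" for y
      unfolding g(2) mult.assoc using integrable_character[OF g(1)] by simp
    have "(\<integral>\<^sup>+x. ennreal (norm (c * g x)) \<partial>lborel) = ennreal (norm c) * (\<integral>\<^sup>+x. ennreal (norm (g x)) \<partial>lborel)"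
      by (subst nn_integral_cmult[symmetric]) (auto simp: norm_mult ennreal_mult')
    then show "(\<integral>\<^sup>+x. ennreal (norm (c * g x)) \<partial>lborel) \<le> ennreal (norm c) * B"
      using g(3) by (auto intro: mult_left_mono)
  qed
qed

text \<open>Completeness of \<open>A\<close>: the witnesses form an absolutely convergent series in
  \<open>L1\<close>, which may be integrated term by term against each character.\<close>

lemma fourier_bounded_suminf:
  fixes f :: "nat \<Rightarrow> 'a::euclidean_space \<Rightarrow> complex"
  assumes f: "\<And>n. fourier_bounded (f n) (B n)" and B: "(\<Sum>n. B n) < \<infinity>"
    and F: "\<And>y. (\<lambda>n. f n y) sums F y"
  shows "fourier_bounded F (\<Sum>n. B n)"
proof -
  obtain g where g: "\<And>n. integrable lborel (g n)"
    "\<And>n y. f n y = (LINT x|lborel. g n x * exp (\<i> * complex_of_real (x \<bullet> y)))"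
    "\<And>n. (\<integral>\<^sup>+x. ennreal (norm (g n x)) \<partial>lborel) \<le> B n"
    using f unfolding fourier_bounded_def by metis
  have [measurable]: "g n \<in> borel_measurable lborel" for n using g(1) by auto
  have le: "(\<integral>\<^sup>+x. (\<Sum>n. ennreal (norm (g n x))) \<partial>lborel) \<le> (\<Sum>n. B n)"
    using g(3) by (subst nn_integral_suminf) (auto intro: suminf_le)
  then have "(\<integral>\<^sup>+x. (\<Sum>n. ennreal (norm (g n x))) \<partial>lborel) \<noteq> \<infinity>" using B by auto
  then have "AE x in lborel. (\<Sum>n. ennreal (norm (g n x))) \<noteq> \<infinity>"
    by (intro nn_integral_noteq_infinite) auto
  then have AEs: "AE x in lborel. summable (\<lambda>n. norm (g n x))"
    by eventually_elim (auto intro: summable_suminf_not_top)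
  have sum1: "summable (\<lambda>n. LINT x|lborel. norm (g n x))"
  proof (rule summable_suminf_not_top)
    have "ennreal (LINT x|lborel. norm (g n x)) \<le> B n" for n
      using g(3)[of n] g(1)[of n] by (simp add: nn_integral_eq_integral)
    then have "(\<Sum>n. ennreal (LINT x|lborel. norm (g n x))) \<le> (\<Sum>n. B n)"
      by (intro suminf_le) auto
    then show "(\<Sum>n. ennreal (LINT x|lborel. norm (g n x))) \<noteq> \<top>" using B by auto
  qed auto
  show ?thesis
  proof (rule fourier_boundedI[of "\<lambda>x. \<Sum>n. g n x"])
    show "integrable lborel (\<lambda>x. \<Sum>n. g n x)"
      by (rule integrable_suminf[OF g(1) AEs sum1])
    show "F y = (LINT x|lborel. (\<Sum>n. g n x) * exp (\<i> * complex_of_real (x \<bullet> y)))" for y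
    proof -
      have "(\<lambda>n. LINT x|lborel. g n x * exp (\<i> * complex_of_real (x \<bullet> y))) sums
          (LINT x|lborel. (\<Sum>n. g n x * exp (\<i> * complex_of_real (x \<bullet> y))))"
        by (rule sums_integral) (use AEs sum1 integrable_character[OF g(1)] in \<open>auto simp: norm_mult\<close>)
      then have "F y = (LINT x|lborel. (\<Sum>n. g n x * exp (\<i> * complex_of_real (x \<bullet> y))))"
        unfolding g(2)[symmetric] using F[of y] sums_unique2 by blast
      also have "\<dots> = (LINT x|lborel. (\<Sum>n. g n x) * exp (\<i> * complex_of_real (x \<bullet> y)))"
      proof (rule integral_cong_AE)
        show "AE x in lborel. (\<Sum>n. g n x * exp (\<i> * complex_of_real (x \<bullet> y))) = (\<Sum>n. g n x) * exp (\<i> * complex_of_real (x \<bullet> y))"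
          using AEs by eventually_elim (metis suminf_mult2 summable_norm_cancel)
      qed auto
      finally show ?thesis .
    qed
    have "(\<integral>\<^sup>+x. ennreal (norm (\<Sum>n. g n x)) \<partial>lborel) \<le> (\<integral>\<^sup>+x. (\<Sum>n. ennreal (norm (g n x))) \<partial>lborel)"
    proof (rule nn_integral_mono_AE)
      show "AE x in lborel. ennreal (norm (\<Sum>n. g n x)) \<le> (\<Sum>n. ennreal (norm (g n x)))"
        using AEs
      proof eventually_elim
        case (elim x)
        then show ?case by (subst suminf_ennreal2) (auto intro: ennreal_leI summable_norm)
      qed
    qed
    with le show "(\<integral>\<^sup>+x. ennreal (norm (\<Sum>n. g n x)) \<partial>lborel) \<le> (\<Sum>n. B n)" by (rule order_trans[rotated])
  qed
qed

lemma fourier_bounded_add: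
  assumes "fourier_bounded f1 B1" "fourier_bounded f2 B2"
  shows "fourier_bounded (\<lambda>y. f1 y + f2 y) (B1 + B2)"
proof -
  obtain g1 where g1: "integrable lborel g1"
    "\<And>y. f1 y = (LINT x|lborel. g1 x * exp (\<i> * complex_of_real (x \<bullet> y)))"
    "(\<integral>\<^sup>+x. ennreal (norm (g1 x)) \<partial>lborel) \<le> B1"
    by (rule fourier_boundedE[OF assms(1)]) (rule that; assumption)
  obtain g2 where g2: "integrable lborel g2"
    "\<And>y. f2 y = (LINT x|lborel. g2 x * exp (\<i> * complex_of_real (x \<bullet> y)))"
    "(\<integral>\<^sup>+x. ennreal (norm (g2 x)) \<partial>lborel) \<le> B2"
    by (rule fourier_boundedE[OF assms(2)]) (rule that; assumption)
  have [measurable]: "g1 \<in> borel_measurable lborel" "g2 \<in> borel_measurable lborel" using g1 g2 by auto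
  show ?thesis
  proof (rule fourier_boundedI[of "\<lambda>x. g1 x + g2 x"])
    show "integrable lborel (\<lambda>x. g1 x + g2 x)" using g1 g2 by auto
    show "f1 y + f2 y = (LINT x|lborel. (g1 x + g2 x) * exp (\<i> * complex_of_real (x \<bullet> y)))" for y
      unfolding g1(2) g2(2) distrib_right
      using integrable_character[OF g1(1)] integrable_character[OF g2(1)] by simp
    have "(\<integral>\<^sup>+x. ennreal (norm (g1 x + g2 x)) \<partial>lborel) \<le> (\<integral>\<^sup>+x. ennreal (norm (g1 x)) + ennreal (norm (g2 x)) \<partial>lborel)"
      by (intro nn_integral_mono) (auto simp: norm_triangle_ineq simp flip: ennreal_plus)
    also have "\<dots> = (\<integral>\<^sup>+x. ennreal (norm (g1 x)) \<partial>lborel) + (\<integral>\<^sup>+x. ennreal (norm (g2 x)) \<partial>lborel)"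
      by (rule nn_integral_add) auto
    also have "\<dots> \<le> B1 + B2" using g1 g2 by (intro add_mono)
    finally show "(\<integral>\<^sup>+x. ennreal (norm (g1 x + g2 x)) \<partial>lborel) \<le> B1 + B2" .
  qed
qed

lemma fourier_bounded_sum:
  assumes "finite A" "\<And>a. a \<in> A \<Longrightarrow> fourier_bounded (f a) (B a)"
  shows "fourier_bounded (\<lambda>y. \<Sum>a\<in>A. f a y) (\<Sum>a\<in>A. B a)"
  using assms by (induction A rule: finite_induct) (auto intro: fourier_bounded_0 fourier_bounded_add)

section \<open>Gaussian regularization, Fourier inversion and Bessel's inequality\<close>

definition gauss :: "real \<times> real \<Rightarrow> real" where
  "gauss z = exp (- (z \<bullet> z) / 2)"

lemma gauss_prod: "gauss (x, y) = exp (- x\<^sup>2 / 2) * exp (- y\<^sup>2 / 2)"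
  by (simp add: gauss_def exp_add[symmetric] power2_eq_square field_simps)

lemma gauss_bounds: "0 < gauss z" "gauss z \<le> 1" by (auto simp: gauss_def)

lemma gauss_measurable [measurable]: "gauss \<in> borel_measurable borel"
  unfolding gauss_def by measurable

lemma gauss_real_fourier:
  "integrable lborel (\<lambda>t. exp (- t\<^sup>2 / 2) :: real)"
  "(LINT t|lborel. complex_of_real (exp (- t\<^sup>2 / 2)) * exp (\<i> * complex_of_real (t * x))) =
    complex_of_real (sqrt (2 * pi) * exp (- x\<^sup>2 / 2))"
proof -
  have eq: "exp (- t\<^sup>2 / 2) = sqrt (2 * pi) * std_normal_density t" for t
    by (simp add: std_normal_density_def)
  show "integrable lborel (\<lambda>t. exp (- t\<^sup>2 / 2) :: real)"
    unfolding eq by (intro integrable_mult_right integrable_normal_density) simp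
  \<comment> \<open>The one-dimensional transform is the characteristic function of the standard
    normal distribution, up to the factor \<open>sqrt (2 * pi)\<close>.\<close>
  have "complex_of_real (exp (- x\<^sup>2 / 2)) = char std_normal_distribution x"
    by (simp add: char_std_normal_distribution)
  also have "\<dots> = (LINT t|lborel. std_normal_density t *\<^sub>R exp (\<i> * complex_of_real (x * t)))"
    unfolding char_def by (subst integral_density) auto
  finally have *: "(LINT t|lborel. std_normal_density t *\<^sub>R exp (\<i> * complex_of_real (x * t))) = complex_of_real (exp (- x\<^sup>2 / 2))" ..
  have "(LINT t|lborel. complex_of_real (exp (- t\<^sup>2 / 2)) * exp (\<i> * complex_of_real (t * x))) =
     (LINT t|lborel. complex_of_real (sqrt (2 * pi)) * (std_normal_density t *\<^sub>R exp (\<i> * complex_of_real (x * t))))"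
    unfolding eq by (simp add: scaleR_conv_of_real mult.commute mult.left_commute)
  also have "\<dots> = complex_of_real (sqrt (2 * pi)) * complex_of_real (exp (- x\<^sup>2 / 2))"
    by (subst integral_mult_right_zero) (simp only: *)
  finally show "(LINT t|lborel. complex_of_real (exp (- t\<^sup>2 / 2)) * exp (\<i> * complex_of_real (t * x))) =
    complex_of_real (sqrt (2 * pi) * exp (- x\<^sup>2 / 2))" by simp
qed

lemma nn_integral_lborel_pair:
  assumes [measurable]: "f \<in> borel_measurable (borel :: ('a::euclidean_space \<times> 'b::euclidean_space) measure)"
  shows "(\<integral>\<^sup>+z. f z \<partial>lborel) = (\<integral>\<^sup>+x. \<integral>\<^sup>+y. f (x, y) \<partial>lborel \<partial>lborel)"
proof -
  have "f \<in> borel_measurable (lborel \<Otimes>\<^sub>M lborel)" by (simp add: lborel_prod)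
  then show ?thesis by (simp add: lborel.nn_integral_fst lborel_prod)
qed

lemma gauss_integrable: "integrable lborel gauss"
proof (rule integrableI_bounded)
  have "(\<integral>\<^sup>+z. ennreal (norm (gauss z)) \<partial>lborel) =
     (\<integral>\<^sup>+x. \<integral>\<^sup>+y. ennreal (exp (- x\<^sup>2 / 2)) * ennreal (exp (- y\<^sup>2 / 2)) \<partial>lborel \<partial>lborel)"
    by (subst nn_integral_lborel_pair) (auto simp: gauss_prod ennreal_mult'[symmetric])
  also have "\<dots> = (\<integral>\<^sup>+x. ennreal (exp (- x\<^sup>2 / 2)) \<partial>lborel) * (\<integral>\<^sup>+y. ennreal (exp (- y\<^sup>2 / 2)) \<partial>lborel)"
    by (simp add: nn_integral_cmult nn_integral_multc)
  also have "\<dots> < \<infinity>"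
    using gauss_real_fourier(1) by (simp add: nn_integral_eq_integral ennreal_mult'[symmetric])
  finally show "(\<integral>\<^sup>+z. ennreal (norm (gauss z)) \<partial>lborel) < \<infinity>" .
qed auto

lemma gauss_fourier:
  "(LINT z|lborel. complex_of_real (gauss z) * exp (\<i> * complex_of_real (z \<bullet> x))) = complex_of_real (2 * pi * gauss x)"
proof -
  obtain a b where x: "x = (a, b)" by (cases x)
  let ?f = "\<lambda>z. complex_of_real (gauss z) * exp (\<i> * complex_of_real (z \<bullet> x))"
  have "integrable lborel (\<lambda>z. complex_of_real (gauss z))" using gauss_integrable by auto
  from integrable_character[OF this] have "integrable (lborel \<Otimes>\<^sub>M lborel) ?f"
    unfolding lborel_prod .
  from lborel_pair.integral_fst'[OF this]
  have "(LINT z|lborel. ?f z) = (LINT s|lborel. LINT t|lborel. ?f (s, t))"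
    by (simp add: lborel_prod)
  also have "\<dots> = (LINT s|lborel. LINT t|lborel. (complex_of_real (exp (- s\<^sup>2 / 2)) * exp (\<i> * complex_of_real (s * a))) *
      (complex_of_real (exp (- t\<^sup>2 / 2)) * exp (\<i> * complex_of_real (t * b))))"
    by (simp add: gauss_prod x exp_add distrib_left mult_ac)
  also have "\<dots> = (LINT s|lborel. (complex_of_real (exp (- s\<^sup>2 / 2)) * exp (\<i> * complex_of_real (s * a))) *
      complex_of_real (sqrt (2 * pi) * exp (- b\<^sup>2 / 2)))"
    by (subst integral_mult_right_zero, subst gauss_real_fourier(2)) simp
  also have "\<dots> = complex_of_real (sqrt (2 * pi) * exp (- a\<^sup>2 / 2)) * complex_of_real (sqrt (2 * pi) * exp (- b\<^sup>2 / 2))"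
    by (subst integral_mult_left_zero, subst gauss_real_fourier(2)) simp
  also have "\<dots> = complex_of_real (sqrt (2 * pi) * sqrt (2 * pi) * gauss x)"
    by (simp only: x gauss_prod of_real_mult mult_ac)
  also have "sqrt (2 * pi) * sqrt (2 * pi) = 2 * pi" by simp
  finally show ?thesis .
qed

text \<open>The transform of the Gaussian at frequency \<open>0\<close>.\<close>

lemma integral_gauss: "(LINT z|lborel. gauss z) = 2 * pi"
proof -
  have "complex_of_real (LINT z|lborel. gauss z) = complex_of_real (2 * pi)"
  proof -
    have "gauss 0 = 1" by (simp add: gauss_def)
    then show ?thesis using gauss_fourier[of 0]
      by (simp only: inner_zero_right of_real_0 mult_zero_right exp_zero mult_1_right integral_complex_of_real)
  qed
  then show ?thesis using of_real_eq_iff by blast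
qed

lemma integral_lborel_affine:
  fixes f :: "'a::euclidean_space \<Rightarrow> 'b::{banach, second_countable_topology}"
  assumes [measurable]: "f \<in> borel_measurable borel" and "c \<noteq> 0"
  shows "(LINT x|lborel. f x) = \<bar>c\<bar> ^ DIM('a) *\<^sub>R (LINT x|lborel. f (t + c *\<^sub>R x))"
  by (subst lborel_affine[OF assms(2), of t], subst integral_density, simp, simp, simp, subst integral_distr) auto

lemma nn_integral_lborel_affine:
  fixes f :: "'a::euclidean_space \<Rightarrow> ennreal"
  assumes [measurable]: "f \<in> borel_measurable borel" and "c \<noteq> 0"
  shows "(\<integral>\<^sup>+x. f x \<partial>lborel) = ennreal (\<bar>c\<bar> ^ DIM('a)) * (\<integral>\<^sup>+x. f (t + c *\<^sub>R x) \<partial>lborel)"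
  by (subst lborel_affine[OF assms(2), of t], subst nn_integral_density, simp, simp, subst nn_integral_distr)
    (auto simp: nn_integral_cmult)

lemma gauss_scaled_fourier:
  assumes "n > 0"
  shows "(LINT z|lborel. complex_of_real (gauss (z /\<^sub>R n)) * exp (\<i> * complex_of_real (z \<bullet> x))) =
    complex_of_real (n\<^sup>2 * (2 * pi * gauss (n *\<^sub>R x)))"
  by (subst integral_lborel_affine[of _ n 0]) (use assms gauss_fourier[of "n *\<^sub>R x"] in \<open>auto simp: scaleR_conv_of_real power2_eq_square\<close>)

lemma gauss_scaled_integrable:
  assumes "n > 0"
  shows "integrable lborel (\<lambda>z. gauss (z /\<^sub>R n))"
proof (rule integrableI_bounded)
  have "(\<integral>\<^sup>+z. ennreal (norm (gauss (z /\<^sub>R n))) \<partial>lborel) = ennreal (n\<^sup>2) * (\<integral>\<^sup>+z. ennreal (norm (gauss z)) \<partial>lborel)"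
    by (subst nn_integral_lborel_affine[of _ n 0]) (use assms in \<open>auto simp: power2_eq_square\<close>)
  also have "\<dots> < \<infinity>" using gauss_integrable unfolding integrable_iff_bounded
    by (simp add: ennreal_mult_less_top)
  finally show "(\<integral>\<^sup>+z. ennreal (norm (gauss (z /\<^sub>R n))) \<partial>lborel) < \<infinity>" .
qed auto

lemma norm_integral_le_nn_integral:
  fixes f :: "'a \<Rightarrow> 'b::{banach, second_countable_topology}"
  shows "ennreal (norm (integral\<^sup>L M f)) \<le> (\<integral>\<^sup>+x. ennreal (norm (f x)) \<partial>M)"
  by (cases "integrable M f") (auto simp: integral_norm_bound_ennreal not_integrable_integral_eq)

text \<open>The sign is opposite to the one in \<open>fourier_L1_functions\<close>, so that
  inversion returns a representation with the sign required there.\<close>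

definition fourier_transform :: "(real \<times> real \<Rightarrow> complex) \<Rightarrow> real \<times> real \<Rightarrow> complex" where
  "fourier_transform u \<xi> = (LINT t|lborel. u t * exp (\<i> * complex_of_real (\<xi> \<bullet> - t)))"

lemma character_measurable [measurable]:
  "(\<lambda>p. exp (\<i> * complex_of_real (fst p \<bullet> snd p))) \<in> borel_measurable (borel :: (('a::euclidean_space) \<times> 'a) measure)"
  by (intro borel_measurable_continuous_onI continuous_intros)

lemma integrable_pair_product:
  fixes a b :: "'a::euclidean_space \<Rightarrow> complex"
  assumes a: "integrable lborel a" and b: "integrable lborel b"
    and [measurable]: "k \<in> borel_measurable (borel :: ('a \<times> 'a) measure)" and k: "\<And>p. norm (k p) \<le> 1"
  shows "integrable (lborel \<Otimes>\<^sub>M lborel) (\<lambda>(x, y). a x * b y * k (x, y))"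
proof -
  have [measurable]: "a \<in> borel_measurable borel" "b \<in> borel_measurable borel" using a b by auto
  have [measurable]: "k \<in> borel_measurable (borel \<Otimes>\<^sub>M borel)" using assms(3) by (simp add: borel_prod)
  have "(\<lambda>(x, y). a x * b y * k (x, y)) \<in> borel_measurable (borel \<Otimes>\<^sub>M borel)"
    by measurable
  then have m: "(\<lambda>(x, y). a x * b y * k (x, y)) \<in> borel_measurable (lborel \<Otimes>\<^sub>M lborel)"
    by (simp add: borel_prod lborel_prod)
  show ?thesis
    unfolding integrable_iff_bounded
  proof (intro conjI m)
    have "(\<integral>\<^sup>+p. ennreal (norm (case p of (x, y) \<Rightarrow> a x * b y * k (x, y))) \<partial>(lborel \<Otimes>\<^sub>M lborel)) =
       (\<integral>\<^sup>+x. \<integral>\<^sup>+y. ennreal (norm (a x * b y * k (x, y))) \<partial>lborel \<partial>lborel)"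
      using m by (subst lborel.nn_integral_fst[symmetric]) (auto simp: split_beta')
    also have "\<dots> \<le> (\<integral>\<^sup>+x. \<integral>\<^sup>+y. ennreal (norm (a x)) * ennreal (norm (b y)) \<partial>lborel \<partial>lborel)"
      by (intro nn_integral_mono) (auto simp: norm_mult ennreal_mult'[symmetric] mult_left_le k intro!: ennreal_leI)
    also have "\<dots> = (\<integral>\<^sup>+x. ennreal (norm (a x)) \<partial>lborel) * (\<integral>\<^sup>+y. ennreal (norm (b y)) \<partial>lborel)"
      by (simp add: nn_integral_cmult nn_integral_multc)
    also have "\<dots> < \<infinity>" using a b unfolding integrable_iff_bounded by (simp add: ennreal_mult_less_top)
    finally show "(\<integral>\<^sup>+p. ennreal (norm (case p of (x, y) \<Rightarrow> a x * b y * k (x, y))) \<partial>(lborel \<Otimes>\<^sub>M lborel)) < \<infinity>" .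
  qed
qed

lemma fourier_transform_measurable [measurable]:
  assumes "integrable lborel u" shows "fourier_transform u \<in> borel_measurable borel"
proof -
  have [measurable]: "u \<in> borel_measurable borel" using assms by auto
  have "(\<lambda>(\<xi>, t). u t * exp (\<i> * complex_of_real (\<xi> \<bullet> - t))) \<in> borel_measurable (borel \<Otimes>\<^sub>M lborel)"
    by measurable
  then have "(\<lambda>\<xi>. LINT t|lborel. u t * exp (\<i> * complex_of_real (\<xi> \<bullet> - t))) \<in> borel_measurable borel"
    by (rule lborel.borel_measurable_lebesgue_integral)
  then show ?thesis unfolding fourier_transform_def .
qed

lemma norm_fourier_transform_le:
  assumes "integrable lborel u" shows "norm (fourier_transform u \<xi>) \<le> (LINT t|lborel. norm (u t))"
  unfolding fourier_transform_def
  by (rule order_trans[OF integral_norm_bound]) (simp add: norm_mult del: inner_minus_right)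

text \<open>The Gaussian factor makes the double integral absolutely convergent; by Fubini it
  becomes an average of \<open>u\<close> against a narrow Gaussian around \<open>y\<close>.\<close>

lemma gauss_regularization:
  assumes u: "integrable lborel u" and "n > 0"
  shows "(LINT \<xi>|lborel. fourier_transform u \<xi> * complex_of_real (gauss (\<xi> /\<^sub>R n)) * exp (\<i> * complex_of_real (\<xi> \<bullet> y))) =
    complex_of_real (2 * pi) * (LINT z|lborel. complex_of_real (gauss z) * u (y - z /\<^sub>R n))"
proof -
  have [measurable]: "u \<in> borel_measurable borel" using u by auto
  have g: "integrable lborel (\<lambda>\<xi>. complex_of_real (gauss (\<xi> /\<^sub>R n)))" using gauss_scaled_integrable[OF \<open>n > 0\<close>] by auto
  let ?k = "\<lambda>p. exp (\<i> * complex_of_real (fst p \<bullet> (y - snd p)))"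
  have int: "integrable (lborel \<Otimes>\<^sub>M lborel) (\<lambda>(\<xi>, t). complex_of_real (gauss (\<xi> /\<^sub>R n)) * u t * ?k (\<xi>, t))"
    by (rule integrable_pair_product[OF g u]) (auto intro!: borel_measurable_continuous_onI continuous_intros)
  have "(LINT \<xi>|lborel. fourier_transform u \<xi> * complex_of_real (gauss (\<xi> /\<^sub>R n)) * exp (\<i> * complex_of_real (\<xi> \<bullet> y))) =
    (LINT \<xi>|lborel. LINT t|lborel. complex_of_real (gauss (\<xi> /\<^sub>R n)) * u t * ?k (\<xi>, t))"
  proof (rule Bochner_Integration.integral_cong[OF refl])
    fix \<xi>
    have "(LINT t|lborel. complex_of_real (gauss (\<xi> /\<^sub>R n)) * u t * ?k (\<xi>, t)) =
      (LINT t|lborel. u t * exp (\<i> * complex_of_real (\<xi> \<bullet> - t)) * (complex_of_real (gauss (\<xi> /\<^sub>R n)) * exp (\<i> * complex_of_real (\<xi> \<bullet> y))))"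
      by (simp add: inner_diff_right exp_diff exp_minus field_simps)
    also have "\<dots> = fourier_transform u \<xi> * (complex_of_real (gauss (\<xi> /\<^sub>R n)) * exp (\<i> * complex_of_real (\<xi> \<bullet> y)))"
      unfolding fourier_transform_def by (rule integral_mult_left_zero)
    finally show "fourier_transform u \<xi> * complex_of_real (gauss (\<xi> /\<^sub>R n)) * exp (\<i> * complex_of_real (\<xi> \<bullet> y)) =
      (LINT t|lborel. complex_of_real (gauss (\<xi> /\<^sub>R n)) * u t * ?k (\<xi>, t))" by (simp only: mult.assoc)
  qed
  also have "\<dots> = (LINT t|lborel. LINT \<xi>|lborel. complex_of_real (gauss (\<xi> /\<^sub>R n)) * u t * ?k (\<xi>, t))"
    by (rule lborel_pair.Fubini_integral[OF int, symmetric])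
  also have "\<dots> = (LINT t|lborel. u t * complex_of_real (n\<^sup>2 * (2 * pi * gauss (n *\<^sub>R (y - t)))))"
  proof (rule Bochner_Integration.integral_cong[OF refl])
    fix t
    have "(LINT \<xi>|lborel. complex_of_real (gauss (\<xi> /\<^sub>R n)) * u t * ?k (\<xi>, t)) =
      (LINT \<xi>|lborel. u t * (complex_of_real (gauss (\<xi> /\<^sub>R n)) * exp (\<i> * complex_of_real (\<xi> \<bullet> (y - t)))))"
      by (simp add: mult_ac)
    then show "(LINT \<xi>|lborel. complex_of_real (gauss (\<xi> /\<^sub>R n)) * u t * ?k (\<xi>, t)) =
      u t * complex_of_real (n\<^sup>2 * (2 * pi * gauss (n *\<^sub>R (y - t))))"
      by (simp only: integral_mult_right_zero gauss_scaled_fourier[OF \<open>n > 0\<close>])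
  qed
  \<comment> \<open>Substitution \<open>t = y - z / n\<close>; its Jacobian cancels the square of
    \<open>n\<close> that comes from the transformed Gaussian.\<close>
  also have "\<dots> = \<bar>- (1 / n)\<bar> ^ DIM(real \<times> real) *\<^sub>R (LINT z|lborel. u (y + (- (1 / n)) *\<^sub>R z) *
      complex_of_real (n\<^sup>2 * (2 * pi * gauss (n *\<^sub>R (y - (y + (- (1 / n)) *\<^sub>R z))))))"
    by (rule integral_lborel_affine) (use \<open>n > 0\<close> in auto)
  also have "\<dots> = (LINT z|lborel. complex_of_real (2 * pi) * (complex_of_real (gauss z) * u (y - z /\<^sub>R n)))"
  proof -
    have "n *\<^sub>R (y - (y + (- (1 / n)) *\<^sub>R z)) = z" for z using \<open>n > 0\<close> by simp
    then show ?thesis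
      unfolding integral_scaleR_right[symmetric]
      using \<open>n > 0\<close> by (intro Bochner_Integration.integral_cong refl)
       (simp add: scaleR_conv_of_real power2_eq_square field_simps)
  qed
  also have "\<dots> = complex_of_real (2 * pi) * (LINT z|lborel. complex_of_real (gauss z) * u (y - z /\<^sub>R n))"
    by (rule integral_mult_right_zero)
  finally show ?thesis .
qed

lemma gauss_rescaled_tendsto_1: "(\<lambda>n. gauss (\<xi> /\<^sub>R real (Suc n))) \<longlonglongrightarrow> 1"
proof -
  have "(\<lambda>n. gauss (\<xi> /\<^sub>R real (Suc n))) \<longlonglongrightarrow> gauss (0 *\<^sub>R \<xi>)"
    unfolding gauss_def
    by (intro tendsto_intros LIMSEQ_inverse_real_of_nat) simp
  then show ?thesis by (simp add: gauss_def)
qed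

text \<open>The Gaussian cut-off is sent to \<open>1\<close>. The left side converges by domination
  with the transform, the right side because \<open>u\<close> is continuous and bounded. One factor
  \<open>2 * pi\<close> comes from the regularization, the other from the integral of the
  Gaussian.\<close>

lemma fourier_inversion:
  assumes u: "integrable lborel u" and cont: "continuous_on UNIV u" and bd: "\<And>x. norm (u x) \<le> K"
    and ft: "integrable lborel (fourier_transform u)"
  shows "(LINT \<xi>|lborel. fourier_transform u \<xi> * exp (\<i> * complex_of_real (\<xi> \<bullet> y))) = complex_of_real ((2 * pi)\<^sup>2) * u y"
proof -
  have [measurable]: "u \<in> borel_measurable borel" using u by auto
  note [measurable] = fourier_transform_measurable[OF u]
  have 1: "(\<lambda>n. LINT \<xi>|lborel. fourier_transform u \<xi> * complex_of_real (gauss (\<xi> /\<^sub>R real (Suc n))) * exp (\<i> * complex_of_real (\<xi> \<bullet> y)))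
     \<longlonglongrightarrow> (LINT \<xi>|lborel. fourier_transform u \<xi> * complex_of_real 1 * exp (\<i> * complex_of_real (\<xi> \<bullet> y)))"
  proof (rule integral_dominated_convergence[where w="\<lambda>\<xi>. norm (fourier_transform u \<xi>)"])
    show "integrable lborel (\<lambda>\<xi>. norm (fourier_transform u \<xi>))" using ft by auto
    show "AE \<xi> in lborel. (\<lambda>n. fourier_transform u \<xi> * complex_of_real (gauss (\<xi> /\<^sub>R real (Suc n))) * exp (\<i> * complex_of_real (\<xi> \<bullet> y)))
       \<longlonglongrightarrow> fourier_transform u \<xi> * complex_of_real 1 * exp (\<i> * complex_of_real (\<xi> \<bullet> y))"
      by (intro AE_I2 tendsto_intros gauss_rescaled_tendsto_1)
    show "AE \<xi> in lborel. norm (fourier_transform u \<xi> * complex_of_real (gauss (\<xi> /\<^sub>R real (Suc n))) * exp (\<i> * complex_of_real (\<xi> \<bullet> y)))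
       \<le> norm (fourier_transform u \<xi>)" for n
      using gauss_bounds by (intro AE_I2) (auto simp: norm_mult less_imp_le abs_of_pos intro!: mult_left_le)
  qed auto
  have 2: "(\<lambda>n. LINT z|lborel. complex_of_real (gauss z) * u (y - z /\<^sub>R real (Suc n))) \<longlonglongrightarrow>
     (LINT z|lborel. complex_of_real (gauss z) * u (y - 0 *\<^sub>R z))"
  proof (rule integral_dominated_convergence[where w="\<lambda>z. gauss z * K"])
    show "integrable lborel (\<lambda>z. gauss z * K)" using gauss_integrable by auto
    show "AE z in lborel. (\<lambda>n. complex_of_real (gauss z) * u (y - z /\<^sub>R real (Suc n))) \<longlonglongrightarrow> complex_of_real (gauss z) * u (y - 0 *\<^sub>R z)"
    proof (intro AE_I2 tendsto_mult tendsto_const)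
      fix z
      have "(\<lambda>n. y - z /\<^sub>R real (Suc n)) \<longlonglongrightarrow> y - 0 *\<^sub>R z"
        by (intro tendsto_intros LIMSEQ_inverse_real_of_nat)
      moreover have "isCont u (y - 0 *\<^sub>R z)" using cont continuous_on_eq_continuous_at[OF open_UNIV] by blast
      ultimately show "(\<lambda>n. u (y - z /\<^sub>R real (Suc n))) \<longlonglongrightarrow> u (y - 0 *\<^sub>R z)"
        by (rule isCont_tendsto_compose[rotated])
    qed
    show "AE z in lborel. norm (complex_of_real (gauss z) * u (y - z /\<^sub>R real (Suc n))) \<le> gauss z * K" for n
      using gauss_bounds bd by (intro AE_I2) (auto simp: norm_mult less_imp_le abs_of_pos intro!: mult_left_mono)
  qed auto
  have "(LINT z|lborel. complex_of_real (gauss z) * u (y - 0 *\<^sub>R z)) = complex_of_real (2 * pi) * u y"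
    using integral_gauss by (simp add: integral_complex_of_real del: of_real_mult)
  with 2 have "(\<lambda>n. complex_of_real (2 * pi) * (LINT z|lborel. complex_of_real (gauss z) * u (y - z /\<^sub>R real (Suc n))))
     \<longlonglongrightarrow> complex_of_real (2 * pi) * (complex_of_real (2 * pi) * u y)"
    by (intro tendsto_mult tendsto_const) auto
  then have "(\<lambda>n. LINT \<xi>|lborel. fourier_transform u \<xi> * complex_of_real (gauss (\<xi> /\<^sub>R real (Suc n))) * exp (\<i> * complex_of_real (\<xi> \<bullet> y)))
    \<longlonglongrightarrow> complex_of_real (2 * pi) * (complex_of_real (2 * pi) * u y)"
    by (subst gauss_regularization[OF u]) auto
  from LIMSEQ_unique[OF 1 this] show ?thesis by (simp add: power2_eq_square mult.assoc)
qed

text \<open>With a Gaussian inserted, the square integral of the transform is a pairing of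
  \<open>u\<close> with a Gaussian average of itself, so an inequality between products and squares
  suffices and no extension of the transform to \<open>L2\<close> enters.\<close>

lemma bessel_regularized:
  assumes u: "integrable lborel u" and "n > 0"
  shows "(\<integral>\<^sup>+\<xi>. ennreal ((norm (fourier_transform u \<xi>))\<^sup>2 * gauss (\<xi> /\<^sub>R n)) \<partial>lborel) \<le>
    ennreal ((2 * pi)\<^sup>2) * (\<integral>\<^sup>+x. ennreal ((norm (u x))\<^sup>2) \<partial>lborel)"
proof -
  have [measurable]: "u \<in> borel_measurable borel" using u by auto
  note [measurable] = fourier_transform_measurable[OF u]
  let ?F = "fourier_transform u"
  let ?g = "\<lambda>\<xi>. complex_of_real (gauss (\<xi> /\<^sub>R n))"
  have ftg: "integrable lborel (\<lambda>\<xi>. ?F \<xi> * ?g \<xi>)"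
  proof (rule Bochner_Integration.integrable_bound[of _ "\<lambda>\<xi>. (LINT t|lborel. norm (u t)) * gauss (\<xi> /\<^sub>R n)"])
    show "AE \<xi> in lborel. norm (?F \<xi> * ?g \<xi>) \<le> norm ((LINT t|lborel. norm (u t)) * gauss (\<xi> /\<^sub>R n))"
      using norm_fourier_transform_le[OF u] gauss_bounds(1)[THEN less_imp_le]
      by (intro AE_I2) (auto simp: norm_mult abs_mult intro!: mult_right_mono order_trans[OF _ abs_ge_self])
  qed (use gauss_scaled_integrable[OF \<open>n > 0\<close>] in auto)
  have cu: "integrable lborel (\<lambda>y. cnj (u y))" using u by auto
  have int: "integrable (lborel \<Otimes>\<^sub>M lborel) (\<lambda>(\<xi>, y). (?F \<xi> * ?g \<xi>) * cnj (u y) * exp (\<i> * complex_of_real (fst (\<xi>, y) \<bullet> snd (\<xi>, y))))"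
    by (rule integrable_pair_product[OF ftg cu]) auto
  \<comment> \<open>Writing the conjugate factor of the squared modulus as an integral over
    \<open>u\<close> produces a double integral whose other inner integral is a Gaussian
    regularization.\<close>
  have cnjF: "(LINT y|lborel. cnj (u y) * exp (\<i> * complex_of_real (\<xi> \<bullet> y))) = cnj (?F \<xi>)" for \<xi>
    unfolding fourier_transform_def by (simp add: exp_cnj del: Bochner_Integration.integral_cnj flip: Bochner_Integration.integral_cnj)
  have intF: "integrable lborel (\<lambda>\<xi>. (norm (?F \<xi>))\<^sup>2 * gauss (\<xi> /\<^sub>R n))"
  proof (rule Bochner_Integration.integrable_bound[of _ "\<lambda>\<xi>. (LINT t|lborel. norm (u t))\<^sup>2 * gauss (\<xi> /\<^sub>R n)"])
    show "AE \<xi> in lborel. norm ((norm (?F \<xi>))\<^sup>2 * gauss (\<xi> /\<^sub>R n)) \<le> norm ((LINT t|lborel. norm (u t))\<^sup>2 * gauss (\<xi> /\<^sub>R n))"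
      using norm_fourier_transform_le[OF u] gauss_bounds(1)[THEN less_imp_le]
      by (intro AE_I2) (auto simp: norm_mult abs_mult intro!: mult_right_mono power_mono)
  qed (use gauss_scaled_integrable[OF \<open>n > 0\<close>] in auto)
  have "complex_of_real (LINT \<xi>|lborel. (norm (?F \<xi>))\<^sup>2 * gauss (\<xi> /\<^sub>R n)) = (LINT \<xi>|lborel. (?F \<xi> * ?g \<xi>) * cnj (?F \<xi>))"
    unfolding integral_complex_of_real[symmetric] of_real_mult complex_norm_square by (simp add: mult_ac)
  also have "\<dots> = (LINT \<xi>|lborel. LINT y|lborel. (?F \<xi> * ?g \<xi>) * cnj (u y) * exp (\<i> * complex_of_real (\<xi> \<bullet> y)))"
    unfolding cnjF[symmetric] integral_mult_right_zero[symmetric] by (simp add: mult.assoc)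
  also have "\<dots> = (LINT y|lborel. LINT \<xi>|lborel. (?F \<xi> * ?g \<xi>) * cnj (u y) * exp (\<i> * complex_of_real (\<xi> \<bullet> y)))"
    using lborel_pair.Fubini_integral[OF int] by simp
  also have "\<dots> = (LINT y|lborel. cnj (u y) * (LINT \<xi>|lborel. ?F \<xi> * ?g \<xi> * exp (\<i> * complex_of_real (\<xi> \<bullet> y))))"
    unfolding integral_mult_right_zero[symmetric] by (simp add: mult_ac)
  also have "\<dots> = (LINT y|lborel. cnj (u y) * (complex_of_real (2 * pi) * (LINT z|lborel. complex_of_real (gauss z) * u (y - z /\<^sub>R n))))"
    unfolding gauss_regularization[OF u \<open>n > 0\<close>] ..
  finally have eq: "complex_of_real (LINT \<xi>|lborel. (norm (?F \<xi>))\<^sup>2 * gauss (\<xi> /\<^sub>R n)) = \<dots>" (is "_ = ?R") .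
  have "(\<integral>\<^sup>+\<xi>. ennreal ((norm (?F \<xi>))\<^sup>2 * gauss (\<xi> /\<^sub>R n)) \<partial>lborel) = ennreal (LINT \<xi>|lborel. (norm (?F \<xi>))\<^sup>2 * gauss (\<xi> /\<^sub>R n))"
    using intF gauss_bounds by (intro nn_integral_eq_integral) (auto simp: less_imp_le)
  also have "\<dots> \<le> ennreal (norm ?R)" unfolding eq[symmetric] by (intro ennreal_leI) auto
  also have "\<dots> \<le> (\<integral>\<^sup>+y. ennreal (norm (cnj (u y) * (complex_of_real (2 * pi) * (LINT z|lborel. complex_of_real (gauss z) * u (y - z /\<^sub>R n))))) \<partial>lborel)"
    by (rule norm_integral_le_nn_integral) 
  also have "\<dots> \<le> (\<integral>\<^sup>+y. ennreal (2 * pi) * (\<integral>\<^sup>+z. ennreal (gauss z * ((norm (u y))\<^sup>2 + (norm (u (y - z /\<^sub>R n)))\<^sup>2) / 2) \<partial>lborel) \<partial>lborel)"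
  proof (rule nn_integral_mono)
    fix y
    have "ennreal (norm (cnj (u y) * (complex_of_real (2 * pi) * (LINT z|lborel. complex_of_real (gauss z) * u (y - z /\<^sub>R n))))) =
       ennreal (2 * pi) * (ennreal (norm (u y)) * ennreal (norm (LINT z|lborel. complex_of_real (gauss z) * u (y - z /\<^sub>R n))))"
      by (simp add: norm_mult ennreal_mult'[symmetric] mult_ac)
    also have "\<dots> \<le> ennreal (2 * pi) * (ennreal (norm (u y)) * (\<integral>\<^sup>+z. ennreal (norm (complex_of_real (gauss z) * u (y - z /\<^sub>R n))) \<partial>lborel))"
      by (intro mult_left_mono norm_integral_le_nn_integral) auto
    also have "\<dots> = ennreal (2 * pi) * (\<integral>\<^sup>+z. ennreal (norm (u y)) * ennreal (norm (complex_of_real (gauss z) * u (y - z /\<^sub>R n))) \<partial>lborel)"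
      by (subst nn_integral_cmult) auto
    also have "\<dots> \<le> ennreal (2 * pi) * (\<integral>\<^sup>+z. ennreal (gauss z * ((norm (u y))\<^sup>2 + (norm (u (y - z /\<^sub>R n)))\<^sup>2) / 2) \<partial>lborel)"
    proof (intro mult_left_mono nn_integral_mono)
      fix z
      \<comment> \<open>Arithmetic-geometric mean; after integration in \<open>y\<close>,
        translation invariance makes both squares contribute equally.\<close>
      have "norm (u y) * norm (u (y - z /\<^sub>R n)) \<le> ((norm (u y))\<^sup>2 + (norm (u (y - z /\<^sub>R n)))\<^sup>2) / 2"
        using sum_squares_bound[of "norm (u y)" "norm (u (y - z /\<^sub>R n))"] by simp
      then have "gauss z * (norm (u y) * norm (u (y - z /\<^sub>R n))) \<le> gauss z * (((norm (u y))\<^sup>2 + (norm (u (y - z /\<^sub>R n)))\<^sup>2) / 2)"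
        using gauss_bounds(1)[of z] by (intro mult_left_mono) auto
      then show "ennreal (norm (u y)) * ennreal (norm (complex_of_real (gauss z) * u (y - z /\<^sub>R n))) \<le>
         ennreal (gauss z * ((norm (u y))\<^sup>2 + (norm (u (y - z /\<^sub>R n)))\<^sup>2) / 2)"
        using gauss_bounds(1)[of z] by (simp add: norm_mult ennreal_mult'[symmetric] ennreal_leI mult_ac)
    qed auto
    finally show "ennreal (norm (cnj (u y) * (complex_of_real (2 * pi) * (LINT z|lborel. complex_of_real (gauss z) * u (y - z /\<^sub>R n))))) \<le>
       ennreal (2 * pi) * (\<integral>\<^sup>+z. ennreal (gauss z * ((norm (u y))\<^sup>2 + (norm (u (y - z /\<^sub>R n)))\<^sup>2) / 2) \<partial>lborel)" .
  qed
  also have "\<dots> = ennreal (2 * pi) * (\<integral>\<^sup>+z. \<integral>\<^sup>+y. ennreal (gauss z * ((norm (u y))\<^sup>2 + (norm (u (y - z /\<^sub>R n)))\<^sup>2) / 2) \<partial>lborel \<partial>lborel)"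
    by (subst nn_integral_cmult, measurable, subst lborel_pair.Fubini') auto
  also have "\<dots> = ennreal (2 * pi) * (\<integral>\<^sup>+z. ennreal (gauss z) * (\<integral>\<^sup>+x. ennreal ((norm (u x))\<^sup>2) \<partial>lborel) \<partial>lborel)"
  proof -
    have "(\<integral>\<^sup>+y. ennreal (gauss z * ((norm (u y))\<^sup>2 + (norm (u (y - z /\<^sub>R n)))\<^sup>2) / 2) \<partial>lborel) =
       ennreal (gauss z) * (\<integral>\<^sup>+x. ennreal ((norm (u x))\<^sup>2) \<partial>lborel)" for z
    proof -
      have "(\<integral>\<^sup>+y. ennreal (gauss z * ((norm (u y))\<^sup>2 + (norm (u (y - z /\<^sub>R n)))\<^sup>2) / 2) \<partial>lborel) =
         (\<integral>\<^sup>+y. ennreal (gauss z / 2) * (ennreal ((norm (u y))\<^sup>2) + ennreal ((norm (u (y - z /\<^sub>R n)))\<^sup>2)) \<partial>lborel)"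
        using gauss_bounds(1)[of z] by (simp add: ennreal_mult'[symmetric] ennreal_plus[symmetric] del: ennreal_plus)
      also have "\<dots> = ennreal (gauss z / 2) * ((\<integral>\<^sup>+y. ennreal ((norm (u y))\<^sup>2) \<partial>lborel) + (\<integral>\<^sup>+y. ennreal ((norm (u (y - z /\<^sub>R n)))\<^sup>2) \<partial>lborel))"
        by (simp add: nn_integral_cmult nn_integral_add)
      also have "(\<integral>\<^sup>+y. ennreal ((norm (u (y - z /\<^sub>R n)))\<^sup>2) \<partial>lborel) = (\<integral>\<^sup>+y. ennreal ((norm (u y))\<^sup>2) \<partial>lborel)"
        by (subst nn_integral_lborel_affine[of _ 1 "z /\<^sub>R n"]) auto
      also have "(\<integral>\<^sup>+y. ennreal ((norm (u y))\<^sup>2) \<partial>lborel) + (\<integral>\<^sup>+y. ennreal ((norm (u y))\<^sup>2) \<partial>lborel) = ennreal 2 * (\<integral>\<^sup>+y. ennreal ((norm (u y))\<^sup>2) \<partial>lborel)"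
        by (simp add: mult_2)
      finally show ?thesis
        using gauss_bounds(1)[of z] by (simp add: mult.assoc[symmetric] ennreal_mult'[symmetric] del: ennreal_numeral)
    qed
    then show ?thesis by simp
  qed
  also have "\<dots> = ennreal ((2 * pi)\<^sup>2) * (\<integral>\<^sup>+x. ennreal ((norm (u x))\<^sup>2) \<partial>lborel)"
  proof -
    have "(\<integral>\<^sup>+z. ennreal (gauss z) \<partial>lborel) = ennreal (2 * pi)"
      using nn_integral_eq_integral[OF gauss_integrable] gauss_bounds(1) integral_gauss by (simp add: less_imp_le)
    then show ?thesis
      by (simp add: nn_integral_multc mult.assoc[symmetric] ennreal_mult'[symmetric] power2_eq_square)
  qed
  finally show ?thesis .
qed

text \<open>Fatou's lemma removes the Gaussian.\<close>

lemma bessel_inequality: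
  assumes u: "integrable lborel u"
  shows "(\<integral>\<^sup>+\<xi>. ennreal ((norm (fourier_transform u \<xi>))\<^sup>2) \<partial>lborel) \<le>
    ennreal ((2 * pi)\<^sup>2) * (\<integral>\<^sup>+x. ennreal ((norm (u x))\<^sup>2) \<partial>lborel)"
proof -
  note [measurable] = fourier_transform_measurable[OF u]
  have "(\<integral>\<^sup>+\<xi>. ennreal ((norm (fourier_transform u \<xi>))\<^sup>2) \<partial>lborel) =
     (\<integral>\<^sup>+\<xi>. liminf (\<lambda>n. ennreal ((norm (fourier_transform u \<xi>))\<^sup>2 * gauss (\<xi> /\<^sub>R real (Suc n)))) \<partial>lborel)"
  proof (rule nn_integral_cong)
    fix \<xi>
    have "(\<lambda>n. ennreal ((norm (fourier_transform u \<xi>))\<^sup>2 * gauss (\<xi> /\<^sub>R real (Suc n)))) \<longlonglongrightarrow> ennreal ((norm (fourier_transform u \<xi>))\<^sup>2 * 1)"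
      by (intro tendsto_ennrealI tendsto_intros gauss_rescaled_tendsto_1)
    then show "ennreal ((norm (fourier_transform u \<xi>))\<^sup>2) = liminf (\<lambda>n. ennreal ((norm (fourier_transform u \<xi>))\<^sup>2 * gauss (\<xi> /\<^sub>R real (Suc n))))"
      using lim_imp_Liminf[OF sequentially_bot] by fastforce
  qed
  also have "\<dots> \<le> liminf (\<lambda>n. \<integral>\<^sup>+\<xi>. ennreal ((norm (fourier_transform u \<xi>))\<^sup>2 * gauss (\<xi> /\<^sub>R real (Suc n))) \<partial>lborel)"
    by (rule nn_integral_liminf) auto
  also have "\<dots> \<le> liminf (\<lambda>n::nat. ennreal ((2 * pi)\<^sup>2) * (\<integral>\<^sup>+x. ennreal ((norm (u x))\<^sup>2) \<partial>lborel))"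
    by (intro Liminf_mono always_eventually allI bessel_regularized[OF u]) auto
  finally show ?thesis by (simp add: Liminf_const)
qed

section \<open>Fourier norms of functions supported in a rectangle\<close>

text \<open>Differences are measured relative to the side lengths, so that \<open>p\<close>, \<open>q\<close>, \<open>r\<close> and \<open>s\<close> are comparable.\<close>

definition rect_lipschitz ::
  "(real \<times> real \<Rightarrow> complex) \<Rightarrow> real \<Rightarrow> real \<Rightarrow> real \<Rightarrow> real \<Rightarrow> real \<Rightarrow> real \<Rightarrow> bool" where
  "rect_lipschitz \<phi> X Y p q r s \<longleftrightarrow> 0 < X \<and> 0 < Y \<and>
     (\<exists>a b. \<forall>x y. \<phi> (x, y) \<noteq> 0 \<longrightarrow> x \<in> {a..a + X} \<and> y \<in> {b..b + Y}) \<and>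
     (\<forall>x y. norm (\<phi> (x, y)) \<le> p) \<and>
     (\<forall>x x' y. norm (\<phi> (x, y) - \<phi> (x', y)) \<le> q / X * \<bar>x - x'\<bar>) \<and>
     (\<forall>x y y'. norm (\<phi> (x, y) - \<phi> (x, y')) \<le> r / Y * \<bar>y - y'\<bar>) \<and>
     (\<forall>x x' y y'. norm (\<phi> (x, y) - \<phi> (x', y) - (\<phi> (x, y') - \<phi> (x', y'))) \<le> s / (X * Y) * \<bar>x - x'\<bar> * \<bar>y - y'\<bar>)"

lemma nn_integral_square_le:
  fixes u :: "real \<times> real \<Rightarrow> complex"
  assumes "\<And>x y. norm (u (x, y)) \<le> K" and "\<And>x y. u (x, y) \<noteq> 0 \<Longrightarrow> x \<in> {a..a + A} \<and> y \<in> {b..b + B}"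
    and "A \<ge> 0" "B \<ge> 0" "K \<ge> 0"
  shows "(\<integral>\<^sup>+z. ennreal ((norm (u z))\<^sup>2) \<partial>lborel) \<le> ennreal (K\<^sup>2 * (A * B))"
proof -
  have "(\<integral>\<^sup>+z. ennreal ((norm (u z))\<^sup>2) \<partial>lborel) \<le>
    (\<integral>\<^sup>+z. ennreal (K\<^sup>2) * indicator ({a..a + A} \<times> {b..b + B}) z \<partial>lborel)"
  proof (rule nn_integral_mono)
    fix z :: "real \<times> real"
    obtain x y where z: "z = (x, y)" by (cases z)
    show "ennreal ((norm (u z))\<^sup>2) \<le> ennreal (K\<^sup>2) * indicator ({a..a + A} \<times> {b..b + B}) z"
    proof (cases "u z = 0")
      case False
      then have "z \<in> {a..a + A} \<times> {b..b + B}" using assms(2)[of x y] z by auto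
      moreover have "(norm (u z))\<^sup>2 \<le> K\<^sup>2" using assms(1)[of x y] z by (intro power_mono) auto
      ultimately show ?thesis by (simp add: ennreal_leI)
    qed simp
  qed
  also have "\<dots> = ennreal (K\<^sup>2) * emeasure lborel ({a..a + A} \<times> {b..b + B})"
    by (rule nn_integral_cmult_indicator) (auto intro!: borel_closed closed_Times)
  also have "emeasure lborel ({a..a + A} \<times> {b..b + B}) = ennreal (A * B)"
    using assms by (simp add: lborel_prod[symmetric] lborel.emeasure_pair_measure_Times ennreal_mult)
  finally show ?thesis using assms by (simp add: ennreal_mult)
qed

lemma rect_lipschitz_continuous:
  assumes "rect_lipschitz \<phi> X Y p q r s" shows "continuous_on UNIV \<phi>"
proof (rule continuous_at_imp_continuous_on, rule ballI)
  fix z :: "real \<times> real"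
  obtain x y where z: "z = (x, y)" by (cases z)
  have le: "norm (\<phi> w - \<phi> z) \<le> q / X * \<bar>fst w - x\<bar> + r / Y * \<bar>snd w - y\<bar>" for w
  proof -
    have "norm (\<phi> (fst w, snd w) - \<phi> (x, snd w)) \<le> q / X * \<bar>fst w - x\<bar>"
      "norm (\<phi> (x, snd w) - \<phi> (x, y)) \<le> r / Y * \<bar>snd w - y\<bar>"
      using assms unfolding rect_lipschitz_def by blast+
    moreover have "\<phi> w - \<phi> z = (\<phi> (fst w, snd w) - \<phi> (x, snd w)) + (\<phi> (x, snd w) - \<phi> (x, y))"
      using z by simp
    ultimately show ?thesis using norm_triangle_ineq by (smt (verit, best))
  qed
  have "((\<lambda>w. q / X * \<bar>fst w - x\<bar> + r / Y * \<bar>snd w - y\<bar>) \<longlongrightarrow> q / X * \<bar>fst z - x\<bar> + r / Y * \<bar>snd z - y\<bar>) (at z)"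
    by (intro tendsto_intros)
  then have "((\<lambda>w. q / X * \<bar>fst w - x\<bar> + r / Y * \<bar>snd w - y\<bar>) \<longlongrightarrow> 0) (at z)" using z by simp
  then have "((\<lambda>w. \<phi> w - \<phi> z) \<longlongrightarrow> 0) (at z)"
    by (rule Lim_null_comparison[rotated]) (use le in auto)
  then show "isCont \<phi> z" unfolding isCont_def by (rule LIM_zero_cancel)
qed

lemma rect_lipschitz_nonneg:
  assumes "rect_lipschitz \<phi> X Y p q r s" shows "0 \<le> p" "0 \<le> q" "0 \<le> r" "0 \<le> s"
proof -
  have X: "X > 0" "Y > 0" using assms unfolding rect_lipschitz_def by auto
  have "norm (\<phi> (0, 0)) \<le> p" "norm (\<phi> (0, 0) - \<phi> (1, 0)) \<le> q / X * \<bar>0 - 1\<bar>"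
    "norm (\<phi> (0, 0) - \<phi> (0, 1)) \<le> r / Y * \<bar>0 - 1\<bar>"
    "norm (\<phi> (0, 0) - \<phi> (1, 0) - (\<phi> (0, 1) - \<phi> (1, 1))) \<le> s / (X * Y) * \<bar>0 - 1\<bar> * \<bar>0 - 1\<bar>"
    using assms unfolding rect_lipschitz_def by blast+
  then have "0 \<le> p" "0 \<le> q / X" "0 \<le> r / Y" "0 \<le> s / (X * Y)"
    by (auto intro: order_trans[OF norm_ge_zero] simp del: times_divide_eq_left)
  then show "0 \<le> p" "0 \<le> q" "0 \<le> r" "0 \<le> s" using X mult_pos_pos[OF X]
    by (auto simp: zero_le_divide_iff)
qed

lemma rect_lipschitz_integrable:
  assumes "rect_lipschitz \<phi> X Y p q r s" shows "integrable lborel \<phi>"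
proof -
  obtain a b where ab: "\<And>x y. \<phi> (x, y) \<noteq> 0 \<Longrightarrow> x \<in> {a..a + X} \<and> y \<in> {b..b + Y}"
    using assms unfolding rect_lipschitz_def by blast
  have "continuous_on (cbox (a, b) (a + X, b + Y)) \<phi>"
    using rect_lipschitz_continuous[OF assms] continuous_on_subset by blast
  then have "set_integrable lborel (cbox (a, b) (a + X, b + Y)) \<phi>"
    unfolding set_integrable_def by (intro borel_integrable_compact compact_cbox)
  moreover have "(\<lambda>z. indicator (cbox (a, b) (a + X, b + Y)) z *\<^sub>R \<phi> z) = \<phi>"
  proof
    fix z :: "real \<times> real" show "indicator (cbox (a, b) (a + X, b + Y)) z *\<^sub>R \<phi> z = \<phi> z"
      using ab[of "fst z" "snd z"] by (cases "\<phi> z = 0") (auto simp: indicator_def cbox_Pair_eq mem_Times_iff)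
  qed
  ultimately show ?thesis unfolding set_integrable_def by simp
qed

lemma fourier_transform_difference:
  assumes u: "integrable lborel u"
  shows "integrable lborel (\<lambda>t. c * (u (t + a) - u t))"
    "fourier_transform (\<lambda>t. c * (u (t + a) - u t)) \<xi> =
      c * (exp (\<i> * complex_of_real (\<xi> \<bullet> a)) - 1) * fourier_transform u \<xi>"
proof -
  have [measurable]: "u \<in> borel_measurable borel" using u by auto
  have sh: "integrable lborel (\<lambda>t. u (t + a))"
    unfolding integrable_iff_bounded
  proof
    have "(\<integral>\<^sup>+x. ennreal (norm (u x)) \<partial>lborel) = (\<integral>\<^sup>+t. ennreal (norm (u (t + a))) \<partial>lborel)"
      by (subst nn_integral_lborel_affine[of _ 1 a]) (auto simp: add.commute)
    then show "(\<integral>\<^sup>+t. ennreal (norm (u (t + a))) \<partial>lborel) < \<infinity>"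
      using u unfolding integrable_iff_bounded by simp
  qed auto
  then show "integrable lborel (\<lambda>t. c * (u (t + a) - u t))" using u by auto
  have "fourier_transform u \<xi> = (LINT t|lborel. u (t + a) * exp (\<i> * complex_of_real (\<xi> \<bullet> - (t + a))))"
    unfolding fourier_transform_def
    by (subst integral_lborel_affine[of _ 1 a]) (auto simp: add.commute intro!: borel_measurable_continuous_onI continuous_intros)
  also have "\<dots> = (LINT t|lborel. (u (t + a) * exp (\<i> * complex_of_real (\<xi> \<bullet> - t))) * exp (- (\<i> * complex_of_real (\<xi> \<bullet> a))))"
    by (simp add: inner_add_right exp_add[symmetric] mult.assoc distrib_left minus_add_distrib del: minus_add_distrib)
      (simp add: algebra_simps inner_diff_right)
  also have "\<dots> = fourier_transform (\<lambda>t. u (t + a)) \<xi> * exp (- (\<i> * complex_of_real (\<xi> \<bullet> a)))"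
    unfolding fourier_transform_def by (rule integral_mult_left_zero)
  finally have "fourier_transform (\<lambda>t. u (t + a)) \<xi> = exp (\<i> * complex_of_real (\<xi> \<bullet> a)) * fourier_transform u \<xi>"
    by (simp add: exp_minus)
  moreover have "fourier_transform (\<lambda>t. c * (u (t + a) - u t)) \<xi> =
      c * (fourier_transform (\<lambda>t. u (t + a)) \<xi> - fourier_transform u \<xi>)"
    unfolding fourier_transform_def mult.assoc left_diff_distrib right_diff_distrib
    using integrable_character[OF sh, of "- \<xi>"] integrable_character[OF u, of "- \<xi>"]
    by (simp add: inner_commute)
  ultimately show "fourier_transform (\<lambda>t. c * (u (t + a) - u t)) \<xi> =
      c * (exp (\<i> * complex_of_real (\<xi> \<bullet> a)) - 1) * fourier_transform u \<xi>"
    by (simp add: algebra_simps)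
qed

lemma character_quotient_tendsto:
  "(\<lambda>n. real (Suc n) * norm (exp (\<i> * complex_of_real (a * (1 / real (Suc n)))) - 1)) \<longlonglongrightarrow> \<bar>a\<bar>"
proof -
  have "((\<lambda>z. exp (z * (\<i> * complex_of_real a))) has_field_derivative (\<i> * complex_of_real a)) (at 0)"
    by (auto intro!: derivative_eq_intros)
  then have d: "((\<lambda>z. (exp (z * (\<i> * complex_of_real a)) - 1) / z) \<longlongrightarrow> \<i> * complex_of_real a) (at 0)"
    by (simp add: has_field_derivative_iff)
  have "(\<lambda>n. complex_of_real (1 / real (Suc n))) \<longlonglongrightarrow> complex_of_real 0"
    using LIMSEQ_inverse_real_of_nat by (intro tendsto_of_real) (simp add: inverse_eq_divide)
  then have "filterlim (\<lambda>n. complex_of_real (1 / real (Suc n))) (at 0) sequentially"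
    by (auto simp: filterlim_at simp del: of_nat_Suc)
  from tendsto_norm[OF filterlim_compose[OF d this]] show ?thesis
    by (simp add: norm_divide norm_mult mult_ac del: of_nat_Suc)
qed

text \<open>Growth of the transform is measured without derivatives of \<open>\<phi>\<close>:
  difference quotients multiply the transform by factors that tend to \<open>w\<close>, and Fatou's
  lemma passes Bessel's inequality to the limit.\<close>

lemma weighted_bessel:
  assumes u: "\<And>n. integrable lborel (u n)" and \<phi>: "integrable lborel \<phi>"
    and ft: "\<And>n \<xi>. norm (fourier_transform (u n) \<xi>) = m n \<xi> * norm (fourier_transform \<phi> \<xi>)"
    and m: "\<And>\<xi>. (\<lambda>n. m n \<xi>) \<longlonglongrightarrow> w \<xi>"
    and le: "\<And>n. (\<integral>\<^sup>+z. ennreal ((norm (u n z))\<^sup>2) \<partial>lborel) \<le> ennreal (c n)" and c: "c \<longlonglongrightarrow> C"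
  shows "(\<integral>\<^sup>+\<xi>. ennreal ((w \<xi> * norm (fourier_transform \<phi> \<xi>))\<^sup>2) \<partial>lborel) \<le> ennreal ((2 * pi)\<^sup>2 * C)"
proof -
  note [measurable] = fourier_transform_measurable[OF u]
  have "(\<integral>\<^sup>+\<xi>. ennreal ((w \<xi> * norm (fourier_transform \<phi> \<xi>))\<^sup>2) \<partial>lborel) =
     (\<integral>\<^sup>+\<xi>. liminf (\<lambda>n. ennreal ((norm (fourier_transform (u n) \<xi>))\<^sup>2)) \<partial>lborel)"
  proof (rule nn_integral_cong)
    fix \<xi>
    have "(\<lambda>n. ennreal ((norm (fourier_transform (u n) \<xi>))\<^sup>2)) \<longlonglongrightarrow> ennreal ((w \<xi> * norm (fourier_transform \<phi> \<xi>))\<^sup>2)"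
      unfolding ft by (intro tendsto_ennrealI tendsto_intros m)
    then show "ennreal ((w \<xi> * norm (fourier_transform \<phi> \<xi>))\<^sup>2) = liminf (\<lambda>n. ennreal ((norm (fourier_transform (u n) \<xi>))\<^sup>2))"
      using lim_imp_Liminf[OF sequentially_bot] by fastforce
  qed
  also have "\<dots> \<le> liminf (\<lambda>n. \<integral>\<^sup>+\<xi>. ennreal ((norm (fourier_transform (u n) \<xi>))\<^sup>2) \<partial>lborel)"
    by (rule nn_integral_liminf) auto
  also have "\<dots> \<le> liminf (\<lambda>n. ennreal ((2 * pi)\<^sup>2 * c n))"
  proof (intro Liminf_mono always_eventually allI)
    fix n
    have "(\<integral>\<^sup>+\<xi>. ennreal ((norm (fourier_transform (u n) \<xi>))\<^sup>2) \<partial>lborel) \<le>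
        ennreal ((2 * pi)\<^sup>2) * (\<integral>\<^sup>+z. ennreal ((norm (u n z))\<^sup>2) \<partial>lborel)" by (rule bessel_inequality[OF u])
    also have "\<dots> \<le> ennreal ((2 * pi)\<^sup>2) * ennreal (c n)" by (intro mult_left_mono le) auto
    finally show "(\<integral>\<^sup>+\<xi>. ennreal ((norm (fourier_transform (u n) \<xi>))\<^sup>2) \<partial>lborel) \<le> ennreal ((2 * pi)\<^sup>2 * c n)"
      by (simp add: ennreal_mult')
  qed
  also have "\<dots> = ennreal ((2 * pi)\<^sup>2 * C)"
    by (intro lim_imp_Liminf tendsto_ennrealI tendsto_intros c) auto
  finally show ?thesis .
qed

lemma rect_lipschitz_weighted:
  assumes rl: "rect_lipschitz \<phi> X Y p q r s"
  defines "F \<equiv> fourier_transform \<phi>"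
  shows "(\<integral>\<^sup>+\<xi>. ennreal ((norm (F \<xi>))\<^sup>2) \<partial>lborel) \<le> ennreal ((2 * pi)\<^sup>2 * (X * Y * p\<^sup>2))"
    "(\<integral>\<^sup>+\<xi>. ennreal ((\<bar>fst \<xi>\<bar> * norm (F \<xi>))\<^sup>2) \<partial>lborel) \<le> ennreal ((2 * pi)\<^sup>2 * (X * Y * (q / X)\<^sup>2))"
    "(\<integral>\<^sup>+\<xi>. ennreal ((\<bar>snd \<xi>\<bar> * norm (F \<xi>))\<^sup>2) \<partial>lborel) \<le> ennreal ((2 * pi)\<^sup>2 * (X * Y * (r / Y)\<^sup>2))"
    "(\<integral>\<^sup>+\<xi>. ennreal ((\<bar>fst \<xi>\<bar> * \<bar>snd \<xi>\<bar> * norm (F \<xi>))\<^sup>2) \<partial>lborel) \<le> ennreal ((2 * pi)\<^sup>2 * (X * Y * (s / (X * Y))\<^sup>2))"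
proof -
  have X: "X > 0" "Y > 0" using rl unfolding rect_lipschitz_def by auto
  obtain a b where "\<forall>x y. \<phi> (x, y) \<noteq> 0 \<longrightarrow> x \<in> {a..a + X} \<and> y \<in> {b..b + Y}"
    using rl unfolding rect_lipschitz_def by blast
  then have ab: "x \<in> {a..a + X} \<and> y \<in> {b..b + Y}" if "\<phi> (x, y) \<noteq> 0" for x y using that by blast
  note nn = rect_lipschitz_nonneg[OF rl]
  have b00: "norm (\<phi> (x, y)) \<le> p" and b10: "norm (\<phi> (x, y) - \<phi> (x', y)) \<le> q / X * \<bar>x - x'\<bar>"
    and b01: "norm (\<phi> (x, y) - \<phi> (x, y')) \<le> r / Y * \<bar>y - y'\<bar>"
    and b11: "norm (\<phi> (x, y) - \<phi> (x', y) - (\<phi> (x, y') - \<phi> (x', y'))) \<le> s / (X * Y) * \<bar>x - x'\<bar> * \<bar>y - y'\<bar>" for x x' y y'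
    using rl unfolding rect_lipschitz_def by blast+
  have \<phi>: "integrable lborel \<phi>" by (rule rect_lipschitz_integrable[OF rl])
  define h where "h n = 1 / real (Suc n)" for n
  have h: "h n > 0" for n by (auto simp: h_def)
  have hlim: "h \<longlonglongrightarrow> 0"
    using LIMSEQ_inverse_real_of_nat unfolding h_def by (simp add: inverse_eq_divide)
  have "(\<integral>\<^sup>+\<xi>. ennreal ((norm (F \<xi>))\<^sup>2) \<partial>lborel) \<le> ennreal ((2 * pi)\<^sup>2) * (\<integral>\<^sup>+z. ennreal ((norm (\<phi> z))\<^sup>2) \<partial>lborel)"
    unfolding F_def by (rule bessel_inequality[OF \<phi>])
  also have "\<dots> \<le> ennreal ((2 * pi)\<^sup>2) * ennreal (p\<^sup>2 * (X * Y))"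
    by (intro mult_left_mono nn_integral_square_le[where a=a and b=b] b00 ab) (use X nn in auto)
  also have "\<dots> = ennreal ((2 * pi)\<^sup>2 * (X * Y * p\<^sup>2))"
    by (subst ennreal_mult'[symmetric]) (simp_all add: mult_ac)
  finally show "(\<integral>\<^sup>+\<xi>. ennreal ((norm (F \<xi>))\<^sup>2) \<partial>lborel) \<le> ennreal ((2 * pi)\<^sup>2 * (X * Y * p\<^sup>2))" .
  \<comment> \<open>\<open>c n\<close> is the reciprocal of the step \<open>h n\<close>;
    \<open>u1\<close>, \<open>u2\<close> and \<open>u3\<close> are the difference quotients in the
    first, in the second and in both variables.\<close>
  define c where "c n = complex_of_real (real (Suc n))" for n
  have c: "norm (c n) = real (Suc n)" "norm (c n) * h n = 1" for n by (auto simp: c_def h_def simp del: of_nat_Suc)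
  define u1 where "u1 n t = c n * (\<phi> (t + (h n, 0)) - \<phi> t)" for n t
  define u2 where "u2 n t = c n * (\<phi> (t + (0, h n)) - \<phi> t)" for n t
  define u3 where "u3 n t = c n * (u1 n (t + (0, h n)) - u1 n t)" for n t
  have i1: "integrable lborel (u1 n)" and i2: "integrable lborel (u2 n)" for n
    unfolding u1_def u2_def by (rule fourier_transform_difference[OF \<phi>])+
  have i3: "integrable lborel (u3 n)" for n
    unfolding u3_def by (rule fourier_transform_difference[OF i1])
  have f1: "norm (fourier_transform (u1 n) \<xi>) = real (Suc n) * norm (exp (\<i> * complex_of_real (fst \<xi> * (1 / real (Suc n)))) - 1) * norm (F \<xi>)" for n \<xi>
    unfolding u1_def F_def fourier_transform_difference(2)[OF \<phi>] norm_mult c(1) by (simp add: inner_prod_def h_def)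
  have f2: "norm (fourier_transform (u2 n) \<xi>) = real (Suc n) * norm (exp (\<i> * complex_of_real (snd \<xi> * (1 / real (Suc n)))) - 1) * norm (F \<xi>)" for n \<xi>
    unfolding u2_def F_def fourier_transform_difference(2)[OF \<phi>] norm_mult c(1) by (simp add: inner_prod_def h_def)
  have f3: "norm (fourier_transform (u3 n) \<xi>) = (real (Suc n) * norm (exp (\<i> * complex_of_real (fst \<xi> * (1 / real (Suc n)))) - 1)) *
      (real (Suc n) * norm (exp (\<i> * complex_of_real (snd \<xi> * (1 / real (Suc n)))) - 1)) * norm (F \<xi>)" for n \<xi>
    unfolding u3_def fourier_transform_difference(2)[OF i1] norm_mult c(1) f1 by (simp add: inner_prod_def h_def)
  \<comment> \<open>The quotient is bounded by the Lipschitz constant. The shift enlarges the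
    support by \<open>h n\<close>, which disappears in the limit.\<close>
  have l1: "(\<integral>\<^sup>+z. ennreal ((norm (u1 n z))\<^sup>2) \<partial>lborel) \<le> ennreal ((q / X)\<^sup>2 * ((X + h n) * Y))" for n
  proof (rule nn_integral_square_le[where a="a - h n" and b=b])
    fix x y
    have "norm (u1 n (x, y)) \<le> norm (c n) * (q / X * \<bar>x + h n - x\<bar>)"
      unfolding u1_def norm_mult using b10[of "x + h n" y x] by (intro mult_left_mono) auto
    also have "\<dots> = q / X * (norm (c n) * h n)" using h[of n] by simp
    finally show "norm (u1 n (x, y)) \<le> q / X" unfolding c(2) by simp
    assume "u1 n (x, y) \<noteq> 0"
    then have "\<phi> (x + h n, y) \<noteq> 0 \<or> \<phi> (x, y) \<noteq> 0" by (auto simp: u1_def)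
    then show "x \<in> {a - h n..a - h n + (X + h n)} \<and> y \<in> {b..b + Y}"
      using ab[of "x + h n" y] ab[of x y] h[of n] by auto
  qed (use X nn h[of n] in auto)
  have l2: "(\<integral>\<^sup>+z. ennreal ((norm (u2 n z))\<^sup>2) \<partial>lborel) \<le> ennreal ((r / Y)\<^sup>2 * (X * (Y + h n)))" for n
  proof (rule nn_integral_square_le[where a=a and b="b - h n"])
    fix x y
    have "norm (u2 n (x, y)) \<le> norm (c n) * (r / Y * \<bar>y + h n - y\<bar>)"
      unfolding u2_def norm_mult using b01[of x "y + h n" y] by (intro mult_left_mono) auto
    also have "\<dots> = r / Y * (norm (c n) * h n)" using h[of n] by simp
    finally show "norm (u2 n (x, y)) \<le> r / Y" unfolding c(2) by simp
    assume "u2 n (x, y) \<noteq> 0"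
    then have "\<phi> (x, y + h n) \<noteq> 0 \<or> \<phi> (x, y) \<noteq> 0" by (auto simp: u2_def)
    then show "x \<in> {a..a + X} \<and> y \<in> {b - h n..b - h n + (Y + h n)}"
      using ab[of x "y + h n"] ab[of x y] h[of n] by auto
  qed (use X nn h[of n] in auto)
  have l3: "(\<integral>\<^sup>+z. ennreal ((norm (u3 n z))\<^sup>2) \<partial>lborel) \<le> ennreal ((s / (X * Y))\<^sup>2 * ((X + h n) * (Y + h n)))" for n
  proof (rule nn_integral_square_le[where a="a - h n" and b="b - h n"])
    fix x y
    have "u3 n (x, y) = c n * c n * (\<phi> (x + h n, y + h n) - \<phi> (x, y + h n) - (\<phi> (x + h n, y) - \<phi> (x, y)))"
      unfolding u3_def u1_def by (simp add: algebra_simps)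
    then have "norm (u3 n (x, y)) \<le> norm (c n * c n) * (s / (X * Y) * \<bar>x + h n - x\<bar> * \<bar>y + h n - y\<bar>)"
      using b11[of "x + h n" "y + h n" x y] by (simp add: norm_mult mult_left_mono del: times_divide_eq_left)
    also have "\<dots> = s / (X * Y) * (norm (c n) * h n) * (norm (c n) * h n)" using h[of n] by (simp add: norm_mult)
    finally show "norm (u3 n (x, y)) \<le> s / (X * Y)" unfolding c(2) by simp
    assume "u3 n (x, y) \<noteq> 0"
    then have "\<phi> (x + h n, y + h n) \<noteq> 0 \<or> \<phi> (x, y + h n) \<noteq> 0 \<or> \<phi> (x + h n, y) \<noteq> 0 \<or> \<phi> (x, y) \<noteq> 0"
      by (auto simp: u3_def u1_def)
    then show "x \<in> {a - h n..a - h n + (X + h n)} \<and> y \<in> {b - h n..b - h n + (Y + h n)}"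
      using ab[of x "y + h n"] ab[of x y] ab[of "x + h n" "y + h n"] ab[of "x + h n" y] h[of n] by auto
  qed (use X nn h[of n] in auto)
  show "(\<integral>\<^sup>+\<xi>. ennreal ((\<bar>fst \<xi>\<bar> * norm (F \<xi>))\<^sup>2) \<partial>lborel) \<le> ennreal ((2 * pi)\<^sup>2 * (X * Y * (q / X)\<^sup>2))"
  proof (unfold F_def, rule weighted_bessel[OF i1 \<phi> f1[unfolded F_def] character_quotient_tendsto l1])
    have "(\<lambda>n. (q / X)\<^sup>2 * ((X + h n) * Y)) \<longlonglongrightarrow> (q / X)\<^sup>2 * ((X + 0) * Y)" by (intro tendsto_intros hlim)
    then show "(\<lambda>n. (q / X)\<^sup>2 * ((X + h n) * Y)) \<longlonglongrightarrow> X * Y * (q / X)\<^sup>2" by (simp add: mult_ac)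
  qed
  show "(\<integral>\<^sup>+\<xi>. ennreal ((\<bar>snd \<xi>\<bar> * norm (F \<xi>))\<^sup>2) \<partial>lborel) \<le> ennreal ((2 * pi)\<^sup>2 * (X * Y * (r / Y)\<^sup>2))"
  proof (unfold F_def, rule weighted_bessel[OF i2 \<phi> f2[unfolded F_def] character_quotient_tendsto l2])
    have "(\<lambda>n. (r / Y)\<^sup>2 * (X * (Y + h n))) \<longlonglongrightarrow> (r / Y)\<^sup>2 * (X * (Y + 0))" by (intro tendsto_intros hlim)
    then show "(\<lambda>n. (r / Y)\<^sup>2 * (X * (Y + h n))) \<longlonglongrightarrow> X * Y * (r / Y)\<^sup>2" by (simp add: mult_ac)
  qed
  show "(\<integral>\<^sup>+\<xi>. ennreal ((\<bar>fst \<xi>\<bar> * \<bar>snd \<xi>\<bar> * norm (F \<xi>))\<^sup>2) \<partial>lborel) \<le> ennreal ((2 * pi)\<^sup>2 * (X * Y * (s / (X * Y))\<^sup>2))"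
  proof (unfold F_def, rule weighted_bessel[OF i3 \<phi> f3[unfolded F_def] tendsto_mult[OF character_quotient_tendsto character_quotient_tendsto] l3])
    have "(\<lambda>n. (s / (X * Y))\<^sup>2 * ((X + h n) * (Y + h n))) \<longlonglongrightarrow> (s / (X * Y))\<^sup>2 * ((X + 0) * (Y + 0))" by (intro tendsto_intros hlim)
    then show "(\<lambda>n. (s / (X * Y))\<^sup>2 * ((X + h n) * (Y + h n))) \<longlonglongrightarrow> X * Y * (s / (X * Y))\<^sup>2" by (simp add: mult_ac)
  qed
qed

lemma fst_snd_borel_measurable [measurable]:
  "(fst :: real \<times> real \<Rightarrow> real) \<in> borel_measurable borel" "(snd :: real \<times> real \<Rightarrow> real) \<in> borel_measurable borel"
  by (auto intro!: borel_measurable_continuous_onI continuous_intros)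

lemma rect_lipschitz_quadratic_weight:
  assumes rl: "rect_lipschitz \<phi> X Y p q r s" and "A1 \<ge> 0" "A2 \<ge> 0" "A3 \<ge> 0"
  shows "(\<integral>\<^sup>+\<xi>. ennreal ((1 + A1 * (fst \<xi>)\<^sup>2 + A2 * (snd \<xi>)\<^sup>2 + A3 * (fst \<xi>)\<^sup>2 * (snd \<xi>)\<^sup>2) * (norm (fourier_transform \<phi> \<xi>))\<^sup>2) \<partial>lborel)
    \<le> ennreal ((2 * pi)\<^sup>2 * (X * Y * (p\<^sup>2 + A1 * (q / X)\<^sup>2 + A2 * (r / Y)\<^sup>2 + A3 * (s / (X * Y))\<^sup>2)))"
proof -
  let ?F = "fourier_transform \<phi>"
  note [measurable] = fourier_transform_measurable[OF rect_lipschitz_integrable[OF rl]]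
  have X: "X > 0" "Y > 0" using rl unfolding rect_lipschitz_def by auto
  have eq: "ennreal ((1 + A1 * (fst \<xi>)\<^sup>2 + A2 * (snd \<xi>)\<^sup>2 + A3 * (fst \<xi>)\<^sup>2 * (snd \<xi>)\<^sup>2) * (norm (?F \<xi>))\<^sup>2) =
    ennreal ((norm (?F \<xi>))\<^sup>2) + ennreal A1 * ennreal ((\<bar>fst \<xi>\<bar> * norm (?F \<xi>))\<^sup>2) +
    ennreal A2 * ennreal ((\<bar>snd \<xi>\<bar> * norm (?F \<xi>))\<^sup>2) + ennreal A3 * ennreal ((\<bar>fst \<xi>\<bar> * \<bar>snd \<xi>\<bar> * norm (?F \<xi>))\<^sup>2)" for \<xi>
    using assms(2-4) by (simp add: ennreal_mult'[symmetric] ennreal_plus[symmetric] power_mult_distrib algebra_simps del: ennreal_plus)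
  have "(\<integral>\<^sup>+\<xi>. ennreal ((1 + A1 * (fst \<xi>)\<^sup>2 + A2 * (snd \<xi>)\<^sup>2 + A3 * (fst \<xi>)\<^sup>2 * (snd \<xi>)\<^sup>2) * (norm (?F \<xi>))\<^sup>2) \<partial>lborel) =
     (\<integral>\<^sup>+\<xi>. ennreal ((norm (?F \<xi>))\<^sup>2) \<partial>lborel) + ennreal A1 * (\<integral>\<^sup>+\<xi>. ennreal ((\<bar>fst \<xi>\<bar> * norm (?F \<xi>))\<^sup>2) \<partial>lborel) +
    ennreal A2 * (\<integral>\<^sup>+\<xi>. ennreal ((\<bar>snd \<xi>\<bar> * norm (?F \<xi>))\<^sup>2) \<partial>lborel) +
    ennreal A3 * (\<integral>\<^sup>+\<xi>. ennreal ((\<bar>fst \<xi>\<bar> * \<bar>snd \<xi>\<bar> * norm (?F \<xi>))\<^sup>2) \<partial>lborel)"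
    unfolding eq by (simp add: nn_integral_add nn_integral_cmult)
  also have "\<dots> \<le> ennreal ((2 * pi)\<^sup>2 * (X * Y * p\<^sup>2)) + ennreal A1 * ennreal ((2 * pi)\<^sup>2 * (X * Y * (q / X)\<^sup>2)) +
     ennreal A2 * ennreal ((2 * pi)\<^sup>2 * (X * Y * (r / Y)\<^sup>2)) + ennreal A3 * ennreal ((2 * pi)\<^sup>2 * (X * Y * (s / (X * Y))\<^sup>2))"
    by (intro add_mono mult_left_mono rect_lipschitz_weighted[OF rl]) auto
  also have "\<dots> = ennreal ((2 * pi)\<^sup>2 * (X * Y * (p\<^sup>2 + A1 * (q / X)\<^sup>2 + A2 * (r / Y)\<^sup>2 + A3 * (s / (X * Y))\<^sup>2)))"
    using assms(2-4) X
    by (simp add: ennreal_mult'[symmetric] ennreal_plus[symmetric] del: ennreal_plus) (simp add: algebra_simps)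
  finally show ?thesis .
qed

text \<open>Cauchy--Schwarz in the form of a pointwise arithmetic-geometric mean with a parameter
  \<open>\<kappa>\<close>, so that only the two integrals in the hypotheses enter. Once the
  transform is integrable, inversion turns it into the witness.\<close>

lemma fourier_bounded_weight:
  assumes rl: "rect_lipschitz \<phi> X Y p q r s" and [measurable]: "w \<in> borel_measurable borel" and w: "\<And>\<xi>. w \<xi> > 0"
    and A: "A > 0" "(\<integral>\<^sup>+\<xi>. ennreal (w \<xi> * (norm (fourier_transform \<phi> \<xi>))\<^sup>2) \<partial>lborel) \<le> ennreal ((2 * pi)\<^sup>2 * (X * Y * A\<^sup>2))"
    and B: "B > 0" "(\<integral>\<^sup>+\<xi>. ennreal (1 / w \<xi>) \<partial>lborel) \<le> ennreal (B\<^sup>2 / (X * Y))"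
  shows "fourier_bounded \<phi> (ennreal (A * B))"
proof -
  let ?F = "fourier_transform \<phi>"
  have X: "X > 0" "Y > 0" using rl unfolding rect_lipschitz_def by auto
  have int: "integrable lborel \<phi>" by (rule rect_lipschitz_integrable[OF rl])
  note [measurable] = fourier_transform_measurable[OF int]
  \<comment> \<open>This value balances the two terms: each becomes
    \<open>pi * A * B\<close>.\<close>
  define \<kappa> where "\<kappa> = B / (2 * pi * (X * Y) * A)"
  have \<kappa>: "\<kappa> > 0" using A B X by (simp add: \<kappa>_def)
  have pt: "norm (?F \<xi>) \<le> \<kappa> / 2 * (w \<xi> * (norm (?F \<xi>))\<^sup>2) + 1 / (2 * \<kappa>) * (1 / w \<xi>)" for \<xi>
  proof -
    have "0 \<le> (\<kappa> * w \<xi> * norm (?F \<xi>) - 1)\<^sup>2 / (2 * \<kappa> * w \<xi>)" using \<kappa> w[of \<xi>] by simp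
    also have "\<dots> = \<kappa> / 2 * (w \<xi> * (norm (?F \<xi>))\<^sup>2) + 1 / (2 * \<kappa>) * (1 / w \<xi>) - norm (?F \<xi>)"
      using \<kappa> w[of \<xi>] by (simp add: power2_eq_square field_simps)
    finally show ?thesis by simp
  qed
  have "(\<integral>\<^sup>+\<xi>. ennreal (norm (?F \<xi>)) \<partial>lborel) \<le>
     (\<integral>\<^sup>+\<xi>. ennreal (\<kappa> / 2) * ennreal (w \<xi> * (norm (?F \<xi>))\<^sup>2) + ennreal (1 / (2 * \<kappa>)) * ennreal (1 / w \<xi>) \<partial>lborel)"
  proof (rule nn_integral_mono)
    fix \<xi>
    have "ennreal (norm (?F \<xi>)) \<le> ennreal (\<kappa> / 2 * (w \<xi> * (norm (?F \<xi>))\<^sup>2) + 1 / (2 * \<kappa>) * (1 / w \<xi>))"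
      by (rule ennreal_leI[OF pt])
    also have "\<dots> = ennreal (\<kappa> / 2) * ennreal (w \<xi> * (norm (?F \<xi>))\<^sup>2) + ennreal (1 / (2 * \<kappa>)) * ennreal (1 / w \<xi>)"
    proof -
      have "0 \<le> \<kappa> / 2" "0 \<le> 1 / (2 * \<kappa>)" "0 \<le> w \<xi> * (norm (?F \<xi>))\<^sup>2" "0 \<le> 1 / w \<xi>" using \<kappa> w[of \<xi>] by auto
      then show ?thesis by (simp only: ennreal_plus mult_nonneg_nonneg ennreal_mult)
    qed
    finally show "ennreal (norm (?F \<xi>)) \<le> ennreal (\<kappa> / 2) * ennreal (w \<xi> * (norm (?F \<xi>))\<^sup>2) + ennreal (1 / (2 * \<kappa>)) * ennreal (1 / w \<xi>)" .
  qed
  also have "\<dots> = ennreal (\<kappa> / 2) * (\<integral>\<^sup>+\<xi>. ennreal (w \<xi> * (norm (?F \<xi>))\<^sup>2) \<partial>lborel) + ennreal (1 / (2 * \<kappa>)) * (\<integral>\<^sup>+\<xi>. ennreal (1 / w \<xi>) \<partial>lborel)"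
    by (simp add: nn_integral_add nn_integral_cmult)
  also have "\<dots> \<le> ennreal (\<kappa> / 2) * ennreal ((2 * pi)\<^sup>2 * (X * Y * A\<^sup>2)) + ennreal (1 / (2 * \<kappa>)) * ennreal (B\<^sup>2 / (X * Y))"
    by (intro add_mono mult_left_mono A B) auto
  also have "\<dots> = ennreal (\<kappa> / 2 * ((2 * pi)\<^sup>2 * (X * Y * A\<^sup>2)) + 1 / (2 * \<kappa>) * (B\<^sup>2 / (X * Y)))"
  proof -
    have "0 \<le> \<kappa> / 2" "0 \<le> 1 / (2 * \<kappa>)" "0 \<le> (2 * pi)\<^sup>2 * (X * Y * A\<^sup>2)" "0 \<le> B\<^sup>2 / (X * Y)" using \<kappa> X by auto
    then show ?thesis by (simp only: ennreal_plus mult_nonneg_nonneg ennreal_mult)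
  qed
  also have "\<kappa> / 2 * ((2 * pi)\<^sup>2 * (X * Y * A\<^sup>2)) + 1 / (2 * \<kappa>) * (B\<^sup>2 / (X * Y)) = 2 * pi * (A * B)"
    unfolding \<kappa>_def using A B X by (simp add: power2_eq_square field_simps)
  finally have L1: "(\<integral>\<^sup>+\<xi>. ennreal (norm (?F \<xi>)) \<partial>lborel) \<le> ennreal (2 * pi * (A * B))" .
  then have intF: "integrable lborel ?F"
    unfolding integrable_iff_bounded by (auto intro: le_less_trans)
  have bd: "norm (\<phi> z) \<le> p" for z using rl unfolding rect_lipschitz_def by (cases z) blast
  note inv = fourier_inversion[OF int rect_lipschitz_continuous[OF rl] bd intF]
  show ?thesis
  \<comment> \<open>After normalisation by the constant of the inversion formula a factor
    \<open>1 / (2 * pi)\<close> is left over, which is dropped.\<close>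
  proof (rule fourier_boundedI[of "\<lambda>\<xi>. complex_of_real (1 / (2 * pi)\<^sup>2) * ?F \<xi>"])
    show "integrable lborel (\<lambda>\<xi>. complex_of_real (1 / (2 * pi)\<^sup>2) * ?F \<xi>)" using intF by auto
    fix y
    have "(LINT \<xi>|lborel. complex_of_real (1 / (2 * pi)\<^sup>2) * ?F \<xi> * exp (\<i> * complex_of_real (\<xi> \<bullet> y))) =
       complex_of_real (1 / (2 * pi)\<^sup>2) * (complex_of_real ((2 * pi)\<^sup>2) * \<phi> y)"
      unfolding inv[symmetric] mult.assoc by (rule integral_mult_right_zero)
    also have "\<dots> = complex_of_real (1 / (2 * pi)\<^sup>2 * (2 * pi)\<^sup>2) * \<phi> y" by (simp only: of_real_mult mult.assoc)
    also have "1 / (2 * pi)\<^sup>2 * (2 * pi)\<^sup>2 = 1" by simp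
    finally show "\<phi> y = (LINT \<xi>|lborel. complex_of_real (1 / (2 * pi)\<^sup>2) * ?F \<xi> * exp (\<i> * complex_of_real (\<xi> \<bullet> y)))"
      by simp
  next
    have "(\<integral>\<^sup>+\<xi>. ennreal (norm (complex_of_real (1 / (2 * pi)\<^sup>2) * ?F \<xi>)) \<partial>lborel) =
       (\<integral>\<^sup>+\<xi>. ennreal (1 / (2 * pi)\<^sup>2) * ennreal (norm (?F \<xi>)) \<partial>lborel)"
      by (simp only: norm_mult norm_of_real ennreal_mult' abs_ge_zero) simp
    also have "\<dots> = ennreal (1 / (2 * pi)\<^sup>2) * (\<integral>\<^sup>+\<xi>. ennreal (norm (?F \<xi>)) \<partial>lborel)"
      by (rule nn_integral_cmult) auto
    also have "\<dots> \<le> ennreal (1 / (2 * pi)\<^sup>2) * ennreal (2 * pi * (A * B))" by (intro mult_left_mono L1) auto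
    also have "\<dots> = ennreal (1 / (2 * pi)\<^sup>2 * (2 * pi * (A * B)))" by (rule ennreal_mult'[symmetric]) auto
    also have "\<dots> \<le> ennreal (A * B)"
    proof (rule ennreal_leI)
      have "1 / (2 * pi)\<^sup>2 * (2 * pi * (A * B)) = A * B / (2 * pi)" by (simp add: power2_eq_square field_simps)
      also have "\<dots> \<le> A * B / 1" using A B pi_ge_two by (intro divide_left_mono) auto
      finally show "1 / (2 * pi)\<^sup>2 * (2 * pi * (A * B)) \<le> A * B" by simp
    qed
    finally show "(\<integral>\<^sup>+\<xi>. ennreal (norm (complex_of_real (1 / (2 * pi)\<^sup>2) * ?F \<xi>)) \<partial>lborel) \<le> ennreal (A * B)" .
  qed
qed

section \<open>Explicit weights and the integrals of their reciprocals\<close>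

lemma nn_integral_inverse_1_plus_square: "(\<integral>\<^sup>+x. ennreal (1 / (1 + x\<^sup>2)) \<partial>lborel) = ennreal pi"
proof -
  have "einterval (-\<infinity>) \<infinity> = (UNIV :: real set)" by (auto simp: einterval_def)
  then have "integrable lborel (\<lambda>x::real. inverse (1 + x\<^sup>2))" "(LINT x|lborel. inverse (1 + x\<^sup>2)) = pi"
    using integrable_inverse_1_plus_square LBINT_inverse_1_plus_square
    by (simp_all add: set_integrable_def interval_lebesgue_integral_def set_lebesgue_integral_def)
  then show ?thesis by (subst nn_integral_eq_integral) (auto simp: inverse_eq_divide)
qed

lemma nn_integral_inverse_quadratic:
  assumes "c > 0" "d > 0"
  shows "(\<integral>\<^sup>+x. ennreal (1 / (c + d * x\<^sup>2)) \<partial>lborel) = ennreal (pi / sqrt (c * d))"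
proof -
  define k where "k = sqrt (c / d)"
  have k: "k > 0" "d * k\<^sup>2 = c" using assms by (auto simp: k_def)
  have "(\<integral>\<^sup>+x. ennreal (1 / (c + d * x\<^sup>2)) \<partial>lborel) = ennreal k * (\<integral>\<^sup>+x. ennreal (1 / (c + d * (k * x)\<^sup>2)) \<partial>lborel)"
    using k by (subst nn_integral_real_affine[of _ k 0]) auto
  also have "(\<integral>\<^sup>+x. ennreal (1 / (c + d * (k * x)\<^sup>2)) \<partial>lborel) = (\<integral>\<^sup>+x. ennreal (1 / c) * ennreal (1 / (1 + x\<^sup>2)) \<partial>lborel)"
  proof (intro nn_integral_cong)
    fix x :: real
    have "c + d * (k * x)\<^sup>2 = c * (1 + x\<^sup>2)" using k(2) by (simp add: power_mult_distrib algebra_simps)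
    then show "ennreal (1 / (c + d * (k * x)\<^sup>2)) = ennreal (1 / c) * ennreal (1 / (1 + x\<^sup>2))"
      using assms by (simp add: ennreal_mult'[symmetric])
  qed
  also have "\<dots> = ennreal (1 / c) * ennreal pi"
    by (subst nn_integral_cmult) (auto simp: nn_integral_inverse_1_plus_square)
  also have "ennreal k * (ennreal (1 / c) * ennreal pi) = ennreal (k * (1 / c * pi))"
    using assms k by (simp add: ennreal_mult'[symmetric] mult_ac)
  also have "k * (1 / c * pi) = pi / sqrt (c * d)"
  proof -
    have "sqrt (c * d) * k = c" using assms by (simp add: k_def real_sqrt_mult real_sqrt_divide)
    moreover have "sqrt (c * d) > 0" using assms by simp
    ultimately show ?thesis using assms by (simp add: field_simps)
  qed
  finally show ?thesis .
qed

text \<open>A weight that factors over the variables has a reciprocal with an explicit integral. The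
  free parameters \<open>a\<close> and \<open>b\<close> are the frequencies, in units of
  \<open>1 / X\<close> and \<open>1 / Y\<close>, beyond which the weight grows.\<close>

lemma fourier_bounded_product_weight:
  assumes rl: "rect_lipschitz \<phi> X Y p q r s" and "a > 0" "b > 0"
    and N: "N > 0" "p + q / a + r / b + s / (a * b) \<le> N"
  shows "fourier_bounded \<phi> (ennreal (pi * sqrt (a * b) * N))"
proof -
  have X: "X > 0" "Y > 0" using rl unfolding rect_lipschitz_def by auto
  note nn = rect_lipschitz_nonneg[OF rl]
  define \<alpha> \<beta> where "\<alpha> = X / a" and "\<beta> = Y / b"
  have \<alpha>: "\<alpha> > 0" "\<beta> > 0" using X assms by (auto simp: \<alpha>_def \<beta>_def)
  define w where "w \<xi> = 1 + \<alpha>\<^sup>2 * (fst \<xi>)\<^sup>2 + \<beta>\<^sup>2 * (snd \<xi>)\<^sup>2 + \<alpha>\<^sup>2 * \<beta>\<^sup>2 * (fst \<xi>)\<^sup>2 * (snd \<xi>)\<^sup>2" for \<xi> :: "real \<times> real"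
  have [measurable]: "w \<in> borel_measurable borel" unfolding w_def by measurable
  have wp: "w \<xi> = (1 + \<alpha>\<^sup>2 * (fst \<xi>)\<^sup>2) * (1 + \<beta>\<^sup>2 * (snd \<xi>)\<^sup>2)" for \<xi>
    by (simp add: w_def algebra_simps)
  have pos: "1 + \<alpha>\<^sup>2 * x\<^sup>2 > 0" "1 + \<beta>\<^sup>2 * x\<^sup>2 > 0" for x
    by (simp_all add: add_pos_nonneg)
  have "fourier_bounded \<phi> (ennreal (N * (pi * sqrt (a * b))))"
  proof (rule fourier_bounded_weight[OF rl, of w])
    show "w \<xi> > 0" for \<xi> unfolding wp using pos by (intro mult_pos_pos) auto
    have "(\<integral>\<^sup>+\<xi>. ennreal (w \<xi> * (norm (fourier_transform \<phi> \<xi>))\<^sup>2) \<partial>lborel) \<le>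
      ennreal ((2 * pi)\<^sup>2 * (X * Y * (p\<^sup>2 + \<alpha>\<^sup>2 * (q / X)\<^sup>2 + \<beta>\<^sup>2 * (r / Y)\<^sup>2 + (\<alpha>\<^sup>2 * \<beta>\<^sup>2) * (s / (X * Y))\<^sup>2)))"
      unfolding w_def by (rule rect_lipschitz_quadratic_weight[OF rl]) auto
    also have "p\<^sup>2 + \<alpha>\<^sup>2 * (q / X)\<^sup>2 + \<beta>\<^sup>2 * (r / Y)\<^sup>2 + (\<alpha>\<^sup>2 * \<beta>\<^sup>2) * (s / (X * Y))\<^sup>2 =
       p\<^sup>2 + (q / a)\<^sup>2 + (r / b)\<^sup>2 + (s / (a * b))\<^sup>2"
      using X by (simp add: \<alpha>_def \<beta>_def power_divide power_mult_distrib)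
    also have "ennreal ((2 * pi)\<^sup>2 * (X * Y * (p\<^sup>2 + (q / a)\<^sup>2 + (r / b)\<^sup>2 + (s / (a * b))\<^sup>2))) \<le> ennreal ((2 * pi)\<^sup>2 * (X * Y * N\<^sup>2))"
    proof (intro ennreal_leI mult_left_mono)
      define P where "P = p + q / a + r / b + s / (a * b)"
      have nn': "0 \<le> p" "0 \<le> q / a" "0 \<le> r / b" "0 \<le> s / (a * b)" using nn assms by auto
      have "p\<^sup>2 + (q / a)\<^sup>2 + (r / b)\<^sup>2 + (s / (a * b))\<^sup>2 = p * p + q / a * (q / a) + r / b * (r / b) + s / (a * b) * (s / (a * b))"
        by (simp only: power2_eq_square)
      also have "\<dots> \<le> p * P + q / a * P + r / b * P + s / (a * b) * P"
        by (intro add_mono mult_left_mono nn') (use nn' in \<open>auto simp: P_def\<close>)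
      also have "\<dots> = P\<^sup>2" unfolding P_def power2_eq_square by (simp only: distrib_right)
      also have "\<dots> \<le> N\<^sup>2" using N(2) nn' by (intro power_mono) (auto simp: P_def)
      finally show "p\<^sup>2 + (q / a)\<^sup>2 + (r / b)\<^sup>2 + (s / (a * b))\<^sup>2 \<le> N\<^sup>2" .
    qed (use X in auto)
    finally show "(\<integral>\<^sup>+\<xi>. ennreal (w \<xi> * (norm (fourier_transform \<phi> \<xi>))\<^sup>2) \<partial>lborel) \<le> ennreal ((2 * pi)\<^sup>2 * (X * Y * N\<^sup>2))" .
    have "(\<integral>\<^sup>+\<xi>. ennreal (1 / w \<xi>) \<partial>lborel) = (\<integral>\<^sup>+x. \<integral>\<^sup>+y. ennreal (1 / (1 + \<alpha>\<^sup>2 * x\<^sup>2)) * ennreal (1 / (1 + \<beta>\<^sup>2 * y\<^sup>2)) \<partial>lborel \<partial>lborel)"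
    proof (subst nn_integral_lborel_pair, measurable, intro nn_integral_cong)
      fix x y :: real
      have "1 / w (x, y) = 1 / (1 + \<alpha>\<^sup>2 * x\<^sup>2) * (1 / (1 + \<beta>\<^sup>2 * y\<^sup>2))" unfolding wp by simp
      then show "ennreal (1 / w (x, y)) = ennreal (1 / (1 + \<alpha>\<^sup>2 * x\<^sup>2)) * ennreal (1 / (1 + \<beta>\<^sup>2 * y\<^sup>2))"
        using pos(1)[of x] by (simp only: ennreal_mult' zero_le_divide_1_iff less_imp_le)
    qed
    also have "\<dots> = (\<integral>\<^sup>+x. ennreal (1 / (1 + \<alpha>\<^sup>2 * x\<^sup>2)) \<partial>lborel) * (\<integral>\<^sup>+y. ennreal (1 / (1 + \<beta>\<^sup>2 * y\<^sup>2)) \<partial>lborel)"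
      by (simp add: nn_integral_cmult nn_integral_multc)
    also have "\<dots> = ennreal (pi / sqrt (1 * \<alpha>\<^sup>2)) * ennreal (pi / sqrt (1 * \<beta>\<^sup>2))"
      using \<alpha> by (simp only: nn_integral_inverse_quadratic zero_less_one zero_less_power)
    also have "\<dots> = ennreal ((pi * sqrt (a * b))\<^sup>2 / (X * Y))"
      using \<alpha> X assms by (simp add: ennreal_mult'[symmetric] power_mult_distrib) (simp add: \<alpha>_def \<beta>_def power2_eq_square field_simps)
    finally show "(\<integral>\<^sup>+\<xi>. ennreal (1 / w \<xi>) \<partial>lborel) \<le> ennreal ((pi * sqrt (a * b))\<^sup>2 / (X * Y))" by simp
  qed (use N assms in auto)
  then show ?thesis by (simp add: mult_ac)
qed

text \<open>The support is bounded, so a difference taken against points left of it or below it is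
  the value of \<open>\<phi>\<close> itself. This disposes of the degenerate cases in which ratios
  such as \<open>s / p\<close> make no sense.\<close>

lemma rect_lipschitz_eq_0:
  assumes rl: "rect_lipschitz \<phi> X Y p q r s" and "p = 0 \<or> q = 0 \<or> r = 0 \<or> s = 0"
  shows "\<phi> = (\<lambda>_. 0)"
proof
  fix z :: "real \<times> real"
  obtain x y where z: "z = (x, y)" by (cases z)
  obtain a b where "\<forall>x y. \<phi> (x, y) \<noteq> 0 \<longrightarrow> x \<in> {a..a + X} \<and> y \<in> {b..b + Y}"
    using rl unfolding rect_lipschitz_def by blast
  then have ab: "\<phi> (x', y) = 0" "\<phi> (x, y') = 0" if "x' < a" "y' < b" for x y x' y'
    using that by (metis atLeastAtMost_iff not_le)+
  have "norm (\<phi> (x, y)) \<le> p" "norm (\<phi> (x, y) - \<phi> (a - 1, y)) \<le> q / X * \<bar>x - (a - 1)\<bar>"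
    "norm (\<phi> (x, y) - \<phi> (x, b - 1)) \<le> r / Y * \<bar>y - (b - 1)\<bar>"
    "norm (\<phi> (x, y) - \<phi> (a - 1, y) - (\<phi> (x, b - 1) - \<phi> (a - 1, b - 1))) \<le> s / (X * Y) * \<bar>x - (a - 1)\<bar> * \<bar>y - (b - 1)\<bar>"
    using rl unfolding rect_lipschitz_def by blast+
  then show "\<phi> z = 0" using assms(2) ab[of "a - 1" "b - 1"] unfolding z by auto
qed

text \<open>Only one variable carries the loss from \<open>p\<close> to \<open>s\<close>. Frequency
  \<open>s / p\<close> in that variable and \<open>1\<close> in the other make all four terms of the
  weight estimate equal to \<open>p\<close>, whence \<open>4 * p\<close>.\<close>

lemma fourier_bounded_geometric_mean:
  assumes rl: "rect_lipschitz \<phi> X Y p p s s \<or> rect_lipschitz \<phi> X Y p s p s"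
  shows "fourier_bounded \<phi> (ennreal (4 * pi * sqrt (p * s)))"
proof (cases "p = 0 \<or> s = 0")
  case True
  then have "\<phi> = (\<lambda>_. 0)" using rl rect_lipschitz_eq_0 by metis
  then show ?thesis by (simp add: fourier_bounded_0)
next
  case False
  then have ps: "p > 0" "s > 0" using rl rect_lipschitz_nonneg by (metis less_le)+
  have eq: "pi * sqrt (s / p) * (4 * p) = 4 * pi * sqrt (p * s)"
    using ps by (simp add: real_sqrt_divide real_sqrt_mult field_simps)
  from rl show ?thesis
  proof
    assume "rect_lipschitz \<phi> X Y p p s s"
    from fourier_bounded_product_weight[OF this, of 1 "s / p" "4 * p"] show ?thesis using ps eq by simp
  next
    assume "rect_lipschitz \<phi> X Y p s p s"
    from fourier_bounded_product_weight[OF this, of "s / p" 1 "4 * p"] show ?thesis using ps eq by simp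
  qed
qed

lemma nn_integral_inverse_Icc:
  assumes "T \<ge> 1"
  shows "(\<integral>\<^sup>+x. ennreal (1 / x) * indicator {1..T} x \<partial>lborel) = ennreal (ln T)"
proof -
  have "(\<integral>\<^sup>+x. ennreal (1 / x) * indicator {1..T} x \<partial>lborel) = ennreal (ln T - ln 1)"
    by (rule nn_integral_FTC_Icc) (use assms in \<open>auto intro!: derivative_eq_intros\<close>)
  then show ?thesis by simp
qed

text \<open>The integrand is at most \<open>1 / T\<close> for \<open>\<bar>x\<bar> \<le> 1\<close>,
  at most \<open>1 / (T * \<bar>x\<bar>)\<close> from there to \<open>T\<close>, and at most
  \<open>2 / (T\<^sup>2 + x\<^sup>2)\<close> beyond. The middle range produces the
  logarithm.\<close>

lemma nn_integral_log_kernel: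
  assumes "T \<ge> 1"
  shows "(\<integral>\<^sup>+x. ennreal (1 / sqrt ((T\<^sup>2 + x\<^sup>2) * (1 + x\<^sup>2))) \<partial>lborel) \<le> ennreal ((2 + 2 * ln T + 2 * pi) / T)"
proof -
  have T: "T > 0" "ln T \<ge> 0" using assms by auto
  let ?g = "\<lambda>x. ennreal (1 / x) * indicator {1..T} x"
  have pt: "ennreal (1 / sqrt ((T\<^sup>2 + x\<^sup>2) * (1 + x\<^sup>2))) \<le>
     ennreal (1 / T) * (indicator {-1..1} x + ?g x + ?g (- x)) + ennreal 2 * ennreal (1 / (T\<^sup>2 + 1 * x\<^sup>2))" for x
  proof -
    have pos: "T\<^sup>2 + x\<^sup>2 > 0" "1 + x\<^sup>2 > 0" using T by (auto intro: add_pos_nonneg)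
    consider "\<bar>x\<bar> \<le> 1" | "1 \<le> \<bar>x\<bar>" "\<bar>x\<bar> \<le> T" | "T \<le> \<bar>x\<bar>" by linarith
    then show ?thesis
    proof cases
      case 1
      have "T = sqrt (T\<^sup>2 * 1)" using T by simp
      also have "\<dots> \<le> sqrt ((T\<^sup>2 + x\<^sup>2) * (1 + x\<^sup>2))"
        by (intro real_sqrt_le_mono mult_mono) auto
      finally have "1 / sqrt ((T\<^sup>2 + x\<^sup>2) * (1 + x\<^sup>2)) \<le> 1 / T"
        using T pos by (intro divide_left_mono) auto
      then have "ennreal (1 / sqrt ((T\<^sup>2 + x\<^sup>2) * (1 + x\<^sup>2))) \<le> ennreal (1 / T) * 1"
        by (simp add: ennreal_leI)
      also have "\<dots> \<le> ennreal (1 / T) * (indicator {-1..1} x + ?g x + ?g (- x))"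
        using 1 by (intro mult_left_mono) (auto simp: indicator_def add.assoc)
      finally show ?thesis by (rule order_trans) simp
    next
      case 2
      have "T * \<bar>x\<bar> = sqrt (T\<^sup>2 * x\<^sup>2)" using T by (simp add: real_sqrt_mult)
      also have "\<dots> \<le> sqrt ((T\<^sup>2 + x\<^sup>2) * (1 + x\<^sup>2))"
        by (intro real_sqrt_le_mono mult_mono) auto
      finally have "1 / sqrt ((T\<^sup>2 + x\<^sup>2) * (1 + x\<^sup>2)) \<le> 1 / (T * \<bar>x\<bar>)"
        using T pos 2 by (intro divide_left_mono) auto
      then have "ennreal (1 / sqrt ((T\<^sup>2 + x\<^sup>2) * (1 + x\<^sup>2))) \<le> ennreal (1 / T) * ennreal (1 / \<bar>x\<bar>)"
        using T by (subst ennreal_mult'[symmetric]) (auto intro: ennreal_leI)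
      also have "\<dots> \<le> ennreal (1 / T) * (indicator {-1..1} x + ?g x + ?g (- x))"
        using 2 by (intro mult_left_mono, cases "x < 0") (auto simp: indicator_def abs_if)
      finally show ?thesis by (rule order_trans) simp
    next
      case 3
      have "T\<^sup>2 \<le> x\<^sup>2" using 3 T by (simp add: abs_le_square_iff[symmetric])
      then have "((T\<^sup>2 + x\<^sup>2) / 2)\<^sup>2 \<le> (T\<^sup>2 + x\<^sup>2) * (1 + x\<^sup>2)"
        unfolding power2_eq_square[of "(T\<^sup>2 + x\<^sup>2) / 2"] using pos by (intro mult_mono) auto
      then have "sqrt (((T\<^sup>2 + x\<^sup>2) / 2)\<^sup>2) \<le> sqrt ((T\<^sup>2 + x\<^sup>2) * (1 + x\<^sup>2))" by (rule real_sqrt_le_mono)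
      then have "(T\<^sup>2 + x\<^sup>2) / 2 \<le> sqrt ((T\<^sup>2 + x\<^sup>2) * (1 + x\<^sup>2))" using pos by simp
      then have "1 / sqrt ((T\<^sup>2 + x\<^sup>2) * (1 + x\<^sup>2)) \<le> 1 / ((T\<^sup>2 + x\<^sup>2) / 2)"
        using pos by (intro divide_left_mono) auto
      then have "ennreal (1 / sqrt ((T\<^sup>2 + x\<^sup>2) * (1 + x\<^sup>2))) \<le> ennreal 2 * ennreal (1 / (T\<^sup>2 + 1 * x\<^sup>2))"
        by (subst ennreal_mult'[symmetric]) (auto intro: ennreal_leI)
      then show ?thesis by (rule order_trans) simp
    qed
  qed
  have "(\<integral>\<^sup>+x. ?g (- x) \<partial>lborel) = (\<integral>\<^sup>+x. ?g x \<partial>lborel)"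
    by (subst (2) nn_integral_real_affine[of _ "-1" 0]) auto
  then have g: "(\<integral>\<^sup>+x. ?g x \<partial>lborel) = ennreal (ln T)" "(\<integral>\<^sup>+x. ?g (- x) \<partial>lborel) = ennreal (ln T)"
    using nn_integral_inverse_Icc[OF assms] by simp_all
  have "(\<integral>\<^sup>+x. ennreal (1 / sqrt ((T\<^sup>2 + x\<^sup>2) * (1 + x\<^sup>2))) \<partial>lborel) \<le>
     (\<integral>\<^sup>+x. ennreal (1 / T) * (indicator {-1..1} x + ?g x + ?g (- x)) + ennreal 2 * ennreal (1 / (T\<^sup>2 + 1 * x\<^sup>2)) \<partial>lborel)"
    by (intro nn_integral_mono pt)
  also have "\<dots> = ennreal (1 / T) * (emeasure lborel {-1..1::real} + (\<integral>\<^sup>+x. ?g x \<partial>lborel) + (\<integral>\<^sup>+x. ?g (- x) \<partial>lborel)) +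
     ennreal 2 * (\<integral>\<^sup>+x. ennreal (1 / (T\<^sup>2 + 1 * x\<^sup>2)) \<partial>lborel)"
    by (subst nn_integral_add, simp, simp, subst nn_integral_cmult, simp, subst nn_integral_cmult, simp,
        subst nn_integral_add, simp, simp, subst nn_integral_add, simp, simp) simp
  also have "\<dots> = ennreal (1 / T) * (ennreal 2 + ennreal (ln T) + ennreal (ln T)) + ennreal 2 * ennreal (pi / sqrt (T\<^sup>2 * 1))"
    unfolding g using T by (subst nn_integral_inverse_quadratic) auto
  also have "\<dots> = ennreal (1 / T * (2 + ln T + ln T) + 2 * (pi / sqrt (T\<^sup>2 * 1)))"
    using T by (simp add: ennreal_mult'[symmetric] ennreal_plus[symmetric] del: ennreal_plus ennreal_numeral)
  also have "1 / T * (2 + ln T + ln T) + 2 * (pi / sqrt (T\<^sup>2 * 1)) = (2 + 2 * ln T + 2 * pi) / T"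
    using T by (simp add: field_simps)
  finally show ?thesis .
qed

text \<open>A product weight with both frequencies equal to \<open>T\<close> would make the
  reciprocal integral of order \<open>T\<^sup>2\<close>. Here the mixed term is strengthened until
  all three differences are divided by the same \<open>T\<close>, which lowers this to
  \<open>T * (1 + ln T)\<close>.\<close>

lemma fourier_bounded_log_weight:
  assumes rl: "rect_lipschitz \<phi> X Y p s s s" and T: "T \<ge> 1" and N: "N > 0" "p + s / T \<le> N"
  shows "fourier_bounded \<phi> (ennreal (12 * N * sqrt (T * (1 + ln T))))"
proof -
  have X: "X > 0" "Y > 0" using rl unfolding rect_lipschitz_def by auto
  have T0: "T > 0" "ln T \<ge> 0" using T by auto
  note nn = rect_lipschitz_nonneg[OF rl]
  define w where "w \<xi> = 1 + (X / T)\<^sup>2 * (fst \<xi>)\<^sup>2 + (Y / T)\<^sup>2 * (snd \<xi>)\<^sup>2 + (X * Y / T)\<^sup>2 * (fst \<xi>)\<^sup>2 * (snd \<xi>)\<^sup>2" for \<xi> :: "real \<times> real"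
  have [measurable]: "w \<in> borel_measurable borel" unfolding w_def by measurable
  have "fourier_bounded \<phi> (ennreal (2 * N * (6 * sqrt (T * (1 + ln T)))))"
  proof (rule fourier_bounded_weight[OF rl, of w])
    show "w \<xi> > 0" for \<xi> unfolding w_def by (intro add_pos_nonneg) auto
    show "2 * N > 0" using N by simp
    have "T * (1 + ln T) > 0" using T0 by (intro mult_pos_pos add_pos_nonneg) auto
    then show "6 * sqrt (T * (1 + ln T)) > 0" by simp
    have "(\<integral>\<^sup>+\<xi>. ennreal (w \<xi> * (norm (fourier_transform \<phi> \<xi>))\<^sup>2) \<partial>lborel) \<le>
      ennreal ((2 * pi)\<^sup>2 * (X * Y * (p\<^sup>2 + (X / T)\<^sup>2 * (s / X)\<^sup>2 + (Y / T)\<^sup>2 * (s / Y)\<^sup>2 + (X * Y / T)\<^sup>2 * (s / (X * Y))\<^sup>2)))"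
      unfolding w_def by (rule rect_lipschitz_quadratic_weight[OF rl]) auto
    also have "p\<^sup>2 + (X / T)\<^sup>2 * (s / X)\<^sup>2 + (Y / T)\<^sup>2 * (s / Y)\<^sup>2 + (X * Y / T)\<^sup>2 * (s / (X * Y))\<^sup>2 =
       p\<^sup>2 + 3 * (s / T)\<^sup>2"
      using X by (simp add: power_divide power_mult_distrib)
    also have "ennreal ((2 * pi)\<^sup>2 * (X * Y * (p\<^sup>2 + 3 * (s / T)\<^sup>2))) \<le> ennreal ((2 * pi)\<^sup>2 * (X * Y * (2 * N)\<^sup>2))"
    proof (intro ennreal_leI mult_left_mono)
      have st: "s / T \<ge> 0" using nn T0 by simp
      then have "p\<^sup>2 \<le> N\<^sup>2" "(s / T)\<^sup>2 \<le> N\<^sup>2" using N nn by (intro power_mono; linarith)+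
      then show "p\<^sup>2 + 3 * (s / T)\<^sup>2 \<le> (2 * N)\<^sup>2" by (simp add: power_mult_distrib)
    qed (use X in auto)
    finally show "(\<integral>\<^sup>+\<xi>. ennreal (w \<xi> * (norm (fourier_transform \<phi> \<xi>))\<^sup>2) \<partial>lborel) \<le> ennreal ((2 * pi)\<^sup>2 * (X * Y * (2 * N)\<^sup>2))" .
    \<comment> \<open>As a quadratic in the second frequency the weight can be integrated exactly;
      rescaling the first frequency by \<open>X\<close> then leaves the logarithmic kernel.\<close>
    have "(\<integral>\<^sup>+\<xi>. ennreal (1 / w \<xi>) \<partial>lborel) = (\<integral>\<^sup>+x. \<integral>\<^sup>+y. ennreal (1 / ((1 + (X / T)\<^sup>2 * x\<^sup>2) + ((Y / T)\<^sup>2 * (1 + X\<^sup>2 * x\<^sup>2)) * y\<^sup>2)) \<partial>lborel \<partial>lborel)"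
      by (subst nn_integral_lborel_pair, measurable)
        (auto intro!: nn_integral_cong arg_cong[where f=ennreal] arg_cong[where f=inverse]
          simp: w_def algebra_simps power_mult_distrib power_divide inverse_eq_divide[symmetric])
    also have "\<dots> = (\<integral>\<^sup>+x. ennreal (pi / sqrt ((1 + (X / T)\<^sup>2 * x\<^sup>2) * ((Y / T)\<^sup>2 * (1 + X\<^sup>2 * x\<^sup>2)))) \<partial>lborel)"
      using X T0 by (intro nn_integral_cong nn_integral_inverse_quadratic) (auto intro!: add_pos_nonneg mult_pos_pos)
    also have "\<dots> = ennreal (1 / X) * (\<integral>\<^sup>+x. ennreal (pi / sqrt ((1 + (X / T)\<^sup>2 * (x / X)\<^sup>2) * ((Y / T)\<^sup>2 * (1 + X\<^sup>2 * (x / X)\<^sup>2)))) \<partial>lborel)"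
      using X by (subst nn_integral_real_affine[of _ "1 / X" 0]) auto
    also have "(\<integral>\<^sup>+x. ennreal (pi / sqrt ((1 + (X / T)\<^sup>2 * (x / X)\<^sup>2) * ((Y / T)\<^sup>2 * (1 + X\<^sup>2 * (x / X)\<^sup>2)))) \<partial>lborel) =
       (\<integral>\<^sup>+x. ennreal (pi * T\<^sup>2 / Y) * ennreal (1 / sqrt ((T\<^sup>2 + x\<^sup>2) * (1 + x\<^sup>2))) \<partial>lborel)"
    proof (rule nn_integral_cong)
      fix x :: real
      have "(1 + (X / T)\<^sup>2 * (x / X)\<^sup>2) * ((Y / T)\<^sup>2 * (1 + X\<^sup>2 * (x / X)\<^sup>2)) = (Y / T\<^sup>2)\<^sup>2 * ((T\<^sup>2 + x\<^sup>2) * (1 + x\<^sup>2))"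
        using X T0 by (simp add: power_divide power_mult_distrib field_simps power2_eq_square)
      then have "sqrt ((1 + (X / T)\<^sup>2 * (x / X)\<^sup>2) * ((Y / T)\<^sup>2 * (1 + X\<^sup>2 * (x / X)\<^sup>2))) = Y / T\<^sup>2 * sqrt ((T\<^sup>2 + x\<^sup>2) * (1 + x\<^sup>2))"
        using X by (simp only: real_sqrt_mult real_sqrt_abs) (simp add: abs_of_pos)
      then show "ennreal (pi / sqrt ((1 + (X / T)\<^sup>2 * (x / X)\<^sup>2) * ((Y / T)\<^sup>2 * (1 + X\<^sup>2 * (x / X)\<^sup>2)))) =
        ennreal (pi * T\<^sup>2 / Y) * ennreal (1 / sqrt ((T\<^sup>2 + x\<^sup>2) * (1 + x\<^sup>2)))"
        using X T0 by (subst ennreal_mult'[symmetric]) auto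
    qed
    also have "\<dots> = ennreal (pi * T\<^sup>2 / Y) * (\<integral>\<^sup>+x. ennreal (1 / sqrt ((T\<^sup>2 + x\<^sup>2) * (1 + x\<^sup>2))) \<partial>lborel)"
      by (rule nn_integral_cmult) auto
    also have "ennreal (1 / X) * \<dots> \<le> ennreal (1 / X) * (ennreal (pi * T\<^sup>2 / Y) * ennreal ((2 + 2 * ln T + 2 * pi) / T))"
      by (intro mult_left_mono nn_integral_log_kernel T) auto
    also have "\<dots> = ennreal (1 / X * (pi * T\<^sup>2 / Y * ((2 + 2 * ln T + 2 * pi) / T)))"
      using X by (simp only: ennreal_mult' zero_le_divide_1_iff less_imp_le pi_ge_zero zero_le_power2 mult_nonneg_nonneg divide_nonneg_nonneg)
    also have "\<dots> \<le> ennreal ((6 * sqrt (T * (1 + ln T)))\<^sup>2 / (X * Y))"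
    proof (rule ennreal_leI)
      have "pi * (2 + 2 * ln T + 2 * pi) \<le> 4 * (9 * (1 + ln T))"
      proof (rule mult_mono)
        have "pi \<le> 7 / 2" using pi_less_4 pi_approx by simp
        moreover have "2 + 2 * L + 2 * q \<le> 9 * (1 + L)" if "q \<le> 7 / 2" "0 \<le> L" for q L :: real
          using that unfolding distrib_left by simp
        ultimately show "2 + 2 * ln T + 2 * pi \<le> 9 * (1 + ln T)" using T0(2) by blast
      qed (use pi_less_4 T0 in auto)
      then have "T * (pi * (2 + 2 * ln T + 2 * pi)) \<le> T * (36 * (1 + ln T))" using T0 by (intro mult_left_mono) auto
      also have "\<dots> = (6 * sqrt (T * (1 + ln T)))\<^sup>2" using T0 by (simp add: power_mult_distrib)
      finally have "T * (pi * (2 + 2 * ln T + 2 * pi)) / (X * Y) \<le> (6 * sqrt (T * (1 + ln T)))\<^sup>2 / (X * Y)"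
        using X by (intro divide_right_mono) auto
      moreover have "1 / X * (pi * T\<^sup>2 / Y * ((2 + 2 * ln T + 2 * pi) / T)) = T * (pi * (2 + 2 * ln T + 2 * pi)) / (X * Y)"
        using T0 by (simp add: power2_eq_square)
      ultimately show "1 / X * (pi * T\<^sup>2 / Y * ((2 + 2 * ln T + 2 * pi) / T)) \<le> (6 * sqrt (T * (1 + ln T)))\<^sup>2 / (X * Y)" by simp
    qed
    finally show "(\<integral>\<^sup>+\<xi>. ennreal (1 / w \<xi>) \<partial>lborel) \<le> ennreal ((6 * sqrt (T * (1 + ln T)))\<^sup>2 / (X * Y))" .
  qed auto
  then show ?thesis by (simp add: mult_ac)
qed

section \<open>Dyadic decomposition\<close>

text \<open>The nodal function at \<open>1\<close> for piecewise linear interpolation with nodes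
  \<open>1/2\<close>, \<open>1\<close> and \<open>2\<close>.\<close>

definition hat :: "real \<Rightarrow> real" where "hat t = max 0 (min (2 * t - 1) (2 - t))"

text \<open>On the positive half line this is the sum of the hats at all nodes
  \<open>1, 1/2, 1/4, ...\<close>.\<close>

definition trapezoid :: "real \<Rightarrow> real" where "trapezoid t = max 0 (min 1 (2 - \<bar>t\<bar>))"

text \<open>Clamping to the block \<open>[X, 2X]\<close> makes this the interpolation error on the block and zero outside.\<close>

definition block_error :: "real \<Rightarrow> (real \<Rightarrow> complex) \<Rightarrow> real \<Rightarrow> complex" where
  "block_error X u x = (let c = max X (min (2 * X) x) in
     u c - (u X + complex_of_real ((c - X) / X) * (u (2 * X) - u X)))"

lemma hat_0: "t \<le> 1/2 \<Longrightarrow> hat t = 0" "t \<ge> 2 \<Longrightarrow> hat t = 0" by (auto simp: hat_def)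
lemma hat_up: "1/2 \<le> t \<Longrightarrow> t \<le> 1 \<Longrightarrow> hat t = 2 * t - 1" by (auto simp: hat_def)
lemma hat_down: "1 \<le> t \<Longrightarrow> t \<le> 2 \<Longrightarrow> hat t = 2 - t" by (auto simp: hat_def)

lemma block_error_outside: "X > 0 \<Longrightarrow> x \<le> X \<Longrightarrow> block_error X u x = 0" "X > 0 \<Longrightarrow> x \<ge> 2 * X \<Longrightarrow> block_error X u x = 0"
  by (auto simp: block_error_def Let_def max_def min_def)

lemma block_error_inside:
  "X \<le> x \<Longrightarrow> x \<le> 2 * X \<Longrightarrow> block_error X u x = u x - (u X + complex_of_real ((x - X) / X) * (u (2 * X) - u X))"
  by (simp add: block_error_def Let_def max_def min_def)

lemma block_error_diff: "block_error X (\<lambda>a. u a - v a) x = block_error X u x - block_error X v x"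
  by (simp add: block_error_def Let_def algebra_simps)

lemma block_error_sums:
  assumes "\<And>a. (\<lambda>k. u k a) sums U a" shows "(\<lambda>k. block_error X (u k) x) sums block_error X U x"
  unfolding block_error_def Let_def by (intro sums_diff sums_add sums_mult assms)

text \<open>The interpolant is a convex combination of the two end values.\<close>

lemma block_error_bound:
  assumes X: "X > 0" and M: "\<And>x. X \<le> x \<Longrightarrow> x \<le> 2 * X \<Longrightarrow> norm (u x) \<le> M"
  shows "norm (block_error X u x) \<le> 2 * M"
proof -
  define c where "c = max X (min (2 * X) x)"
  define \<theta> where "\<theta> = (c - X) / X"
  have c: "X \<le> c" "c \<le> 2 * X" using X by (auto simp: c_def)
  have \<theta>: "0 \<le> \<theta>" "\<theta> \<le> 1" using c X by (auto simp: \<theta>_def)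
  have "norm (complex_of_real (1 - \<theta>) * u X + complex_of_real \<theta> * u (2 * X)) \<le> (1 - \<theta>) * norm (u X) + \<theta> * norm (u (2 * X))"
    using norm_triangle_ineq[of "complex_of_real (1 - \<theta>) * u X" "complex_of_real \<theta> * u (2 * X)"] \<theta>
    by (simp add: norm_mult del: of_real_diff)
  also have "\<dots> \<le> (1 - \<theta>) * M + \<theta> * M" using X \<theta> by (intro add_mono mult_left_mono M) auto
  finally have "norm (complex_of_real (1 - \<theta>) * u X + complex_of_real \<theta> * u (2 * X)) \<le> M" by (simp add: algebra_simps)
  moreover have "block_error X u x = u c - (complex_of_real (1 - \<theta>) * u X + complex_of_real \<theta> * u (2 * X))"
    unfolding block_error_def Let_def c_def[symmetric] \<theta>_def[symmetric] by (simp add: algebra_simps)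
  ultimately show ?thesis using M[OF c] norm_triangle_ineq4[of "u c" "complex_of_real (1 - \<theta>) * u X + complex_of_real \<theta> * u (2 * X)"]
    by simp
qed

text \<open>The chord has slope at most \<open>K\<close> and clamping is a contraction. The error
  vanishes at the left end of the block, so the Lipschitz bound also controls its size.\<close>

lemma block_error_lipschitz:
  assumes X: "X > 0"
    and K: "\<And>x x'. X \<le> x \<Longrightarrow> x \<le> 2 * X \<Longrightarrow> X \<le> x' \<Longrightarrow> x' \<le> 2 * X \<Longrightarrow> norm (u x - u x') \<le> K * \<bar>x - x'\<bar>"
  shows "norm (block_error X u x - block_error X u x') \<le> 2 * K * \<bar>x - x'\<bar>"
    and "norm (block_error X u x) \<le> 2 * (K * X)"
proof -
  have K2: "norm (u (2 * X) - u X) \<le> K * X" using K[of "2 * X" X] X by simp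
  then have "0 \<le> K * X" using norm_ge_zero order_trans by blast
  then have K0: "K \<ge> 0" using X by (simp add: zero_le_mult_iff)
  show lip: "norm (block_error X u x - block_error X u x') \<le> 2 * K * \<bar>x - x'\<bar>" for x x'
  proof -
    define c c' where "c = max X (min (2 * X) x)" and "c' = max X (min (2 * X) x')"
    have c: "X \<le> c" "c \<le> 2 * X" "X \<le> c'" "c' \<le> 2 * X" "\<bar>c - c'\<bar> \<le> \<bar>x - x'\<bar>" using X by (auto simp: c_def c'_def)
    have "block_error X u x - block_error X u x' = (u c - u c') - complex_of_real ((c - c') / X) * (u (2 * X) - u X)"
      unfolding block_error_def Let_def c_def[symmetric] c'_def[symmetric] by (simp add: diff_divide_distrib algebra_simps)
    also have "norm \<dots> \<le> norm (u c - u c') + norm (complex_of_real ((c - c') / X) * (u (2 * X) - u X))"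
      by (rule norm_triangle_ineq4)
    also have "\<dots> \<le> K * \<bar>c - c'\<bar> + \<bar>c - c'\<bar> / X * (K * X)"
      unfolding norm_mult norm_of_real abs_divide abs_of_pos[OF X] using K2 X c by (intro add_mono K mult_mono) auto
    also have "\<dots> = 2 * K * \<bar>c - c'\<bar>" using X by simp
    also have "\<dots> \<le> 2 * K * \<bar>x - x'\<bar>" using c(5) K0 by (intro mult_left_mono) auto
    finally show ?thesis .
  qed
  show "norm (block_error X u x) \<le> 2 * (K * X)"
  proof (cases "X \<le> x \<and> x \<le> 2 * X")
    case True
    have "norm (block_error X u x) \<le> 2 * K * \<bar>x - X\<bar>" using lip[of x X] block_error_outside(1)[of X X u] X by simp
    also have "\<dots> \<le> 2 * K * X" using True K0 by (intro mult_left_mono) auto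
    finally show ?thesis by simp
  next
    case False
    then have "block_error X u x = 0" using block_error_outside[OF X] by force
    then show ?thesis using \<open>0 \<le> K * X\<close> by simp
  qed
qed

text \<open>The hats at the nodes \<open>1, 1/2, ..., (1/2) ^ (n - 1)\<close>: the factors that
  summation by parts leaves next to the increments of \<open>u\<close>.\<close>

definition low_bumps :: "nat \<Rightarrow> real \<Rightarrow> real" where "low_bumps n x = (\<Sum>l<n. hat (x * 2 ^ l))"

text \<open>The two half lines share the value at \<open>0\<close>: each carries one half of \<open>u 0 * trapezoid x\<close>, which explains
  the terms with \<open>trapezoid x / 2\<close>.\<close>

definition low_part :: "nat \<Rightarrow> (real \<Rightarrow> complex) \<Rightarrow> real \<Rightarrow> complex" where
  "low_part i u x = (u (2 * (1/2) ^ i) - u ((1/2) ^ i)) * complex_of_real (low_bumps i x - trapezoid x / 2) + block_error ((1/2) ^ i) u x"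

definition high_part :: "nat \<Rightarrow> (real \<Rightarrow> complex) \<Rightarrow> real \<Rightarrow> complex" where
  "high_part i u x = u (2 ^ Suc i) * complex_of_real (hat (x / 2 ^ Suc i) + (if i = 0 then trapezoid x / 2 else 0)) + block_error (2 ^ Suc i) u x"

lemma low_partial_sums_below:
  assumes "x \<le> (1/2) ^ n"
  shows "(\<Sum>i<Suc n. (u (2 * (1/2) ^ i) - u ((1/2) ^ i)) * complex_of_real (low_bumps i x) + block_error ((1/2) ^ i) u x) = 0"
proof (rule sum.neutral, rule ballI)
  fix i assume "i \<in> {..<Suc n}"
  then have i: "i \<le> n" by auto
  have "(1/2::real) ^ n \<le> (1/2) ^ i" using i by (intro power_decreasing) auto
  then have "block_error ((1/2) ^ i) u x = 0" using assms by (intro block_error_outside(1)) (simp, linarith)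
  moreover have "low_bumps i x = 0" unfolding low_bumps_def
  proof (rule sum.neutral, rule ballI)
    fix l assume "l \<in> {..<i}"
    then have "2 * (2::real) ^ l \<le> 2 ^ n" using i power_increasing[of "Suc l" n "2::real"] by simp
    moreover have "x * 2 ^ l \<le> (1/2) ^ n * 2 ^ l" using assms by (intro mult_right_mono) auto
    moreover have "(1/2::real) ^ n * 2 ^ n = 1" by (simp flip: power_mult_distrib)
    moreover have "(1/2::real) ^ n * (2 * 2 ^ l) \<le> (1/2) ^ n * 2 ^ n" using calculation(1) by (intro mult_left_mono) auto
    moreover have "x * (2 * 2 ^ l) \<le> (1/2) ^ n * (2 * 2 ^ l)" using assms by (intro mult_right_mono) auto
    ultimately have "x * (2 * 2 ^ l) \<le> 1" by linarith
    then have "x * 2 ^ l \<le> 1/2" by simp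
    then show "hat (x * 2 ^ l) = 0" by (rule hat_0)
  qed
  ultimately show "(u (2 * (1/2) ^ i) - u ((1/2) ^ i)) * complex_of_real (low_bumps i x) + block_error ((1/2) ^ i) u x = 0" by simp
qed

text \<open>Summation by parts: the last term is its boundary term, and
  \<open>u 2 * hat (x / 2)\<close> is the share of the node \<open>2\<close>, which belongs to the
  high part. In the induction only the block that contains \<open>x\<close> contributes something
  new.\<close>

lemma low_partial_sums:
  assumes "(1/2) ^ n \<le> x" "x \<le> 2"
  shows "(\<Sum>i<Suc n. (u (2 * (1/2) ^ i) - u ((1/2) ^ i)) * complex_of_real (low_bumps i x) + block_error ((1/2) ^ i) u x) =
    u x - u 2 * complex_of_real (hat (x / 2)) - u ((1/2) ^ n) * complex_of_real (low_bumps (Suc n) x)"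
  using assms
proof (induction n)
  case 0
  have h: "hat (x / 2) = x - 1" "hat x = 2 - x" using 0 hat_up[of "x / 2"] hat_down[of x] by auto
  show ?case using 0 by (simp add: low_bumps_def block_error_inside h) (simp add: algebra_simps)
next
  case (Suc n)
  let ?n = "Suc n"
  show ?case
  proof (cases "(1/2) ^ n \<le> x")
    case True
    have "block_error ((1/2) ^ ?n) u x = 0" using True by (intro block_error_outside(2)) auto
    moreover have "hat (x * 2 ^ ?n) = 0"
    proof (rule hat_0(2))
      have "(1/2) ^ n * 2 ^ ?n \<le> x * 2 ^ ?n" using True by (intro mult_right_mono) auto
      then show "2 \<le> x * 2 ^ ?n" by (simp add: power_divide)
    qed
    then have "low_bumps (Suc ?n) x = low_bumps ?n x" by (simp add: low_bumps_def)
    ultimately show ?thesis using Suc.IH[OF True Suc.prems(2)]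
      by (subst sum.lessThan_Suc) (simp add: algebra_simps)
  next
    case False
    \<comment> \<open>The position of \<open>x\<close> in its block, rescaled to
      \<open>[1, 2]\<close>; the hats at the left and right end of the block take the values
      \<open>2 - t\<close> and \<open>t - 1\<close>.\<close>
    define t where "t = x * 2 ^ ?n"
    have "(1/2) ^ ?n * 2 ^ ?n \<le> t" "t \<le> (1/2) ^ n * 2 ^ ?n" unfolding t_def using Suc.prems False by (intro mult_right_mono; simp)+
    then have t: "1 \<le> t" "t \<le> 2" by (auto simp: power_divide)
    have b: "low_bumps n x = 0" unfolding low_bumps_def
    proof (rule sum.neutral, rule ballI)
      fix l assume "l \<in> {..<n}"
      then have "(2::real) ^ l * 4 \<le> 2 ^ ?n" using power_increasing[of "l + 2" ?n "2::real"] by simp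
      then have "x * (2 ^ l * 4) \<le> t" unfolding t_def using Suc.prems by (intro mult_left_mono) (auto intro: order_trans[OF _ Suc.prems(1)])
      then show "hat (x * 2 ^ l) = 0" using t by (simp add: hat_def)
    qed
    have hn: "hat (x * 2 ^ n) = t - 1" using hat_up[of "x * 2 ^ n"] t by (simp add: t_def)
    have hSn: "hat (x * 2 ^ ?n) = 2 - t" using hat_down[of t] t by (simp add: t_def)
    have h2: "hat (x / 2) = 0"
    proof (rule hat_0)
      have "(1/2::real) ^ n \<le> 1" by (simp add: power_le_one)
      then show "x / 2 \<le> 1/2" using False by simp
    qed
    have S0: "(\<Sum>i<Suc n. (u (2 * (1/2) ^ i) - u ((1/2) ^ i)) * complex_of_real (low_bumps i x) + block_error ((1/2) ^ i) u x) = 0"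
      using False by (intro low_partial_sums_below) auto
    have be: "block_error ((1/2) ^ ?n) u x = u x - (u ((1/2) ^ ?n) + complex_of_real (t - 1) * (u (2 * (1/2) ^ ?n) - u ((1/2) ^ ?n)))"
    proof -
      have "(x - (1/2) ^ ?n) / (1/2) ^ ?n = t - 1" by (simp add: t_def power_divide field_simps)
      then show ?thesis using Suc.prems False by (subst block_error_inside) auto
    qed
    have lb: "low_bumps ?n x = t - 1" "low_bumps (Suc ?n) x = 1"
      using b hn hSn by (simp_all add: low_bumps_def)
    show ?thesis
      unfolding sum.lessThan_Suc[of _ ?n] S0 be lb h2 by (simp add: algebra_simps)
  qed
qed

text \<open>For the constant function \<open>1\<close> all increments and errors vanish, and the
  interpolation identity says that the hats form a partition of unity.\<close>

lemma low_bumps_eq: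
  assumes "(1/2) ^ n \<le> x" "x \<le> 2" shows "low_bumps (Suc n) x = trapezoid x"
proof -
  have "block_error X (\<lambda>_. 1) y = 0" for X y by (simp add: block_error_def Let_def)
  then have "complex_of_real (low_bumps (Suc n) x) = complex_of_real (1 - hat (x / 2))"
    using low_partial_sums[OF assms, of "\<lambda>_. 1"] by (simp add: algebra_simps)
  then have "low_bumps (Suc n) x = 1 - hat (x / 2)" using of_real_eq_iff by blast
  moreover have "0 < x" using assms(1) by (rule less_le_trans[rotated]) simp
  ultimately show ?thesis using assms(2) by (auto simp: hat_def trapezoid_def)
qed

text \<open>The two ranges are proved together: when \<open>x\<close> enters a new block, the second
  claim describes the sum over the earlier blocks.\<close>

lemma high_partial_sums:
  "x \<le> 2 ^ Suc n \<Longrightarrow> x \<ge> 2 \<Longrightarrow> (\<Sum>i<Suc n. u (2 ^ Suc i) * complex_of_real (hat (x / 2 ^ Suc i)) + block_error (2 ^ Suc i) u x) = u x"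
  "x \<ge> 2 ^ Suc n \<Longrightarrow> (\<Sum>i<Suc n. u (2 ^ Suc i) * complex_of_real (hat (x / 2 ^ Suc i)) + block_error (2 ^ Suc i) u x) =
     u (2 ^ Suc n) * complex_of_real (hat (x / 2 ^ Suc n)) + block_error (2 ^ Suc n) u x"
proof (induction n)
  case 0
  { case 1
    then have "x = 2" by simp
    then show ?case using hat_up[of 1] block_error_outside(1)[of 2 2 u] by simp
  next
    case 2 show ?case by simp }
next
  case (Suc n)
  { case 1
    show ?case
    proof (cases "x \<le> 2 ^ Suc n")
      case True
      have "hat (x / 2 ^ Suc (Suc n)) = 0" using True by (intro hat_0(1)) (simp add: field_simps)
      moreover have "(2::real) ^ Suc n \<le> 2 ^ Suc (Suc n)" by (intro power_increasing) auto
      then have "block_error (2 ^ Suc (Suc n)) u x = 0" using True by (intro block_error_outside(1)) (simp, linarith)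
      ultimately show ?thesis using Suc(1)[OF True 1(2)] by (subst sum.lessThan_Suc) simp
    next
      case False
      define t where "t = x / 2 ^ Suc n"
      have t: "1 \<le> t" "t \<le> 2" using False 1 by (auto simp: t_def field_simps)
      have h1: "hat (x / 2 ^ Suc n) = 2 - t" using hat_down[of t] t by (simp add: t_def)
      have h2: "hat (x / 2 ^ Suc (Suc n)) = t - 1" using hat_up[of "t / 2"] t by (simp add: t_def field_simps)
      have b1: "block_error (2 ^ Suc (Suc n)) u x = 0" using 1 by (intro block_error_outside(1)) auto
      have b2: "block_error (2 ^ Suc n) u x = u x - (u (2 ^ Suc n) + complex_of_real (t - 1) * (u (2 * 2 ^ Suc n) - u (2 ^ Suc n)))"
      proof -
        have "(x - 2 ^ Suc n) / 2 ^ Suc n = t - 1" by (simp add: t_def diff_divide_distrib)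
        then show ?thesis using 1 False by (subst block_error_inside) auto
      qed
      have "(\<Sum>i<Suc n. u (2 ^ Suc i) * complex_of_real (hat (x / 2 ^ Suc i)) + block_error (2 ^ Suc i) u x) =
         u (2 ^ Suc n) * complex_of_real (hat (x / 2 ^ Suc n)) + block_error (2 ^ Suc n) u x"
        using Suc(2) False by simp
      then show ?thesis unfolding sum.lessThan_Suc[of _ "Suc n"] h1 h2 b1 b2 by (simp add: algebra_simps)
    qed
  next
    case 2
    have "hat (x / 2 ^ Suc n) = 0" using 2 by (intro hat_0(2)) (simp add: field_simps)
    moreover have "block_error (2 ^ Suc n) u x = 0" using 2 by (intro block_error_outside(2)) auto
    moreover have "(2::real) ^ Suc n \<le> 2 ^ Suc (Suc n)" by (intro power_increasing) auto
    then have "x \<ge> 2 ^ Suc n" using 2 by linarith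
    ultimately show ?case using Suc(2) by (subst sum.lessThan_Suc) simp }
qed

lemma high_partial_sums_below:
  assumes "x \<le> 2"
  shows "(\<Sum>i<Suc n. u (2 ^ Suc i) * complex_of_real (hat (x / 2 ^ Suc i)) + block_error (2 ^ Suc i) u x) =
    u 2 * complex_of_real (hat (x / 2))"
proof (induction n)
  case 0
  show ?case using block_error_outside(1)[of 2 x u] assms by simp
next
  case (Suc n)
  have le: "(2::real) ^ Suc (Suc n) \<ge> 4" using power_increasing[of 2 "Suc (Suc n)" "2::real"] by simp
  then have "block_error (2 ^ Suc (Suc n)) u x = 0" using assms by (intro block_error_outside(1)) (simp, linarith)
  moreover have "hat (x / 2 ^ Suc (Suc n)) = 0"
  proof (rule hat_0)
    show "x / 2 ^ Suc (Suc n) \<le> 1/2" using le assms by (simp add: divide_le_eq del: power_Suc)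
  qed
  ultimately show ?case using Suc by (subst sum.lessThan_Suc) simp
qed

text \<open>The corrections by \<open>trapezoid x / 2\<close> telescope along the increments, and
  the extra term of the high part at \<open>i = 0\<close> cancels the value at \<open>2\<close>.
  What remains is the value at \<open>(1/2) ^ n\<close>.\<close>

lemma parts_partial_sums:
  "(\<Sum>i<Suc n. low_part i u x + high_part i u x) =
    (\<Sum>i<Suc n. (u (2 * (1/2) ^ i) - u ((1/2) ^ i)) * complex_of_real (low_bumps i x) + block_error ((1/2) ^ i) u x) +
    (\<Sum>i<Suc n. u (2 ^ Suc i) * complex_of_real (hat (x / 2 ^ Suc i)) + block_error (2 ^ Suc i) u x) +
    complex_of_real (trapezoid x / 2) * u ((1/2) ^ n)"
proof -
  define c where "c = complex_of_real (trapezoid x / 2)"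
  have lp: "low_part i u x = (u (2 * (1/2) ^ i) - u ((1/2) ^ i)) * (complex_of_real (low_bumps i x) - c) + block_error ((1/2) ^ i) u x" for i
    by (simp add: low_part_def c_def)
  have hp0: "high_part 0 u x = u 2 * (complex_of_real (hat (x / 2)) + c) + block_error 2 u x"
    by (simp add: high_part_def c_def)
  have hpS: "high_part (Suc i) u x = u (2 ^ Suc (Suc i)) * complex_of_real (hat (x / 2 ^ Suc (Suc i))) + block_error (2 ^ Suc (Suc i)) u x" for i
    by (simp add: high_part_def)
  have half: "2 * (1/2::real) ^ Suc n = (1/2) ^ n" for n by simp
  show ?thesis unfolding c_def[symmetric]
  proof (induction n)
    case 0
    show ?case by (simp add: lp hp0 low_bumps_def) (simp add: algebra_simps)
  next
    case (Suc n)
    show ?case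
      unfolding sum.lessThan_Suc[of _ "Suc n"] Suc.IH unfolding lp[of "Suc n"] hpS[of n] half
      by (simp only: distrib_left distrib_right right_diff_distrib left_diff_distrib) simp
  qed
qed

text \<open>Continuity at \<open>0\<close> identifies the limit of the boundary values
  \<open>u ((1/2) ^ n)\<close>.\<close>

lemma parts_sums:
  assumes "isCont u 0"
  shows "(\<lambda>i. low_part i u x + high_part i u x) sums
    (if x > 0 then u x - complex_of_real (trapezoid x / 2) * u 0 else complex_of_real (trapezoid x / 2) * u 0)"
proof -
  let ?S = "\<lambda>n. \<Sum>i<n. low_part i u x + high_part i u x"
  let ?c = "complex_of_real (trapezoid x / 2)"
  have "(\<lambda>n. (1/2::real) ^ n) \<longlonglongrightarrow> 0" by (rule LIMSEQ_power_zero) simp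
  then have lim: "(\<lambda>n. u ((1/2) ^ n)) \<longlonglongrightarrow> u 0" using assms by (rule isCont_tendsto_compose[rotated])
  have "(\<lambda>n. ?S (Suc n)) \<longlonglongrightarrow> (if x > 0 then u x - ?c * u 0 else ?c * u 0)"
  proof (cases "x > 0")
    case False
    then have le: "x \<le> (1/2) ^ n" for n using zero_less_power[of "1/2::real" n] by (simp del: zero_less_power)
    have eq: "?S (Suc n) = ?c * u ((1/2) ^ n)" for n
    proof -
      have "hat (x / 2) = 0" using False by (simp add: hat_def)
      then show ?thesis unfolding parts_partial_sums using low_partial_sums_below[OF le, of u n] high_partial_sums_below[of x u n] False by simp
    qed
    show ?thesis unfolding eq if_not_P[OF False] by (intro tendsto_intros lim)
  next
    case True
    have ev: "\<forall>\<^sub>F n in sequentially. (1/2) ^ n \<le> x"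
      using order_tendstoD(2)[OF \<open>(\<lambda>n. (1/2::real) ^ n) \<longlonglongrightarrow> 0\<close> True] by eventually_elim simp
    show ?thesis
    proof (cases "x \<le> 2")
      case x2: True
      have "\<forall>\<^sub>F n in sequentially. u x - ?c * u ((1/2) ^ n) = ?S (Suc n)"
        using ev
      proof eventually_elim
        case (elim n)
        show ?case unfolding parts_partial_sums low_partial_sums[OF elim x2] high_partial_sums_below[OF x2] low_bumps_eq[OF elim x2]
          by (simp add: algebra_simps)
      qed
      moreover have "(\<lambda>n. u x - ?c * u ((1/2) ^ n)) \<longlonglongrightarrow> u x - ?c * u 0" by (intro tendsto_intros lim)
      ultimately show ?thesis unfolding if_P[OF True] by (rule Lim_transform_eventually[rotated])
    next
      case False
      then have t0: "trapezoid x = 0" by (simp add: trapezoid_def)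
      have l0: "low_bumps i x = 0" for i unfolding low_bumps_def
      proof (rule sum.neutral, rule ballI)
        fix l
        have "x * 1 \<le> x * 2 ^ l" using True by (intro mult_left_mono) auto
        then have "2 \<le> x * 2 ^ l" using False by linarith
        then show "hat (x * 2 ^ l) = 0" by (rule hat_0(2))
      qed
      have b0: "block_error ((1/2) ^ i) u x = 0" for i
      proof (rule block_error_outside(2))
        have "(1/2::real) ^ i \<le> 1" by (simp add: power_le_one)
        then show "2 * (1/2) ^ i \<le> x" using False by linarith
      qed simp
      obtain N where N: "x < 2 ^ N" using real_arch_pow[of 2 x] by auto
      have "\<forall>\<^sub>F n in sequentially. u x = ?S (Suc n)"
        using eventually_ge_at_top[of N]
      proof eventually_elim
        case (elim n)
        have "(2::real) ^ N \<le> 2 ^ Suc n" using elim by (intro power_increasing) auto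
        then have "x \<le> 2 ^ Suc n" using N by linarith
        then show ?case unfolding parts_partial_sums t0 l0 b0 using False by (subst high_partial_sums(1)) auto
      qed
      then have "(\<lambda>n. ?S (Suc n)) \<longlonglongrightarrow> u x" by (rule Lim_transform_eventually[OF tendsto_const])
      then show ?thesis unfolding if_P[OF True] t0 by simp
    qed
  qed
  then show ?thesis unfolding sums_def by (rule LIMSEQ_imp_Suc)
qed

definition line_part :: "nat \<Rightarrow> (real \<Rightarrow> complex) \<Rightarrow> real \<Rightarrow> complex" where
  "line_part i u x = low_part i u x + high_part i u x + (low_part i (\<lambda>a. u (- a)) (- x) + high_part i (\<lambda>a. u (- a)) (- x))"

lemma line_part_sums:
  assumes "isCont u 0" shows "(\<lambda>i. line_part i u x) sums u x"
proof -
  have "isCont (\<lambda>a. u (- a)) 0" by (rule isCont_o2[where f=uminus and g=u]) (use assms in auto)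
  from sums_add[OF parts_sums[OF assms, of x] parts_sums[OF this, of "- x"]]
  have "(\<lambda>i. line_part i u x) sums ((if x > 0 then u x - complex_of_real (trapezoid x / 2) * u 0 else complex_of_real (trapezoid x / 2) * u 0) +
     (if - x > 0 then u (- (- x)) - complex_of_real (trapezoid (- x) / 2) * u (- 0) else complex_of_real (trapezoid (- x) / 2) * u (- 0)))"
    unfolding line_part_def .
  \<comment> \<open>At \<open>x = 0\<close> both half lines are in the second case, and each
    contributes half of \<open>u 0\<close>.\<close>
  moreover have "trapezoid (- x) = trapezoid x" "trapezoid 0 = 1" by (auto simp: trapezoid_def)
  ultimately show ?thesis by (cases x "0 :: real" rule: linorder_cases) auto
qed

text \<open>A piece depends linearly on finitely many values of \<open>u\<close>, hence commutes
  with pointwise convergent series. This permits decomposing in the second variable inside a piece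
  in the first.\<close>

lemma line_part_sums_linear:
  assumes "\<And>a. (\<lambda>k. u k a) sums U a" shows "(\<lambda>k. line_part i (u k) x) sums line_part i U x"
  unfolding line_part_def low_part_def high_part_def
  by (intro sums_add sums_diff sums_mult2 block_error_sums assms)

section \<open>Norm estimates for tensor products of one-variable pieces\<close>

definition bump :: "(real \<Rightarrow> real) \<Rightarrow> real \<Rightarrow> bool" where
  "bump e X \<longleftrightarrow> X > 0 \<and> (\<exists>a. \<forall>x. e x \<noteq> 0 \<longrightarrow> x \<in> {a..a + X}) \<and> (\<forall>x. \<bar>e x\<bar> \<le> 1) \<and>
     (\<forall>x x'. \<bar>e x - e x'\<bar> \<le> 4 / X * \<bar>x - x'\<bar>)"

text \<open>The one-variable counterpart of \<open>rect_lipschitz\<close>, again with differences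
  measured relative to the length of the support.\<close>

definition profile :: "(real \<Rightarrow> complex) \<Rightarrow> real \<Rightarrow> real \<Rightarrow> real \<Rightarrow> bool" where
  "profile v X p t \<longleftrightarrow> X > 0 \<and> (\<exists>a. \<forall>x. v x \<noteq> 0 \<longrightarrow> x \<in> {a..a + X}) \<and> (\<forall>x. norm (v x) \<le> p) \<and>
     (\<forall>x x'. norm (v x - v x') \<le> t / X * \<bar>x - x'\<bar>)"

lemma bump_trapezoid: "bump trapezoid 4"
  unfolding bump_def
proof (intro conjI allI)
  show "\<exists>a. \<forall>x. trapezoid x \<noteq> 0 \<longrightarrow> x \<in> {a..a + 4}"
    by (intro exI[of _ "-2"]) (auto simp: trapezoid_def split: if_splits)
  show "\<bar>trapezoid x - trapezoid x'\<bar> \<le> 4 / 4 * \<bar>x - x'\<bar>" for x x'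
  proof -
    have "\<bar>trapezoid x - trapezoid x'\<bar> \<le> \<bar>x - x'\<bar>" unfolding trapezoid_def by linarith
    then show ?thesis by simp
  qed
qed (auto simp: trapezoid_def)

text \<open>Slope \<open>2 / X\<close> on width \<open>3 / 2 * X\<close> fits the constant
  \<open>4\<close> of \<open>bump\<close> with room to spare; the trapezoid, with slope
  \<open>1\<close> on width \<open>4\<close>, attains it.\<close>

lemma bump_hat:
  assumes "X > 0" shows "bump (\<lambda>x. hat (x / X)) (3 / 2 * X)"
  unfolding bump_def
proof (intro conjI allI)
  show "\<exists>a. \<forall>x. hat (x / X) \<noteq> 0 \<longrightarrow> x \<in> {a..a + 3 / 2 * X}"
  proof (intro exI[of _ "X / 2"] allI impI)
    fix x assume "hat (x / X) \<noteq> 0"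
    then have "1/2 < x / X" "x / X < 2" using hat_0[of "x / X"] by (meson not_le)+
    then show "x \<in> {X / 2..X / 2 + 3 / 2 * X}" using assms by (simp add: field_simps)
  qed
  show "\<bar>hat (x / X)\<bar> \<le> 1" for x by (auto simp: hat_def)
  have "\<bar>hat t - hat t'\<bar> \<le> 2 * \<bar>t - t'\<bar>" for t t'
  proof -
    have "\<bar>max 0 a - max 0 b\<bar> \<le> \<bar>a - b\<bar>" for a b :: real by linarith
    moreover have "\<bar>min a b - min c d\<bar> \<le> max \<bar>a - c\<bar> \<bar>b - d\<bar>" for a b c d :: real by linarith
    then have "\<bar>min (2 * t - 1) (2 - t) - min (2 * t' - 1) (2 - t')\<bar> \<le> max \<bar>(2 * t - 1) - (2 * t' - 1)\<bar> \<bar>(2 - t) - (2 - t')\<bar>" .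
    then have "\<bar>min (2 * t - 1) (2 - t) - min (2 * t' - 1) (2 - t')\<bar> \<le> 2 * \<bar>t - t'\<bar>"
      by (rule order_trans) (simp add: abs_if)
    ultimately show ?thesis unfolding hat_def by (rule order_trans)
  qed
  then have "\<bar>hat (x / X) - hat (x' / X)\<bar> \<le> 2 * \<bar>x / X - x' / X\<bar>" for x x' .
  moreover have "2 * \<bar>x / X - x' / X\<bar> = 2 / X * \<bar>x - x'\<bar>" for x x'
    using assms by (simp add: diff_divide_distrib[symmetric] abs_divide)
  moreover have "2 / X * \<bar>x - x'\<bar> \<le> 4 / (3 / 2 * X) * \<bar>x - x'\<bar>" for x x'
    using assms by (intro mult_right_mono) (auto simp: field_simps)
  ultimately show "\<bar>hat (x / X) - hat (x' / X)\<bar> \<le> 4 / (3 / 2 * X) * \<bar>x - x'\<bar>" for x x'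
    by (metis order_trans)
qed (use assms in auto)

lemma profile_bump:
  assumes "bump e X" shows "profile (\<lambda>x. c * complex_of_real (e x)) X (norm c) (4 * norm c)"
  unfolding profile_def
proof (intro conjI allI)
  show "X > 0" "\<exists>a. \<forall>x. c * complex_of_real (e x) \<noteq> 0 \<longrightarrow> x \<in> {a..a + X}"
    using assms unfolding bump_def by auto
  fix x x'
  have b: "\<bar>e x\<bar> \<le> 1" "\<bar>e x - e x'\<bar> \<le> 4 / X * \<bar>x - x'\<bar>" using assms unfolding bump_def by blast+
  show "norm (c * complex_of_real (e x)) \<le> norm c"
    using b(1) by (simp add: norm_mult mult_left_le)
  have "norm (c * complex_of_real (e x) - c * complex_of_real (e x')) = norm c * \<bar>e x - e x'\<bar>"
    by (simp only: right_diff_distrib[symmetric] of_real_diff[symmetric] norm_mult norm_of_real)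
  also have "\<dots> \<le> norm c * (4 / X * \<bar>x - x'\<bar>)" by (intro mult_left_mono b) auto
  finally show "norm (c * complex_of_real (e x) - c * complex_of_real (e x')) \<le> 4 * norm c / X * \<bar>x - x'\<bar>" by (simp add: mult_ac)
qed

lemma profile_block_error:
  assumes X: "X > 0" and M: "\<And>x. X \<le> x \<Longrightarrow> x \<le> 2 * X \<Longrightarrow> norm (u x) \<le> M"
    and K: "\<And>x x'. X \<le> x \<Longrightarrow> x \<le> 2 * X \<Longrightarrow> X \<le> x' \<Longrightarrow> x' \<le> 2 * X \<Longrightarrow> norm (u x - u x') \<le> K * \<bar>x - x'\<bar>"
  shows "profile (block_error X u) X (2 * M) (2 * (K * X))"
  unfolding profile_def
proof (intro conjI allI)
  show "\<exists>a. \<forall>x. block_error X u x \<noteq> 0 \<longrightarrow> x \<in> {a..a + X}"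
    using block_error_outside[OF X] by (intro exI[of _ X] allI impI) (metis atLeastAtMost_iff mult_2 nle_le)
  show "norm (block_error X u x) \<le> 2 * M" for x by (rule block_error_bound[OF X M])
  show "norm (block_error X u x - block_error X u x') \<le> 2 * (K * X) / X * \<bar>x - x'\<bar>" for x x'
    using block_error_lipschitz(1)[OF X K] X by simp
qed (rule X)

lemma profile_block_error_lipschitz:
  assumes X: "X > 0"
    and K: "\<And>x x'. X \<le> x \<Longrightarrow> x \<le> 2 * X \<Longrightarrow> X \<le> x' \<Longrightarrow> x' \<le> 2 * X \<Longrightarrow> norm (u x - u x') \<le> K * \<bar>x - x'\<bar>"
  shows "profile (block_error X u) X (2 * (K * X)) (2 * (K * X))"
  unfolding profile_def
proof (intro conjI allI)
  show "\<exists>a. \<forall>x. block_error X u x \<noteq> 0 \<longrightarrow> x \<in> {a..a + X}"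
    using block_error_outside[OF X] by (intro exI[of _ X] allI impI) (metis atLeastAtMost_iff mult_2 nle_le)
  show "norm (block_error X u x) \<le> 2 * (K * X)" for x by (rule block_error_lipschitz(2)[OF X K])
  show "norm (block_error X u x - block_error X u x') \<le> 2 * (K * X) / X * \<bar>x - x'\<bar>" for x x'
    using block_error_lipschitz(1)[OF X K] X by simp
qed (rule X)

lemma profile_nonneg: assumes "profile v X p t" shows "0 \<le> p" "0 \<le> t"
proof -
  have X: "X > 0" and "norm (v 0) \<le> p" "norm (v 0 - v 1) \<le> t / X * \<bar>0 - 1\<bar>" using assms unfolding profile_def by blast+
  then have "0 \<le> p" "0 \<le> t / X * \<bar>0 - 1\<bar>" using norm_ge_zero order_trans by blast+
  with X show "0 \<le> p" "0 \<le> t" by (auto simp: zero_le_divide_iff)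
qed

text \<open>A bump contributes at most \<open>4\<close> to any difference in its own variable. Using
  \<open>4\<close> for the sizes too gives the two shapes to which the geometric mean estimate
  applies.\<close>

lemma rect_lipschitz_tensor:
  assumes v: "profile v X p t" and e: "bump e Y"
  shows "rect_lipschitz (\<lambda>(x, y). v x * complex_of_real (e y)) X Y (4 * p) (4 * t) (4 * p) (4 * t)"
    and "rect_lipschitz (\<lambda>(y, x). v x * complex_of_real (e y)) Y X (4 * p) (4 * p) (4 * t) (4 * t)"
proof -
  have X: "X > 0" "Y > 0" using v e by (auto simp: profile_def bump_def)
  have pt: "0 \<le> p" "0 \<le> t" by (rule profile_nonneg[OF v])+
  have v1: "norm (v x) \<le> p" and v2: "norm (v x - v x') \<le> t / X * \<bar>x - x'\<bar>" for x x'
    using v unfolding profile_def by blast+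
  have e1: "\<bar>e y\<bar> \<le> 1" and e2: "\<bar>e y - e y'\<bar> \<le> 4 / Y * \<bar>y - y'\<bar>" for y y'
    using e unfolding bump_def by blast+
  have s: "\<exists>a b. \<forall>x y. v x * complex_of_real (e y) \<noteq> 0 \<longrightarrow> x \<in> {a..a + X} \<and> y \<in> {b..b + Y}"
    using v e unfolding profile_def bump_def by (metis mult_eq_0_iff of_real_0)
  have s': "\<exists>b a. \<forall>y x. v x * complex_of_real (e y) \<noteq> 0 \<longrightarrow> y \<in> {b..b + Y} \<and> x \<in> {a..a + X}"
    using s by metis
  have b: "norm (v x * complex_of_real (e y)) \<le> 4 * p" for x y
  proof -
    have "norm (v x * complex_of_real (e y)) \<le> p * 1"
      unfolding norm_mult norm_of_real using v1 e1 pt by (intro mult_mono) auto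
    then show ?thesis using pt by simp
  qed
  have bx: "norm (v x * complex_of_real (e y) - v x' * complex_of_real (e y)) \<le> 4 * t / X * \<bar>x - x'\<bar>" for x x' y
  proof -
    have "norm (v x * complex_of_real (e y) - v x' * complex_of_real (e y)) = norm (v x - v x') * \<bar>e y\<bar>"
      by (simp only: left_diff_distrib[symmetric] norm_mult norm_of_real)
    also have "\<dots> \<le> (t / X * \<bar>x - x'\<bar>) * 1" using v2 e1 X pt by (intro mult_mono) auto
    also have "\<dots> \<le> 4 * t / X * \<bar>x - x'\<bar>" using pt X by (simp add: divide_right_mono mult_right_mono)
    finally show ?thesis .
  qed
  have by': "norm (v x * complex_of_real (e y) - v x * complex_of_real (e y')) \<le> 4 * p / Y * \<bar>y - y'\<bar>" for x y y'
  proof -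
    have "norm (v x * complex_of_real (e y) - v x * complex_of_real (e y')) = norm (v x) * \<bar>e y - e y'\<bar>"
      by (simp only: right_diff_distrib[symmetric] of_real_diff[symmetric] norm_mult norm_of_real)
    also have "\<dots> \<le> p * (4 / Y * \<bar>y - y'\<bar>)" using v1 e2 pt by (intro mult_mono) auto
    finally show ?thesis by (simp add: mult_ac)
  qed
  have bxy: "norm (v x * complex_of_real (e y) - v x' * complex_of_real (e y) - (v x * complex_of_real (e y') - v x' * complex_of_real (e y')))
      \<le> 4 * t / (X * Y) * \<bar>x - x'\<bar> * \<bar>y - y'\<bar>" for x x' y y'
  proof -
    have "norm (v x * complex_of_real (e y) - v x' * complex_of_real (e y) - (v x * complex_of_real (e y') - v x' * complex_of_real (e y')))
       = norm (v x - v x') * \<bar>e y - e y'\<bar>"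
      by (simp only: left_diff_distrib[symmetric] right_diff_distrib[symmetric] of_real_diff[symmetric] norm_mult norm_of_real)
    also have "\<dots> \<le> (t / X * \<bar>x - x'\<bar>) * (4 / Y * \<bar>y - y'\<bar>)" using v2 e2 pt X by (intro mult_mono) auto
    finally show ?thesis by (simp add: mult_ac)
  qed
  show "rect_lipschitz (\<lambda>(x, y). v x * complex_of_real (e y)) X Y (4 * p) (4 * t) (4 * p) (4 * t)"
    unfolding rect_lipschitz_def prod.case by (intro conjI X s allI b bx by' bxy)
  have bxy': "norm (v x * complex_of_real (e y) - v x * complex_of_real (e y') - (v x' * complex_of_real (e y) - v x' * complex_of_real (e y')))
      \<le> 4 * t / (Y * X) * \<bar>y - y'\<bar> * \<bar>x - x'\<bar>" for x x' y y'
    using bxy[of x y x' y'] by (simp add: algebra_simps)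
  show "rect_lipschitz (\<lambda>(y, x). v x * complex_of_real (e y)) Y X (4 * p) (4 * p) (4 * t) (4 * t)"
    unfolding rect_lipschitz_def prod.case by (intro conjI X s' allI b bx by' bxy')
qed

lemma rect_lipschitz_reflect:
  assumes rl: "rect_lipschitz \<phi> X Y p q r w" and st: "\<bar>s\<bar> = 1" "\<bar>t\<bar> = 1"
  shows "rect_lipschitz (\<lambda>(x, y). \<phi> (s * x, t * y)) X Y p q r w"
proof -
  obtain a b where "\<forall>x y. \<phi> (x, y) \<noteq> 0 \<longrightarrow> x \<in> {a..a + X} \<and> y \<in> {b..b + Y}"
    using rl unfolding rect_lipschitz_def by blast
  then have ab: "x \<in> {a..a + X} \<and> y \<in> {b..b + Y}" if "\<phi> (x, y) \<noteq> 0" for x y using that by blast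
  have abs: "\<bar>s * x - s * x'\<bar> = \<bar>x - x'\<bar>" "\<bar>t * x - t * x'\<bar> = \<bar>x - x'\<bar>" for x x'
    using st by (simp_all add: right_diff_distrib[symmetric] abs_mult)
  have "\<exists>a b. \<forall>x y. \<phi> (s * x, t * y) \<noteq> 0 \<longrightarrow> x \<in> {a..a + X} \<and> y \<in> {b..b + Y}"
  proof (intro exI allI impI)
    fix x y assume "\<phi> (s * x, t * y) \<noteq> 0"
    then have "s * x \<in> {a..a + X}" "t * y \<in> {b..b + Y}" using ab by auto
    then show "x \<in> {(if s = 1 then a else - a - X)..(if s = 1 then a else - a - X) + X} \<and>
       y \<in> {(if t = 1 then b else - b - Y)..(if t = 1 then b else - b - Y) + Y}"
      using st by (auto simp: abs_if split: if_splits)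
  qed
  moreover have "X > 0" "Y > 0" using rl unfolding rect_lipschitz_def by auto
  moreover have "norm (\<phi> (s * x, t * y)) \<le> p" for x y using rl unfolding rect_lipschitz_def by blast
  moreover have "norm (\<phi> (s * x, t * y) - \<phi> (s * x', t * y)) \<le> q / X * \<bar>s * x - s * x'\<bar>"
    "norm (\<phi> (s * x, t * y) - \<phi> (s * x, t * y')) \<le> r / Y * \<bar>t * y - t * y'\<bar>"
    "norm (\<phi> (s * x, t * y) - \<phi> (s * x', t * y) - (\<phi> (s * x, t * y') - \<phi> (s * x', t * y'))) \<le> w / (X * Y) * \<bar>s * x - s * x'\<bar> * \<bar>t * y - t * y'\<bar>"
    for x x' y y' using rl unfolding rect_lipschitz_def by blast+
  ultimately show ?thesis unfolding rect_lipschitz_def prod.case abs by blast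
qed

lemma fourier_bounded_tensor:
  assumes v: "profile v X p t" and e: "bump e Y" and \<sigma>: "\<bar>\<sigma>1\<bar> = 1" "\<bar>\<sigma>2\<bar> = 1"
  shows "fourier_bounded (\<lambda>(x, y). v (\<sigma>1 * x) * complex_of_real (e (\<sigma>2 * y))) (ennreal (16 * pi * sqrt (p * t)))"
    and "fourier_bounded (\<lambda>(y, x). v (\<sigma>1 * x) * complex_of_real (e (\<sigma>2 * y))) (ennreal (16 * pi * sqrt (p * t)))"
proof -
  have eq: "4 * pi * sqrt (4 * p * (4 * t)) = 16 * pi * sqrt (p * t)"
    using real_sqrt_mult[of 16 "p * t"] by (simp add: mult_ac)
  show "fourier_bounded (\<lambda>(x, y). v (\<sigma>1 * x) * complex_of_real (e (\<sigma>2 * y))) (ennreal (16 * pi * sqrt (p * t)))"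
    using fourier_bounded_geometric_mean[OF disjI2[OF rect_lipschitz_reflect[OF rect_lipschitz_tensor(1)[OF v e] \<sigma>]]]
    unfolding eq prod.case .
  show "fourier_bounded (\<lambda>(y, x). v (\<sigma>1 * x) * complex_of_real (e (\<sigma>2 * y))) (ennreal (16 * pi * sqrt (p * t)))"
    using fourier_bounded_geometric_mean[OF disjI1[OF rect_lipschitz_reflect[OF rect_lipschitz_tensor(2)[OF v e] \<sigma>(2,1)]]]
    unfolding eq prod.case .
qed

text \<open>A sum of hats over many scales is steep at its inner end and long at its outer end, so
  it is no good bump at any single scale. It is treated as \<open>n\<close> separate bumps, and
  \<open>n\<close> enters the norm linearly.\<close>

definition bump_sum :: "nat \<Rightarrow> (real \<Rightarrow> real) \<Rightarrow> bool" where
  "bump_sum n e \<longleftrightarrow> (\<exists>c b W. (\<forall>m<n. \<bar>c m\<bar> \<le> 1 \<and> bump (b m) (W m)) \<and> e = (\<lambda>x. \<Sum>m<n. c m * b m x))"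

lemma fourier_bounded_tensor_sum:
  assumes v: "profile v X p t" and e: "bump_sum n e" and \<sigma>: "\<bar>\<sigma>1\<bar> = 1" "\<bar>\<sigma>2\<bar> = 1"
  shows "fourier_bounded (\<lambda>(x, y). v (\<sigma>1 * x) * complex_of_real (e (\<sigma>2 * y))) (ennreal (n * (16 * pi * sqrt (p * t))))"
    and "fourier_bounded (\<lambda>(y, x). v (\<sigma>1 * x) * complex_of_real (e (\<sigma>2 * y))) (ennreal (n * (16 * pi * sqrt (p * t))))"
proof -
  obtain c b W where cb: "\<And>m. m < n \<Longrightarrow> \<bar>c m\<bar> \<le> 1 \<and> bump (b m) (W m)" "e = (\<lambda>x. \<Sum>m<n. c m * b m x)"
    using e unfolding bump_sum_def by blast
  let ?B = "ennreal (16 * pi * sqrt (p * t))"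
  have sumB: "(\<Sum>m<n. ?B) = ennreal (n * (16 * pi * sqrt (p * t)))"
    by (simp add: ennreal_mult' ennreal_of_nat_eq_real_of_nat)
  have le: "fourier_bounded (\<lambda>y. complex_of_real (c m) * g y) ?B" if "fourier_bounded g ?B" "m < n" for g :: "real \<times> real \<Rightarrow> complex" and m
  proof (rule fourier_bounded_mono[OF fourier_bounded_cmult[OF that(1)]])
    have "ennreal \<bar>c m\<bar> * ?B \<le> 1 * ?B" using cb(1)[OF that(2)] by (intro mult_right_mono) (auto simp: ennreal_le_1)
    then show "ennreal (norm (complex_of_real (c m))) * ?B \<le> ?B" by simp
  qed
  have "fourier_bounded (\<lambda>z. \<Sum>m<n. complex_of_real (c m) * (case z of (x, y) \<Rightarrow> v (\<sigma>1 * x) * complex_of_real (b m (\<sigma>2 * y)))) (\<Sum>m<n. ?B)"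
    by (intro fourier_bounded_sum finite_lessThan le fourier_bounded_tensor(1)[OF v _ \<sigma>]) (use cb in auto)
  then show "fourier_bounded (\<lambda>(x, y). v (\<sigma>1 * x) * complex_of_real (e (\<sigma>2 * y))) (ennreal (n * (16 * pi * sqrt (p * t))))"
    unfolding sumB cb(2) by (simp add: case_prod_unfold sum_distrib_left mult_ac)
  have "fourier_bounded (\<lambda>z. \<Sum>m<n. complex_of_real (c m) * (case z of (y, x) \<Rightarrow> v (\<sigma>1 * x) * complex_of_real (b m (\<sigma>2 * y)))) (\<Sum>m<n. ?B)"
    by (intro fourier_bounded_sum finite_lessThan le fourier_bounded_tensor(2)[OF v _ \<sigma>]) (use cb in auto)
  then show "fourier_bounded (\<lambda>(y, x). v (\<sigma>1 * x) * complex_of_real (e (\<sigma>2 * y))) (ennreal (n * (16 * pi * sqrt (p * t))))"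
    unfolding sumB cb(2) by (simp add: case_prod_unfold sum_distrib_left mult_ac)
qed

lemma fourier_bounded_tensor_sums:
  assumes e1: "bump_sum n e1" and e2: "bump_sum m e2" and \<sigma>: "\<bar>\<sigma>1\<bar> = 1" "\<bar>\<sigma>2\<bar> = 1"
  shows "fourier_bounded (\<lambda>(x, y). C * complex_of_real (e1 (\<sigma>1 * x)) * complex_of_real (e2 (\<sigma>2 * y))) (ennreal (n * (m * (32 * pi * norm C))))"
proof -
  obtain c b W where cb: "\<And>k. k < n \<Longrightarrow> \<bar>c k\<bar> \<le> 1 \<and> bump (b k) (W k)" "e1 = (\<lambda>x. \<Sum>k<n. c k * b k x)"
    using e1 unfolding bump_sum_def by blast
  let ?B = "ennreal (m * (32 * pi * norm C))"
  have sumB: "(\<Sum>k<n. ?B) = ennreal (n * (m * (32 * pi * norm C)))"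
    by (simp add: ennreal_mult' ennreal_of_nat_eq_real_of_nat)
  have "fourier_bounded (\<lambda>z. \<Sum>k<n. case z of (x, y) \<Rightarrow> C * complex_of_real (c k) * complex_of_real (b k (\<sigma>1 * x)) * complex_of_real (e2 (\<sigma>2 * y))) (\<Sum>k<n. ?B)"
  proof (intro fourier_bounded_sum finite_lessThan)
    fix k assume "k \<in> {..<n}"
    then have k: "\<bar>c k\<bar> \<le> 1" "bump (b k) (W k)" using cb by auto
    have "fourier_bounded (\<lambda>(x, y). C * complex_of_real (c k) * complex_of_real (b k (\<sigma>1 * x)) * complex_of_real (e2 (\<sigma>2 * y)))
      (ennreal (m * (16 * pi * sqrt (norm (C * complex_of_real (c k)) * (4 * norm (C * complex_of_real (c k)))))))"
      by (rule fourier_bounded_tensor_sum(1)[OF profile_bump[OF k(2)] e2 \<sigma>])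
    \<comment> \<open>A multiple of a bump has relative differences at most four times its size; the
      square root of \<open>4\<close> turns \<open>16\<close> into \<open>32\<close>.\<close>
    moreover have "sqrt (norm (C * complex_of_real (c k)) * (4 * norm (C * complex_of_real (c k)))) \<le> 2 * norm C"
    proof -
      have "sqrt (norm (C * complex_of_real (c k)) * (4 * norm (C * complex_of_real (c k)))) = 2 * norm (C * complex_of_real (c k))"
        by (rule real_sqrt_unique) (simp_all add: power2_eq_square)
      also have "\<dots> \<le> 2 * norm C" using k(1) by (simp add: norm_mult mult_left_le)
      finally show ?thesis .
    qed
    then have "16 * pi * sqrt (norm (C * complex_of_real (c k)) * (4 * norm (C * complex_of_real (c k)))) \<le> 16 * pi * (2 * norm C)"
      by (rule mult_left_mono) simp
    then have "real m * (16 * pi * sqrt (norm (C * complex_of_real (c k)) * (4 * norm (C * complex_of_real (c k))))) \<le> real m * (16 * pi * (2 * norm C))"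
      by (rule mult_left_mono) simp
    then have "ennreal (m * (16 * pi * sqrt (norm (C * complex_of_real (c k)) * (4 * norm (C * complex_of_real (c k)))))) \<le> ?B"
      by (intro ennreal_leI) simp
    ultimately show "fourier_bounded (\<lambda>(x, y). C * complex_of_real (c k) * complex_of_real (b k (\<sigma>1 * x)) * complex_of_real (e2 (\<sigma>2 * y))) ?B"
      by (rule fourier_bounded_mono)
  qed
  then show ?thesis unfolding sumB cb(2) by (simp add: case_prod_unfold sum_distrib_left sum_distrib_right mult_ac)
qed

lemma bump_sum_low: "bump_sum (Suc i) (\<lambda>x. low_bumps i x - trapezoid x / 2)"
  unfolding bump_sum_def
proof (intro exI conjI)
  let ?c = "\<lambda>m. if m < i then 1 else - (1 / 2 :: real)"
  let ?b = "\<lambda>m x. if m < i then hat (x / (1 / 2) ^ m) else trapezoid x"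
  let ?W = "\<lambda>m. if m < i then 3 / 2 * (1 / 2) ^ m else (4 :: real)"
  show "\<forall>m<Suc i. \<bar>?c m\<bar> \<le> 1 \<and> bump (?b m) (?W m)"
    using bump_hat[of "(1 / 2) ^ m" for m] bump_trapezoid by auto
  show "(\<lambda>x. low_bumps i x - trapezoid x / 2) = (\<lambda>x. \<Sum>m<Suc i. ?c m * ?b m x)"
    by (auto simp: low_bumps_def power_divide intro!: sum.cong)
qed

lemma bump_sum_high: "bump_sum 2 (\<lambda>x. hat (x / 2 ^ Suc i) + (if i = 0 then trapezoid x / 2 else 0))"
  unfolding bump_sum_def
proof (intro exI conjI)
  let ?c = "\<lambda>m. if m = (0::nat) then 1 else if i = 0 then 1 / 2 else (0 :: real)"
  let ?b = "\<lambda>m x. if m = (0::nat) then hat (x / 2 ^ Suc i) else trapezoid x"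
  let ?W = "\<lambda>m. if m = (0::nat) then 3 / 2 * 2 ^ Suc i else (4 :: real)"
  show "\<forall>m<2. \<bar>?c m\<bar> \<le> 1 \<and> bump (?b m) (?W m)"
    using bump_hat[of "2 ^ Suc i"] bump_trapezoid by auto
  show "(\<lambda>x. hat (x / 2 ^ Suc i) + (if i = 0 then trapezoid x / 2 else 0)) = (\<lambda>x. \<Sum>m<2. ?c m * ?b m x)"
    by (auto simp: numeral_2_eq_2)
qed

text \<open>Common form of the low and high parts: \<open>\<delta> = 1\<close> yields an increment
  between two nodes, \<open>\<delta> = 0\<close> a single point value.\<close>

definition scale_part :: "real \<Rightarrow> real \<Rightarrow> real \<Rightarrow> (real \<Rightarrow> real) \<Rightarrow> real \<Rightarrow> (real \<Rightarrow> complex) \<Rightarrow> real \<Rightarrow> complex" where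
  "scale_part A B \<delta> e X u x = (u A - complex_of_real \<delta> * u B) * complex_of_real (e x) + block_error X u x"

text \<open>Each variable splits into a nodal term and an error. The numbered hypotheses estimate
  the products nodal-nodal, error-nodal, nodal-error and error-error, in this order.\<close>

lemma fourier_bounded_parts:
  fixes F :: "real \<Rightarrow> real \<Rightarrow> complex"
  assumes e: "bump_sum n1 e1" "bump_sum n2 e2"
    and 1: "norm ((F A1 A2 - complex_of_real \<delta>2 * F A1 B2) - complex_of_real \<delta>1 * (F B1 A2 - complex_of_real \<delta>2 * F B1 B2)) \<le> M"
    and 2: "profile (block_error X (\<lambda>a. F a A2 - complex_of_real \<delta>2 * F a B2)) X p1 t1"
    and 3: "profile (block_error Y (\<lambda>b. F A1 b - complex_of_real \<delta>1 * F B1 b)) Y p2 t2"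
    and 4: "fourier_bounded (\<lambda>(x, y). block_error X (\<lambda>a. block_error Y (F a) (\<sigma>2 * y)) (\<sigma>1 * x)) D"
    and \<sigma>: "\<bar>\<sigma>1\<bar> = 1" "\<bar>\<sigma>2\<bar> = 1"
  shows "fourier_bounded (\<lambda>(x, y). scale_part A1 B1 \<delta>1 e1 X (\<lambda>a. scale_part A2 B2 \<delta>2 e2 Y (F a) (\<sigma>2 * y)) (\<sigma>1 * x))
    (ennreal (n1 * (n2 * (32 * pi * M)) + n2 * (16 * pi * sqrt (p1 * t1)) + n1 * (16 * pi * sqrt (p2 * t2))) + D)"
proof -
  let ?C = "(F A1 A2 - complex_of_real \<delta>2 * F A1 B2) - complex_of_real \<delta>1 * (F B1 A2 - complex_of_real \<delta>2 * F B1 B2)"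
  have f1: "fourier_bounded (\<lambda>(x, y). ?C * complex_of_real (e1 (\<sigma>1 * x)) * complex_of_real (e2 (\<sigma>2 * y))) (ennreal (n1 * (n2 * (32 * pi * M))))"
    by (rule fourier_bounded_mono[OF fourier_bounded_tensor_sums[OF e \<sigma>]]) (use 1 in \<open>auto intro!: ennreal_leI mult_left_mono\<close>)
  note f2 = fourier_bounded_tensor_sum(1)[OF 2 e(2) \<sigma>]
  note f3 = fourier_bounded_tensor_sum(2)[OF 3 e(1) \<sigma>(2,1)]
  \<comment> \<open>At a fixed point the error is a fixed linear combination of three values of its
    argument, which gives linearity without unfolding the clamp.\<close>
  have be: "block_error X (\<lambda>a. w a * c + g a) x = block_error X w x * c + block_error X g x" for X w c g x
  proof -
    obtain d \<theta> where h: "\<And>u. block_error X u x = u d - (u X + \<theta> * (u (2 * X) - u X))"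
      unfolding block_error_def Let_def by blast
    show ?thesis unfolding h by (simp add: algebra_simps)
  qed
  have be2: "block_error Y (\<lambda>b. F A1 b - complex_of_real \<delta>1 * F B1 b) y = block_error Y (F A1) y - complex_of_real \<delta>1 * block_error Y (F B1) y" for y
  proof -
    obtain d \<theta> where h: "\<And>u. block_error Y u y = u d - (u Y + \<theta> * (u (2 * Y) - u Y))"
      unfolding block_error_def Let_def by blast
    show ?thesis unfolding h by (simp add: algebra_simps)
  qed
  have M: "0 \<le> M" using 1 norm_ge_zero order_trans by blast
  have eq: "ennreal (n1 * (n2 * (32 * pi * M))) + ennreal (n2 * (16 * pi * sqrt (p1 * t1))) + ennreal (n1 * (16 * pi * sqrt (p2 * t2))) + D =
     ennreal (n1 * (n2 * (32 * pi * M)) + n2 * (16 * pi * sqrt (p1 * t1)) + n1 * (16 * pi * sqrt (p2 * t2))) + D"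
    using M profile_nonneg[OF 2] profile_nonneg[OF 3] by (simp add: ennreal_plus[symmetric] del: ennreal_plus)
  show ?thesis
    using fourier_bounded_add[OF fourier_bounded_add[OF fourier_bounded_add[OF f1 f2] f3] 4]
    unfolding eq scale_part_def be be2 case_prod_unfold by (simp add: algebra_simps)
qed

text \<open>Passing to the error in a variable costs a factor \<open>2\<close> and can trade a
  Lipschitz constant for a size. The four versions differ in what bounds the size: the mixed
  difference near both axes, the values of \<open>F\<close> far from both, and a first difference in
  the remaining two regions.\<close>

lemma rect_lipschitz_block_error:
  fixes F :: "real \<Rightarrow> real \<Rightarrow> complex"
  assumes XY: "X > 0" "Y > 0"
    and S: "\<And>x x' y y'. X \<le> x \<Longrightarrow> X \<le> x' \<Longrightarrow> Y \<le> y \<Longrightarrow> Y \<le> y' \<Longrightarrow>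
       norm (F x y - F x' y - (F x y' - F x' y')) \<le> S * \<bar>x - x'\<bar> * \<bar>y - y'\<bar>"
  defines "\<phi> \<equiv> \<lambda>(x, y). block_error X (\<lambda>a. block_error Y (F a) y) x"
  shows "rect_lipschitz \<phi> X Y (4 * (S * X * Y)) (4 * (S * X * Y)) (4 * (S * X * Y)) (4 * (S * X * Y))"
    and "\<lbrakk>\<And>x y. X \<le> x \<Longrightarrow> Y \<le> y \<Longrightarrow> norm (F x y) \<le> P\<rbrakk> \<Longrightarrow>
       rect_lipschitz \<phi> X Y (4 * P) (4 * (S * X * Y)) (4 * (S * X * Y)) (4 * (S * X * Y))"
    and "\<lbrakk>\<And>x x' y. X \<le> x \<Longrightarrow> X \<le> x' \<Longrightarrow> Y \<le> y \<Longrightarrow> norm (F x y - F x' y) \<le> Q * \<bar>x - x'\<bar>\<rbrakk> \<Longrightarrow>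
       rect_lipschitz \<phi> X Y (4 * (Q * X)) (4 * (Q * X)) (4 * (S * X * Y)) (4 * (S * X * Y))"
    and "\<lbrakk>\<And>x y y'. X \<le> x \<Longrightarrow> Y \<le> y \<Longrightarrow> Y \<le> y' \<Longrightarrow> norm (F x y - F x y') \<le> R * \<bar>y - y'\<bar>\<rbrakk> \<Longrightarrow>
       rect_lipschitz \<phi> X Y (4 * (R * Y)) (4 * (S * X * Y)) (4 * (R * Y)) (4 * (S * X * Y))"
proof -
  have dx: "block_error Y (F a) y - block_error Y (F a') y = block_error Y (\<lambda>b. F a b - F a' b) y" for a a' y
    by (rule block_error_diff[symmetric])
  \<comment> \<open>Differences in \<open>y\<close> are moved inside the outer error, so that the
    outer estimates apply to a function of the first variable alone.\<close>
  have dy: "\<phi> (x, y) - \<phi> (x, y') = block_error X (\<lambda>a. block_error Y (F a) y - block_error Y (F a) y') x" for x y y'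
    unfolding \<phi>_def prod.case block_error_diff ..
  have l1: "norm ((block_error Y (F a) y - block_error Y (F a) y') - (block_error Y (F a') y - block_error Y (F a') y')) \<le> (2 * S * \<bar>y - y'\<bar>) * \<bar>a - a'\<bar>"
    if "X \<le> a" "X \<le> a'" for a a' y y'
  proof -
    have "norm (block_error Y (\<lambda>b. F a b - F a' b) y - block_error Y (\<lambda>b. F a b - F a' b) y') \<le> 2 * (S * \<bar>a - a'\<bar>) * \<bar>y - y'\<bar>"
      by (rule block_error_lipschitz(1)[OF XY(2)]) (use S that in auto)
    then show ?thesis unfolding dx[symmetric] by (simp add: algebra_simps)
  qed
  have mixed: "norm (\<phi> (x, y) - \<phi> (x', y) - (\<phi> (x, y') - \<phi> (x', y'))) \<le> 4 * (S * X * Y) / (X * Y) * \<bar>x - x'\<bar> * \<bar>y - y'\<bar>" for x x' y y'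
  proof -
    have "norm ((\<phi> (x, y) - \<phi> (x, y')) - (\<phi> (x', y) - \<phi> (x', y'))) \<le> 2 * (2 * S * \<bar>y - y'\<bar>) * \<bar>x - x'\<bar>"
      unfolding dy by (rule block_error_lipschitz(1)[OF XY(1)]) (rule l1)
    moreover have "4 * (S * X * Y) / (X * Y) = 4 * S" using XY by simp
    ultimately show ?thesis by (simp add: algebra_simps)
  qed
  have supp: "x \<in> {X..X + X} \<and> y \<in> {Y..Y + Y}" if "\<phi> (x, y) \<noteq> 0" for x y
  proof
    show "x \<in> {X..X + X}"
    proof (rule ccontr)
      assume "x \<notin> {X..X + X}"
      then have "x \<le> X \<or> x \<ge> 2 * X" by auto
      then show False using that block_error_outside[OF XY(1)] by (auto simp: \<phi>_def)
    qed
    show "y \<in> {Y..Y + Y}"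
    proof (rule ccontr)
      assume "y \<notin> {Y..Y + Y}"
      then have "y \<le> Y \<or> y \<ge> 2 * Y" by auto
      then have "(\<lambda>a. block_error Y (F a) y) = (\<lambda>_. 0)" using block_error_outside[OF XY(2)] by auto
      then have "\<phi> (x, y) = block_error X (\<lambda>_. 0) x" unfolding \<phi>_def prod.case by (rule arg_cong)
      then show False using that by (simp add: block_error_def Let_def)
    qed
  qed
  then have supp': "\<exists>a b. \<forall>x y. \<phi> (x, y) \<noteq> 0 \<longrightarrow> x \<in> {a..a + X} \<and> y \<in> {b..b + Y}" by blast
  have ylip: "norm (\<phi> (x, y) - \<phi> (x, y')) \<le> 4 * (S * X * Y) / Y * \<bar>y - y'\<bar>" for x y y'
  proof -
    have "norm (\<phi> (x, y) - \<phi> (x, y')) \<le> 2 * ((2 * S * \<bar>y - y'\<bar>) * X)"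
      unfolding dy by (rule block_error_lipschitz(2)[OF XY(1)]) (rule l1)
    moreover have "4 * (S * X * Y) / Y = 4 * S * X" using XY by simp
    ultimately show ?thesis by (simp add: algebra_simps)
  qed
  have l2: "norm (block_error Y (F a) y - block_error Y (F a') y) \<le> (2 * (S * Y)) * \<bar>a - a'\<bar>" if "X \<le> a" "X \<le> a'" for a a' y
  proof -
    have "norm (block_error Y (\<lambda>b. F a b - F a' b) y) \<le> 2 * ((S * \<bar>a - a'\<bar>) * Y)"
      by (rule block_error_lipschitz(2)[OF XY(2)]) (use S that in auto)
    then show ?thesis unfolding dx by (simp add: algebra_simps)
  qed
  have xlip: "norm (\<phi> (x, y) - \<phi> (x', y)) \<le> 4 * (S * X * Y) / X * \<bar>x - x'\<bar>" for x x' y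
  proof -
    have "norm (\<phi> (x, y) - \<phi> (x', y)) \<le> 2 * (2 * (S * Y)) * \<bar>x - x'\<bar>"
      unfolding \<phi>_def prod.case by (rule block_error_lipschitz(1)[OF XY(1)]) (rule l2)
    moreover have "4 * (S * X * Y) / X = 4 * S * Y" using XY by simp
    ultimately show ?thesis by (simp add: algebra_simps)
  qed
  have sup: "norm (\<phi> (x, y)) \<le> 4 * (S * X * Y)" for x y
  proof -
    have "norm (\<phi> (x, y)) \<le> 2 * ((2 * (S * Y)) * X)"
      unfolding \<phi>_def prod.case by (rule block_error_lipschitz(2)[OF XY(1)]) (rule l2)
    then show ?thesis by (simp add: algebra_simps)
  qed
  show "rect_lipschitz \<phi> X Y (4 * (S * X * Y)) (4 * (S * X * Y)) (4 * (S * X * Y)) (4 * (S * X * Y))"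
    unfolding rect_lipschitz_def by (intro conjI XY supp' allI sup xlip ylip mixed)
  show "rect_lipschitz \<phi> X Y (4 * P) (4 * (S * X * Y)) (4 * (S * X * Y)) (4 * (S * X * Y))"
    if P: "\<And>x y. X \<le> x \<Longrightarrow> Y \<le> y \<Longrightarrow> norm (F x y) \<le> P"
  proof -
    have "norm (\<phi> (x, y)) \<le> 2 * (2 * P)" for x y
      unfolding \<phi>_def prod.case by (intro block_error_bound XY P)
    then have "norm (\<phi> (x, y)) \<le> 4 * P" for x y by simp
    then show ?thesis unfolding rect_lipschitz_def by (intro conjI XY supp' allI xlip ylip mixed)
  qed
  show "rect_lipschitz \<phi> X Y (4 * (Q * X)) (4 * (Q * X)) (4 * (S * X * Y)) (4 * (S * X * Y))"
    if Q: "\<And>x x' y. X \<le> x \<Longrightarrow> X \<le> x' \<Longrightarrow> Y \<le> y \<Longrightarrow> norm (F x y - F x' y) \<le> Q * \<bar>x - x'\<bar>"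
  proof -
    have l: "norm (block_error Y (F a) y - block_error Y (F a') y) \<le> (2 * Q) * \<bar>a - a'\<bar>" if "X \<le> a" "X \<le> a'" for a a' y
    proof -
      have "norm (block_error Y (\<lambda>b. F a b - F a' b) y) \<le> 2 * (Q * \<bar>a - a'\<bar>)"
        by (rule block_error_bound[OF XY(2)]) (use Q that in auto)
      then show ?thesis unfolding dx by simp
    qed
    have "norm (\<phi> (x, y) - \<phi> (x', y)) \<le> 2 * (2 * Q) * \<bar>x - x'\<bar>" for x x' y
      unfolding \<phi>_def prod.case by (rule block_error_lipschitz(1)[OF XY(1)]) (rule l)
    moreover have "norm (\<phi> (x, y)) \<le> 2 * ((2 * Q) * X)" for x y
      unfolding \<phi>_def prod.case by (rule block_error_lipschitz(2)[OF XY(1)]) (rule l)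
    moreover have "4 * (Q * X) / X = 2 * (2 * Q)" "4 * (Q * X) = 2 * ((2 * Q) * X)" using XY by auto
    ultimately show ?thesis unfolding rect_lipschitz_def
      by (intro conjI XY supp' allI ylip mixed) (simp_all only:)
  qed
  show "rect_lipschitz \<phi> X Y (4 * (R * Y)) (4 * (S * X * Y)) (4 * (R * Y)) (4 * (S * X * Y))"
    if R: "\<And>x y y'. X \<le> x \<Longrightarrow> Y \<le> y \<Longrightarrow> Y \<le> y' \<Longrightarrow> norm (F x y - F x y') \<le> R * \<bar>y - y'\<bar>"
  proof -
    have b1: "norm (block_error Y (F a) y) \<le> 2 * (R * Y)" "norm (block_error Y (F a) y - block_error Y (F a) y') \<le> 2 * R * \<bar>y - y'\<bar>"
      if "X \<le> a" for a y y' using block_error_lipschitz[OF XY(2), of "F a" R] R that by blast+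
    have "norm (\<phi> (x, y)) \<le> 2 * (2 * (R * Y))" for x y
      unfolding \<phi>_def prod.case by (rule block_error_bound[OF XY(1)]) (rule b1)
    moreover have "norm (\<phi> (x, y) - \<phi> (x, y')) \<le> 2 * (2 * R * \<bar>y - y'\<bar>)" for x y y'
      unfolding dy by (rule block_error_bound[OF XY(1)]) (rule b1)
    moreover have "4 * (R * Y) / Y * z = 2 * (2 * R * z)" "4 * (R * Y) = 2 * (2 * (R * Y))" for z using XY by auto
    ultimately show ?thesis unfolding rect_lipschitz_def
      by (intro conjI XY supp' allI xlip mixed) (simp_all only:)
  qed
qed

section \<open>Summation over the dyadic pieces\<close>

text \<open>The exponent \<open>D\<close> only has to dominate the logarithm of the ratio \<open>s / p\<close>; when that ratio is
  larger than \<open>64 ^ D\<close>, the bound \<open>s \<le> S 2 ^ D\<close> makes the piece negligible.\<close>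

lemma fourier_bounded_log:
  assumes rl: "rect_lipschitz \<phi> X Y (4 * p) (4 * s) (4 * s) (4 * s)" and s: "s \<le> S * 2 ^ D" and D: "D \<ge> 2"
  shows "fourier_bounded \<phi> (ennreal (96 * p + 96 * (sqrt (p * s) * sqrt (7 * real D)) + 96 * (S * (1/2) ^ D)))"
proof -
  have nn: "0 \<le> p" "0 \<le> s" using rect_lipschitz_nonneg[OF rl] by auto
  then have S: "0 \<le> S" using s by (smt (verit) zero_le_mult_iff zero_less_power)
  have sum_nn: "0 \<le> 96 * p" "0 \<le> 96 * (sqrt (p * s) * sqrt (7 * real D))" "0 \<le> 96 * (S * (1/2) ^ D)"
    using nn S by auto
  \<comment> \<open>A vanishing piece, a piece for which \<open>T = 1\<close> suffices, a ratio
    \<open>s / p\<close> within the range allowed by \<open>D\<close>, and a larger ratio.\<close>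
  consider "p = 0 \<or> s = 0" | "p > 0" "s > 0" "s \<le> p" | "p > 0" "p < s" "s \<le> 2 ^ (6 * D) * p" | "p > 0" "s > 2 ^ (6 * D) * p"
    using nn by linarith
  then show ?thesis
  proof cases
    case 1
    then have "\<phi> = (\<lambda>_. 0)" using rect_lipschitz_eq_0[OF rl] by auto
    then show ?thesis by (simp add: fourier_bounded_0)
  next
    case 2
    have "fourier_bounded \<phi> (ennreal (12 * (8 * p) * sqrt (1 * (1 + ln 1))))"
      by (rule fourier_bounded_log_weight[OF rl]) (use 2 in auto)
    then show ?thesis by (rule fourier_bounded_mono) (use sum_nn in \<open>auto intro!: ennreal_leI\<close>)
  next
    case 3
    define T where "T = s / p"
    have T: "T \<ge> 1" "T \<le> 2 ^ (6 * D)" using 3 by (auto simp: T_def field_simps)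
    have "ln T \<le> ln (2 ^ (6 * D))" using T by (subst ln_le_cancel_iff) auto
    also have "\<dots> = real (6 * D) * ln 2" by (rule ln_realpow)
    also have "\<dots> \<le> real (6 * D) * 1" using ln_2_less_1 by (intro mult_left_mono) auto
    finally have lnT: "1 + ln T \<le> 7 * real D" using D by simp
    have "fourier_bounded \<phi> (ennreal (12 * (8 * p) * sqrt (T * (1 + ln T))))"
      by (rule fourier_bounded_log_weight[OF rl T(1)]) (use 3 in \<open>auto simp: T_def\<close>)
    moreover have "12 * (8 * p) * sqrt (T * (1 + ln T)) \<le> 96 * (sqrt (p * s) * sqrt (7 * real D))"
    proof -
      have "p * sqrt (T * (1 + ln T)) \<le> p * sqrt (T * (7 * real D))"
        using 3 T lnT by (intro mult_left_mono real_sqrt_le_mono) auto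
      also have "\<dots> = sqrt (p * p * (T * (7 * real D)))" using 3 by (simp add: real_sqrt_mult)
      also have "p * p * (T * (7 * real D)) = p * s * (7 * real D)" using 3 by (simp add: T_def)
      also have "sqrt (p * s * (7 * real D)) = sqrt (p * s) * sqrt (7 * real D)" by (rule real_sqrt_mult)
      finally show ?thesis by simp
    qed
    then have "ennreal (12 * (8 * p) * sqrt (T * (1 + ln T))) \<le> ennreal (96 * p + 96 * (sqrt (p * s) * sqrt (7 * real D)) + 96 * (S * (1/2) ^ D))"
      using sum_nn by (intro ennreal_leI) linarith
    ultimately show ?thesis by (rule fourier_bounded_mono)
  next
    case 4
    \<comment> \<open>With this exponent \<open>s / T\<close> is at most
      \<open>S * 2 ^ D / 2 ^ (6 * D)\<close> and the weight factor at most
      \<open>2 ^ (4 * D)\<close>, so the product decays like \<open>(1/2) ^ D\<close>.\<close>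
    define T where "T = (2::real) ^ (6 * D)"
    have T: "T \<ge> 1" by (simp add: T_def)
    have s0: "s > 0" using 4 by (smt (verit) mult_pos_pos zero_less_power)
    have "ln T = real (6 * D) * ln 2" unfolding T_def by (rule ln_realpow)
    also have "\<dots> \<le> real (6 * D) * 1" using ln_2_less_1 by (intro mult_left_mono) auto
    finally have lnT: "1 + ln T \<le> 7 * real D" using D by simp
    \<comment> \<open>The induction starts at \<open>D = 2\<close> with
      \<open>14 \<le> 16\<close>.\<close>
    have "7 * D \<le> 4 ^ D" using D
    proof (induction D rule: dec_induct)
      case (step n) then show ?case by simp
    qed simp
    then have D4: "7 * real D \<le> 4 ^ D" by (metis of_nat_le_iff of_nat_mult of_nat_numeral of_nat_power)
    have "p \<le> s / T" using 4 T by (simp add: T_def field_simps)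
    then have "fourier_bounded \<phi> (ennreal (12 * (8 * (s / T)) * sqrt (T * (1 + ln T))))"
      using T s0 by (intro fourier_bounded_log_weight[OF rl T]) auto
    moreover have "12 * (8 * (s / T)) * sqrt (T * (1 + ln T)) \<le> 96 * (S * (1/2) ^ D)"
    proof -
      have "sqrt (T * (1 + ln T)) \<le> sqrt (T * 4 ^ D)"
        using T lnT D4 by (intro real_sqrt_le_mono mult_left_mono) auto
      also have "T * 4 ^ D = (2 ^ (4 * D))\<^sup>2"
      proof -
        have "(4::real) ^ D = 2 ^ (2 * D)" by (simp add: power_mult)
        then show ?thesis unfolding T_def by (simp flip: power_add power_mult)
      qed
      finally have "sqrt (T * (1 + ln T)) \<le> 2 ^ (4 * D)" by simp
      then have "s / T * sqrt (T * (1 + ln T)) \<le> (S * 2 ^ D) / T * 2 ^ (4 * D)"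
        using s s0 T nn S lnT by (intro mult_mono divide_right_mono) (auto intro!: add_nonneg_nonneg)
      also have "\<dots> = S * (1/2) ^ D"
      proof -
        have "T = 2 ^ D * 2 ^ D * 2 ^ (4 * D)" unfolding T_def by (simp flip: power_add)
        then show ?thesis by (simp add: power_divide)
      qed
      finally show ?thesis by simp
    qed
    then have "ennreal (12 * (8 * (s / T)) * sqrt (T * (1 + ln T))) \<le> ennreal (96 * p + 96 * (sqrt (p * s) * sqrt (7 * real D)) + 96 * (S * (1/2) ^ D))"
      using sum_nn by (intro ennreal_leI) linarith
    ultimately show ?thesis by (rule fourier_bounded_mono)
  qed
qed

section \<open>Pieces in the four regions of low and high scales\<close>

lemma low_part_scale:
  "low_part i u x = scale_part (2 * (1/2) ^ i) ((1/2) ^ i) 1 (\<lambda>x. low_bumps i x - trapezoid x / 2) ((1/2) ^ i) u x"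
  by (simp add: low_part_def scale_part_def)

lemma high_part_scale:
  "high_part i u x = scale_part (2 ^ Suc i) (2 ^ Suc i) 0 (\<lambda>x. hat (x / 2 ^ Suc i) + (if i = 0 then trapezoid x / 2 else 0)) (2 ^ Suc i) u x"
  by (simp add: high_part_def scale_part_def)

lemma fourier_bounded_parts_le:
  fixes F :: "real \<Rightarrow> real \<Rightarrow> complex"
  assumes e: "bump_sum n1 e1" "bump_sum n2 e2"
    and 1: "norm ((F A1 A2 - complex_of_real \<delta>2 * F A1 B2) - complex_of_real \<delta>1 * (F B1 A2 - complex_of_real \<delta>2 * F B1 B2)) \<le> M"
    and 2: "profile (block_error X (\<lambda>a. F a A2 - complex_of_real \<delta>2 * F a B2)) X p1 t1"
    and 3: "profile (block_error Y (\<lambda>b. F A1 b - complex_of_real \<delta>1 * F B1 b)) Y p2 t2"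
    and 4: "fourier_bounded (\<lambda>(x, y). block_error X (\<lambda>a. block_error Y (F a) (\<sigma>2 * y)) (\<sigma>1 * x)) (ennreal d)"
    and \<sigma>: "\<bar>\<sigma>1\<bar> = 1" "\<bar>\<sigma>2\<bar> = 1"
    and le: "0 \<le> d" "real n1 * (real n2 * (32 * pi * M)) + real n2 * (16 * pi * sqrt (p1 * t1)) + real n1 * (16 * pi * sqrt (p2 * t2)) + d \<le> B"
  shows "fourier_bounded (\<lambda>(x, y). scale_part A1 B1 \<delta>1 e1 X (\<lambda>a. scale_part A2 B2 \<delta>2 e2 Y (F a) (\<sigma>2 * y)) (\<sigma>1 * x)) (ennreal B)"
proof (rule fourier_bounded_mono[OF fourier_bounded_parts[OF e 1 2 3 4 \<sigma>]])
  have M: "0 \<le> M" using 1 norm_ge_zero order_trans by blast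
  have nn: "0 \<le> real n1 * (real n2 * (32 * pi * M)) + real n2 * (16 * pi * sqrt (p1 * t1)) + real n1 * (16 * pi * sqrt (p2 * t2))"
    using M profile_nonneg[OF 2] profile_nonneg[OF 3] by (intro add_nonneg_nonneg mult_nonneg_nonneg) auto
  show "ennreal (real n1 * (real n2 * (32 * pi * M)) + real n2 * (16 * pi * sqrt (p1 * t1)) + real n1 * (16 * pi * sqrt (p2 * t2))) + ennreal d \<le> ennreal B"
    unfolding ennreal_plus[OF nn le(1), symmetric] by (rule ennreal_leI[OF le(2)])
qed

text \<open>Absorbs the terms with fewer bump counts into the one with the full product of
  counts.\<close>

lemma le_nat_multiples:
  fixes z :: real
  assumes "0 \<le> z"
  shows "z \<le> real (Suc i) * (real (Suc k) * z)" "real (Suc k) * z \<le> real (Suc i) * (real (Suc k) * z)"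
    "real (Suc i) * z \<le> real (Suc i) * (real (Suc k) * z)" "z \<le> real (Suc k) * z"
proof -
  have *: "w \<le> real (Suc j) * w" if "0 \<le> w" for w :: real and j
    using mult_right_mono[of 1 "real (Suc j)" w] that by simp
  show "z \<le> real (Suc k) * z" by (rule *[OF assms])
  show "real (Suc k) * z \<le> real (Suc i) * (real (Suc k) * z)" using assms by (intro *) auto
  then show "z \<le> real (Suc i) * (real (Suc k) * z)" using *[OF assms, of k] by linarith
  show "real (Suc i) * z \<le> real (Suc i) * (real (Suc k) * z)" by (intro mult_left_mono * assms) auto
qed

text \<open>\<open>F\<close> is \<open>f\<close> with a quadrant reflected onto the positive one;
  \<open>P\<close>, \<open>Q\<close>, \<open>R\<close>, \<open>S\<close> stand for the majorants
  with indices 00, 10, 01, 11. High blocks begin at \<open>2\<close>, hence this threshold; each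
  bound is requested only in the range of scales where it is used.\<close>

locale quadrant =
  fixes F :: "real \<Rightarrow> real \<Rightarrow> complex" and P Q R S :: "real \<Rightarrow> real \<Rightarrow> real"
  assumes P: "2 \<le> X \<Longrightarrow> 2 \<le> Y \<Longrightarrow> X \<le> x \<Longrightarrow> Y \<le> y \<Longrightarrow> norm (F x y) \<le> P X Y"
    and Q: "0 < X \<Longrightarrow> 2 \<le> Y \<Longrightarrow> X \<le> x \<Longrightarrow> X \<le> x' \<Longrightarrow> Y \<le> y \<Longrightarrow> norm (F x y - F x' y) \<le> Q X Y * \<bar>x - x'\<bar>"
    and R: "2 \<le> X \<Longrightarrow> 0 < Y \<Longrightarrow> X \<le> x \<Longrightarrow> Y \<le> y \<Longrightarrow> Y \<le> y' \<Longrightarrow> norm (F x y - F x y') \<le> R X Y * \<bar>y - y'\<bar>"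
    and S: "0 < X \<Longrightarrow> 0 < Y \<Longrightarrow> X \<le> x \<Longrightarrow> X \<le> x' \<Longrightarrow> Y \<le> y \<Longrightarrow> Y \<le> y' \<Longrightarrow>
      norm (F x y - F x' y - (F x y' - F x' y')) \<le> S X Y * \<bar>x - x'\<bar> * \<bar>y - y'\<bar>"
begin

lemma nonneg:
  shows "2 \<le> X \<Longrightarrow> 2 \<le> Y \<Longrightarrow> 0 \<le> P X Y" "0 < X \<Longrightarrow> 2 \<le> Y \<Longrightarrow> 0 \<le> Q X Y"
    "2 \<le> X \<Longrightarrow> 0 < Y \<Longrightarrow> 0 \<le> R X Y" "0 < X \<Longrightarrow> 0 < Y \<Longrightarrow> 0 \<le> S X Y"
proof -
  show "0 \<le> P X Y" if "2 \<le> X" "2 \<le> Y"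
    using order_trans[OF norm_ge_zero P[OF that, of X Y]] by simp
  show "0 \<le> Q X Y" if "0 < X" "2 \<le> Y"
    using order_trans[OF norm_ge_zero Q[OF that, of X "X + 1" Y]] by simp
  show "0 \<le> R X Y" if "2 \<le> X" "0 < Y"
    using order_trans[OF norm_ge_zero R[OF that, of X Y "Y + 1"]] by simp
  show "0 \<le> S X Y" if "0 < X" "0 < Y"
    using order_trans[OF norm_ge_zero S[OF that, of X "X + 1" Y "Y + 1"]] by simp
qed

lemma reflected_rect:
  assumes rl: "rect_lipschitz (\<lambda>(x, y). block_error X (\<lambda>a. block_error Y (F a) y) x) X Y p q r w"
    and "\<bar>\<sigma>1\<bar> = 1" "\<bar>\<sigma>2\<bar> = 1"
  shows "rect_lipschitz (\<lambda>(x, y). block_error X (\<lambda>a. block_error Y (F a) (\<sigma>2 * y)) (\<sigma>1 * x)) X Y p q r w"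
  using rect_lipschitz_reflect[OF assms] by simp

text \<open>Near both axes all four products are controlled by the mixed difference alone, so no
  geometric mean of different quantities appears. The counts \<open>Suc i\<close> and
  \<open>Suc k\<close> are numbers of bumps, and \<open>112\<close> is
  \<open>32 + 32 + 32 + 16\<close>.\<close>

lemma fourier_bounded_low_low:
  assumes \<sigma>: "\<bar>\<sigma>1\<bar> = 1" "\<bar>\<sigma>2\<bar> = 1"
  defines "X \<equiv> \<lambda>i. (1/2) ^ i"
  shows "fourier_bounded (\<lambda>(x, y). low_part i (\<lambda>a. low_part k (F a) (\<sigma>2 * y)) (\<sigma>1 * x))
    (ennreal (112 * pi * (real (Suc i) * real (Suc k) * (S (X i) (X k) * X i * X k))))"
proof -
  let ?X = "X i" and ?Y = "X k"
  have X: "?X > 0" "?Y > 0" by (auto simp: X_def)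
  define s where "s = S ?X ?Y * ?X * ?Y"
  have s: "s \<ge> 0" using nonneg(4)[OF X] X by (simp add: s_def)
  note Sb = S[OF X]
  show ?thesis
    unfolding low_part_scale X_def[symmetric]
  proof (rule fourier_bounded_parts_le[OF bump_sum_low bump_sum_low _ _ _ _ \<sigma>])
    show "norm (F (2 * ?X) (2 * ?Y) - complex_of_real 1 * F (2 * ?X) ?Y - complex_of_real 1 * (F ?X (2 * ?Y) - complex_of_real 1 * F ?X ?Y)) \<le> s"
      using Sb[of "2 * ?X" ?X "2 * ?Y" ?Y] X by (simp add: s_def algebra_simps)
    have "profile (block_error ?X (\<lambda>a. F a (2 * ?Y) - complex_of_real 1 * F a ?Y)) ?X (2 * ((S ?X ?Y * ?Y) * ?X)) (2 * ((S ?X ?Y * ?Y) * ?X))"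
    proof (rule profile_block_error_lipschitz[OF X(1)])
      fix x x' assume "?X \<le> x" "?X \<le> x'"
      then show "norm (F x (2 * ?Y) - complex_of_real 1 * F x ?Y - (F x' (2 * ?Y) - complex_of_real 1 * F x' ?Y)) \<le> S ?X ?Y * ?Y * \<bar>x - x'\<bar>"
        using Sb[of x x' "2 * ?Y" ?Y] X by (simp add: algebra_simps)
    qed
    then show "profile (block_error ?X (\<lambda>a. F a (2 * ?Y) - complex_of_real 1 * F a ?Y)) ?X (2 * s) (2 * s)" by (simp add: s_def mult_ac)
    have "profile (block_error ?Y (\<lambda>b. F (2 * ?X) b - complex_of_real 1 * F ?X b)) ?Y (2 * ((S ?X ?Y * ?X) * ?Y)) (2 * ((S ?X ?Y * ?X) * ?Y))"
    proof (rule profile_block_error_lipschitz[OF X(2)])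
      fix y y' assume "?Y \<le> y" "?Y \<le> y'"
      then show "norm (F (2 * ?X) y - complex_of_real 1 * F ?X y - (F (2 * ?X) y' - complex_of_real 1 * F ?X y')) \<le> S ?X ?Y * ?X * \<bar>y - y'\<bar>"
        using Sb[of "2 * ?X" ?X y y'] X by (simp add: algebra_simps)
    qed
    then show "profile (block_error ?Y (\<lambda>b. F (2 * ?X) b - complex_of_real 1 * F ?X b)) ?Y (2 * s) (2 * s)" by (simp add: s_def mult_ac)
    have "rect_lipschitz (\<lambda>(x, y). block_error ?X (\<lambda>a. block_error ?Y (F a) y) x) ?X ?Y (4 * s) (4 * s) (4 * s) (4 * s)"
      unfolding s_def by (rule rect_lipschitz_block_error(1)[OF X Sb])
    from fourier_bounded_geometric_mean[OF disjI1[OF reflected_rect[OF this \<sigma>]]]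
    show "fourier_bounded (\<lambda>(x, y). block_error ?X (\<lambda>a. block_error ?Y (F a) (\<sigma>2 * y)) (\<sigma>1 * x)) (ennreal (4 * pi * sqrt (4 * s * (4 * s))))" .
    show "real (Suc i) * (real (Suc k) * (32 * pi * s)) + real (Suc k) * (16 * pi * sqrt (2 * s * (2 * s))) +
        real (Suc i) * (16 * pi * sqrt (2 * s * (2 * s))) + 4 * pi * sqrt (4 * s * (4 * s))
      \<le> 112 * pi * (real (Suc i) * real (Suc k) * (S ?X ?Y * ?X * ?Y))"
    proof -
      have sq: "sqrt (2 * s * (2 * s)) = 2 * s" "sqrt (4 * s * (4 * s)) = 4 * s" using s by (simp_all only: real_sqrt_abs2)
      have "0 \<le> pi * s" using s by simp
      from le_nat_multiples(1-3)[OF this, where i=i and k=k] show ?thesis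
        unfolding sq s_def[symmetric] by (simp add: algebra_simps)
    qed
  qed (use s in auto)
qed

text \<open>The first variable enters through increments, of size \<open>q\<close>. Errors in the
  second variable have size \<open>q\<close> and differences \<open>s\<close>, hence the square
  root.\<close>

lemma fourier_bounded_low_high:
  assumes \<sigma>: "\<bar>\<sigma>1\<bar> = 1" "\<bar>\<sigma>2\<bar> = 1"
  defines "X \<equiv> \<lambda>i. (1/2) ^ i" and "Y \<equiv> \<lambda>k. 2 ^ Suc k"
  shows "fourier_bounded (\<lambda>(x, y). low_part i (\<lambda>a. high_part k (F a) (\<sigma>2 * y)) (\<sigma>1 * x))
    (ennreal (128 * pi * (real (Suc i) * (Q (X i) (Y k) * X i + sqrt (Q (X i) (Y k) * X i * (S (X i) (Y k) * X i * Y k))))))"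
proof -
  let ?X = "X i" and ?Y = "Y k"
  have X: "?X > 0" "?Y > 0" by (auto simp: X_def Y_def)
  have Y2: "2 \<le> ?Y" by (simp add: Y_def)
  have XL: "(1/2) ^ j = X j" and YH: "2 ^ Suc j = Y j" for j by (simp_all add: X_def Y_def)
  define q where "q = Q ?X ?Y * ?X"
  define s where "s = S ?X ?Y * ?X * ?Y"
  have qs: "q \<ge> 0" "s \<ge> 0" using nonneg X Y2 by (auto simp: q_def s_def)
  note Sb = S[OF X] and Qb = Q[OF X(1) Y2]
  show ?thesis
    unfolding low_part_scale high_part_scale XL YH
  proof (rule fourier_bounded_parts_le[OF bump_sum_low bump_sum_high[unfolded YH] _ _ _ _ \<sigma>])
    show "norm (F (2 * ?X) ?Y - complex_of_real 0 * F (2 * ?X) ?Y - complex_of_real 1 * (F ?X ?Y - complex_of_real 0 * F ?X ?Y)) \<le> q"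
      using Qb[of "2 * ?X" ?X ?Y] X by (simp add: q_def)
    have "profile (block_error ?X (\<lambda>a. F a ?Y - complex_of_real 0 * F a ?Y)) ?X (2 * (Q ?X ?Y * ?X)) (2 * (Q ?X ?Y * ?X))"
      by (rule profile_block_error_lipschitz[OF X(1)]) (use Qb in auto)
    then show "profile (block_error ?X (\<lambda>a. F a ?Y - complex_of_real 0 * F a ?Y)) ?X (2 * q) (2 * q)" by (simp only: q_def)
    have "profile (block_error ?Y (\<lambda>b. F (2 * ?X) b - complex_of_real 1 * F ?X b)) ?Y (2 * q) (2 * ((S ?X ?Y * ?X) * ?Y))"
    proof (rule profile_block_error[OF X(2)])
      fix y y' assume "?Y \<le> y"
      then show "norm (F (2 * ?X) y - complex_of_real 1 * F ?X y) \<le> q"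
        using Qb[of "2 * ?X" ?X y] X by (simp add: q_def)
      assume "?Y \<le> y'"
      with \<open>?Y \<le> y\<close> show "norm (F (2 * ?X) y - complex_of_real 1 * F ?X y - (F (2 * ?X) y' - complex_of_real 1 * F ?X y')) \<le> S ?X ?Y * ?X * \<bar>y - y'\<bar>"
        using Sb[of "2 * ?X" ?X y y'] X by (simp add: algebra_simps)
    qed
    then show "profile (block_error ?Y (\<lambda>b. F (2 * ?X) b - complex_of_real 1 * F ?X b)) ?Y (2 * q) (2 * s)" by (simp only: s_def)
    have "rect_lipschitz (\<lambda>(x, y). block_error ?X (\<lambda>a. block_error ?Y (F a) y) x) ?X ?Y (4 * q) (4 * q) (4 * s) (4 * s)"
      unfolding s_def q_def by (rule rect_lipschitz_block_error(3)[OF X Sb Qb])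
    from fourier_bounded_geometric_mean[OF disjI1[OF reflected_rect[OF this \<sigma>]]]
    show "fourier_bounded (\<lambda>(x, y). block_error ?X (\<lambda>a. block_error ?Y (F a) (\<sigma>2 * y)) (\<sigma>1 * x)) (ennreal (4 * pi * sqrt (4 * q * (4 * s))))" .
    show "real (Suc i) * (real 2 * (32 * pi * q)) + real 2 * (16 * pi * sqrt (2 * q * (2 * q))) +
        real (Suc i) * (16 * pi * sqrt (2 * q * (2 * s))) + 4 * pi * sqrt (4 * q * (4 * s))
      \<le> 128 * pi * (real (Suc i) * (Q ?X ?Y * ?X + sqrt (Q ?X ?Y * ?X * (S ?X ?Y * ?X * ?Y))))"
    proof -
      have sq: "sqrt (2 * q * (2 * q)) = 2 * q" "sqrt (2 * q * (2 * s)) = 2 * sqrt (q * s)" "sqrt (4 * q * (4 * s)) = 4 * sqrt (q * s)"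
        using qs by (simp_all add: real_sqrt_mult)
      have nn: "0 \<le> pi * q" "0 \<le> pi * sqrt (q * s)" using qs by simp_all
      from le_nat_multiples(4)[OF nn(1), where k=i] le_nat_multiples(4)[OF nn(2), where k=i] nn show ?thesis
        unfolding sq s_def[symmetric] q_def[symmetric] by (simp add: algebra_simps)
    qed
  qed (use qs in auto)
qed

text \<open>The mirror image of the region low-high; now the loss from size to difference occurs in
  the first variable, so the other alternative of the geometric mean estimate applies.\<close>

lemma fourier_bounded_high_low:
  assumes \<sigma>: "\<bar>\<sigma>1\<bar> = 1" "\<bar>\<sigma>2\<bar> = 1"
  defines "X \<equiv> \<lambda>i. 2 ^ Suc i" and "Y \<equiv> \<lambda>k. (1/2) ^ k"
  shows "fourier_bounded (\<lambda>(x, y). high_part i (\<lambda>a. low_part k (F a) (\<sigma>2 * y)) (\<sigma>1 * x))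
    (ennreal (128 * pi * (real (Suc k) * (R (X i) (Y k) * Y k + sqrt (R (X i) (Y k) * Y k * (S (X i) (Y k) * X i * Y k))))))"
proof -
  let ?X = "X i" and ?Y = "Y k"
  have X: "?X > 0" "?Y > 0" by (auto simp: X_def Y_def)
  have X2: "2 \<le> ?X" by (simp add: X_def)
  have YL: "(1/2) ^ j = Y j" and XH: "2 ^ Suc j = X j" for j by (simp_all add: X_def Y_def)
  define r where "r = R ?X ?Y * ?Y"
  define s where "s = S ?X ?Y * ?X * ?Y"
  have rs: "r \<ge> 0" "s \<ge> 0" using nonneg X X2 by (auto simp: r_def s_def)
  note Sb = S[OF X] and Rb = R[OF X2 X(2)]
  show ?thesis
    unfolding low_part_scale high_part_scale YL XH
  proof (rule fourier_bounded_parts_le[OF bump_sum_high[unfolded XH] bump_sum_low _ _ _ _ \<sigma>])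
    show "norm (F ?X (2 * ?Y) - complex_of_real 1 * F ?X ?Y - complex_of_real 0 * (F ?X (2 * ?Y) - complex_of_real 1 * F ?X ?Y)) \<le> r"
      using Rb[of ?X "2 * ?Y" ?Y] X by (simp add: r_def)
    have "profile (block_error ?Y (\<lambda>b. F ?X b - complex_of_real 0 * F ?X b)) ?Y (2 * (R ?X ?Y * ?Y)) (2 * (R ?X ?Y * ?Y))"
      by (rule profile_block_error_lipschitz[OF X(2)]) (use Rb in auto)
    then show "profile (block_error ?Y (\<lambda>b. F ?X b - complex_of_real 0 * F ?X b)) ?Y (2 * r) (2 * r)" by (simp only: r_def)
    have "profile (block_error ?X (\<lambda>a. F a (2 * ?Y) - complex_of_real 1 * F a ?Y)) ?X (2 * r) (2 * ((S ?X ?Y * ?Y) * ?X))"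
    proof (rule profile_block_error[OF X(1)])
      fix x x' assume "?X \<le> x"
      then show "norm (F x (2 * ?Y) - complex_of_real 1 * F x ?Y) \<le> r"
        using Rb[of x "2 * ?Y" ?Y] X by (simp add: r_def)
      assume "?X \<le> x'"
      with \<open>?X \<le> x\<close> show "norm (F x (2 * ?Y) - complex_of_real 1 * F x ?Y - (F x' (2 * ?Y) - complex_of_real 1 * F x' ?Y)) \<le> S ?X ?Y * ?Y * \<bar>x - x'\<bar>"
        using Sb[of x x' "2 * ?Y" ?Y] X by (simp add: algebra_simps)
    qed
    then show "profile (block_error ?X (\<lambda>a. F a (2 * ?Y) - complex_of_real 1 * F a ?Y)) ?X (2 * r) (2 * s)" by (simp add: s_def mult_ac)
    have "rect_lipschitz (\<lambda>(x, y). block_error ?X (\<lambda>a. block_error ?Y (F a) y) x) ?X ?Y (4 * r) (4 * s) (4 * r) (4 * s)"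
      unfolding s_def r_def by (rule rect_lipschitz_block_error(4)[OF X Sb Rb])
    from fourier_bounded_geometric_mean[OF disjI2[OF reflected_rect[OF this \<sigma>]]]
    show "fourier_bounded (\<lambda>(x, y). block_error ?X (\<lambda>a. block_error ?Y (F a) (\<sigma>2 * y)) (\<sigma>1 * x)) (ennreal (4 * pi * sqrt (4 * r * (4 * s))))" .
    show "real 2 * (real (Suc k) * (32 * pi * r)) + real (Suc k) * (16 * pi * sqrt (2 * r * (2 * s))) +
        real 2 * (16 * pi * sqrt (2 * r * (2 * r))) + 4 * pi * sqrt (4 * r * (4 * s))
      \<le> 128 * pi * (real (Suc k) * (R ?X ?Y * ?Y + sqrt (R ?X ?Y * ?Y * (S ?X ?Y * ?X * ?Y))))"
    proof -
      have sq: "sqrt (2 * r * (2 * r)) = 2 * r" "sqrt (2 * r * (2 * s)) = 2 * sqrt (r * s)" "sqrt (4 * r * (4 * s)) = 4 * sqrt (r * s)"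
        using rs by (simp_all add: real_sqrt_mult)
      have nn: "0 \<le> pi * r" "0 \<le> pi * sqrt (r * s)" using rs by simp_all
      from le_nat_multiples(4)[OF nn(1), where k=k] le_nat_multiples(4)[OF nn(2), where k=k] nn show ?thesis
        unfolding sq s_def[symmetric] r_def[symmetric] by (simp add: algebra_simps)
    qed
  qed (use rs in auto)
qed

text \<open>Far from both axes the double error has size \<open>p\<close> but all its differences
  are of order \<open>s\<close>; for it the logarithmic estimate replaces the geometric
  mean.\<close>

lemma fourier_bounded_high_high:
  assumes \<sigma>: "\<bar>\<sigma>1\<bar> = 1" "\<bar>\<sigma>2\<bar> = 1" and S0: "\<And>X Y. 2 \<le> X \<Longrightarrow> 2 \<le> Y \<Longrightarrow> S X Y \<le> S0"
  defines "X \<equiv> \<lambda>i. 2 ^ Suc i"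
  shows "fourier_bounded (\<lambda>(x, y). high_part i (\<lambda>a. high_part k (F a) (\<sigma>2 * y)) (\<sigma>1 * x))
    (ennreal (400 * pi * (P (X i) (X k) + sqrt (P (X i) (X k) * (Q (X i) (X k) * X i)) + sqrt (P (X i) (X k) * (R (X i) (X k) * X k)) +
      sqrt (real (Suc i) * real (Suc k)) * sqrt (P (X i) (X k) * (S (X i) (X k) * X i * X k)) + S0 * (1/2) ^ (i + k + 2))))"
proof -
  let ?X = "X i" and ?Y = "X k"
  have X: "?X > 0" "?Y > 0" and X2: "2 \<le> ?X" "2 \<le> ?Y" by (auto simp: X_def)
  have XH: "2 ^ Suc j = X j" for j by (simp add: X_def)
  define p where "p = P ?X ?Y"
  define q where "q = Q ?X ?Y * ?X"
  define r where "r = R ?X ?Y * ?Y"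
  define s where "s = S ?X ?Y * ?X * ?Y"
  have nn: "p \<ge> 0" "q \<ge> 0" "r \<ge> 0" "s \<ge> 0" using nonneg X X2 by (auto simp: p_def q_def r_def s_def)
  have S0nn: "S0 \<ge> 0" using nonneg(4)[OF X] S0[OF X2] by linarith
  note Sb = S[OF X] and Pb = P[OF X2] and Qb = Q[OF X(1) X2(2)] and Rb = R[OF X2(1) X(2)]
  \<comment> \<open>\<open>X i * X k\<close> is \<open>2 ^ D\<close>, so \<open>s\<close> is at most
    \<open>S0 * 2 ^ D\<close>, as the logarithmic estimate asks.\<close>
  define D where "D = i + k + 2"
  have sD: "s \<le> S0 * 2 ^ D"
  proof -
    have "s = S ?X ?Y * 2 ^ D" by (simp add: s_def X_def D_def power_add)
    then show ?thesis using S0[OF X2] by simp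
  qed
  define d where "d = 96 * p + 96 * (sqrt (p * s) * sqrt (7 * real D)) + 96 * (S0 * (1/2) ^ D)"
  show ?thesis
    unfolding high_part_scale XH
  proof (rule fourier_bounded_parts_le[OF bump_sum_high[unfolded XH] bump_sum_high[unfolded XH] _ _ _ _ \<sigma>])
    show "norm (F ?X ?Y - complex_of_real 0 * F ?X ?Y - complex_of_real 0 * (F ?X ?Y - complex_of_real 0 * F ?X ?Y)) \<le> p"
      using Pb[of ?X ?Y] by (simp add: p_def)
    have "profile (block_error ?X (\<lambda>a. F a ?Y - complex_of_real 0 * F a ?Y)) ?X (2 * p) (2 * (Q ?X ?Y * ?X))"
      by (rule profile_block_error[OF X(1)]) (use Qb Pb in \<open>auto simp: p_def\<close>)
    then show "profile (block_error ?X (\<lambda>a. F a ?Y - complex_of_real 0 * F a ?Y)) ?X (2 * p) (2 * q)" by (simp only: q_def)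
    have "profile (block_error ?Y (\<lambda>b. F ?X b - complex_of_real 0 * F ?X b)) ?Y (2 * p) (2 * (R ?X ?Y * ?Y))"
      by (rule profile_block_error[OF X(2)]) (use Rb Pb in \<open>auto simp: p_def\<close>)
    then show "profile (block_error ?Y (\<lambda>b. F ?X b - complex_of_real 0 * F ?X b)) ?Y (2 * p) (2 * r)" by (simp only: r_def)
    have "rect_lipschitz (\<lambda>(x, y). block_error ?X (\<lambda>a. block_error ?Y (F a) y) x) ?X ?Y (4 * p) (4 * s) (4 * s) (4 * s)"
      unfolding s_def p_def by (rule rect_lipschitz_block_error(2)[OF X Sb Pb])
    from fourier_bounded_log[OF reflected_rect[OF this \<sigma>] sD]
    show "fourier_bounded (\<lambda>(x, y). block_error ?X (\<lambda>a. block_error ?Y (F a) (\<sigma>2 * y)) (\<sigma>1 * x)) (ennreal d)"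
      unfolding d_def by (simp add: D_def)
    show "0 \<le> d" unfolding d_def using nn S0nn by (intro add_nonneg_nonneg mult_nonneg_nonneg) auto
    show "real 2 * (real 2 * (32 * pi * p)) + real 2 * (16 * pi * sqrt (2 * p * (2 * q))) +
        real 2 * (16 * pi * sqrt (2 * p * (2 * r))) + d
      \<le> 400 * pi * (P ?X ?Y + sqrt (P ?X ?Y * (Q ?X ?Y * ?X)) + sqrt (P ?X ?Y * (R ?X ?Y * ?Y)) +
      sqrt (real (Suc i) * real (Suc k)) * sqrt (P ?X ?Y * (S ?X ?Y * ?X * ?Y)) + S0 * (1/2) ^ (i + k + 2))"
    proof -
      have sq: "sqrt (2 * p * (2 * q)) = 2 * sqrt (p * q)" "sqrt (2 * p * (2 * r)) = 2 * sqrt (p * r)"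
        using nn by (simp_all add: real_sqrt_mult)
      define a where "a = sqrt (real (Suc i) * real (Suc k)) * sqrt (p * s)"
      define b where "b = S0 * (1/2) ^ D"
      have ab: "0 \<le> a" "0 \<le> b" using nn S0nn by (auto simp: a_def b_def)
      \<comment> \<open>The sum \<open>i + k\<close> from the logarithm is relaxed to a product, so
        that the weights separate and the tail inequality can act in each variable.\<close>
      have "7 * real D \<le> 16 * (real (Suc i) * real (Suc k))" by (simp add: D_def algebra_simps)
      then have "sqrt (7 * real D) \<le> sqrt (16 * (real (Suc i) * real (Suc k)))" by (rule real_sqrt_le_mono)
      also have "\<dots> = 4 * sqrt (real (Suc i) * real (Suc k))" by (simp add: real_sqrt_mult)
      finally have "sqrt (p * s) * sqrt (7 * real D) \<le> sqrt (p * s) * (4 * sqrt (real (Suc i) * real (Suc k)))"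
        using nn by (intro mult_left_mono) auto
      then have "d \<le> 96 * p + 384 * a + 96 * b" by (simp add: d_def a_def b_def mult_ac)
      moreover have "96 * p + 384 * a + 96 * b \<le> pi * (96 * p + 384 * a + 96 * b)"
        using mult_right_mono[of 1 pi "96 * p + 384 * a + 96 * b"] pi_ge_two nn ab by simp
      moreover have "0 \<le> pi * p" "0 \<le> pi * a" "0 \<le> pi * b" "0 \<le> pi * sqrt (p * q)" "0 \<le> pi * sqrt (p * r)" using nn ab by simp_all
      ultimately show ?thesis
        unfolding sq p_def[symmetric] s_def[symmetric] q_def[symmetric] r_def[symmetric] a_def[symmetric] D_def[symmetric] b_def[symmetric]
        by (simp add: algebra_simps)
    qed
  qed
qed

end

lemma part_add:
  "low_part i (\<lambda>a. u a + v a) x = low_part i u x + low_part i v x"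
  "high_part i (\<lambda>a. u a + v a) x = high_part i u x + high_part i v x"
proof -
  have "block_error X (\<lambda>a. u a + v a) x = block_error X u x + block_error X v x" for X
  proof -
    obtain d \<theta> where h: "\<And>u. block_error X u x = u d - (u X + \<theta> * (u (2 * X) - u X))"
      unfolding block_error_def Let_def by blast
    show ?thesis unfolding h by (simp add: algebra_simps)
  qed
  then show "low_part i (\<lambda>a. u a + v a) x = low_part i u x + low_part i v x"
    "high_part i (\<lambda>a. u a + v a) x = high_part i u x + high_part i v x"
    by (simp_all add: low_part_def high_part_def) (simp_all add: algebra_simps)
qed

text \<open>A piece collects four reflected quadrants and four combinations of low and high.
  Summation over \<open>k\<close> for fixed \<open>i\<close> restores \<open>f\<close> in the second
  variable, summation over \<open>i\<close> then in the first; at both stages the functions converge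
  pointwise and their norms are summable.\<close>

theorem fourier_L1_dyadic:
  fixes f :: "real \<times> real \<Rightarrow> complex"
  assumes cont: "continuous_on UNIV f"
    and quad: "\<And>\<sigma>1 \<sigma>2. \<bar>\<sigma>1\<bar> = 1 \<Longrightarrow> \<bar>\<sigma>2\<bar> = 1 \<Longrightarrow> quadrant (\<lambda>a b. f (\<sigma>1 * a, \<sigma>2 * b)) P Q R S"
    and S0: "\<And>X Y. 2 \<le> X \<Longrightarrow> 2 \<le> Y \<Longrightarrow> S X Y \<le> S0"
  defines "L \<equiv> \<lambda>i. (1/2 :: real) ^ i" and "H \<equiv> \<lambda>i. (2 :: real) ^ Suc i"
  defines "B1 \<equiv> \<lambda>i k. ennreal (112 * pi * (real (Suc i) * real (Suc k) * (S (L i) (L k) * L i * L k)))"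
    and "B2 \<equiv> \<lambda>i k. ennreal (128 * pi * (real (Suc i) * (Q (L i) (H k) * L i + sqrt (Q (L i) (H k) * L i * (S (L i) (H k) * L i * H k)))))"
    and "B3 \<equiv> \<lambda>i k. ennreal (128 * pi * (real (Suc k) * (R (H i) (L k) * L k + sqrt (R (H i) (L k) * L k * (S (H i) (L k) * H i * L k)))))"
    and "B4 \<equiv> \<lambda>i k. ennreal (400 * pi * (P (H i) (H k) + sqrt (P (H i) (H k) * (Q (H i) (H k) * H i)) + sqrt (P (H i) (H k) * (R (H i) (H k) * H k)) +
      sqrt (real (Suc i) * real (Suc k)) * sqrt (P (H i) (H k) * (S (H i) (H k) * H i * H k)) + S0 * (1/2) ^ (i + k + 2)))"
  assumes sums: "(\<Sum>i. \<Sum>k. B1 i k) < \<infinity>" "(\<Sum>i. \<Sum>k. B2 i k) < \<infinity>" "(\<Sum>i. \<Sum>k. B3 i k) < \<infinity>" "(\<Sum>i. \<Sum>k. B4 i k) < \<infinity>"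
  shows "f \<in> fourier_L1_functions"
proof -
  define B where "B i k = B1 i k + B2 i k + B3 i k + B4 i k" for i k
  have *: "fourier_bounded (\<lambda>(x, y). low_part i (\<lambda>a. low_part k (\<lambda>b. f (\<sigma>1 * a, \<sigma>2 * b)) (\<sigma>2 * y)) (\<sigma>1 * x) +
       low_part i (\<lambda>a. high_part k (\<lambda>b. f (\<sigma>1 * a, \<sigma>2 * b)) (\<sigma>2 * y)) (\<sigma>1 * x) +
       high_part i (\<lambda>a. low_part k (\<lambda>b. f (\<sigma>1 * a, \<sigma>2 * b)) (\<sigma>2 * y)) (\<sigma>1 * x) +
       high_part i (\<lambda>a. high_part k (\<lambda>b. f (\<sigma>1 * a, \<sigma>2 * b)) (\<sigma>2 * y)) (\<sigma>1 * x)) (B i k)"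
    if \<sigma>: "\<bar>\<sigma>1\<bar> = 1" "\<bar>\<sigma>2\<bar> = 1" for \<sigma>1 \<sigma>2 i k
  proof -
    interpret quadrant "\<lambda>a b. f (\<sigma>1 * a, \<sigma>2 * b)" P Q R S by (rule quad[OF \<sigma>])
    show ?thesis
      using fourier_bounded_add[OF fourier_bounded_add[OF fourier_bounded_add[OF
        fourier_bounded_low_low[OF \<sigma>, of i k] fourier_bounded_low_high[OF \<sigma>, of i k]] fourier_bounded_high_low[OF \<sigma>, of i k]]
        fourier_bounded_high_high[OF \<sigma> S0, of i k]]
      unfolding B_def B1_def B2_def B3_def B4_def L_def H_def case_prod_unfold by simp
  qed
  have piece: "fourier_bounded (\<lambda>(x, y). line_part i (\<lambda>a. line_part k (\<lambda>b. f (a, b)) y) x) (B i k + B i k + (B i k + B i k))" for i k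
    using fourier_bounded_add[OF fourier_bounded_add[OF *[of 1 1 i k] *[of 1 "-1" i k]] fourier_bounded_add[OF *[of "-1" 1 i k] *[of "-1" "-1" i k]]]
    unfolding line_part_def part_add case_prod_unfold by (simp add: add_ac)
  have c1: "isCont (\<lambda>a. f (a, y)) 0" and c2: "isCont (\<lambda>b. f (x, b)) 0" for x y
  proof -
    have f: "isCont f z" for z using cont continuous_on_eq_continuous_at[OF open_UNIV] by blast
    show "isCont (\<lambda>a. f (a, y)) 0" by (rule isCont_o2[where f="\<lambda>a. (a, y)" and g=f]) (auto intro!: continuous_intros f)
    show "isCont (\<lambda>b. f (x, b)) 0" by (rule isCont_o2[where f="\<lambda>b. (x, b)" and g=f]) (auto intro!: continuous_intros f)
  qed
  have Bsum: "(\<Sum>i. \<Sum>k. B i k + B i k + (B i k + B i k)) < \<infinity>"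
    using sums unfolding B_def by (simp add: suminf_add[symmetric])
  have Bi: "(\<Sum>k. B i k + B i k + (B i k + B i k)) < \<infinity>" for i
  proof -
    have "(\<Sum>k. B i k + B i k + (B i k + B i k)) \<le> (\<Sum>i. \<Sum>k. B i k + B i k + (B i k + B i k))"
      using sum_le_suminf[of "\<lambda>i. \<Sum>k. B i k + B i k + (B i k + B i k)" "{i}"] by simp
    then show ?thesis using Bsum by (rule le_less_trans)
  qed
  have "fourier_bounded (\<lambda>(x, y). line_part i (\<lambda>a. f (a, y)) x) (\<Sum>k. B i k + B i k + (B i k + B i k))" for i
    by (rule fourier_bounded_suminf[OF piece Bi]) (auto intro!: line_part_sums_linear line_part_sums c2)
  then have "fourier_bounded f (\<Sum>i. \<Sum>k. B i k + B i k + (B i k + B i k))"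
    by (rule fourier_bounded_suminf[OF _ Bsum]) (auto intro!: line_part_sums c1)
  then show ?thesis by (rule fourier_bounded_imp_fourier_L1)
qed

section \<open>Bounds by the majorants\<close>

lemma abs_cont_on_diff:
  assumes "abs_cont_on S g" "abs_cont_on S h" shows "abs_cont_on S (\<lambda>x. g x - h x)"
  unfolding abs_cont_on_iff
proof (intro allI impI)
  fix e :: real assume "e > 0"
  then have e2: "e / 2 > 0" by simp
  obtain d1 where d1: "d1 > 0" "\<And>I. interval_family S I \<Longrightarrow>
     (\<Sum>(a, b)\<in>I. b - a) < d1 \<Longrightarrow> (\<Sum>(a, b)\<in>I. norm (g b - g a)) < e / 2"
    by (rule abs_cont_onE[OF assms(1) e2]) (rule that; assumption)
  obtain d2 where d2: "d2 > 0" "\<And>I. interval_family S I \<Longrightarrow>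
     (\<Sum>(a, b)\<in>I. b - a) < d2 \<Longrightarrow> (\<Sum>(a, b)\<in>I. norm (h b - h a)) < e / 2"
    by (rule abs_cont_onE[OF assms(2) e2]) (rule that; assumption)
  have "(\<Sum>(a, b)\<in>I. norm (g b - h b - (g a - h a))) < e"
    if I: "interval_family S I" "(\<Sum>(a, b)\<in>I. b - a) < min d1 d2" for I
  proof -
    have "(\<Sum>(a, b)\<in>I. norm (g b - h b - (g a - h a))) \<le> (\<Sum>(a, b)\<in>I. norm (g b - g a) + norm (h b - h a))"
    proof (intro sum_mono, clarify)
      fix a b
      have "g b - h b - (g a - h a) = (g b - g a) - (h b - h a)" by simp
      then show "norm (g b - h b - (g a - h a)) \<le> norm (g b - g a) + norm (h b - h a)"
        by (metis norm_triangle_ineq4)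
    qed
    also have "\<dots> = (\<Sum>(a, b)\<in>I. norm (g b - g a)) + (\<Sum>(a, b)\<in>I. norm (h b - h a))"
      by (simp add: case_prod_unfold sum.distrib)
    finally show ?thesis using d1(2)[OF I(1)] d2(2)[OF I(1)] I(2) by simp
  qed
  then show "\<exists>\<delta>>0. \<forall>I. interval_family S I \<longrightarrow> (\<Sum>(a, b)\<in>I. b - a) < \<delta> \<longrightarrow>
      (\<Sum>(a, b)\<in>I. norm (g b - h b - (g a - h a))) < e"
    using d1(1) d2(1) by (intro exI[of _ "min d1 d2"]) simp
qed

text \<open>If \<open>g\<close> is not measurable on the larger set, the right side is
  \<open>top\<close>; otherwise measurability passes to the smaller set.\<close>

lemma esssup_restrict_mono:
  assumes "A \<subseteq> B" "A \<in> sets lebesgue" "B \<in> sets lebesgue"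
  shows "esssup (lebesgue_on A) g \<le> esssup (lebesgue_on B) (g :: 'a::euclidean_space \<Rightarrow> ennreal)"
proof (cases "g \<in> borel_measurable (lebesgue_on B)")
  case False
  then show ?thesis by (simp add: esssup_non_measurable)
next
  case True
  have g: "g \<in> borel_measurable (lebesgue_on A)"
    by (rule measurable_restrict_mono[OF True assms(1)])
  have "AE x in lebesgue_on B. g x \<le> esssup (lebesgue_on B) g" by (rule esssup_AE)
  then have "AE x in lebesgue. x \<in> B \<longrightarrow> g x \<le> esssup (lebesgue_on B) g"
    using assms(3) by (simp add: AE_restrict_space_iff)
  then have "AE x in lebesgue. x \<in> A \<longrightarrow> g x \<le> esssup (lebesgue_on B) g"
    by eventually_elim (use assms(1) in auto)
  then have "AE x in lebesgue_on A. g x \<le> esssup (lebesgue_on B) g"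
    using assms(2) by (simp add: AE_restrict_space_iff)
  then show ?thesis by (rule esssup_I[OF g])
qed

lemma half_line_sets: "{u::real. \<bar>u\<bar> \<ge> x \<and> x > 0} \<in> sets lebesgue" "closed {u::real. \<bar>u\<bar> \<ge> x \<and> x > 0}"
proof -
  have "{u::real. \<bar>u\<bar> \<ge> x \<and> x > 0} = (if x > 0 then {u. x \<le> \<bar>u\<bar>} else {})" by auto
  moreover have "closed {u::real. x \<le> \<bar>u\<bar>}" by (intro closed_Collect_le continuous_intros)
  ultimately show c: "closed {u::real. \<bar>u\<bar> \<ge> x \<and> x > 0}" by simp
  then show "{u::real. \<bar>u\<bar> \<ge> x \<and> x > 0} \<in> sets lebesgue" by (intro sets_completionI_sets) (simp add: borel_closed)
qed

lemma maj00_mono: "0 < X \<Longrightarrow> X \<le> X' \<Longrightarrow> 0 < Y \<Longrightarrow> Y \<le> Y' \<Longrightarrow> maj00 f X' Y' \<le> maj00 f X Y"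
  unfolding maj00_def by (intro SUP_subset_mono) auto

lemma maj10_mono:
  assumes "0 < X" "X \<le> X'" "0 < Y" "Y \<le> Y'" shows "maj10 f X' Y' \<le> maj10 f X Y"
  unfolding maj10_def
proof (intro SUP_mono)
  fix v assume "v \<in> {v. \<bar>v\<bar> \<ge> \<bar>Y'\<bar>}"
  then show "\<exists>w\<in>{v. \<bar>v\<bar> \<ge> \<bar>Y\<bar>}. esssup (lebesgue_on {u. \<bar>u\<bar> \<ge> \<bar>X'\<bar> \<and> \<bar>X'\<bar> > 0}) (\<lambda>u. ennreal (norm (pderiv1 f (u, v))))
     \<le> esssup (lebesgue_on {u. \<bar>u\<bar> \<ge> \<bar>X\<bar> \<and> \<bar>X\<bar> > 0}) (\<lambda>u. ennreal (norm (pderiv1 f (u, w))))"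
    using assms by (intro bexI[of _ v] esssup_restrict_mono half_line_sets) auto
qed

lemma maj01_mono:
  assumes "0 < X" "X \<le> X'" "0 < Y" "Y \<le> Y'" shows "maj01 f X' Y' \<le> maj01 f X Y"
  unfolding maj01_def
proof (intro SUP_mono)
  fix u assume "u \<in> {u. \<bar>u\<bar> \<ge> \<bar>X'\<bar>}"
  then show "\<exists>w\<in>{u. \<bar>u\<bar> \<ge> \<bar>X\<bar>}. esssup (lebesgue_on {v. \<bar>v\<bar> \<ge> \<bar>Y'\<bar> \<and> \<bar>Y'\<bar> > 0}) (\<lambda>v. ennreal (norm (pderiv2 f (u, v))))
     \<le> esssup (lebesgue_on {v. \<bar>v\<bar> \<ge> \<bar>Y\<bar> \<and> \<bar>Y\<bar> > 0}) (\<lambda>v. ennreal (norm (pderiv2 f (w, v))))"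
    using assms by (intro bexI[of _ u] esssup_restrict_mono half_line_sets) auto
qed

lemma quadrant_sets: "{u::real. \<bar>u\<bar> \<ge> x \<and> x > 0} \<times> {v::real. \<bar>v\<bar> \<ge> y \<and> y > 0} \<in> sets lebesgue"
  by (intro sets_completionI_sets) (simp add: borel_closed closed_Times half_line_sets(2))

lemma maj11_mono:
  assumes "0 < X" "X \<le> X'" "0 < Y" "Y \<le> Y'" shows "maj11 f X' Y' \<le> maj11 f X Y"
  unfolding maj11_def using assms by (intro esssup_restrict_mono quadrant_sets) auto

lemma maj00_bound:
  assumes "maj00 f X Y < \<infinity>" "0 < X" "0 < Y" "X \<le> \<bar>x\<bar>" "Y \<le> \<bar>y\<bar>"
  shows "norm (f (x, y)) \<le> enn2real (maj00 f X Y)"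
proof -
  have "ennreal (norm (f (x, y))) \<le> maj00 f X Y"
    unfolding maj00_def by (rule SUP_upper2[of "(x, y)"]) (use assms in auto)
  then have "enn2real (ennreal (norm (f (x, y)))) \<le> enn2real (maj00 f X Y)"
    using assms(1) by (intro enn2real_mono) auto
  then show ?thesis by simp
qed

lemma AE_section_bound:
  fixes g :: "real \<Rightarrow> complex"
  assumes "esssup (lebesgue_on {u. \<bar>u\<bar> \<ge> \<bar>X\<bar> \<and> \<bar>X\<bar> > 0}) (\<lambda>u. ennreal (norm (g u))) \<le> ennreal M" "0 < X" "0 \<le> M"
  shows "AE u in lborel. X \<le> \<bar>u\<bar> \<longrightarrow> norm (g u) \<le> M"
proof -
  have "AE u in lebesgue_on {u. \<bar>u\<bar> \<ge> \<bar>X\<bar> \<and> \<bar>X\<bar> > 0}. ennreal (norm (g u)) \<le> esssup (lebesgue_on {u. \<bar>u\<bar> \<ge> \<bar>X\<bar> \<and> \<bar>X\<bar> > 0}) (\<lambda>u. ennreal (norm (g u)))"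
    by (rule esssup_AE)
  then have "AE u in lebesgue_on {u. \<bar>u\<bar> \<ge> \<bar>X\<bar> \<and> \<bar>X\<bar> > 0}. ennreal (norm (g u)) \<le> ennreal M"
    by eventually_elim (rule order_trans[OF _ assms(1)])
  then have "AE u in lebesgue. u \<in> {u. \<bar>u\<bar> \<ge> \<bar>X\<bar> \<and> \<bar>X\<bar> > 0} \<longrightarrow> ennreal (norm (g u)) \<le> ennreal M"
    using half_line_sets(1)[of "\<bar>X\<bar>"] by (simp add: AE_restrict_space_iff)
  then have "AE u in lborel. u \<in> {u. \<bar>u\<bar> \<ge> \<bar>X\<bar> \<and> \<bar>X\<bar> > 0} \<longrightarrow> ennreal (norm (g u)) \<le> ennreal M"
    unfolding AE_completion_iff .
  then show ?thesis by eventually_elim (use assms in auto)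
qed

section \<open>Lipschitz bounds for sections and mixed differences\<close>

lemma locally_abs_cont_off_axesD:
  assumes "locally_abs_cont_off_axes h" "0 \<notin> {a..b}"
  shows "y \<noteq> 0 \<Longrightarrow> abs_cont_on {a..b} (\<lambda>x. h (x, y))" "x \<noteq> 0 \<Longrightarrow> abs_cont_on {a..b} (\<lambda>y. h (x, y))"
  using assms unfolding locally_abs_cont_off_axes_def locally_abs_cont_on_def by (metis Compl_iff empty_iff insertE subsetI)+

text \<open>The alternative for \<open>a\<close> and \<open>b\<close> keeps the segment on one side
  of the axis, where the section is absolutely continuous and the essential supremum bounds its
  derivative.\<close>

lemma section_lipschitz1:
  assumes ac: "locally_abs_cont_off_axes f" and fin: "maj10 f X Y < \<infinity>" and XY: "0 < X" "0 < Y"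
    and ab: "a \<le> b" "X \<le> a \<or> b \<le> - X" and y: "Y \<le> \<bar>y\<bar>"
  shows "norm (f (b, y) - f (a, y)) \<le> enn2real (maj10 f X Y) * (b - a)"
proof (rule abs_cont_on_lipschitz[OF _ ab(1)])
  show "abs_cont_on {a..b} (\<lambda>x. f (x, y))"
    using ab y XY by (intro locally_abs_cont_off_axesD(1)[OF ac]) auto
  have "esssup (lebesgue_on {u. \<bar>u\<bar> \<ge> \<bar>X\<bar> \<and> \<bar>X\<bar> > 0}) (\<lambda>u. ennreal (norm (pderiv1 f (u, y)))) \<le> maj10 f X Y"
    unfolding maj10_def by (rule SUP_upper) (use XY y in auto)
  also have "\<dots> = ennreal (enn2real (maj10 f X Y))" using fin by simp
  finally have "AE u in lborel. X \<le> \<bar>u\<bar> \<longrightarrow> norm (pderiv1 f (u, y)) \<le> enn2real (maj10 f X Y)"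
    by (rule AE_section_bound) (use XY in auto)
  then show "AE x in lborel. x \<in> {a<..<b} \<longrightarrow> norm (vector_derivative (\<lambda>x. f (x, y)) (at x)) \<le> enn2real (maj10 f X Y)"
    by eventually_elim (use ab in \<open>auto simp: pderiv1_def\<close>)
qed

lemma section_lipschitz2:
  assumes ac: "locally_abs_cont_off_axes f" and fin: "maj01 f X Y < \<infinity>" and XY: "0 < X" "0 < Y"
    and ab: "c \<le> d" "Y \<le> c \<or> d \<le> - Y" and x: "X \<le> \<bar>x\<bar>"
  shows "norm (f (x, d) - f (x, c)) \<le> enn2real (maj01 f X Y) * (d - c)"
proof (rule abs_cont_on_lipschitz[OF _ ab(1)])
  show "abs_cont_on {c..d} (\<lambda>y. f (x, y))"
    using ab x XY by (intro locally_abs_cont_off_axesD(2)[OF ac]) auto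
  have "esssup (lebesgue_on {v. \<bar>v\<bar> \<ge> \<bar>Y\<bar> \<and> \<bar>Y\<bar> > 0}) (\<lambda>v. ennreal (norm (pderiv2 f (x, v)))) \<le> maj01 f X Y"
    unfolding maj01_def by (rule SUP_upper) (use XY x in auto)
  also have "\<dots> = ennreal (enn2real (maj01 f X Y))" using fin by simp
  finally have "AE v in lborel. Y \<le> \<bar>v\<bar> \<longrightarrow> norm (pderiv2 f (x, v)) \<le> enn2real (maj01 f X Y)"
    by (rule AE_section_bound) (use XY in auto)
  then show "AE y in lborel. y \<in> {c<..<d} \<longrightarrow> norm (vector_derivative (\<lambda>y. f (x, y)) (at y)) \<le> enn2real (maj01 f X Y)"
    by eventually_elim (use ab in \<open>auto simp: pderiv2_def\<close>)
qed

text \<open>Almost every section of a plane null set is null.\<close>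

lemma AE_lborel_pair_sections:
  fixes A :: "real \<times> real \<Rightarrow> bool"
  assumes "AE z in lborel. A z" shows "AE v in lborel. AE u in lborel. A (u, v)"
proof -
  obtain N where N: "{z \<in> space lborel. \<not> A z} \<subseteq> N" "emeasure lborel N = 0" "N \<in> sets lborel"
    by (rule AE_E[OF assms])
  have N': "N \<in> sets (lborel \<Otimes>\<^sub>M lborel)" using N(3) unfolding lborel_prod .
  have "(\<integral>\<^sup>+v. emeasure lborel ((\<lambda>u. (u, v)) -` N) \<partial>lborel) = 0"
    using lborel_pair.emeasure_pair_measure_alt2[OF N'] N(2) by (simp add: lborel_prod)
  then have "AE v in lborel. emeasure lborel ((\<lambda>u. (u, v)) -` N) = 0"
    using lborel_pair.measurable_emeasure_Pair2[OF N'] by (simp add: nn_integral_0_iff_AE)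
  then show ?thesis
  proof eventually_elim
    case (elim v)
    have "(\<lambda>u. (u, v)) -` N \<in> null_sets lborel"
      using elim sets_Pair2[OF N', of v] by (auto intro!: null_setsI)
    then show ?case by (rule AE_I') (use N(1) in auto)
  qed
qed

text \<open>The Lipschitz lemma is used twice. For almost every \<open>v\<close> the mixed
  derivative is bounded at almost every \<open>u\<close>, which bounds the increment of
  \<open>pderiv2 f (u, v)\<close> from \<open>a\<close> to \<open>b\<close>. That increment is the
  derivative in \<open>v\<close> of \<open>f (b, v) - f (a, v)\<close>, whose own increment is the
  mixed difference.\<close>

lemma mixed_lipschitz:
  assumes diff2: "\<And>x y. x \<noteq> 0 \<Longrightarrow> y \<noteq> 0 \<Longrightarrow> (\<lambda>v. f (x, v)) differentiable (at y)"
    and ac: "locally_abs_cont_off_axes f" and ac2: "locally_abs_cont_off_axes (pderiv2 f)"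
    and fin: "maj11 f X Y < \<infinity>" and XY: "0 < X" "0 < Y"
    and ab: "a \<le> b" "X \<le> a \<or> b \<le> - X" and cd: "c \<le> d" "Y \<le> c \<or> d \<le> - Y"
  shows "norm (f (b, d) - f (a, d) - (f (b, c) - f (a, c))) \<le> enn2real (maj11 f X Y) * (b - a) * (d - c)"
proof (rule abs_cont_on_lipschitz[where g="\<lambda>v. f (b, v) - f (a, v)", OF _ cd(1)])
  let ?M = "enn2real (maj11 f X Y)"
  have nz: "0 \<notin> {c..d}" "0 \<notin> {a..b}" "a \<noteq> 0" "b \<noteq> 0" using ab cd XY by auto
  show "abs_cont_on {c..d} (\<lambda>v. f (b, v) - f (a, v))"
    by (intro abs_cont_on_diff locally_abs_cont_off_axesD(2)[OF ac nz(1)] nz)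
  let ?A = "{u. \<bar>u\<bar> \<ge> \<bar>X\<bar> \<and> \<bar>X\<bar> > 0} \<times> {v. \<bar>v\<bar> \<ge> \<bar>Y\<bar> \<and> \<bar>Y\<bar> > 0}"
  have "AE z in lebesgue_on ?A. ennreal (norm (pderiv12 f z)) \<le> maj11 f X Y"
    unfolding maj11_def by (rule esssup_AE)
  then have "AE z in lebesgue. z \<in> ?A \<longrightarrow> ennreal (norm (pderiv12 f z)) \<le> maj11 f X Y"
    using quadrant_sets[of "\<bar>X\<bar>" "\<bar>Y\<bar>"] by (simp add: AE_restrict_space_iff)
  then have "AE z in lborel. z \<in> ?A \<longrightarrow> ennreal (norm (pderiv12 f z)) \<le> maj11 f X Y"
    unfolding AE_completion_iff .
  then have "AE z in lborel. z \<in> ?A \<longrightarrow> norm (pderiv12 f z) \<le> ?M"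
  proof eventually_elim
    case (elim z)
    show ?case
    proof
      assume "z \<in> ?A"
      then have "ennreal (norm (pderiv12 f z)) \<le> ennreal ?M" using elim fin by simp
      then show "norm (pderiv12 f z) \<le> ?M" by simp
    qed
  qed
  then have "AE v in lborel. AE u in lborel. (u, v) \<in> ?A \<longrightarrow> norm (pderiv12 f (u, v)) \<le> ?M"
    by (rule AE_lborel_pair_sections)
  then show "AE v in lborel. v \<in> {c<..<d} \<longrightarrow> norm (vector_derivative (\<lambda>v. f (b, v) - f (a, v)) (at v)) \<le> ?M * (b - a)"
  proof eventually_elim
    case (elim v)
    show ?case
    proof
      assume v: "v \<in> {c<..<d}"
      then have v0: "v \<noteq> 0" "Y \<le> \<bar>v\<bar>" using cd XY by auto
      \<comment> \<open>\<open>pderiv2\<close> has an unspecified value where no derivative exists;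
        by \<open>diff2\<close> it is a true derivative off the axes.\<close>
      have hv: "((\<lambda>v. f (x, v)) has_vector_derivative pderiv2 f (x, v)) (at v)" if "x \<noteq> 0" for x
        using diff2[OF that v0(1)] by (simp add: pderiv2_def vector_derivative_works)
      have "vector_derivative (\<lambda>v. f (b, v) - f (a, v)) (at v) = pderiv2 f (b, v) - pderiv2 f (a, v)"
        by (intro vector_derivative_at has_vector_derivative_diff hv nz)
      also have "norm \<dots> \<le> ?M * (b - a)"
      proof (rule abs_cont_on_lipschitz[OF _ ab(1)])
        show "abs_cont_on {a..b} (\<lambda>u. pderiv2 f (u, v))"
          by (rule locally_abs_cont_off_axesD(1)[OF ac2 nz(2) v0(1)])
        show "AE u in lborel. u \<in> {a<..<b} \<longrightarrow> norm (vector_derivative (\<lambda>u. pderiv2 f (u, v)) (at u)) \<le> ?M"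
          using elim by eventually_elim (use ab v0 XY in \<open>auto simp: pderiv12_def pderiv1_def\<close>)
      qed
      finally show "norm (vector_derivative (\<lambda>v. f (b, v) - f (a, v)) (at v)) \<le> ?M * (b - a)" .
    qed
  qed
qed

lemma reflected_bounds:
  assumes "\<bar>s\<bar> = (1::real)" "0 < X" "X \<le> x" "X \<le> x'"
  shows "X \<le> min (s * x) (s * x') \<or> max (s * x) (s * x') \<le> - X"
    and "max (s * x) (s * x') - min (s * x) (s * x') = \<bar>x - x'\<bar>"
  using assms by (auto simp: abs_if min_def max_def split: if_splits)

lemma reflected_lipschitz1:
  assumes ac: "locally_abs_cont_off_axes f" and fin: "maj10 f X Y < \<infinity>" and XY: "0 < X" "0 < Y"
    and s: "\<bar>s\<bar> = 1" and x: "X \<le> x" "X \<le> x'" and y: "Y \<le> \<bar>y\<bar>"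
  shows "norm (f (s * x, y) - f (s * x', y)) \<le> enn2real (maj10 f X Y) * \<bar>x - x'\<bar>"
proof -
  note b = reflected_bounds[OF s XY(1) x]
  have "norm (f (max (s * x) (s * x'), y) - f (min (s * x) (s * x'), y)) \<le> enn2real (maj10 f X Y) * \<bar>x - x'\<bar>"
    unfolding b(2)[symmetric] by (rule section_lipschitz1[OF ac fin XY _ b(1) y]) simp
  then show ?thesis by (simp add: max_def min_def norm_minus_commute split: if_splits)
qed

lemma reflected_lipschitz2:
  assumes ac: "locally_abs_cont_off_axes f" and fin: "maj01 f X Y < \<infinity>" and XY: "0 < X" "0 < Y"
    and s: "\<bar>s\<bar> = 1" and x: "Y \<le> y" "Y \<le> y'" and y: "X \<le> \<bar>x\<bar>"
  shows "norm (f (x, s * y) - f (x, s * y')) \<le> enn2real (maj01 f X Y) * \<bar>y - y'\<bar>"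
proof -
  note b = reflected_bounds[OF s XY(2) x]
  have "norm (f (x, max (s * y) (s * y')) - f (x, min (s * y) (s * y'))) \<le> enn2real (maj01 f X Y) * \<bar>y - y'\<bar>"
    unfolding b(2)[symmetric] by (rule section_lipschitz2[OF ac fin XY _ b(1) y]) simp
  then show ?thesis by (simp add: max_def min_def norm_minus_commute split: if_splits)
qed

lemma reflected_mixed_lipschitz:
  assumes diff2: "\<And>x y. x \<noteq> 0 \<Longrightarrow> y \<noteq> 0 \<Longrightarrow> (\<lambda>v. f (x, v)) differentiable (at y)"
    and ac: "locally_abs_cont_off_axes f" and ac2: "locally_abs_cont_off_axes (pderiv2 f)"
    and fin: "maj11 f X Y < \<infinity>" and XY: "0 < X" "0 < Y"
    and s: "\<bar>s\<bar> = 1" and x: "X \<le> x" "X \<le> x'" and t: "\<bar>t\<bar> = 1" and y: "Y \<le> y" "Y \<le> y'"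
  shows "norm (f (s * x, t * y) - f (s * x', t * y) - (f (s * x, t * y') - f (s * x', t * y')))
    \<le> enn2real (maj11 f X Y) * \<bar>x - x'\<bar> * \<bar>y - y'\<bar>"
proof -
  note b = reflected_bounds[OF s XY(1) x]
  note c = reflected_bounds[OF t XY(2) y]
  define a0 b0 c0 d0 where d: "a0 = min (s * x) (s * x')" "b0 = max (s * x) (s * x')"
    "c0 = min (t * y) (t * y')" "d0 = max (t * y) (t * y')"
  have 1: "norm (f (b0, d0) - f (a0, d0) - (f (b0, c0) - f (a0, c0))) \<le> enn2real (maj11 f X Y) * \<bar>x - x'\<bar> * \<bar>y - y'\<bar>"
    unfolding b(2)[symmetric] c(2)[symmetric] unfolding d
    by (rule mixed_lipschitz[OF diff2 ac ac2 fin XY _ b(1) _ c(1)]) simp_all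
  \<comment> \<open>Exchanging the two points in either variable changes only the sign of the mixed
    difference.\<close>
  have flip: "norm (p - q - (r - w)) = norm (q - p - (w - r))" "norm (p - q - (r - w)) = norm (r - w - (p - q))"
    for p q r w :: complex
    by (simp_all add: norm_minus_commute) (metis minus_diff_eq norm_minus_cancel diff_diff_eq2 add_diff_eq diff_add_eq diff_right_commute uminus_add_conv_diff)
  have ab: "(a0 = s * x \<and> b0 = s * x') \<or> (a0 = s * x' \<and> b0 = s * x)" by (auto simp: d min_def max_def)
  have cd: "(c0 = t * y \<and> d0 = t * y') \<or> (c0 = t * y' \<and> d0 = t * y)" by (auto simp: d min_def max_def)
  show ?thesis using ab cd 1 flip by (elim disjE conjE) metis+
qed

section \<open>Dyadic sums from the integral conditions\<close>

lemma ennreal_sqrt_mono: "a \<le> b \<Longrightarrow> ennreal_sqrt a \<le> ennreal_sqrt b"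
  unfolding ennreal_sqrt_def by (auto intro!: enn2real_mono simp: less_top top_unique)

lemma ennreal_sqrt_ennreal: "0 \<le> x \<Longrightarrow> ennreal_sqrt (ennreal x) = ennreal (sqrt x)"
  by (simp add: ennreal_sqrt_def)

lemma divide_ennreal_eq: "0 < r \<Longrightarrow> z / ennreal r = z * ennreal (1 / r)"
  by (simp add: divide_ennreal_def inverse_ennreal inverse_eq_divide)

lemma ennreal_mult_assoc:
  "0 \<le> a \<Longrightarrow> 0 \<le> b \<Longrightarrow> z * ennreal a * ennreal b = z * ennreal (a * b)"
  "0 \<le> a \<Longrightarrow> 0 \<le> b \<Longrightarrow> 0 \<le> c \<Longrightarrow> z * ennreal a * ennreal b * ennreal c = z * ennreal (a * b * c)"
  by (simp_all add: ennreal_mult mult.assoc)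

text \<open>The left side is the integral of a step function below \<open>h\<close>. Monotonicity of
  the integral holds for arbitrary integrands, so this covers the nested tail integrals as they
  stand.\<close>

lemma suminf_le_set_nn_integral:
  fixes c :: "nat \<Rightarrow> ennreal" and J :: "nat \<Rightarrow> real set"
  assumes "disjoint_family J" "\<And>k. J k \<in> sets lborel" "\<And>k. J k \<subseteq> B"
    and "\<And>k y. y \<in> J k \<Longrightarrow> c k \<le> h y"
  shows "(\<Sum>k. c k * emeasure lborel (J k)) \<le> (\<integral>\<^sup>+y\<in>B. h y \<partial>lborel)"
proof -
  have "(\<Sum>k. c k * emeasure lborel (J k)) = (\<Sum>k. \<integral>\<^sup>+y. c k * indicator (J k) y \<partial>lborel)"
    using assms(2) by (simp add: nn_integral_cmult_indicator)
  also have "\<dots> = (\<integral>\<^sup>+y. (\<Sum>k. c k * indicator (J k) y) \<partial>lborel)"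
    using assms(2) by (intro nn_integral_suminf[symmetric]) auto
  also have "\<dots> \<le> (\<integral>\<^sup>+y\<in>B. h y \<partial>lborel)"
  proof (rule nn_integral_mono)
    fix y
    show "(\<Sum>k. c k * indicator (J k) y) \<le> h y * indicator B y"
    proof (cases "\<exists>k. y \<in> J k")
      case True
      then obtain k where k: "y \<in> J k" by blast
      then show ?thesis
        using suminf_cmult_indicator[OF assms(1) k, of c] assms(3)[of k] assms(4)[OF k] by auto
    next
      case False
      then show ?thesis by simp
    qed
  qed
  finally show ?thesis .
qed

lemma suminf_swap_ennreal: "(\<Sum>i. \<Sum>k. (a i k :: ennreal)) = (\<Sum>k. \<Sum>i. a i k)"
proof -
  have "(\<Sum>i. \<Sum>k. a i k) = (\<integral>\<^sup>+i. (\<Sum>k. a i k) \<partial>count_space UNIV)"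
    by (simp add: nn_integral_count_space_nat)
  also have "\<dots> = (\<Sum>k. \<integral>\<^sup>+i. a i k \<partial>count_space UNIV)"
    by (rule nn_integral_suminf) simp
  finally show ?thesis by (simp add: nn_integral_count_space_nat)
qed

text \<open>Comparison on a grid: \<open>c i k\<close> is at most \<open>C\<close> times the area of
  the rectangle \<open>I i \<times> J k\<close> times the value of \<open>h\<close> at any of its
  points.\<close>

lemma double_suminf_finite:
  fixes c :: "nat \<Rightarrow> nat \<Rightarrow> ennreal" and I J :: "nat \<Rightarrow> real set"
  assumes fin: "(\<integral>\<^sup>+x\<in>A. (\<integral>\<^sup>+y\<in>B. h x y \<partial>lborel) \<partial>lborel) < \<infinity>"
    and I: "disjoint_family I" "\<And>i. I i \<in> sets lborel" "\<And>i. I i \<subseteq> A" "\<And>i. emeasure lborel (I i) = ennreal (l i)" "\<And>i. 0 < l i"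
    and J: "disjoint_family J" "\<And>i. J i \<in> sets lborel" "\<And>i. J i \<subseteq> B" "\<And>i. emeasure lborel (J i) = ennreal (m i)" "\<And>i. 0 < m i"
    and C: "0 < C" and le: "\<And>i k x y. x \<in> I i \<Longrightarrow> y \<in> J k \<Longrightarrow> c i k \<le> h x y * ennreal (C * l i * m k)"
  shows "(\<Sum>i. \<Sum>k. c i k) < \<infinity>"
proof -
  define d where "d i k = c i k * ennreal (1 / (C * l i * m k))" for i k
  have pos: "0 < C * l i * m k" for i k using C I(5) J(5) by simp
  have inv: "q * (1 / q) = 1" if "0 < q" for q :: real using that by simp
  have d: "d i k \<le> h x y" if "x \<in> I i" "y \<in> J k" for i k x y
  proof -
    have "d i k \<le> h x y * ennreal (C * l i * m k) * ennreal (1 / (C * l i * m k))"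
      unfolding d_def by (intro mult_right_mono le that) simp
    also have "\<dots> = h x y * (ennreal (C * l i * m k) * ennreal (1 / (C * l i * m k)))" by (rule mult.assoc)
    also have "ennreal (C * l i * m k) * ennreal (1 / (C * l i * m k)) = ennreal (C * l i * m k * (1 / (C * l i * m k)))"
      using pos[of i k] by (intro ennreal_mult[symmetric]) (simp_all only: less_imp_le zero_le_divide_1_iff)
    also have "C * l i * m k * (1 / (C * l i * m k)) = 1" by (rule inv[OF pos])
    also have "h x y * ennreal 1 = h x y" by simp
    finally show ?thesis .
  qed
  have e: "d i k * ennreal (m k) * ennreal (l i) = c i k * ennreal (1 / C)" for i k
  proof -
    have "1 / (C * l i * m k) * m k * l i = 1 / C"
      using C I(5)[of i] J(5)[of k] by (simp add: field_simps)
    moreover have "d i k * ennreal (m k) * ennreal (l i) = c i k * ennreal (1 / (C * l i * m k) * m k * l i)"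
      unfolding d_def using pos[of i k] I(5)[of i] J(5)[of k]
      by (intro ennreal_mult_assoc(2)) (simp_all only: less_imp_le zero_le_divide_1_iff)
    ultimately show ?thesis by simp
  qed
  have "(\<Sum>i. (\<Sum>k. d i k * ennreal (m k)) * ennreal (l i)) \<le> (\<integral>\<^sup>+x\<in>A. (\<integral>\<^sup>+y\<in>B. h x y \<partial>lborel) \<partial>lborel)"
    unfolding I(4)[symmetric] J(4)[symmetric]
    by (intro suminf_le_set_nn_integral I(1,2,3) J(1,2,3) d)
  also have "(\<Sum>i. (\<Sum>k. d i k * ennreal (m k)) * ennreal (l i)) = (\<Sum>i. \<Sum>k. c i k) * ennreal (1 / C)"
    unfolding ennreal_suminf_multc[symmetric] e ..
  finally have "(\<Sum>i. \<Sum>k. c i k) * ennreal (1 / C) < \<infinity>" using fin by (rule le_less_trans)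
  then show ?thesis using C by (auto simp: ennreal_mult_less_top ennreal_eq_0_iff)
qed

text \<open>The dyadic point of the scale bounds its interval from above, so an antitone majorant at
  that point is below its values on the interval. High blocks are halved: outer variables run over
  the lower half, and the upper half is kept for the tail integrals, since it lies to the right of
  every point of the lower half.\<close>

abbreviation low_interval :: "nat \<Rightarrow> real set" where "low_interval i \<equiv> {(1/2) ^ Suc i<..<(1/2) ^ i}"
abbreviation high_interval :: "nat \<Rightarrow> real set" where "high_interval i \<equiv> {2 ^ i<..<3 / 2 * 2 ^ i}"
abbreviation tail_interval :: "nat \<Rightarrow> real set" where "tail_interval i \<equiv> {3 / 2 * 2 ^ i<..<2 * 2 ^ i}"

lemma disjoint_familyI_less:
  assumes "\<And>i j::nat. i < j \<Longrightarrow> A i \<inter> A j = {}" shows "disjoint_family A"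
  unfolding disjoint_family_on_def by (metis assms inf_commute linorder_neqE_nat)

lemma low_interval:
  "disjoint_family low_interval" "low_interval i \<in> sets lborel" "low_interval i \<subseteq> {0..1}"
  "emeasure lborel (low_interval i) = ennreal ((1/2) ^ Suc i)" "0 < (1/2 :: real) ^ Suc i"
proof -
  show "disjoint_family low_interval"
  proof (rule disjoint_familyI_less)
    fix i j :: nat assume "i < j"
    then have "(1/2 :: real) ^ j \<le> (1/2) ^ Suc i" by (intro power_decreasing) auto
    then show "low_interval i \<inter> low_interval j = {}" by auto
  qed
  have "(1/2 :: real) ^ i \<le> 1" by (rule power_le_one) auto
  moreover have "0 < (1/2 :: real) ^ Suc i" by simp
  ultimately show "low_interval i \<subseteq> {0..1}" by auto
qed (simp_all)

lemma high_interval: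
  "disjoint_family high_interval" "high_interval i \<in> sets lborel" "high_interval i \<subseteq> {1..}"
  "emeasure lborel (high_interval i) = ennreal (2 ^ i / 2)" "0 < (2 :: real) ^ i / 2"
proof -
  show "disjoint_family high_interval"
  proof (rule disjoint_familyI_less)
    fix i j :: nat assume "i < j"
    then have "(2 :: real) ^ Suc i \<le> 2 ^ j" by (intro power_increasing) auto
    then show "high_interval i \<inter> high_interval j = {}" by auto
  qed
  have "1 \<le> (2 :: real) ^ i" by (rule one_le_power) auto
  then show "high_interval i \<subseteq> {1..}" by (meson atLeast_iff greaterThanLessThan_iff less_imp_le order_trans subsetI)
qed (simp_all add: algebra_simps)

lemma tail_interval:
  "disjoint_family (\<lambda>j. tail_interval (i + j))" "tail_interval i \<in> sets lborel"
  "x \<in> high_interval i \<Longrightarrow> tail_interval (i + j) \<subseteq> {x..}"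
  "emeasure lborel (tail_interval i) = ennreal (2 ^ i / 2)"
proof -
  show "disjoint_family (\<lambda>j. tail_interval (i + j))"
  proof (rule disjoint_familyI_less)
    fix k l :: nat assume "k < l"
    then have "(2 :: real) ^ Suc (i + k) \<le> 2 ^ (i + l)" by (intro power_increasing) auto
    then show "tail_interval (i + k) \<inter> tail_interval (i + l) = {}" by auto
  qed
  have le: "(2 :: real) ^ i \<le> 2 ^ (i + j)" by (intro power_increasing) auto
  show "tail_interval (i + j) \<subseteq> {x..}" if "x \<in> high_interval i"
  proof
    fix z assume "z \<in> tail_interval (i + j)"
    then have "3 / 2 * 2 ^ (i + j) < z" by (simp only: greaterThanLessThan_iff)
    moreover have "x < 3 / 2 * 2 ^ i" using that by (simp only: greaterThanLessThan_iff)
    ultimately have "x \<le> z" using le by linarith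
    then show "z \<in> {x..}" by simp
  qed
qed (simp_all add: algebra_simps)

text \<open>Here the logarithms of the hypotheses meet the bump counts \<open>Suc i\<close>:
  \<open>2 / x\<close> is at least \<open>2 ^ Suc i\<close>, and \<open>ln 2\<close> is at least
  \<open>1/2\<close>.\<close>

lemma ln_low_interval:
  assumes "x \<in> low_interval i" shows "real (Suc i) / 2 \<le> ln (2 / x)"
proof -
  have x: "0 < x" "x < (1/2) ^ i"
    using assms less_trans[of 0 "(1/2) ^ Suc i" x] by auto
  have "real (Suc i) * ln 2 = ln (2 ^ Suc i)" by (simp only: ln_realpow)
  also have "\<dots> \<le> ln (2 / x)"
    using x by (intro ln_mono) (auto simp: field_simps power_one_over)
  finally have "real (Suc i) * ln 2 \<le> ln (2 / x)" .
  moreover have "real (Suc i) * (1/2) \<le> real (Suc i) * ln 2"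
    using ln2_ge_two_thirds by (intro mult_left_mono) auto
  ultimately show ?thesis by linarith
qed

lemma high_interval_inverse:
  assumes "y \<in> high_interval k" shows "0 < y" "2 / 3 \<le> 1 / y * 2 ^ k"
proof -
  have "(0 :: real) < 2 ^ k" by simp
  then show "0 < y" using assms less_trans[of 0 "2 ^ k" y] by auto
  then show "2 / 3 \<le> 1 / y * 2 ^ k" using assms by (auto simp: field_simps)
qed

text \<open>The upper half of the block alone contributes this much, and it lies in the tail of
  every point of the lower half.\<close>

lemma tail_integral_ge:
  fixes h :: "real \<Rightarrow> ennreal"
  assumes "y \<in> high_interval k" "\<And>t. 0 < t \<Longrightarrow> t \<le> 2 ^ Suc k \<Longrightarrow> h (2 ^ Suc k) \<le> h t"
  shows "h (2 ^ Suc k) * ennreal (2 ^ k / 2) \<le> (\<integral>\<^sup>+t\<in>{y..}. h t \<partial>lborel)"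
proof -
  have "h (2 ^ Suc k) * ennreal (2 ^ k / 2) = (\<integral>\<^sup>+t. h (2 ^ Suc k) * indicator (tail_interval k) t \<partial>lborel)"
    using tail_interval(2,4) by (simp add: nn_integral_cmult_indicator)
  also have "\<dots> \<le> (\<integral>\<^sup>+t\<in>{y..}. h t \<partial>lborel)"
  proof (rule nn_integral_mono)
    fix t
    have "0 < y" by (rule high_interval_inverse(1)[OF assms(1)])
    then show "h (2 ^ Suc k) * indicator (tail_interval k) t \<le> h t * indicator {y..} t"
      using assms(1) by (cases "t \<in> tail_interval k") (auto simp: indicator_def intro!: assms(2)[simplified])
  qed
  finally show ?thesis .
qed

lemma ennreal_mult_le_mult: "a \<le> b \<Longrightarrow> r \<le> s \<Longrightarrow> a * ennreal r \<le> b * ennreal s"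
  by (intro mult_mono ennreal_leI) auto

lemma low_low_sum:
  assumes "(\<integral>\<^sup>+y\<in>{0..1}. (\<integral>\<^sup>+x\<in>{0..1}. G x y * ennreal (ln (2 / x)) * ennreal (ln (2 / y)) \<partial>lborel) \<partial>lborel) < \<infinity>"
    and g: "\<And>i k x y. x \<in> low_interval i \<Longrightarrow> y \<in> low_interval k \<Longrightarrow> g i k \<le> G x y"
  shows "(\<Sum>i. \<Sum>k. g i k * ennreal (real (Suc i) * real (Suc k) * ((1/2) ^ i * (1/2) ^ k))) < \<infinity>"
proof -
  have le: "g i k * ennreal (real (Suc i) * real (Suc k) * ((1/2) ^ i * (1/2) ^ k))
      \<le> G x y * ennreal (ln (2 / x)) * ennreal (ln (2 / y)) * ennreal (16 * (1/2) ^ Suc k * (1/2) ^ Suc i)"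
    if x: "x \<in> low_interval i" and y: "y \<in> low_interval k" for i k x y
  proof -
    note l = ln_low_interval[OF x] ln_low_interval[OF y]
    have nn: "0 \<le> ln (2 / x)" "0 \<le> ln (2 / y)" using l by (auto intro: order_trans[rotated])
    have "real (Suc i) / 2 * (real (Suc k) / 2) \<le> ln (2 / x) * ln (2 / y)"
      by (intro mult_mono l nn) simp
    then have "real (Suc i) / 2 * (real (Suc k) / 2) * (4 * ((1/2) ^ i * (1/2) ^ k)) \<le> ln (2 / x) * ln (2 / y) * (4 * ((1/2) ^ i * (1/2) ^ k))"
      by (rule mult_right_mono) simp
    then have "real (Suc i) * real (Suc k) * ((1/2) ^ i * (1/2) ^ k) \<le> ln (2 / x) * ln (2 / y) * (16 * (1/2) ^ Suc k * (1/2) ^ Suc i)"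
      by (simp add: field_simps)
    then have "g i k * ennreal (real (Suc i) * real (Suc k) * ((1/2) ^ i * (1/2) ^ k)) \<le> G x y * ennreal (ln (2 / x) * ln (2 / y) * (16 * (1/2) ^ Suc k * (1/2) ^ Suc i))"
      by (rule ennreal_mult_le_mult[OF g[OF x y]])
    then show ?thesis by (subst ennreal_mult_assoc(2)) (use nn in simp_all)
  qed
  \<comment> \<open>The integral over \<open>y\<close> is the outer one, so the order of summation
    is exchanged first. Of the constant \<open>16\<close>, a factor \<open>4\<close> comes from the
    two logarithms and \<open>4\<close> from the interval lengths.\<close>
  show ?thesis
    by (subst suminf_swap_ennreal, rule double_suminf_finite[OF assms(1) low_interval low_interval, of 16])
      (simp, rule le)
qed

lemma low_high_sum:
  assumes "(\<integral>\<^sup>+x\<in>{0..1}. (\<integral>\<^sup>+y\<in>{1..}. G x y * ennreal (ln (2 / x)) / ennreal y \<partial>lborel) \<partial>lborel) < \<infinity>"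
    and g: "\<And>i k x y. x \<in> low_interval i \<Longrightarrow> y \<in> high_interval k \<Longrightarrow> g i k \<le> G x y"
  shows "(\<Sum>i. \<Sum>k. g i k * ennreal (real (Suc i) * (1/2) ^ i)) < \<infinity>"
proof -
  have le: "g i k * ennreal (real (Suc i) * (1/2) ^ i)
      \<le> G x y * ennreal (ln (2 / x)) / ennreal y * ennreal (12 * (1/2) ^ Suc i * (2 ^ k / 2))"
    if x: "x \<in> low_interval i" and y: "y \<in> high_interval k" for i k x y
  proof -
    note l = ln_low_interval[OF x] high_interval_inverse[OF y]
    have nn: "0 \<le> ln (2 / x)" using l by (auto intro: order_trans[rotated])
    \<comment> \<open>The logarithm gives at least \<open>Suc i / 2\<close>, and
      \<open>1 / y\<close> at least \<open>2 / 3\<close> of \<open>1 / 2 ^ k\<close>. Each interval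
      length supplies a further factor \<open>2\<close>, which makes \<open>12\<close>.\<close>
    have "real (Suc i) / 2 * (2 / 3) \<le> ln (2 / x) * (1 / y * 2 ^ k)"
      by (intro mult_mono l nn) simp
    then have "real (Suc i) / 2 * (2 / 3) * (3 * (1/2) ^ i) \<le> ln (2 / x) * (1 / y * 2 ^ k) * (3 * (1/2) ^ i)"
      by (rule mult_right_mono) simp
    also have "ln (2 / x) * (1 / y * 2 ^ k) * (3 * (1/2) ^ i) = ln (2 / x) * (1 / y) * (12 * (1/2) ^ Suc i * (2 ^ k / 2))"
      by simp
    also have "real (Suc i) / 2 * (2 / 3) * (3 * (1/2) ^ i) = real (Suc i) * (1/2) ^ i" by simp
    finally have "real (Suc i) * (1/2) ^ i \<le> ln (2 / x) * (1 / y) * (12 * (1/2) ^ Suc i * (2 ^ k / 2))" .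
    then have "g i k * ennreal (real (Suc i) * (1/2) ^ i) \<le> G x y * ennreal (ln (2 / x) * (1 / y) * (12 * (1/2) ^ Suc i * (2 ^ k / 2)))"
      by (rule ennreal_mult_le_mult[OF g[OF x y]])
    then show ?thesis unfolding divide_ennreal_eq[OF l(2)]
      by (subst ennreal_mult_assoc(2)) (use nn l(2) in simp_all)
  qed
  show ?thesis
    by (rule double_suminf_finite[OF assms(1) low_interval high_interval, of 12]) (simp, rule le)
qed

lemma high_low_sum:
  assumes "(\<integral>\<^sup>+x\<in>{1..}. (\<integral>\<^sup>+y\<in>{0..1}. G x y * ennreal (ln (2 / y)) / ennreal x \<partial>lborel) \<partial>lborel) < \<infinity>"
    and g: "\<And>i k x y. x \<in> high_interval i \<Longrightarrow> y \<in> low_interval k \<Longrightarrow> g i k \<le> G x y"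
  shows "(\<Sum>i. \<Sum>k. g i k * ennreal (real (Suc k) * (1/2) ^ k)) < \<infinity>"
proof -
  have le: "g i k * ennreal (real (Suc k) * (1/2) ^ k)
      \<le> G x y * ennreal (ln (2 / y)) / ennreal x * ennreal (12 * (2 ^ i / 2) * (1/2) ^ Suc k)"
    if x: "x \<in> high_interval i" and y: "y \<in> low_interval k" for i k x y
  proof -
    note l = ln_low_interval[OF y] high_interval_inverse[OF x]
    have nn: "0 \<le> ln (2 / y)" using l by (auto intro: order_trans[rotated])
    have "real (Suc k) / 2 * (2 / 3) \<le> ln (2 / y) * (1 / x * 2 ^ i)"
      by (intro mult_mono l nn) simp
    then have "real (Suc k) / 2 * (2 / 3) * (3 * (1/2) ^ k) \<le> ln (2 / y) * (1 / x * 2 ^ i) * (3 * (1/2) ^ k)"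
      by (rule mult_right_mono) simp
    also have "ln (2 / y) * (1 / x * 2 ^ i) * (3 * (1/2) ^ k) = ln (2 / y) * (1 / x) * (12 * (2 ^ i / 2) * (1/2) ^ Suc k)"
      by simp
    also have "real (Suc k) / 2 * (2 / 3) * (3 * (1/2) ^ k) = real (Suc k) * (1/2) ^ k" by simp
    finally have "real (Suc k) * (1/2) ^ k \<le> ln (2 / y) * (1 / x) * (12 * (2 ^ i / 2) * (1/2) ^ Suc k)" .
    then have "g i k * ennreal (real (Suc k) * (1/2) ^ k) \<le> G x y * ennreal (ln (2 / y) * (1 / x) * (12 * (2 ^ i / 2) * (1/2) ^ Suc k))"
      by (rule ennreal_mult_le_mult[OF g[OF x y]])
    then show ?thesis unfolding divide_ennreal_eq[OF l(2)]
      by (subst ennreal_mult_assoc(2)) (use nn l(2) in simp_all)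
  qed
  show ?thesis
    by (rule double_suminf_finite[OF assms(1) high_interval low_interval, of 12]) (simp, rule le)
qed

lemma high_high_sum:
  assumes "(\<integral>\<^sup>+y\<in>{1..}. (\<integral>\<^sup>+x\<in>{1..}. G x y / ennreal (x * y) \<partial>lborel) \<partial>lborel) < \<infinity>"
    and g: "\<And>i k x y. x \<in> high_interval i \<Longrightarrow> y \<in> high_interval k \<Longrightarrow> g i k \<le> G x y"
  shows "(\<Sum>i. \<Sum>k. g i k) < \<infinity>"
proof -
  have le: "g i k \<le> G x y / ennreal (x * y) * ennreal (9 * (2 ^ k / 2) * (2 ^ i / 2))"
    if x: "x \<in> high_interval i" and y: "y \<in> high_interval k" for i k x y
  proof -
    note l = high_interval_inverse[OF x] high_interval_inverse[OF y]
    \<comment> \<open>A factor \<open>3 / 2\<close> for each reciprocal and \<open>2\<close> for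
      each length give the constant \<open>9\<close>.\<close>
    have "2 / 3 * (2 / 3) \<le> (1 / x * 2 ^ i) * (1 / y * 2 ^ k)"
      using l by (intro mult_mono l) auto
    then have "1 \<le> 1 / (x * y) * (9 * (2 ^ k / 2) * (2 ^ i / 2))"
      by (simp add: field_simps)
    then have "g i k * ennreal 1 \<le> G x y * ennreal (1 / (x * y) * (9 * (2 ^ k / 2) * (2 ^ i / 2)))"
      by (rule ennreal_mult_le_mult[OF g[OF x y]])
    then show ?thesis unfolding divide_ennreal_eq[OF mult_pos_pos[OF l(1,3)]]
      by (subst ennreal_mult_assoc(1)) (use l(1,3) in simp_all)
  qed
  show ?thesis
    by (subst suminf_swap_ennreal, rule double_suminf_finite[OF assms(1) high_interval high_interval, of 9]) (simp, rule le)
qed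

section \<open>A tail inequality of Hardy type\<close>

lemma ennreal_suminf_Suc: "(\<Sum>n. (f n :: ennreal)) = f 0 + (\<Sum>n. f (Suc n))"
proof -
  have "(\<lambda>n. f (Suc n)) sums (\<Sum>n. f (Suc n))" by (simp add: summable_sums)
  then have "(\<lambda>n. (\<Sum>i<n. f (Suc i)) + f 0) \<longlonglongrightarrow> (\<Sum>n. f (Suc n)) + f 0"
    unfolding sums_def by (intro tendsto_add) auto
  then have "(\<lambda>n. \<Sum>i<Suc n. f i) \<longlonglongrightarrow> (\<Sum>n. f (Suc n)) + f 0"
    unfolding sum.lessThan_Suc_shift by (simp add: add.commute)
  then have "f sums ((\<Sum>n. f (Suc n)) + f 0)"
    unfolding sums_def by (rule LIMSEQ_imp_Suc)
  then show ?thesis by (simp add: sums_iff add.commute)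
qed

lemma suminf_term_le: "f j \<le> (\<Sum>n. (f n :: ennreal))"
  using sum_le_suminf[of f "{j}"] by simp

text \<open>Factor the difference of squares. The arithmetic-geometric mean separates
  \<open>real (Suc j) * (r j - r (Suc j))\<close>, whose sum collapses to that of \<open>r\<close>
  by Abel summation, from \<open>r j + r (Suc j)\<close>, which is summable directly.\<close>

lemma hardy_tail_real:
  fixes r :: "nat \<Rightarrow> real"
  assumes "\<And>j. r (Suc j) \<le> r j" "\<And>j. 0 \<le> r j"
  shows "(\<Sum>j<n. sqrt (real (Suc j)) * sqrt ((r j)\<^sup>2 - (r (Suc j))\<^sup>2)) \<le> 2 * (\<Sum>j<Suc n. r j)"
proof -
  have tele: "(\<Sum>j<n. real (Suc j) * (r j - r (Suc j))) = (\<Sum>j<n. r j) - real n * r n" for n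
    by (induction n) (simp_all add: algebra_simps)
  have summand: "sqrt (real (Suc j)) * sqrt ((r j)\<^sup>2 - (r (Suc j))\<^sup>2) \<le> (real (Suc j) * (r j - r (Suc j)) + (r j + r (Suc j))) / 2" for j
  proof -
    have "sqrt (real (Suc j)) * sqrt ((r j)\<^sup>2 - (r (Suc j))\<^sup>2) = sqrt ((real (Suc j) * (r j - r (Suc j))) * (r j + r (Suc j)))"
      by (simp add: real_sqrt_mult[symmetric] power2_eq_square algebra_simps)
    also have "\<dots> \<le> (real (Suc j) * (r j - r (Suc j)) + (r j + r (Suc j))) / 2"
      using assms[of j] assms(2)[of "Suc j"] by (intro arith_geo_mean_sqrt) auto
    finally show ?thesis .
  qed
  have shift: "(\<Sum>j<n. r (Suc j)) \<le> (\<Sum>j<Suc n. r j)"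
    unfolding sum.lessThan_Suc_shift using assms(2) by simp
  have incl: "(\<Sum>j<n. r j) \<le> (\<Sum>j<Suc n. r j)" using assms(2) by simp
  have "(\<Sum>j<n. sqrt (real (Suc j)) * sqrt ((r j)\<^sup>2 - (r (Suc j))\<^sup>2)) \<le> (\<Sum>j<n. (real (Suc j) * (r j - r (Suc j)) + (r j + r (Suc j))) / 2)"
    by (intro sum_mono summand)
  also have "\<dots> = ((\<Sum>j<n. r j) - real n * r n + ((\<Sum>j<n. r j) + (\<Sum>j<n. r (Suc j)))) / 2"
    unfolding tele[symmetric] by (simp add: sum.distrib sum_divide_distrib[symmetric])
  also have "\<dots> \<le> 2 * (\<Sum>j<Suc n. r j)"
  proof -
    have "0 \<le> real n * r n" "0 \<le> (\<Sum>j<Suc n. r j)" by (intro mult_nonneg_nonneg sum_nonneg assms(2) of_nat_0_le_iff)+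
    moreover have "(a - c + (a + b)) / 2 \<le> 2 * d" if that: "0 \<le> c" "0 \<le> d" "b \<le> d" "a \<le> d" for a b c d :: real
    proof -
      have "a - c + (a + b) \<le> 2 * (2 * d)" using that by arith
      then show ?thesis by simp
    qed
    ultimately show ?thesis using shift incl by blast
  qed
  finally show ?thesis .
qed

text \<open>With \<open>r m\<close> the square root of the tail from \<open>m\<close> on,
  \<open>b j\<close> is the difference of the squares of \<open>r j\<close> and
  \<open>r (Suc j)\<close>. An infinite tail makes the right side infinite.\<close>

lemma hardy_tail:
  fixes b :: "nat \<Rightarrow> ennreal"
  shows "(\<Sum>j. ennreal (sqrt (real (Suc j))) * ennreal_sqrt (b j)) \<le> 2 * (\<Sum>m. ennreal_sqrt (\<Sum>j. b (j + m)))"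
proof (cases "\<forall>m. (\<Sum>j. b (j + m)) < \<infinity>")
  case False
  then obtain m where "(\<Sum>j. b (j + m)) = \<infinity>" unfolding infinity_ennreal_def less_top[symmetric] by blast
  then have "ennreal_sqrt (\<Sum>j. b (j + m)) = \<infinity>" by (simp add: ennreal_sqrt_def)
  then have "(\<Sum>m. ennreal_sqrt (\<Sum>j. b (j + m))) = \<infinity>"
    using suminf_term_le[of "\<lambda>m. ennreal_sqrt (\<Sum>j. b (j + m))" m] by (simp add: top_unique)
  then show ?thesis by (simp add: ennreal_mult_top)
next
  case True
  define F where "F m = (\<Sum>j. b (j + m))" for m
  define r where "r m = sqrt (enn2real (F m))" for m
  have r0: "0 \<le> r j" for j by (simp add: r_def)
  have F: "F m = ennreal ((r m)\<^sup>2)" for m using True by (simp add: r_def F_def)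
  have rF: "ennreal_sqrt (F m) = ennreal (r m)" for m unfolding F by (simp add: ennreal_sqrt_ennreal r0)
  have FS: "F j = b j + F (Suc j)" for j unfolding F_def by (subst ennreal_suminf_Suc) simp
  have dec: "r (Suc j) \<le> r j" for j
  proof -
    have "F (Suc j) \<le> F j" unfolding FS[of j] by simp
    then have "(r (Suc j))\<^sup>2 \<le> (r j)\<^sup>2" unfolding F by (simp add: ennreal_le_iff)
    then show ?thesis using r0 by (rule power2_le_imp_le)
  qed
  have b: "ennreal_sqrt (b j) = ennreal (sqrt ((r j)\<^sup>2 - (r (Suc j))\<^sup>2))" for j
  proof -
    have le: "(r (Suc j))\<^sup>2 \<le> (r j)\<^sup>2" by (intro power_mono dec r0)
    have "b j \<noteq> \<infinity>" using FS[of j] F[of j] by auto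
    then obtain c where c: "b j = ennreal c" "0 \<le> c" by (cases "b j") auto
    have "ennreal ((r j)\<^sup>2) = ennreal (c + (r (Suc j))\<^sup>2)" using FS[of j] unfolding F c(1) using c(2) by simp
    then have "(r j)\<^sup>2 = c + (r (Suc j))\<^sup>2" using c(2) by (subst (asm) ennreal_inj) auto
    then show ?thesis unfolding c(1) using c(2) by (simp add: ennreal_sqrt_ennreal)
  qed
  have "(\<Sum>j<n. ennreal (sqrt (real (Suc j))) * ennreal_sqrt (b j)) \<le> 2 * (\<Sum>m. ennreal_sqrt (F m))" for n
  proof -
    have "(\<Sum>j<n. ennreal (sqrt (real (Suc j))) * ennreal_sqrt (b j))
        = ennreal (\<Sum>j<n. sqrt (real (Suc j)) * sqrt ((r j)\<^sup>2 - (r (Suc j))\<^sup>2))"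
      unfolding b by (subst sum_ennreal[symmetric]) (auto simp: ennreal_mult power_mono dec r0)
    also have "\<dots> \<le> ennreal (2 * (\<Sum>j<Suc n. r j))" by (intro ennreal_leI hardy_tail_real dec r0)
    also have "\<dots> = 2 * (\<Sum>j<Suc n. ennreal (r j))"
      unfolding sum_ennreal[OF r0] by (simp only: ennreal_mult sum_nonneg r0 ennreal_numeral zero_le_numeral)
    also have "\<dots> \<le> 2 * (\<Sum>m. ennreal (r m))" by (intro mult_left_mono sum_le_suminf) auto
    finally show ?thesis unfolding rF .
  qed
  then show ?thesis unfolding F_def[symmetric] by (subst suminf_eq_SUP) (rule SUP_least)
qed

text \<open>Used in \<open>k\<close> for each \<open>i\<close>, the inequality leaves square roots
  of inner tails. For fixed \<open>n\<close> these are again square roots of a sequence in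
  \<open>i\<close>, so it applies once more; hence \<open>4 = 2 * 2\<close>.\<close>

lemma hardy_tail_double:
  fixes b :: "nat \<Rightarrow> nat \<Rightarrow> ennreal"
  shows "(\<Sum>i. \<Sum>k. ennreal (sqrt (real (Suc i))) * (ennreal (sqrt (real (Suc k))) * ennreal_sqrt (b i k)))
    \<le> 4 * (\<Sum>m. \<Sum>n. ennreal_sqrt (\<Sum>i. \<Sum>k. b (i + m) (k + n)))"
proof -
  have "(\<Sum>i. \<Sum>k. ennreal (sqrt (real (Suc i))) * (ennreal (sqrt (real (Suc k))) * ennreal_sqrt (b i k)))
      \<le> (\<Sum>i. ennreal (sqrt (real (Suc i))) * (2 * (\<Sum>n. ennreal_sqrt (\<Sum>k. b i (k + n)))))"
    unfolding ennreal_suminf_cmult by (intro suminf_le mult_left_mono hardy_tail) auto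
  also have "\<dots> = 2 * (\<Sum>n. \<Sum>i. ennreal (sqrt (real (Suc i))) * ennreal_sqrt (\<Sum>k. b i (k + n)))"
    unfolding suminf_swap_ennreal[of "\<lambda>n i. ennreal (sqrt (real (Suc i))) * ennreal_sqrt (\<Sum>k. b i (k + n))"]
    by (simp add: ennreal_suminf_cmult mult.left_commute)
  also have "\<dots> \<le> 2 * (\<Sum>n. 2 * (\<Sum>m. ennreal_sqrt (\<Sum>i. \<Sum>k. b (i + m) (k + n))))"
    by (intro mult_left_mono suminf_le hardy_tail) auto
  also have "\<dots> = 4 * (\<Sum>m. \<Sum>n. ennreal_sqrt (\<Sum>i. \<Sum>k. b (i + m) (k + n)))"
    by (simp add: suminf_swap_ennreal[of "\<lambda>m n. ennreal_sqrt (\<Sum>i. \<Sum>k. b (i + m) (k + n))"]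
      ennreal_suminf_cmult mult.assoc[symmetric])
  finally show ?thesis .
qed

section \<open>Discretising the integral hypotheses\<close>

definition antitone2 :: "(real \<Rightarrow> real \<Rightarrow> ennreal) \<Rightarrow> bool" where
  "antitone2 G \<longleftrightarrow> (\<forall>X X' Y Y'. 0 < X \<longrightarrow> X \<le> X' \<longrightarrow> 0 < Y \<longrightarrow> Y \<le> Y' \<longrightarrow> G X' Y' \<le> G X Y)"

lemma antitone2D: "antitone2 G \<Longrightarrow> 0 < X \<Longrightarrow> X \<le> X' \<Longrightarrow> 0 < Y \<Longrightarrow> Y \<le> Y' \<Longrightarrow> G X' Y' \<le> G X Y"
  by (simp add: antitone2_def)

lemma antitone2_mult: "antitone2 G \<Longrightarrow> antitone2 G' \<Longrightarrow> antitone2 (\<lambda>x y. G x y * G' x y)"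
  by (auto simp: antitone2_def intro!: mult_mono)

lemma interval_bounds:
  "x \<in> low_interval i \<Longrightarrow> 0 < x \<and> x \<le> (1/2) ^ i"
  "x \<in> high_interval i \<Longrightarrow> 0 < x \<and> x \<le> 2 ^ Suc i"
  "x \<in> tail_interval i \<Longrightarrow> 0 < x \<and> x \<le> 2 ^ Suc i"
proof -
  have pos: "0 < (1/2 :: real) ^ Suc i" "0 < (2 :: real) ^ i" by simp_all
  show "x \<in> low_interval i \<Longrightarrow> 0 < x \<and> x \<le> (1/2) ^ i"
    using pos(1) unfolding greaterThanLessThan_iff by linarith
  show "x \<in> high_interval i \<Longrightarrow> 0 < x \<and> x \<le> 2 ^ Suc i" "x \<in> tail_interval i \<Longrightarrow> 0 < x \<and> x \<le> 2 ^ Suc i"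
    using pos(2) unfolding greaterThanLessThan_iff power_Suc by linarith+
qed

lemma sqrt_tail_y:
  assumes G: "antitone2 G" and x: "0 < x" "x \<le> X" and y: "y \<in> high_interval k"
  shows "ennreal_sqrt (G X (2 ^ Suc k) * ennreal (2 ^ k / 2)) \<le> ennreal_sqrt (\<integral>\<^sup>+t\<in>{y..}. G x t \<partial>lborel)"
proof (rule ennreal_sqrt_mono)
  have "G X (2 ^ Suc k) * ennreal (2 ^ k / 2) \<le> G x (2 ^ Suc k) * ennreal (2 ^ k / 2)"
    by (intro mult_right_mono antitone2D[OF G] x) auto
  also have "\<dots> \<le> (\<integral>\<^sup>+t\<in>{y..}. G x t \<partial>lborel)"
    by (rule tail_integral_ge[OF y]) (rule antitone2D[OF G], use x in auto)
  finally show "G X (2 ^ Suc k) * ennreal (2 ^ k / 2) \<le> (\<integral>\<^sup>+t\<in>{y..}. G x t \<partial>lborel)" .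
qed

lemma antitone2_flip: "antitone2 G \<Longrightarrow> antitone2 (\<lambda>x y. G y x)"
  by (simp add: antitone2_def)

lemma sqrt_tail_x:
  assumes G: "antitone2 G" and y: "0 < y" "y \<le> Y" and x: "x \<in> high_interval i"
  shows "ennreal_sqrt (G (2 ^ Suc i) Y * ennreal (2 ^ i / 2)) \<le> ennreal_sqrt (\<integral>\<^sup>+s\<in>{x..}. G s y \<partial>lborel)"
  by (rule sqrt_tail_y[OF antitone2_flip[OF G] y x])

text \<open>All later blocks are kept in both variables, because the tail inequality asks for full
  tail sums and not just their first terms.\<close>

lemma sqrt_tail_xy:
  assumes G: "antitone2 G" and x: "x \<in> high_interval i" and y: "y \<in> high_interval k"
  shows "ennreal_sqrt (\<Sum>j. \<Sum>l. G (2 ^ Suc (j + i)) (2 ^ Suc (l + k)) * ennreal (2 ^ (l + k) / 2) * ennreal (2 ^ (j + i) / 2))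
    \<le> ennreal_sqrt (\<integral>\<^sup>+s\<in>{x..}. (\<integral>\<^sup>+t\<in>{y..}. G s t \<partial>lborel) \<partial>lborel)"
proof (rule ennreal_sqrt_mono)
  have "(\<Sum>j. \<Sum>l. G (2 ^ Suc (i + j)) (2 ^ Suc (k + l)) * ennreal (2 ^ (k + l) / 2) * ennreal (2 ^ (i + j) / 2))
    = (\<Sum>j. (\<Sum>l. G (2 ^ Suc (i + j)) (2 ^ Suc (k + l)) * emeasure lborel (tail_interval (k + l))) * emeasure lborel (tail_interval (i + j)))"
    unfolding tail_interval(4) ennreal_suminf_multc ..
  also have "\<dots> \<le> (\<integral>\<^sup>+s\<in>{x..}. (\<integral>\<^sup>+t\<in>{y..}. G s t \<partial>lborel) \<partial>lborel)"
    by (intro suminf_le_set_nn_integral tail_interval(1,2) tail_interval(3)[OF x] tail_interval(3)[OF y] antitone2D[OF G])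
      (use interval_bounds(3) in blast)+
  finally show "(\<Sum>j. \<Sum>l. G (2 ^ Suc (j + i)) (2 ^ Suc (l + k)) * ennreal (2 ^ (l + k) / 2) * ennreal (2 ^ (j + i) / 2))
    \<le> (\<integral>\<^sup>+s\<in>{x..}. (\<integral>\<^sup>+t\<in>{y..}. G s t \<partial>lborel) \<partial>lborel)"
    by (simp only: add.commute[of _ i] add.commute[of _ k])
qed

lemma double_suminf_le_cmult:
  assumes "(\<Sum>i. \<Sum>k. a i k) < (\<infinity> :: ennreal)" "\<And>i k. b i k \<le> ennreal C * a i k"
  shows "(\<Sum>i. \<Sum>k. b i k) < \<infinity>"
proof -
  have "(\<Sum>i. \<Sum>k. b i k) \<le> (\<Sum>i. \<Sum>k. ennreal C * a i k)" by (intro suminf_le assms(2)) auto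
  also have "\<dots> = ennreal C * (\<Sum>i. \<Sum>k. a i k)" by (simp add: ennreal_suminf_cmult)
  also have "\<dots> < \<infinity>" using assms(1) by (simp add: ennreal_mult_less_top)
  finally show ?thesis .
qed

lemma double_suminf_add_finite:
  assumes "(\<Sum>i. \<Sum>k. a i k) < (\<infinity> :: ennreal)" "(\<Sum>i. \<Sum>k. b i k) < \<infinity>"
  shows "(\<Sum>i. \<Sum>k. a i k + b i k) < \<infinity>"
  using assms by (simp add: suminf_add[symmetric])

lemma double_suminf_term_finite:
  assumes "(\<Sum>i. \<Sum>k. a i k) < (\<infinity> :: ennreal)" shows "a i k < \<infinity>"
proof -
  have "a i k \<le> (\<Sum>k. a i k)" by (rule suminf_term_le)
  also have "\<dots> \<le> (\<Sum>i. \<Sum>k. a i k)" by (rule suminf_term_le)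
  finally show ?thesis using assms by (rule le_less_trans)
qed

text \<open>Takes care of the negligible terms \<open>S0 * (1/2) ^ (i + k + 2)\<close> left by the
  logarithmic estimate.\<close>

lemma double_geometric_finite:
  assumes "0 \<le> c" shows "(\<Sum>i. \<Sum>k. ennreal (c * (1/2) ^ (i + k + 2))) < \<infinity>"
proof -
  have g: "(\<Sum>i. ennreal ((1/2) ^ i)) < \<infinity>"
    by (subst suminf_ennreal2) (auto intro!: summable_geometric)
  have "(\<Sum>i. \<Sum>k. ennreal ((1/2) ^ i) * ennreal ((1/2) ^ k)) < \<infinity>"
    using g by (simp add: ennreal_suminf_cmult ennreal_suminf_multc ennreal_mult_less_top)
  then show ?thesis
  proof (rule double_suminf_le_cmult)
    fix i k
    show "ennreal (c * (1/2) ^ (i + k + 2)) \<le> ennreal (c) * (ennreal ((1/2) ^ i) * ennreal ((1/2) ^ k))"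
    proof -
      have "c * (1/2) ^ (i + k + 2) \<le> c * ((1/2) ^ i * (1/2) ^ k)"
        unfolding power_add[symmetric] using assms by (intro mult_mono power_decreasing) auto
      then show ?thesis using assms by (simp only: ennreal_mult[symmetric] ennreal_leI zero_le_power zero_le_divide_1_iff zero_le_numeral mult_nonneg_nonneg)
    qed
  qed
qed

text \<open>The majorants enter through monotonicity alone. The nine sums are the nine integrals,
  sampled at the dyadic points; where a tail in a single variable occurs, one half block of it
  suffices.\<close>

lemma dyadic_sums_finite:
  assumes anti: "antitone2 P" "antitone2 Q" "antitone2 R" "antitone2 S"
    and int1: "(\<integral>\<^sup>+y\<in>{0..1}. (\<integral>\<^sup>+x\<in>{0..1}.
        S x y * ennreal (ln (2 / x)) * ennreal (ln (2 / y)) \<partial>lborel) \<partial>lborel) < \<infinity>"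
    and int2: "(\<integral>\<^sup>+y\<in>{1..}. (\<integral>\<^sup>+x\<in>{1..}. P x y / ennreal (x * y) \<partial>lborel) \<partial>lborel) < \<infinity>"
    and int3: "(\<integral>\<^sup>+y\<in>{1..}. (\<integral>\<^sup>+x\<in>{1..}.
        ennreal_sqrt (\<integral>\<^sup>+s\<in>{x..}. (\<integral>\<^sup>+t\<in>{y..}. P s t * S s t \<partial>lborel) \<partial>lborel)
          / ennreal (x * y) \<partial>lborel) \<partial>lborel) < \<infinity>"
    and int4: "(\<integral>\<^sup>+x\<in>{0..1}. (\<integral>\<^sup>+y\<in>{1..}.
        Q x y * ennreal (ln (2 / x)) / ennreal y \<partial>lborel) \<partial>lborel) < \<infinity>"
    and int5: "(\<integral>\<^sup>+x\<in>{0..1}. (\<integral>\<^sup>+y\<in>{1..}.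
        ennreal_sqrt (\<integral>\<^sup>+t\<in>{y..}. Q x t * S x t \<partial>lborel)
          * ennreal (ln (2 / x)) / ennreal y \<partial>lborel) \<partial>lborel) < \<infinity>"
    and int6: "(\<integral>\<^sup>+x\<in>{1..}. (\<integral>\<^sup>+y\<in>{0..1}.
        R x y * ennreal (ln (2 / y)) / ennreal x \<partial>lborel) \<partial>lborel) < \<infinity>"
    and int7: "(\<integral>\<^sup>+x\<in>{1..}. (\<integral>\<^sup>+y\<in>{0..1}.
        ennreal_sqrt (\<integral>\<^sup>+s\<in>{x..}. R s y * S s y \<partial>lborel)
          * ennreal (ln (2 / y)) / ennreal x \<partial>lborel) \<partial>lborel) < \<infinity>"
    and int8: "(\<integral>\<^sup>+y\<in>{1..}. (\<integral>\<^sup>+x\<in>{1..}.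
        ennreal_sqrt (\<integral>\<^sup>+t\<in>{y..}. P x t * R x t \<partial>lborel)
          / ennreal (x * y) \<partial>lborel) \<partial>lborel) < \<infinity>"
    and int9: "(\<integral>\<^sup>+y\<in>{1..}. (\<integral>\<^sup>+x\<in>{1..}.
        ennreal_sqrt (\<integral>\<^sup>+s\<in>{x..}. P s y * Q s y \<partial>lborel)
          / ennreal (x * y) \<partial>lborel) \<partial>lborel) < \<infinity>"
  defines "L \<equiv> \<lambda>i. (1/2 :: real) ^ i" and "H \<equiv> \<lambda>i. (2 :: real) ^ Suc i"
  shows "(\<Sum>i. \<Sum>k. S (L i) (L k) * ennreal (real (Suc i) * real (Suc k) * (L i * L k))) < \<infinity>"
    and "(\<Sum>i. \<Sum>k. P (H i) (H k)) < \<infinity>"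
    and "(\<Sum>i. \<Sum>k. ennreal (sqrt (real (Suc i))) * (ennreal (sqrt (real (Suc k))) *
      ennreal_sqrt (P (H i) (H k) * S (H i) (H k) * ennreal (2 ^ k / 2) * ennreal (2 ^ i / 2)))) < \<infinity>"
    and "(\<Sum>i. \<Sum>k. Q (L i) (H k) * ennreal (real (Suc i) * L i)) < \<infinity>"
    and "(\<Sum>i. \<Sum>k. ennreal_sqrt (Q (L i) (H k) * S (L i) (H k) * ennreal (2 ^ k / 2)) * ennreal (real (Suc i) * L i)) < \<infinity>"
    and "(\<Sum>i. \<Sum>k. R (H i) (L k) * ennreal (real (Suc k) * L k)) < \<infinity>"
    and "(\<Sum>i. \<Sum>k. ennreal_sqrt (R (H i) (L k) * S (H i) (L k) * ennreal (2 ^ i / 2)) * ennreal (real (Suc k) * L k)) < \<infinity>"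
    and "(\<Sum>i. \<Sum>k. ennreal_sqrt (P (H i) (H k) * R (H i) (H k) * ennreal (2 ^ k / 2))) < \<infinity>"
    and "(\<Sum>i. \<Sum>k. ennreal_sqrt (P (H i) (H k) * Q (H i) (H k) * ennreal (2 ^ i / 2))) < \<infinity>"
proof -
  note bd = interval_bounds(1)[THEN conjunct1] interval_bounds(1)[THEN conjunct2]
    interval_bounds(2)[THEN conjunct1] interval_bounds(2)[THEN conjunct2]
  show "(\<Sum>i. \<Sum>k. S (L i) (L k) * ennreal (real (Suc i) * real (Suc k) * (L i * L k))) < \<infinity>"
    unfolding L_def by (rule low_low_sum[OF int1]) (intro antitone2D[OF anti(4)] bd)
  show "(\<Sum>i. \<Sum>k. P (H i) (H k)) < \<infinity>"
    unfolding H_def by (rule high_high_sum[OF int2]) (intro antitone2D[OF anti(1)] bd)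
  show "(\<Sum>i. \<Sum>k. Q (L i) (H k) * ennreal (real (Suc i) * L i)) < \<infinity>"
    unfolding L_def H_def by (rule low_high_sum[OF int4]) (intro antitone2D[OF anti(2)] bd)
  show "(\<Sum>i. \<Sum>k. R (H i) (L k) * ennreal (real (Suc k) * L k)) < \<infinity>"
    unfolding L_def H_def by (rule high_low_sum[OF int6]) (intro antitone2D[OF anti(3)] bd)
  show "(\<Sum>i. \<Sum>k. ennreal_sqrt (Q (L i) (H k) * S (L i) (H k) * ennreal (2 ^ k / 2)) * ennreal (real (Suc i) * L i)) < \<infinity>"
    unfolding L_def H_def by (rule low_high_sum[OF int5]) (intro sqrt_tail_y[OF antitone2_mult[OF anti(2,4)]] bd)
  show "(\<Sum>i. \<Sum>k. ennreal_sqrt (R (H i) (L k) * S (H i) (L k) * ennreal (2 ^ i / 2)) * ennreal (real (Suc k) * L k)) < \<infinity>"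
    unfolding L_def H_def by (rule high_low_sum[OF int7]) (intro sqrt_tail_x[OF antitone2_mult[OF anti(3,4)]] bd)
  show "(\<Sum>i. \<Sum>k. ennreal_sqrt (P (H i) (H k) * R (H i) (H k) * ennreal (2 ^ k / 2))) < \<infinity>"
    unfolding L_def H_def by (rule high_high_sum[OF int8]) (intro sqrt_tail_y[OF antitone2_mult[OF anti(1,3)]] bd)
  show "(\<Sum>i. \<Sum>k. ennreal_sqrt (P (H i) (H k) * Q (H i) (H k) * ennreal (2 ^ i / 2))) < \<infinity>"
    unfolding L_def H_def by (rule high_high_sum[OF int9]) (intro sqrt_tail_x[OF antitone2_mult[OF anti(1,2)]] bd)
  \<comment> \<open>The hypothesis controls square roots of double tails; the tail inequality
    exchanges them for single terms weighted by \<open>sqrt (real (Suc i))\<close> and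
    \<open>sqrt (real (Suc k))\<close>.\<close>
  have "(\<Sum>m. \<Sum>n. ennreal_sqrt (\<Sum>i. \<Sum>k. P (H (i + m)) (H (k + n)) * S (H (i + m)) (H (k + n))
      * ennreal (2 ^ (k + n) / 2) * ennreal (2 ^ (i + m) / 2))) < \<infinity>"
    unfolding H_def by (rule high_high_sum[OF int3]) (rule sqrt_tail_xy[OF antitone2_mult[OF anti(1,4)]])
  then have "4 * (\<Sum>m. \<Sum>n. ennreal_sqrt (\<Sum>i. \<Sum>k. P (H (i + m)) (H (k + n)) * S (H (i + m)) (H (k + n))
      * ennreal (2 ^ (k + n) / 2) * ennreal (2 ^ (i + m) / 2))) < \<infinity>"
    by (simp add: ennreal_mult_less_top)
  then show "(\<Sum>i. \<Sum>k. ennreal (sqrt (real (Suc i))) * (ennreal (sqrt (real (Suc k))) *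
      ennreal_sqrt (P (H i) (H k) * S (H i) (H k) * ennreal (2 ^ k / 2) * ennreal (2 ^ i / 2)))) < \<infinity>"
    by (rule le_less_trans[OF hardy_tail_double])
qed

lemma antitone2_maj: "antitone2 (maj00 f)" "antitone2 (maj10 f)" "antitone2 (maj01 f)" "antitone2 (maj11 f)"
  by (simp_all add: antitone2_def maj00_mono maj10_mono maj01_mono maj11_mono)

text \<open>Finiteness at dyadic points spreads to all arguments, since the majorants are antitone
  and every positive number exceeds some \<open>(1/2) ^ i\<close>.\<close>

lemma quadrant_majorants:
  assumes diff2: "\<And>x y. x \<noteq> 0 \<Longrightarrow> y \<noteq> 0 \<Longrightarrow> (\<lambda>v. f (x, v)) differentiable (at y)"
    and ac: "locally_abs_cont_off_axes f" and ac2: "locally_abs_cont_off_axes (pderiv2 f)"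
    and fin00: "maj00 f 2 2 < \<infinity>" and fin10: "\<And>i. maj10 f ((1/2) ^ i) 2 < \<infinity>"
    and fin01: "\<And>k. maj01 f 2 ((1/2) ^ k) < \<infinity>"
    and fin11: "\<And>i k. maj11 f ((1/2) ^ i) ((1/2) ^ k) < \<infinity>"
    and \<sigma>: "\<bar>\<sigma>1\<bar> = 1" "\<bar>\<sigma>2\<bar> = 1"
  shows "quadrant (\<lambda>a b. f (\<sigma>1 * a, \<sigma>2 * b)) (\<lambda>X Y. enn2real (maj00 f X Y)) (\<lambda>X Y. enn2real (maj10 f X Y))
    (\<lambda>X Y. enn2real (maj01 f X Y)) (\<lambda>X Y. enn2real (maj11 f X Y))"
proof
  note anti = antitone2_maj[of f, THEN antitone2D]
  have small: "\<exists>i. (1/2) ^ i \<le> X" if "0 < X" for X :: real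
    using real_arch_pow_inv[OF that, of "1/2"] by (auto intro: less_imp_le)
  have abs: "\<bar>\<sigma>1 * x\<bar> = \<bar>x\<bar>" "\<bar>\<sigma>2 * x\<bar> = \<bar>x\<bar>" for x using \<sigma> by (simp_all add: abs_mult)
  fix X Y x x' y y' :: real
  show "norm (f (\<sigma>1 * x, \<sigma>2 * y)) \<le> enn2real (maj00 f X Y)" if "2 \<le> X" "2 \<le> Y" "X \<le> x" "Y \<le> y"
  proof (rule maj00_bound)
    show "maj00 f X Y < \<infinity>" by (rule le_less_trans[OF anti(1) fin00]) (use that in auto)
  qed (use that in \<open>auto simp: abs\<close>)
  show "norm (f (\<sigma>1 * x, \<sigma>2 * y) - f (\<sigma>1 * x', \<sigma>2 * y)) \<le> enn2real (maj10 f X Y) * \<bar>x - x'\<bar>"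
    if h: "0 < X" "2 \<le> Y" "X \<le> x" "X \<le> x'" "Y \<le> y"
  proof (rule reflected_lipschitz1[OF ac _ h(1) _ \<sigma>(1) h(3,4)])
    obtain i where "(1/2) ^ i \<le> X" using small[OF h(1)] ..
    then show "maj10 f X Y < \<infinity>" by (intro le_less_trans[OF anti(2) fin10]) (use h in auto)
  qed (use h in \<open>auto simp: abs\<close>)
  show "norm (f (\<sigma>1 * x, \<sigma>2 * y) - f (\<sigma>1 * x, \<sigma>2 * y')) \<le> enn2real (maj01 f X Y) * \<bar>y - y'\<bar>"
    if h: "2 \<le> X" "0 < Y" "X \<le> x" "Y \<le> y" "Y \<le> y'"
  proof (rule reflected_lipschitz2[OF ac _ _ h(2) \<sigma>(2) h(4,5)])
    obtain i where "(1/2) ^ i \<le> Y" using small[OF h(2)] ..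
    then show "maj01 f X Y < \<infinity>" by (intro le_less_trans[OF anti(3) fin01]) (use h in auto)
  qed (use h in \<open>auto simp: abs\<close>)
  show "norm (f (\<sigma>1 * x, \<sigma>2 * y) - f (\<sigma>1 * x', \<sigma>2 * y) - (f (\<sigma>1 * x, \<sigma>2 * y') - f (\<sigma>1 * x', \<sigma>2 * y')))
      \<le> enn2real (maj11 f X Y) * \<bar>x - x'\<bar> * \<bar>y - y'\<bar>"
    if h: "0 < X" "0 < Y" "X \<le> x" "X \<le> x'" "Y \<le> y" "Y \<le> y'"
  proof (rule reflected_mixed_lipschitz[OF diff2 ac ac2 _ h(1,2) \<sigma>(1) h(3,4) \<sigma>(2) h(5,6)])
    obtain i k where "(1/2) ^ i \<le> X" "(1/2) ^ k \<le> Y" using small h by metis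
    then show "maj11 f X Y < \<infinity>" by (intro le_less_trans[OF anti(4) fin11]) (use h in auto)
  qed
qed

lemma sqrt_square_mult: "0 \<le> c \<Longrightarrow> sqrt (c\<^sup>2 * z) = c * sqrt z"
  by (simp add: real_sqrt_mult)

text \<open>The pieces carry full block end points \<open>2 ^ Suc k\<close>, the sums half block
  lengths \<open>2 ^ k / 2\<close>. Their ratio \<open>4\<close> becomes \<open>2\<close> under the
  root, once for each high variable.\<close>

lemma block_sqrt:
  fixes l q s :: real
  assumes "0 \<le> l" shows "sqrt (q * l * (s * l * 2 ^ Suc k)) = 2 * l * sqrt (q * s * (2 ^ k / 2))"
    "sqrt (q * l * (s * 2 ^ Suc k * l)) = 2 * l * sqrt (q * s * (2 ^ k / 2))"
    "sqrt (q * (s * 2 ^ Suc k)) = 2 * sqrt (q * s * (2 ^ k / 2))"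
    "sqrt (q * (s * 2 ^ Suc i * 2 ^ Suc k)) = 4 * sqrt (q * s * (2 ^ k / 2) * (2 ^ i / 2))"
proof -
  have "0 \<le> 2 * l" using assms by simp
  note * = sqrt_square_mult[OF this, of "q * s * (2 ^ k / 2)", symmetric]
    sqrt_square_mult[of 2 "q * s * (2 ^ k / 2)", symmetric] sqrt_square_mult[of 4 "q * s * (2 ^ k / 2) * (2 ^ i / 2)", symmetric]
  show "sqrt (q * l * (s * l * 2 ^ Suc k)) = 2 * l * sqrt (q * s * (2 ^ k / 2))"
    "sqrt (q * l * (s * 2 ^ Suc k * l)) = 2 * l * sqrt (q * s * (2 ^ k / 2))"
    unfolding *(1) by (simp_all add: power2_eq_square mult_ac)
  show "sqrt (q * (s * 2 ^ Suc k)) = 2 * sqrt (q * s * (2 ^ k / 2))"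
    by (subst *(2)) (simp_all add: mult_ac)
  show "sqrt (q * (s * 2 ^ Suc i * 2 ^ Suc k)) = 4 * sqrt (q * s * (2 ^ k / 2) * (2 ^ i / 2))"
    by (subst *(3)) (simp_all add: mult_ac)
qed

lemma ennreal_sqrt_mult_ennreals:
  assumes "0 \<le> a" "0 \<le> b" "0 \<le> c" "0 \<le> d"
  shows "ennreal_sqrt (ennreal a * ennreal b * ennreal c) = ennreal (sqrt (a * b * c))"
    "ennreal_sqrt (ennreal a * ennreal b * ennreal c * ennreal d) = ennreal (sqrt (a * b * c * d))"
  using assms by (simp_all add: ennreal_mult[symmetric] ennreal_sqrt_ennreal)

lemma ennreal_mult_finiteD: "a * ennreal r < \<infinity> \<Longrightarrow> 0 < r \<Longrightarrow> a < \<infinity>"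
  by (auto simp: ennreal_mult_less_top ennreal_eq_0_iff)

theorem theorem1:
  fixes f :: "real \<times> real \<Rightarrow> complex"
  assumes C0: "f \<in> C0_functions"
    and diff1: "\<And>x y. x \<noteq> 0 \<Longrightarrow> y \<noteq> 0 \<Longrightarrow> (\<lambda>u. f (u, y)) differentiable (at x)"
    and diff2: "\<And>x y. x \<noteq> 0 \<Longrightarrow> y \<noteq> 0 \<Longrightarrow> (\<lambda>v. f (x, v)) differentiable (at y)"
    and ac: "locally_abs_cont_off_axes f"
    and ac1: "locally_abs_cont_off_axes (pderiv1 f)"
    and ac2: "locally_abs_cont_off_axes (pderiv2 f)"
    and bd1: "ae_bounded_off_axes (pderiv1 f)"
    and bd2: "ae_bounded_off_axes (pderiv2 f)"
    and bd12: "ae_bounded_off_axes (pderiv12 f)"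
    and int1: "(\<integral>\<^sup>+y\<in>{0..1}. (\<integral>\<^sup>+x\<in>{0..1}.
        maj11 f x y * ennreal (ln (2 / x)) * ennreal (ln (2 / y)) \<partial>lborel) \<partial>lborel) < \<infinity>"
    and int2: "(\<integral>\<^sup>+y\<in>{1..}. (\<integral>\<^sup>+x\<in>{1..}. maj00 f x y / ennreal (x * y) \<partial>lborel) \<partial>lborel) < \<infinity>"
    and int3: "(\<integral>\<^sup>+y\<in>{1..}. (\<integral>\<^sup>+x\<in>{1..}.
        ennreal_sqrt (\<integral>\<^sup>+s\<in>{x..}. (\<integral>\<^sup>+t\<in>{y..}. maj00 f s t * maj11 f s t \<partial>lborel) \<partial>lborel)
          / ennreal (x * y) \<partial>lborel) \<partial>lborel) < \<infinity>"
    and int4: "(\<integral>\<^sup>+x\<in>{0..1}. (\<integral>\<^sup>+y\<in>{1..}.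
        maj10 f x y * ennreal (ln (2 / x)) / ennreal y \<partial>lborel) \<partial>lborel) < \<infinity>"
    and int5: "(\<integral>\<^sup>+x\<in>{0..1}. (\<integral>\<^sup>+y\<in>{1..}.
        ennreal_sqrt (\<integral>\<^sup>+t\<in>{y..}. maj10 f x t * maj11 f x t \<partial>lborel)
          * ennreal (ln (2 / x)) / ennreal y \<partial>lborel) \<partial>lborel) < \<infinity>"
    and int6: "(\<integral>\<^sup>+x\<in>{1..}. (\<integral>\<^sup>+y\<in>{0..1}.
        maj01 f x y * ennreal (ln (2 / y)) / ennreal x \<partial>lborel) \<partial>lborel) < \<infinity>"
    and int7: "(\<integral>\<^sup>+x\<in>{1..}. (\<integral>\<^sup>+y\<in>{0..1}.
        ennreal_sqrt (\<integral>\<^sup>+s\<in>{x..}. maj01 f s y * maj11 f s y \<partial>lborel)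
          * ennreal (ln (2 / y)) / ennreal x \<partial>lborel) \<partial>lborel) < \<infinity>"
    and int8: "(\<integral>\<^sup>+y\<in>{1..}. (\<integral>\<^sup>+x\<in>{1..}.
        ennreal_sqrt (\<integral>\<^sup>+t\<in>{y..}. maj00 f x t * maj01 f x t \<partial>lborel)
          / ennreal (x * y) \<partial>lborel) \<partial>lborel) < \<infinity>"
    and int9: "(\<integral>\<^sup>+y\<in>{1..}. (\<integral>\<^sup>+x\<in>{1..}.
        ennreal_sqrt (\<integral>\<^sup>+s\<in>{x..}. maj00 f s y * maj10 f s y \<partial>lborel)
          / ennreal (x * y) \<partial>lborel) \<partial>lborel) < \<infinity>"
  shows "f \<in> fourier_L1_functions"
proof -
  \<comment> \<open>Real versions of the majorants. \<open>enn2real\<close> sends an infinite value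
    to \<open>0\<close>, so finiteness at every point used is established before the two are
    identified.\<close>
  define P Q R S where "P X Y = enn2real (maj00 f X Y)" "Q X Y = enn2real (maj10 f X Y)"
    "R X Y = enn2real (maj01 f X Y)" "S X Y = enn2real (maj11 f X Y)" for X Y
  note PQRS = this
  have nn: "0 \<le> P X Y" "0 \<le> Q X Y" "0 \<le> R X Y" "0 \<le> S X Y" for X Y by (simp_all add: PQRS)
  define L H where "L i = (1/2 :: real) ^ i" and "H i = (2 :: real) ^ Suc i" for i
  have LH: "0 < L i" "0 < H i" "1 \<le> H i" "L i \<le> 1" "2 \<le> H i" for i
    by (auto simp: L_def H_def power_le_one intro: one_le_power order_trans[of 1 2])
  have H0: "H 0 = 2" by (simp add: H_def)
  note anti = antitone2_maj[of f, THEN antitone2D]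
  note sums = dyadic_sums_finite[OF antitone2_maj int1 int2 int3 int4 int5 int6 int7 int8 int9, folded L_def H_def]
  \<comment> \<open>The terms of a finite sum are finite, and the coefficient here is positive; so
    the integral hypotheses themselves make the majorants finite at the dyadic points.\<close>
  have fin11: "maj11 f (L i) (L k) < \<infinity>" for i k
    by (rule ennreal_mult_finiteD[OF double_suminf_term_finite[OF sums(1), of i k]]) (simp add: LH(1))
  have fin00: "maj00 f 2 2 < \<infinity>"
    using double_suminf_term_finite[OF sums(2), of 0 0] by (simp add: H0)
  have fin10: "maj10 f (L i) 2 < \<infinity>" for i
    by (rule ennreal_mult_finiteD[OF double_suminf_term_finite[OF sums(4), of i 0, unfolded H0]]) (simp add: LH(1))
  have fin01: "maj01 f 2 (L k) < \<infinity>" for k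
    by (rule ennreal_mult_finiteD[OF double_suminf_term_finite[OF sums(6), of 0 k, unfolded H0]]) (simp add: LH(1))
  have e11: "maj11 f X Y = ennreal (S X Y)" if "L i \<le> X" "L k \<le> Y" for i k X Y
    using le_less_trans[OF anti(4)[OF LH(1) that(1) LH(1) that(2)] fin11] by (simp add: PQRS)
  have e00: "maj00 f (H i) (H k) = ennreal (P (H i) (H k))" for i k
    using le_less_trans[OF anti(1) fin00, of "H i" "H k"] LH by (simp add: PQRS)
  have e10: "maj10 f X (H k) = ennreal (Q X (H k))" if "L i \<le> X" for X i k
    using le_less_trans[OF anti(2)[OF LH(1) that _ LH(5)] fin10] by (simp add: PQRS)
  have e01: "maj01 f (H i) Y = ennreal (R (H i) Y)" if "L k \<le> Y" for Y i k
    using le_less_trans[OF anti(3)[OF _ LH(5) LH(1) that] fin01] by (simp add: PQRS)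
  have L0H: "L 0 \<le> H i" for i using LH(3)[of i] by (simp add: L_def)
  note e = e00 e10[OF order_refl] e10[OF L0H] e01[OF order_refl] e01[OF L0H]
    e11[OF order_refl order_refl] e11[OF L0H order_refl] e11[OF order_refl L0H] e11[OF L0H L0H]
  have h0: "0 \<le> (2::real) ^ k / 2" for k by simp
  note sq = ennreal_sqrt_mult_ennreals[OF nn(1) nn(4) h0 h0] ennreal_sqrt_mult_ennreals(1)[OF nn(2) nn(4) h0 h0]
    ennreal_sqrt_mult_ennreals(1)[OF nn(3) nn(4) h0 h0] ennreal_sqrt_mult_ennreals(1)[OF nn(1) nn(3) h0 h0]
    ennreal_sqrt_mult_ennreals(1)[OF nn(1) nn(2) h0 h0]
  note fsums = sums[unfolded e sq]
  \<comment> \<open>Monotonicity makes the mixed majorant at \<open>(2, 2)\<close> the uniform bound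
    required on the high blocks.\<close>
  have S2: "S X Y \<le> S 2 2" if "2 \<le> X" "2 \<le> Y" for X Y
  proof -
    have "maj11 f X Y \<le> maj11 f 2 2" by (rule anti(4)) (use that in auto)
    moreover have "maj11 f 2 2 < \<top>"
      using le_less_trans[OF anti(4) fin11, of 0 2 0 2] by (simp add: L_def)
    ultimately show ?thesis unfolding PQRS by (intro enn2real_mono)
  qed
  have combine: "ennreal r \<le> ennreal c * (ennreal a * ennreal b)"
    if "r = c * (a * b)" "0 \<le> a" "0 \<le> b" "0 \<le> c" for r c a b :: real
    using that by (simp add: ennreal_mult)
  have B1: "(\<Sum>i. \<Sum>k. ennreal (112 * pi * (real (Suc i) * real (Suc k) * (S (L i) (L k) * L i * L k)))) < \<infinity>"
    by (rule double_suminf_le_cmult[OF fsums(1), of _ "112 * pi"], rule combine)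
      (use LH nn in \<open>simp_all add: less_imp_le algebra_simps\<close>)
  have B2: "(\<Sum>i. \<Sum>k. ennreal (128 * pi * (real (Suc i) * (Q (L i) (H k) * L i +
      sqrt (Q (L i) (H k) * L i * (S (L i) (H k) * L i * H k)))))) < \<infinity>"
  proof (rule double_suminf_le_cmult[OF double_suminf_add_finite[OF fsums(4,5)], of _ "256 * pi"])
    fix i k
    define q s n l where v: "q = Q (L i) (H k)" "s = sqrt (Q (L i) (H k) * S (L i) (H k) * (2 ^ k / 2))" "n = real (Suc i)" "l = L i"
    have nn': "0 \<le> q" "0 \<le> s" "0 \<le> n" "0 \<le> l" unfolding v using nn LH(1)[of i] by simp_all
    have "128 * pi * (n * (q * l + 2 * l * s)) \<le> 256 * pi * (q * (n * l) + s * (n * l))"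
      using nn' by (simp add: algebra_simps)
    then have "ennreal (128 * pi * (n * (q * l + 2 * l * s))) \<le> ennreal (256 * pi * (q * (n * l) + s * (n * l)))"
      by (rule ennreal_leI)
    also have "\<dots> = ennreal (256 * pi) * (ennreal q * ennreal (n * l) + ennreal s * ennreal (n * l))"
      using nn' by (simp add: ennreal_mult)
    finally show "ennreal (128 * pi * (real (Suc i) * (Q (L i) (H k) * L i +
        sqrt (Q (L i) (H k) * L i * (S (L i) (H k) * L i * H k))))) \<le> ennreal (256 * pi) *
        (ennreal (Q (L i) (H k)) * ennreal (real (Suc i) * L i) +
         ennreal (sqrt (Q (L i) (H k) * S (L i) (H k) * (2 ^ k / 2))) * ennreal (real (Suc i) * L i))"
      unfolding H_def[of k] block_sqrt(1)[OF less_imp_le[OF LH(1)]] unfolding H_def[of k, symmetric] v .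
  qed
  have B3: "(\<Sum>i. \<Sum>k. ennreal (128 * pi * (real (Suc k) * (R (H i) (L k) * L k +
      sqrt (R (H i) (L k) * L k * (S (H i) (L k) * H i * L k)))))) < \<infinity>"
  proof (rule double_suminf_le_cmult[OF double_suminf_add_finite[OF fsums(6,7)], of _ "256 * pi"])
    fix i k
    define q s n l where v: "q = R (H i) (L k)" "s = sqrt (R (H i) (L k) * S (H i) (L k) * (2 ^ i / 2))" "n = real (Suc k)" "l = L k"
    have nn': "0 \<le> q" "0 \<le> s" "0 \<le> n" "0 \<le> l" unfolding v using nn LH(1)[of k] by simp_all
    have "128 * pi * (n * (q * l + 2 * l * s)) \<le> 256 * pi * (q * (n * l) + s * (n * l))"
      using nn' by (simp add: algebra_simps)
    then have "ennreal (128 * pi * (n * (q * l + 2 * l * s))) \<le> ennreal (256 * pi * (q * (n * l) + s * (n * l)))"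
      by (rule ennreal_leI)
    also have "\<dots> = ennreal (256 * pi) * (ennreal q * ennreal (n * l) + ennreal s * ennreal (n * l))"
      using nn' by (simp add: ennreal_mult)
    finally show "ennreal (128 * pi * (real (Suc k) * (R (H i) (L k) * L k +
        sqrt (R (H i) (L k) * L k * (S (H i) (L k) * H i * L k))))) \<le> ennreal (256 * pi) *
        (ennreal (R (H i) (L k)) * ennreal (real (Suc k) * L k) +
         ennreal (sqrt (R (H i) (L k) * S (H i) (L k) * (2 ^ i / 2))) * ennreal (real (Suc k) * L k))"
      unfolding H_def[of i] block_sqrt(2)[OF less_imp_le[OF LH(1)]] unfolding H_def[of i, symmetric] v .
  qed
  \<comment> \<open>Five finite sums are combined: point values, the two square roots with a first
    derivative, the square root with the logarithmic weight, and the geometric remainder.\<close>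
  have B4: "(\<Sum>i. \<Sum>k. ennreal (400 * pi * (P (H i) (H k) + sqrt (P (H i) (H k) * (Q (H i) (H k) * H i)) +
      sqrt (P (H i) (H k) * (R (H i) (H k) * H k)) +
      sqrt (real (Suc i) * real (Suc k)) * sqrt (P (H i) (H k) * (S (H i) (H k) * H i * H k)) +
      S 2 2 * (1/2) ^ (i + k + 2)))) < \<infinity>"
  proof (rule double_suminf_le_cmult[OF double_suminf_add_finite[OF double_suminf_add_finite[OF double_suminf_add_finite[OF
      double_suminf_add_finite[OF fsums(2,9)] fsums(8)] fsums(3)] double_geometric_finite[OF nn(4)[of 2 2]]], of _ "1600 * pi"])
    fix i k
    define p q r s n m g where v: "p = P (H i) (H k)" "q = sqrt (P (H i) (H k) * Q (H i) (H k) * (2 ^ i / 2))"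
      "r = sqrt (P (H i) (H k) * R (H i) (H k) * (2 ^ k / 2))"
      "s = sqrt (P (H i) (H k) * S (H i) (H k) * (2 ^ k / 2) * (2 ^ i / 2))"
      "n = sqrt (real (Suc i))" "m = sqrt (real (Suc k))" "g = S 2 2 * (1/2) ^ (i + k + 2)"
    have nn': "0 \<le> p" "0 \<le> q" "0 \<le> r" "0 \<le> s" "0 \<le> n" "0 \<le> m" "0 \<le> g" unfolding v using nn by simp_all
    have *: "sqrt (P (H i) (H k) * (Q (H i) (H k) * H i)) = 2 * q"
      "sqrt (P (H i) (H k) * (R (H i) (H k) * H k)) = 2 * r"
      "sqrt (P (H i) (H k) * (S (H i) (H k) * H i * H k)) = 4 * s"
      unfolding v using block_sqrt(3,4)[OF zero_le_one] unfolding H_def[symmetric] by blast+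
    have "400 * pi * (p + 2 * q + 2 * r + n * m * (4 * s) + g) \<le> 1600 * pi * (p + q + r + n * (m * s) + g)"
    proof -
      have "p + 2 * q + 2 * r + n * m * (4 * s) + g \<le> 4 * (p + q + r + n * (m * s) + g)" using nn' by simp
      then have "400 * pi * (p + 2 * q + 2 * r + n * m * (4 * s) + g) \<le> 400 * pi * (4 * (p + q + r + n * (m * s) + g))"
        by (rule mult_left_mono) simp
      then show ?thesis by simp
    qed
    then have "ennreal (400 * pi * (p + 2 * q + 2 * r + n * m * (4 * s) + g)) \<le> ennreal (1600 * pi * (p + q + r + n * (m * s) + g))"
      by (rule ennreal_leI)
    also have "\<dots> = ennreal (1600 * pi) * (ennreal p + ennreal q + ennreal r + ennreal n * (ennreal m * ennreal s) + ennreal g)"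
      using nn' by (simp add: ennreal_mult)
    finally show "ennreal (400 * pi * (P (H i) (H k) + sqrt (P (H i) (H k) * (Q (H i) (H k) * H i)) +
      sqrt (P (H i) (H k) * (R (H i) (H k) * H k)) +
      sqrt (real (Suc i) * real (Suc k)) * sqrt (P (H i) (H k) * (S (H i) (H k) * H i * H k)) +
      S 2 2 * (1/2) ^ (i + k + 2))) \<le> ennreal (1600 * pi) *
      (ennreal (P (H i) (H k)) + ennreal (sqrt (P (H i) (H k) * Q (H i) (H k) * (2 ^ i / 2))) +
        ennreal (sqrt (P (H i) (H k) * R (H i) (H k) * (2 ^ k / 2))) +
        ennreal (sqrt (real (Suc i))) * (ennreal (sqrt (real (Suc k))) *
          ennreal (sqrt (P (H i) (H k) * S (H i) (H k) * (2 ^ k / 2) * (2 ^ i / 2)))) +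
        ennreal (S 2 2 * (1/2) ^ (i + k + 2)))"
      unfolding * unfolding v real_sqrt_mult[of "real (Suc i)"] .
  qed
  have quad: "quadrant (\<lambda>a b. f (\<sigma>1 * a, \<sigma>2 * b)) P Q R S" if "\<bar>\<sigma>1\<bar> = 1" "\<bar>\<sigma>2\<bar> = 1" for \<sigma>1 \<sigma>2
    using quadrant_majorants[OF diff2 ac ac2 fin00 fin10[unfolded L_def] fin01[unfolded L_def] fin11[unfolded L_def] that]
    unfolding PQRS[abs_def] .
  have cont: "continuous_on UNIV f" using C0 by (simp add: C0_functions_def)
  show ?thesis
    by (rule fourier_L1_dyadic[OF cont quad S2 B1[unfolded L_def] B2[unfolded L_def H_def] B3[unfolded L_def H_def] B4[unfolded H_def]])
qed

end
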